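(* For every infinite regular cardinal $\lambda$, there exists a $10120$-Shelah group of size $\lambda^+$. In particular, there exist Shelah groups of size $\aleph_1,\aleph_2,\aleph_3,\ldots$.
   Context: The ambient theory is ZFC. For a group $G$, a subset $X\subseteq G$ and a positive integer $n$, $X^n$ denotes the set of all products $x_1x_2\cdots x_n$ with $x_1,\ldots,x_n\in X$ (group words of length exactly $n$ in the elements of $X$). A subset $X\subseteq G$ is of full size if $|X|=|G|$. A group $G$ is $n$-Shelah if $X^n=G$ for every $X\subseteq G$ of full size. A group is Shelah if it is $n$-Shelah for some positive integer $n$. $\lambda^+$ denotes the successor cardinal of $\lambda$. *)

theory Defs
  imports "HOL-Algebra.Group"
begin

unbundle cardinal_syntax

definition word_set :: "('a, 'b) monoid_scheme \<Rightarrow> 'a set \<Rightarrow> nat \<Rightarrow> 'a set" where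
  "word_set G X n = {foldr (\<otimes>\<^bsub>G\<^esub>) xs \<one>\<^bsub>G\<^esub> | xs. length xs = n \<and> set xs \<subseteq> X}"

definition full_size :: "('a, 'b) monoid_scheme \<Rightarrow> 'a set \<Rightarrow> bool" where
  "full_size G X \<longleftrightarrow> X \<subseteq> carrier G \<and> |X| =o |carrier G|"

definition n_Shelah :: "nat \<Rightarrow> ('a, 'b) monoid_scheme \<Rightarrow> bool" where
  "n_Shelah n G \<longleftrightarrow> group G \<and> 0 < n \<and> (\<forall>X. full_size G X \<longrightarrow> word_set G X n = carrier G)"

definition Shelah :: "('a, 'b) monoid_scheme \<Rightarrow> bool" where
  "Shelah G \<longleftrightarrow> (\<exists>n. n_Shelah n G)"

text \<open>
  \<open>is_aleph n r\<close> says that \<open>r\<close> is a cardinal order of size \<open>\<aleph>\<^sub>n\<close>. All cardinals involved live on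
  one type \<open>'a\<close>, which loses nothing: a cardinal order \<open>r\<close> on \<open>'a\<close> contains initial segments of
  every smaller cardinality. A predicate is used because no function of \<open>n\<close> can return orders
  whose type grows with \<open>n\<close>. The lemmas below show that each \<open>\<aleph>\<^sub>n\<close> is realised on a suitable type.
\<close>

primrec is_aleph :: "nat \<Rightarrow> 'a rel \<Rightarrow> bool" where
  "is_aleph 0 r \<longleftrightarrow> r =o natLeq"
| "is_aleph (Suc n) r \<longleftrightarrow> (\<exists>s :: 'a rel. is_aleph n s \<and> r =o cardSuc s)"

lemma is_aleph_Card_order: "is_aleph n r \<Longrightarrow> Card_order r"
proof (induction n arbitrary: r)
  case 0
  then show ?case using Card_order_ordIso natLeq_Card_order by auto
next
  case (Suc n)
  then show ?case using Card_order_ordIso cardSuc_Card_order by fastforce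
qed

lemma is_aleph_ordIso:
  fixes r :: "'a rel" and r' :: "'b rel"
  assumes "is_aleph n r" and "r =o r'"
  shows "is_aleph n r'"
  using assms
proof (induction n arbitrary: r r')
  case 0
  then show ?case using ordIso_symmetric ordIso_transitive by (metis is_aleph.simps(1))
next
  case (Suc n)
  then obtain s :: "'a rel" where s: "is_aleph n s" "r =o cardSuc s" by auto
  have Cs: "Card_order s" using s(1) by (rule is_aleph_Card_order)
  have r': "r' =o cardSuc s"
    using Suc.prems(2) s(2) ordIso_symmetric ordIso_transitive by blast
  then have Cr': "Card_order r'" using Card_order_ordIso cardSuc_Card_order[OF Cs] by blast
  have "s <o r'"
    using cardSuc_greater[OF Cs] r' ordIso_symmetric ordLess_ordIso_trans by blast
  then have "|Field s| \<le>o |Field r'|"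
    by (meson Cs Cr' card_of_Field_ordIso ordIso_ordLeq_trans ordIso_symmetric
        ordLeq_ordIso_trans ordLess_imp_ordLeq)
  then obtain f where f: "inj_on f (Field s)" "f ` Field s \<subseteq> Field r'"
    using card_of_ordLeq by (metis)
  define s' where "s' = |f ` Field s|"
  have ss': "s =o s'" unfolding s'_def
    by (meson Cs card_of_Field_ordIso card_of_ordIso f(1) inj_on_imp_bij_betw
        ordIso_symmetric ordIso_transitive)
  have "is_aleph n s'" using Suc.IH[OF s(1) ss'] .
  moreover have "cardSuc s =o cardSuc s'"
    using cardSuc_invar_ordIso[OF Cs] ss' s'_def card_of_Card_order by blast
  ultimately show ?case using r' ordIso_transitive by (auto intro!: exI[of _ s'])
qed

lemma is_aleph_natLeq: "is_aleph 0 natLeq"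
  by (simp add: natLeq_Card_order ordIso_reflexive natLeq_Well_order)

lemma is_aleph_cardSuc:
  fixes r :: "'a rel"
  assumes "is_aleph n r"
  shows "is_aleph (Suc n) (cardSuc r)"
proof -
  have C: "Card_order r" using assms by (rule is_aleph_Card_order)
  define s where "s = |(\<lambda>x. {x}) ` Field r|"
  have "bij_betw (\<lambda>x. {x}) (Field r) ((\<lambda>x. {x}) ` Field r)"
    by (auto simp: bij_betw_def)
  then have rs: "r =o s" unfolding s_def
    by (meson C card_of_Field_ordIso card_of_ordIso ordIso_symmetric ordIso_transitive)
  have "cardSuc r =o cardSuc s"
    using cardSuc_invar_ordIso[OF C] rs s_def card_of_Card_order by blast
  then show ?thesis using is_aleph_ordIso[OF assms rs] by auto
qed

end

theory Submission
  imports Defs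
begin

text \<open>
  Write \<open>\<kappa> = \<lambda>\<^sup>+\<close>. The group is built by recursion on pairs \<open>(b, i)\<close> with \<open>b < \<kappa>\<close> and \<open>i < \<lambda>\<close>. Every element has a level
  below \<open>\<kappa>\<close>, and a locally small ultrametric distance \<open>e\<close> on \<open>\<kappa>\<close> cuts the elements of level less than \<open>b\<close> into an increasing
  chain of subgroups \<open>S b i\<close>. Step \<open>(b, i)\<close> takes the amalgam of \<open>S b i\<close> with the part of level at most \<open>b\<close> constructed before,
  over their intersection, and divides it by relations \<open>w = z\<close>, where \<open>w\<close> is a fixed long word in elements of increasing level and
  \<open>z\<close> is prescribed by a colouring \<open>\<pi>\<close> of \<open>\<kappa>\<close>. The relations satisfy a small cancellation condition over the amalgam, so both factors embed
  and are malnormal in the quotient, which keeps the recursion going. Given a subset \<open>X\<close> of size \<open>\<kappa>\<close> and \<open>g\<close>, an Ulam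
  matrix argument yields a limit \<open>\<delta>\<close> of levels of \<open>X\<close> whose colour demands \<open>w = g\<close> for suitable elements of \<open>X\<close>.

  The quotient of the amalgam is obtained without diagrams: a complex on which it acts is grown layer by layer, freely except
  that a path which reads all but one syllable of a relator is closed. Every path that is forced to close descends from
  both ends and has at most one short bump, so all relators close in the limit, while a word containing no
  large part of a relator leaves the root and does not return.
\<close>

section \<open>Amalgams and small cancellation\<close>

text \<open>There are more subsets of size \<kappa> than steps of the recursion, so the pairs
  \<open>(X, g)\<close> cannot be treated one by one. The colour of an ordinal guesses only two
  letters and the target; every completion by letters of suitable levels receives its relation at
  once. So many relations are harmless only if no two of them overlap much. Malnormality of the
  amalgamated subgroup ensures this: it makes the twisting elements constant along a common part, so
  that the repetitions in the pattern of a relator can be read off.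

  The constants depend on each other. A window of 27 letters determines the position in a pattern of
  period 13 * 2^8 = 3328. A common part of two relators may contain two exceptional letters, hence
  three windows are provided; with two syllables for each letter and some margin, 170 common
  syllables suffice. The complex needs relators of at least 39 * 170 = 6630 syllables, and 2 * 3328
  = 6656. A letter contributes at most three factors, so words have length at most 3 * 3328 = 9984,
  and a shorter exponent can be raised to 10120.\<close>

definition grp :: "'g set \<Rightarrow> ('g \<Rightarrow> 'g \<Rightarrow> 'g) \<Rightarrow> 'g \<Rightarrow> bool" where
  "grp S f e \<longleftrightarrow> e \<in> S \<and> (\<forall>x\<in>S. \<forall>y\<in>S. f x y \<in> S) \<and>
     (\<forall>x\<in>S. \<forall>y\<in>S. \<forall>z\<in>S. f (f x y) z = f x (f y z)) \<and>
     (\<forall>x\<in>S. f e x = x \<and> f x e = x) \<and> (\<forall>x\<in>S. \<exists>y\<in>S. f x y = e \<and> f y x = e)"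

locale amalgam =
  fixes L M :: "'g set" and f :: "'g \<Rightarrow> 'g \<Rightarrow> 'g" (infixl "\<cdot>" 70) and e :: 'g
  assumes grpL: "grp L f e" and grpM: "grp M f e" and grpH: "grp (L \<inter> M) f e"
begin

definition H :: "'g set" where "H = L \<inter> M"

definition G :: "nat \<Rightarrow> 'g set" where "G k = (if even k then L else M)"

text \<open>One function serves both factors: since \<open>L \<inter> M\<close> is itself a group,
  an element of the intersection has an inverse there, and this is its inverse in either
  factor.\<close>

definition iv :: "'g \<Rightarrow> 'g" where
  "iv x = (SOME y. (x \<in> L \<longrightarrow> y \<in> L) \<and> (x \<in> M \<longrightarrow> y \<in> M) \<and> x \<cdot> y = e \<and> y \<cdot> x = e)"

lemma iv_props:
  assumes "x \<in> L \<union> M"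
  shows "(x \<in> L \<longrightarrow> iv x \<in> L) \<and> (x \<in> M \<longrightarrow> iv x \<in> M) \<and> x \<cdot> iv x = e \<and> iv x \<cdot> x = e"
  unfolding iv_def
proof (rule someI_ex)
  consider "x \<in> L \<inter> M" | "x \<in> L" "x \<notin> M" | "x \<in> M" "x \<notin> L" using assms by blast
  then show "\<exists>y. (x \<in> L \<longrightarrow> y \<in> L) \<and> (x \<in> M \<longrightarrow> y \<in> M) \<and> x \<cdot> y = e \<and> y \<cdot> x = e"
  proof cases
    case 1 then show ?thesis using grpH unfolding grp_def by blast
  next
    case 2 then show ?thesis using grpL unfolding grp_def by blast
  next
    case 3 then show ?thesis using grpM unfolding grp_def by blast
  qed
qed

lemma grpG: "grp (G k) f e" using grpL grpM by (simp add: G_def)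

lemma HG: "x \<in> H \<Longrightarrow> x \<in> G k" by (auto simp: H_def G_def)
lemma GLM: "x \<in> G k \<Longrightarrow> x \<in> L \<union> M" by (auto simp: G_def split: if_splits)
lemma G_both: "x \<in> G k \<Longrightarrow> x \<in> G (Suc k) \<Longrightarrow> x \<in> H" by (auto simp: H_def G_def split: if_splits)
lemma G_parity: "even (i + j) \<Longrightarrow> G i = G j" by (auto simp: G_def)

lemma LM_G: assumes "x \<in> L \<union> M" obtains k where "x \<in> G k"
  using assms unfolding G_def by (metis UnE even_Suc)

lemma eG[simp]: "e \<in> G k" using grpG by (simp add: grp_def)
lemma eH[simp]: "e \<in> H" using grpH by (simp add: grp_def H_def)
lemma mG[simp]: "x \<in> G k \<Longrightarrow> y \<in> G k \<Longrightarrow> x \<cdot> y \<in> G k" using grpG unfolding grp_def by blast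
lemma mH[simp]: "x \<in> H \<Longrightarrow> y \<in> H \<Longrightarrow> x \<cdot> y \<in> H" using grpH unfolding grp_def H_def by blast
lemma ivG[simp]: "x \<in> G k \<Longrightarrow> iv x \<in> G k" using iv_props[of x] by (auto simp: G_def split: if_splits)
lemma ivH[simp]: "x \<in> H \<Longrightarrow> iv x \<in> H" using iv_props[of x] by (auto simp: H_def)
lemma aG: "x \<in> G k \<Longrightarrow> y \<in> G k \<Longrightarrow> z \<in> G k \<Longrightarrow> (x \<cdot> y) \<cdot> z = x \<cdot> (y \<cdot> z)"
  using grpG unfolding grp_def by blast
lemma el: "x \<in> L \<union> M \<Longrightarrow> e \<cdot> x = x" and er: "x \<in> L \<union> M \<Longrightarrow> x \<cdot> e = x"
  using grpL grpM unfolding grp_def by auto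
lemma elG[simp]: "x \<in> G k \<Longrightarrow> e \<cdot> x = x" and erG[simp]: "x \<in> G k \<Longrightarrow> x \<cdot> e = x"
  using GLM el er by blast+
lemma elH[simp]: "x \<in> H \<Longrightarrow> e \<cdot> x = x" and erH[simp]: "x \<in> H \<Longrightarrow> x \<cdot> e = x"
  using el er by (auto simp: H_def)
lemma ivl: "x \<in> L \<union> M \<Longrightarrow> iv x \<cdot> x = e" and ivr: "x \<in> L \<union> M \<Longrightarrow> x \<cdot> iv x = e"
  using iv_props by blast+
lemma ivlG[simp]: "x \<in> G k \<Longrightarrow> iv x \<cdot> x = e" and ivrG[simp]: "x \<in> G k \<Longrightarrow> x \<cdot> iv x = e"
  using GLM ivl ivr by blast+
lemma ivlH[simp]: "x \<in> H \<Longrightarrow> iv x \<cdot> x = e" and ivrH[simp]: "x \<in> H \<Longrightarrow> x \<cdot> iv x = e"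
  using ivl ivr by (auto simp: H_def)
lemma iv_cancel_l[simp]: "x \<in> G k \<Longrightarrow> y \<in> G k \<Longrightarrow> iv x \<cdot> (x \<cdot> y) = y"
  by (simp add: aG[of "iv x" k x y, symmetric])
lemma iv_cancel_r[simp]: "x \<in> G k \<Longrightarrow> y \<in> G k \<Longrightarrow> x \<cdot> (iv x \<cdot> y) = y"
  by (simp add: aG[of x k "iv x" y, symmetric])
lemma iv_unique: "x \<in> G k \<Longrightarrow> y \<in> G k \<Longrightarrow> x \<cdot> y = e \<Longrightarrow> iv x = y"
  using iv_cancel_l[of x k y] erG[OF ivG, of x k] by simp
lemma iv_iv[simp]: "x \<in> L \<union> M \<Longrightarrow> iv (iv x) = x"
proof -
  assume "x \<in> L \<union> M"
  then obtain k where k: "x \<in> G k" by (rule LM_G)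
  show ?thesis by (rule iv_unique[of _ k]) (use k in auto)
qed
lemma iv_ivG[simp]: "x \<in> G k \<Longrightarrow> iv (iv x) = x" using GLM iv_iv by blast
lemma iv_mult: "x \<in> G k \<Longrightarrow> y \<in> G k \<Longrightarrow> iv (x \<cdot> y) = iv y \<cdot> iv x"
  by (rule iv_unique[of _ k]) (auto simp: aG)
lemma iv_e[simp]: "iv e = e" by (rule iv_unique[of _ 0]) auto
lemma aH: "x \<in> H \<Longrightarrow> y \<in> H \<Longrightarrow> z \<in> H \<Longrightarrow> (x \<cdot> y) \<cdot> z = x \<cdot> (y \<cdot> z)"
  using aG[of x 0 y z] HG by blast
lemma iv_ivH[simp]: "x \<in> H \<Longrightarrow> iv (iv x) = x" using HG iv_ivG by blast
lemma notH_mult: "x \<in> G k - H \<Longrightarrow> c \<in> H \<Longrightarrow> x \<cdot> c \<in> G k - H"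
proof -
  assume a: "x \<in> G k - H" "c \<in> H"
  have "x = (x \<cdot> c) \<cdot> iv c" using a HG[of c k] HG[of "iv c" k] by (auto simp: aG)
  then show ?thesis using a mH[of "x \<cdot> c" "iv c"] HG[of c k] by auto
qed
lemma notH_mult2: "x \<in> G k - H \<Longrightarrow> c \<in> H \<Longrightarrow> c \<cdot> x \<in> G k - H"
proof -
  assume a: "x \<in> G k - H" "c \<in> H"
  have "x = iv c \<cdot> (c \<cdot> x)" using a HG[of c k] HG[of "iv c" k] by auto
  then show ?thesis using a mH[of "iv c" "c \<cdot> x"] HG[of c k] by auto
qed
lemma notH_iv: "x \<in> G k - H \<Longrightarrow> iv x \<in> G k - H"
  using ivH[of "iv x"] iv_ivG[of x k] ivG[of x k] by auto
lemma cancel_l: "x \<in> G k \<Longrightarrow> y \<in> G k \<Longrightarrow> z \<in> G k \<Longrightarrow> x \<cdot> y = x \<cdot> z \<Longrightarrow> y = z"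
proof -
  assume a: "x \<in> G k" "y \<in> G k" "z \<in> G k" "x \<cdot> y = x \<cdot> z"
  have "y = iv x \<cdot> (x \<cdot> y)" by (rule iv_cancel_l[OF a(1,2), symmetric])
  also have "\<dots> = iv x \<cdot> (x \<cdot> z)" by (simp only: a(4))
  also have "\<dots> = z" by (rule iv_cancel_l[OF a(1,3)])
  finally show ?thesis .
qed
lemma cancel_r: "x \<in> G k \<Longrightarrow> y \<in> G k \<Longrightarrow> z \<in> G k \<Longrightarrow> y \<cdot> x = z \<cdot> x \<Longrightarrow> y = z"
proof -
  assume a: "x \<in> G k" "y \<in> G k" "z \<in> G k" "y \<cdot> x = z \<cdot> x"
  have "y = (y \<cdot> x) \<cdot> iv x" using a(1,2) by (simp add: aG)
  also have "\<dots> = (z \<cdot> x) \<cdot> iv x" by (simp only: a(4))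
  also have "\<dots> = z" using a(1,3) by (simp add: aG)
  finally show ?thesis .
qed

lemmas gs = aG erG elG ivlG ivrG iv_cancel_l iv_cancel_r iv_ivG mG ivG iv_mult

section \<open>Twists, shifts and reversals of syllable sequences\<close>

definition twist :: "(nat \<Rightarrow> 'g) \<Rightarrow> (nat \<Rightarrow> 'g) \<Rightarrow> nat \<Rightarrow> 'g" where
  "twist c r = (\<lambda>i. iv (c i) \<cdot> r i \<cdot> c (Suc i))"

definition sh :: "nat \<Rightarrow> (nat \<Rightarrow> 'g) \<Rightarrow> nat \<Rightarrow> 'g" where "sh k r = (\<lambda>i. r (i + k))"

definition rv :: "nat \<Rightarrow> (nat \<Rightarrow> 'g) \<Rightarrow> nat \<Rightarrow> 'g" where
  "rv P r = (\<lambda>i. iv (r (P - 1 - i mod P)))"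

definition alt :: "(nat \<Rightarrow> 'g) \<Rightarrow> nat \<Rightarrow> bool" where "alt r k \<longleftrightarrow> (\<forall>i. r i \<in> G (k + i) - H)"

definition hper :: "nat \<Rightarrow> (nat \<Rightarrow> 'g) \<Rightarrow> bool" where
  "hper P c \<longleftrightarrow> (\<forall>i. c i \<in> H) \<and> (\<forall>i. c (i + P) = c i)"

lemma LM_iv: "x \<in> L \<union> M \<Longrightarrow> iv x \<in> L \<union> M" using iv_props by blast

lemma twist_comp:
  assumes "\<forall>i. s i \<in> L \<union> M" "\<forall>i. c i \<in> H" "\<forall>i. d i \<in> H"
  shows "twist d (twist c s) = twist (\<lambda>i. c i \<cdot> d i) s"
proof
  fix i
  obtain k where k: "s i \<in> G k" using assms(1) LM_G by blast
  have "c i \<in> G k" "c (Suc i) \<in> G k" "d i \<in> G k" "d (Suc i) \<in> G k" using assms HG by auto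
  then show "twist d (twist c s) i = twist (\<lambda>i. c i \<cdot> d i) s i"
    using k unfolding twist_def by (simp add: gs[where k=k])
qed

lemma twist_one: "\<forall>i. s i \<in> L \<union> M \<Longrightarrow> twist (\<lambda>_. e) s = s" unfolding twist_def using el er by auto

lemma twist_LM: "\<forall>i. s i \<in> L \<union> M \<Longrightarrow> \<forall>i. c i \<in> H \<Longrightarrow> twist c s i \<in> L \<union> M"
proof -
  assume a: "\<forall>i. s i \<in> L \<union> M" "\<forall>i. c i \<in> H"
  obtain k where k: "s i \<in> G k" using a(1) LM_G by blast
  have "c i \<in> G k" "c (Suc i) \<in> G k" using a HG by auto
  then show ?thesis using k GLM[of "twist c s i" k] unfolding twist_def by simp
qed

lemma twist_undo:
  assumes "\<forall>i. s i \<in> L \<union> M" "\<forall>i. c i \<in> H" shows "twist (\<lambda>i. iv (c i)) (twist c s) = s"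
  using twist_comp[OF assms, of "\<lambda>i. iv (c i)"] twist_one[OF assms(1)] assms(2) by simp

lemma shift_twist: "sh k (twist c r) = twist (sh k c) (sh k r)" unfolding sh_def twist_def by auto

lemma shift_shift: "sh i (sh j r) = sh (i + j) r" unfolding sh_def by (auto simp: add.assoc)

lemma hper_shift: "hper P c \<Longrightarrow> hper P (sh k c)"
proof -
  assume a: "hper P c"
  have "c (i + P + k) = c (i + k)" for i using a unfolding hper_def by (metis add.assoc add.commute)
  then show ?thesis using a unfolding hper_def sh_def by auto
qed

text \<open>Reversal reads the gaps backwards: the gap in front of syllable \<open>i\<close> of the
  inverse is the gap behind syllable \<open>P - 1 - i\<close>, whence
  \<open>d i = c (P - i mod P)\<close>.\<close>

lemma twist_rev:
  assumes P: "P > 0" and s: "\<forall>i. s i \<in> L \<union> M" and c: "hper P c"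
  shows "\<exists>d. hper P d \<and> twist c (rv P s) = rv P (twist d s)"
proof (intro exI conjI)
  define d where "d i = c (P - i mod P)" for i
  show hd: "hper P d" unfolding hper_def d_def using c unfolding hper_def by simp
  show "twist c (rv P s) = rv P (twist d s)"
  proof
    fix i
    define l where "l = P - 1 - i mod P"
    have iP: "i mod P < P" using P by simp
    obtain k where k: "s l \<in> G k" using s LM_G by blast
    have dG: "d j \<in> G k" for j using hd HG unfolding hper_def by blast
    have cm: "c (j mod P) = c j" for j
    proof -
      have "c (j mod P + n * P) = c (j mod P)" for n
        using c unfolding hper_def by (induction n) (auto simp: algebra_simps, metis add.assoc add.commute)
      from this[of "j div P"] show ?thesis by simp
    qed
    have lP: "l < P" unfolding l_def using P by simp
    have 1: "d l = c (Suc i)"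
    proof -
      have "d l = c (Suc (i mod P))" unfolding d_def using lP iP unfolding l_def by simp
      also have "\<dots> = c (Suc i)" using cm[of "Suc (i mod P)"] cm[of "Suc i"] by (simp add: mod_Suc_eq)
      finally show ?thesis .
    qed
    have 2: "d (Suc l) = c i"
    proof (cases "i mod P = 0")
      case True
      then have "Suc l = P" unfolding l_def using P by simp
      moreover have "c P = c 0" using c unfolding hper_def by (metis add_0)
      ultimately show ?thesis unfolding d_def using cm[of i] True by simp
    next
      case False
      then have "Suc l = P - i mod P" "P - i mod P < P" unfolding l_def using iP P by linarith+
      then show ?thesis unfolding d_def using cm[of i] iP by simp
    qed
    have "rv P (twist d s) i = iv (iv (d l) \<cdot> s l \<cdot> d (Suc l))" unfolding rv_def twist_def l_def by simp
    also have "\<dots> = iv (d (Suc l)) \<cdot> iv (s l) \<cdot> d l" using k dG by (simp add: gs[where k=k])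
    also have "\<dots> = twist c (rv P s) i" unfolding 1 2 unfolding twist_def rv_def l_def by simp
    finally show "twist c (rv P s) i = rv P (twist d s) i" by simp
  qed
qed

lemma per_mod: "(\<And>i. s (i + P) = s i) \<Longrightarrow> s (i mod P) = s (i :: nat)"
proof -
  assume a: "\<And>i. s (i + P) = s i"
  have "s (i mod P + n * P) = s (i mod P)" for n
  proof (induction n)
    case (Suc n) then show ?case using a[of "i mod P + n * P"] by (simp add: algebra_simps)
  qed simp
  from this[of "i div P"] show ?thesis by simp
qed

lemma sh_mod: "(\<And>i. s (i + P) = s i) \<Longrightarrow> sh (k mod P) s = sh k s"
  unfolding sh_def using per_mod[of s P] by (metis mod_add_right_eq)

lemma rev_rev: "P > 0 \<Longrightarrow> (\<And>i. s (i + P) = s i) \<Longrightarrow> \<forall>i. s i \<in> L \<union> M \<Longrightarrow> rv P (rv P s) = s"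
proof
  fix i assume a: "P > 0" "\<And>i. s (i + P) = s i" "\<forall>i. s i \<in> L \<union> M"
  have "P - 1 - (P - 1 - i mod P) mod P = i mod P" using a(1) by (simp add: Suc_leI)
  then show "rv P (rv P s) i = s i" unfolding rv_def using per_mod[of s P, OF a(2)] a(3) iv_iv by simp
qed

lemma rev_twist:
  assumes P: "P > 0" and s: "\<forall>i. s i \<in> L \<union> M" "\<And>i. s (i + P) = s i" and c: "hper P c"
  shows "\<exists>d. hper P d \<and> rv P (twist c s) = twist d (rv P s)"
proof -
  have q: "\<forall>i. rv P s i \<in> L \<union> M" "\<And>i. rv P s (i + P) = rv P s i" using s LM_iv unfolding rv_def by auto
  obtain d where d: "hper P d" "twist c (rv P (rv P s)) = rv P (twist d (rv P s))" using twist_rev[OF P q(1) c] by blast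
  have dp: "d i \<in> H" "d (i + P) = d i" for i using d(1) unfolding hper_def by auto
  have "twist d (rv P s) (i + P) = twist d (rv P s) i" for i
    using dp(2)[of i] dp(2)[of "Suc i"] q(2)[of i] unfolding twist_def by simp
  then have "rv P (rv P (twist d (rv P s))) = twist d (rv P s)"
    by (intro rev_rev P) (use twist_LM q(1) dp in auto)
  then show ?thesis using d rev_rev[OF P s(2,1)] by metis
qed

lemma rev_sh:
  assumes P0: "P > 0" and per: "\<And>i. s (i + P) = s i" and k: "k \<le> P"
  shows "rv P (sh k s) = sh (P - k) (rv P s)"
proof
  fix i
  have "s (P - 1 - i mod P + k) = s (P - 1 - (i + (P - k)) mod P)"
  proof (cases "i mod P < k")
    case True
    have "(i + (P - k)) mod P = (i mod P + (P - k)) mod P" by (simp add: mod_simps)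
    also have "\<dots> = i mod P + (P - k)" using True k by (intro mod_less) auto
    finally have "P - 1 - i mod P + k = P - 1 - (i + (P - k)) mod P + P"
      using True k mod_less_divisor[OF P0, of i] by auto
    then show ?thesis using per by simp
  next
    case False
    have "(i + (P - k)) mod P = (i mod P + (P - k)) mod P" by (simp add: mod_simps)
    also have "i mod P + (P - k) = (i mod P - k) + P" using False k by auto
    also have "\<dots> mod P = i mod P - k" using mod_less_divisor[OF P0, of i]
      by (simp add: less_imp_diff_less)
    finally have "P - 1 - i mod P + k = P - 1 - (i + (P - k)) mod P"
      using False mod_less_divisor[OF P0, of i] by auto
    then show ?thesis by simp
  qed
  then show "rv P (sh k s) i = sh (P - k) (rv P s) i" unfolding rv_def sh_def by simp
qed

lemma sh_rev:
  assumes P0: "P > 0" and per: "\<And>i. s (i + P) = s i"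
  shows "\<exists>j. sh k (rv P s) = rv P (sh j s)"
proof
  have "rv P s (i + P) = rv P s i" for i unfolding rv_def by simp
  then have "sh k (rv P s) = sh (k mod P) (rv P s)" using sh_mod[of "rv P s" P] by simp
  also have "\<dots> = rv P (sh (P - k mod P) s)"
    using rev_sh[of P s "P - k mod P", OF P0 per] mod_less_divisor[OF P0, of k] by simp
  finally show "sh k (rv P s) = rv P (sh (P - k mod P) s)" .
qed

end

text \<open>A line \<open>r \<in> Ln\<close> is a bi-infinite reading of the relator \<open>r 0 \<cdots> r (P - 1)\<close>, whose syllables lie alternately in
  \<open>L - H\<close> and \<open>M - H\<close>. Lines are identified up to shift, reversal \<open>rv\<close> (the inverse relator) and twists, which move elements
  of \<open>H\<close> across the gaps between syllables. \<open>SC\<close> is the small cancellation condition, with pieces of length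
  less than \<open>\<epsilon>\<close>.\<close>

locale smallcanc = amalgam L M f e for L M :: "'g set" and f (infixl "\<cdot>" 70) and e +
  fixes Ln :: "(nat \<Rightarrow> 'g) set" and P \<epsilon> :: nat
  assumes eps: "2 \<le> \<epsilon>" and P40: "39 * \<epsilon> \<le> P" and evenP: "even P"
    and Ln_alt: "r \<in> Ln \<Longrightarrow> \<exists>k. alt r k"
    and Ln_per: "r \<in> Ln \<Longrightarrow> r (i + P) = r i"
    and Ln_sh: "r \<in> Ln \<Longrightarrow> sh k r \<in> Ln"
    and Ln_rv: "r \<in> Ln \<Longrightarrow> rv P r \<in> Ln"
    and Ln_twist: "r \<in> Ln \<Longrightarrow> hper P c \<Longrightarrow> twist c r \<in> Ln"
    and SC: "r \<in> Ln \<Longrightarrow> s \<in> Ln \<Longrightarrow> (\<And>i. i < \<epsilon> \<Longrightarrow> r i = s i) \<Longrightarrow>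
        \<exists>c. hper P c \<and> c 0 = e \<and> s = twist c r"
    and NR: "r \<in> Ln \<Longrightarrow> hper P c \<Longrightarrow> \<exists>i<\<epsilon>. r i \<noteq> twist c (sh k (rv P r)) i"
begin

text \<open>Half a relator less a margin. A cell hangs from its peak, and each of its two sides is
  guaranteed to descend \<open>A\<close> steps before the bottom of the cell is reached.\<close>

definition A :: nat where "A = P div 2 - 1 - \<epsilon>"

lemma A_bounds: "18 * \<epsilon> \<le> A" "2 * A + 2 + 2 * \<epsilon> = P" "P > 0" "\<epsilon> < P"
proof -
  obtain q where q: "P = 2 * q" using evenP by auto
  then show "18 * \<epsilon> \<le> A" "2 * A + 2 + 2 * \<epsilon> = P" "P > 0" "\<epsilon> < P"
    using P40 eps unfolding A_def by auto
qed

lemma Ln_nH: "r \<in> Ln \<Longrightarrow> r i \<notin> H" using Ln_alt unfolding alt_def by blast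

lemma Ln_G:
  assumes "r \<in> Ln" "r i \<in> G m" shows "r j \<in> G (m + i + j) - H"
proof -
  obtain k where k: "alt r k" using Ln_alt assms(1) by blast
  have 1: "r i \<in> G (k + i) - H" "r j \<in> G (k + j) - H" using k unfolding alt_def by auto
  have "even (k + i + m)"
  proof (rule ccontr)
    assume "odd (k + i + m)"
    then have "G (k + i) = G (Suc m)" by (intro G_parity) auto
    then show False using 1(1) assms(2) G_both[of "r i" m] by auto
  qed
  then have "G (k + j) = G (m + i + j)" by (intro G_parity) presburger
  then show ?thesis using 1 by auto
qed

lemma Ln_LM: "r \<in> Ln \<Longrightarrow> r i \<in> L \<union> M" using Ln_alt GLM unfolding alt_def by blast

lemma hper_H: "hper P c \<Longrightarrow> c i \<in> H" unfolding hper_def by blast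

lemma hper_mult: "hper P c \<Longrightarrow> hper P d \<Longrightarrow> hper P (\<lambda>i. c i \<cdot> d i)"
  unfolding hper_def by auto

lemma twist_twist:
  assumes "s \<in> Ln" "\<forall>i. c i \<in> H" "\<forall>i. d i \<in> H"
  shows "twist d (twist c s) = twist (\<lambda>i. c i \<cdot> d i) s"
  by (rule twist_comp) (use Ln_LM assms in auto)

lemma sh_P: "r \<in> Ln \<Longrightarrow> sh P r = r" unfolding sh_def using Ln_per by auto

lemma hper_const: "c \<in> H \<Longrightarrow> hper P (\<lambda>_. c)" unfolding hper_def by auto

text \<open>A local comparison determines the twisting elements only on a window; cut off and
  repeated with period \<open>P\<close>, they become an admissible twist.\<close>

lemma hper_fin:
  assumes "\<forall>j. c j \<in> H"
  shows "hper P (\<lambda>j. if j mod P \<le> n then c (j mod P) else e)"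
  using assms unfolding hper_def by auto

end

text \<open>The vertices of the complex are the orbits of \<open>G k\<close> on \<open>V k\<close>; they form layer \<open>k\<close>. A point of \<open>E k\<close> is an edge between
  the layers \<open>k\<close> and \<open>k + 1\<close>, up to \<open>H\<close>. Acting by an element outside \<open>H\<close> moves to another edge at the same vertex,
  so that walks read words.\<close>

locale stage = smallcanc L M f e Ln P \<epsilon>
  for L M :: "'g set" and f (infixl "\<cdot>" 70) and e and Ln and P \<epsilon> :: nat +
  fixes E :: "nat \<Rightarrow> 'p set" and act :: "'p \<Rightarrow> 'g \<Rightarrow> 'p" (infixl "\<odot>" 65) and N :: nat
begin

definition V :: "nat \<Rightarrow> 'p set" where "V k = (if k = 0 then E 0 else E (k - 1) \<union> E k)"

text \<open>The action is meaningful only for elements of the groups of the two vertices of an edge;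
  this records that such a vertex exists in a layer already built.\<close>

definition ok :: "nat \<Rightarrow> 'p \<Rightarrow> 'g \<Rightarrow> bool" where "ok n q g \<longleftrightarrow> (\<exists>k\<le>n. q \<in> V k \<and> g \<in> G k)"

primrec walk :: "'p \<Rightarrow> (nat \<Rightarrow> 'g) \<Rightarrow> nat \<Rightarrow> 'p" where
  "walk p r 0 = p" | "walk p r (Suc j) = walk p r j \<odot> r j"

definition desc :: "'p \<Rightarrow> (nat \<Rightarrow> 'g) \<Rightarrow> nat \<Rightarrow> nat \<Rightarrow> bool" where
  "desc p r t k \<longleftrightarrow> t \<le> k \<and> (\<forall>j<t. r j \<in> G (k - j)) \<and> (\<forall>j\<le>t. walk p r j \<in> E (k - j))"

text \<open>Uniqueness of the way down: the lower edges at the vertex of \<open>p\<close> make up at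
  most one orbit of \<open>H\<close>.\<close>

definition single :: "nat \<Rightarrow> 'p \<Rightarrow> bool" where
  "single k p \<longleftrightarrow> (\<forall>g\<in>G k. \<forall>g'\<in>G k. p \<odot> g \<in> E (k - 1) \<longrightarrow> p \<odot> g' \<in> E (k - 1) \<longrightarrow> (\<exists>c\<in>H. g' = g \<cdot> c))"

text \<open>A vertex with two different lower edges arises only as the top of a cell. The line
  \<open>r\<close> is its boundary: \<open>g\<close> crosses the top, both sides descend, and the
  other \<open>P - 1\<close> syllables lead back to \<open>p\<close> without rising above the edges
  of \<open>E k\<close>.\<close>

definition peaks :: "nat \<Rightarrow> bool" where
  "peaks k \<longleftrightarrow> (\<forall>p\<in>E k. \<forall>g\<in>G (Suc k) - H. p \<odot> g \<in> E k \<longrightarrow>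
     (\<exists>r\<in>Ln. r 0 = g \<and> A \<le> k \<and> (\<forall>j\<le>A. walk (p \<odot> g) (sh 1 r) j \<in> E (k - j))
       \<and> (\<forall>j\<le>A. walk p (rv P r) j \<in> E (k - j))
       \<and> walk (p \<odot> g) (sh 1 r) (P - 1) = p
       \<and> (\<forall>j<P. \<exists>i\<le>k. walk (p \<odot> g) (sh 1 r) j \<in> E i)))"

text \<open>A path that reads all but one syllable of a relator and stays in the edge sets up to
  \<open>E n\<close>. When the next layer is added, the missing syllable has to join its two
  ends.\<close>

definition relpath :: "nat \<Rightarrow> 'p \<Rightarrow> (nat \<Rightarrow> 'g) \<Rightarrow> bool" where
  "relpath n p r \<longleftrightarrow> p \<in> E n \<and> r \<in> Ln \<and> r 0 \<in> G n \<and> (\<forall>j<P. \<exists>i\<le>n. walk p r j \<in> E i)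
     \<and> (\<forall>j<P - 1. ok n (walk p r j) (r j)) \<and> walk p r (P - 1) \<in> E n"

text \<open>The invariant of the construction up to layer \<open>N\<close>. Its last clause stops at
  \<open>n < N\<close> because the syllable that closes a path with ends in \<open>E N\<close> acts
  at the vertices of the next layer.\<close>

definition good :: bool where
  "good \<longleftrightarrow> (\<forall>i\<le>N. \<forall>j\<le>N. i \<noteq> j \<longrightarrow> E i \<inter> E j = {})
    \<and> (\<forall>k\<le>N. \<forall>p\<in>V k. \<forall>g\<in>G k. p \<odot> g \<in> V k \<and> (\<forall>g'\<in>G k. p \<odot> g \<odot> g' = p \<odot> (g \<cdot> g')) \<and> (p \<odot> g = p \<longrightarrow> g = e))
    \<and> (\<forall>k\<le>N. \<forall>p\<in>V k. p \<odot> e = p)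
    \<and> (\<forall>k\<le>N. \<forall>p\<in>E k. \<forall>h\<in>H. p \<odot> h \<in> E k)
    \<and> (\<forall>k<N. \<forall>p\<in>E (Suc k). \<exists>g\<in>G (Suc k). p \<odot> g \<in> E k)
    \<and> E 0 \<noteq> {} \<and> (\<forall>p\<in>E 0. \<forall>q\<in>E 0. \<exists>g\<in>L. q = p \<odot> g)
    \<and> (\<forall>k<N. peaks k)
    \<and> (\<forall>n<N. \<forall>p r. relpath n p r \<longrightarrow> walk p r P = p)"

lemma walk_add: "walk p r (i + j) = walk (walk p r i) (sh i r) j"
  by (induction j) (auto simp: sh_def add.commute)

lemma V_E: "p \<in> E k \<Longrightarrow> p \<in> V k" "p \<in> E k \<Longrightarrow> p \<in> V (Suc k)" by (auto simp: V_def)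

lemma V_cases: assumes "p \<in> V k" obtains "p \<in> E k" | "k > 0" "p \<in> E (k - 1)"
  using assms by (auto simp: V_def split: if_splits)

end

section \<open>Descents in a good stage are unique up to twists\<close>

locale gstage = stage L M f e Ln P \<epsilon> E act N
  for L M :: "'g set" and f (infixl "\<cdot>" 70) and e and Ln and P \<epsilon> :: nat
    and E :: "nat \<Rightarrow> 'p set" and act (infixl "\<odot>" 65) and N :: nat +
  assumes good: good
begin

lemma disj: "i \<le> N \<Longrightarrow> j \<le> N \<Longrightarrow> p \<in> E i \<Longrightarrow> p \<in> E j \<Longrightarrow> i = j"
  using good[unfolded good_def, THEN conjunct1] by blast
lemmas good_tail = good[unfolded good_def, THEN conjunct2, THEN conjunct2, THEN conjunct2]
lemmas good_tail2 = good_tail[THEN conjunct2, THEN conjunct2, THEN conjunct2]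
lemmas good_act = good[unfolded good_def, THEN conjunct2, THEN conjunct1]
lemma V_cl: "k \<le> N \<Longrightarrow> p \<in> V k \<Longrightarrow> g \<in> G k \<Longrightarrow> p \<odot> g \<in> V k"
  using good_act by simp
lemma act_m: "k \<le> N \<Longrightarrow> p \<in> V k \<Longrightarrow> g \<in> G k \<Longrightarrow> g' \<in> G k \<Longrightarrow> p \<odot> g \<odot> g' = p \<odot> (g \<cdot> g')"
  using good_act by simp
lemma act_free: "k \<le> N \<Longrightarrow> p \<in> V k \<Longrightarrow> g \<in> G k \<Longrightarrow> p \<odot> g = p \<Longrightarrow> g = e"
  using good_act by meson
lemma act_e: "k \<le> N \<Longrightarrow> p \<in> V k \<Longrightarrow> p \<odot> e = p"
  using good[unfolded good_def, THEN conjunct2, THEN conjunct2, THEN conjunct1] by simp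
lemma E_H: "k \<le> N \<Longrightarrow> p \<in> E k \<Longrightarrow> h \<in> H \<Longrightarrow> p \<odot> h \<in> E k"
  using good_tail[THEN conjunct1] by simp
lemma down: "k < N \<Longrightarrow> p \<in> E (Suc k) \<Longrightarrow> \<exists>g\<in>G (Suc k). p \<odot> g \<in> E k"
  using good_tail[THEN conjunct2, THEN conjunct1] by simp
lemma root_ne: "E 0 \<noteq> {}" by (rule good_tail[THEN conjunct2, THEN conjunct2, THEN conjunct1])
lemma root: "p \<in> E 0 \<Longrightarrow> q \<in> E 0 \<Longrightarrow> \<exists>g\<in>L. q = p \<odot> g"
  using good_tail2[THEN conjunct1] by simp
lemma peaksD: "k < N \<Longrightarrow> peaks k" using good_tail2[THEN conjunct2, THEN conjunct1] by simp
lemma closing: "n < N \<Longrightarrow> relpath n p r \<Longrightarrow> walk p r P = p"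
  using good_tail2[THEN conjunct2, THEN conjunct2] by simp

lemma act_inj2:
  assumes "k \<le> N" "p \<in> V k" "g \<in> G k" "g' \<in> G k" "p \<odot> g = p \<odot> g'" shows "g = g'"
proof -
  have "p \<odot> (g' \<cdot> iv g) = p \<odot> (g \<cdot> iv g)"
    using assms act_m[OF assms(1,2,3) ivG[OF assms(3)]] act_m[OF assms(1,2,4) ivG[OF assms(3)]] by simp
  then have "p \<odot> (g' \<cdot> iv g) = p" using assms act_e by auto
  then have "g' \<cdot> iv g = e" using act_free[OF assms(1,2)] assms by auto
  then have "g' \<cdot> iv g \<cdot> g = e \<cdot> g" by simp
  then show ?thesis using assms by (simp add: aG[of g' k "iv g" g])
qed

lemma act_inv:
  assumes "k \<le> N" "p \<in> V k" "g \<in> G k" shows "p \<odot> g \<odot> iv g = p" "p \<odot> iv g \<odot> g = p"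
  using assms act_m[of k p g "iv g"] act_m[of k p "iv g" g] act_e by auto

lemma twist_walk:
  assumes c: "\<forall>i. c i \<in> H" and okt: "\<forall>j<t. ok N (walk p r j) (r j)" and jt: "j \<le> t"
  shows "walk (p \<odot> c 0) (twist c r) j = walk p r j \<odot> c j"
  using jt
proof (induction j)
  case (Suc j)
  obtain k where k: "k \<le> N" "walk p r j \<in> V k" "r j \<in> G k"
    using okt Suc.prems unfolding ok_def by (metis Suc_le_lessD)
  have H: "c j \<in> G k" "c (Suc j) \<in> G k" using c HG by auto
  have w: "walk p r j \<odot> c j \<in> V k" using V_cl k H by auto
  have "walk (p \<odot> c 0) (twist c r) (Suc j) = walk p r j \<odot> c j \<odot> (iv (c j) \<cdot> r j \<cdot> c (Suc j))"
    using Suc by (simp add: twist_def)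
  also have "\<dots> = walk p r j \<odot> (c j \<cdot> (iv (c j) \<cdot> r j \<cdot> c (Suc j)))"
    using act_m[OF k(1,2) H(1)] k H by auto
  also have "c j \<cdot> (iv (c j) \<cdot> r j \<cdot> c (Suc j)) = r j \<cdot> c (Suc j)"
    using k H by (simp add: aG[where k=k])
  also have "walk p r j \<odot> (r j \<cdot> c (Suc j)) = walk p r j \<odot> r j \<odot> c (Suc j)"
    using act_m[OF k(1,2,3) H(2)] by simp
  finally show ?case by simp
qed simp

lemma ok_E: "p \<in> E i \<Longrightarrow> i < n \<Longrightarrow> g \<in> L \<union> M \<Longrightarrow> ok n p g"
proof -
  assume a: "p \<in> E i" "i < n" "g \<in> L \<union> M"
  have "g \<in> G i \<or> g \<in> G (Suc i)" using a unfolding G_def by auto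
  then show ?thesis unfolding ok_def using a V_E by (meson Suc_leI less_imp_le)
qed

lemma ok_desc: "desc p r t k \<Longrightarrow> k \<le> N \<Longrightarrow> j < t \<Longrightarrow> ok N (walk p r j) (r j)"
  unfolding desc_def ok_def by (meson V_E(1) diff_le_self le_trans less_imp_le)

lemma desc_mono: "desc p r t k \<Longrightarrow> t' \<le> t \<Longrightarrow> desc p r t' k" unfolding desc_def by auto

lemma desc_shift: "desc p r t k \<Longrightarrow> j \<le> t \<Longrightarrow> desc (walk p r j) (sh j r) (t - j) (k - j)"
  unfolding desc_def
proof (intro conjI allI impI)
  assume a: "t \<le> k \<and> (\<forall>j<t. r j \<in> G (k - j)) \<and> (\<forall>j\<le>t. walk p r j \<in> E (k - j))" "j \<le> t"
  show "t - j \<le> k - j" using a by auto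
  fix i
  show "sh j r i \<in> G (k - j - i)" if "i < t - j"
    using a that by (auto simp: sh_def add.commute)
  show "walk (walk p r j) (sh j r) i \<in> E (k - j - i)" if "i \<le> t - j"
    using a that by (auto simp: walk_add[symmetric])
qed

lemma desc_twist:
  assumes "desc p r t k" "k \<le> N" "\<forall>i. c i \<in> H"
  shows "desc (p \<odot> c 0) (twist c r) t k"
  unfolding desc_def
proof (intro conjI allI impI)
  show "t \<le> k" using assms desc_def by auto
  fix j
  show "twist c r j \<in> G (k - j)" if "j < t"
    using assms that HG unfolding twist_def desc_def by auto
  show "walk (p \<odot> c 0) (twist c r) j \<in> E (k - j)" if "j \<le> t"
    using twist_walk[of c t p r j] ok_desc[OF assms(1,2)] assms that E_H[of "k - j"]
    unfolding desc_def by auto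
qed

lemma desc_Ln:
  assumes "r \<in> Ln" "r 0 \<in> G k" "t \<le> k" "\<And>j. j \<le> t \<Longrightarrow> walk p r j \<in> E (k - j)"
  shows "desc p r t k"
  unfolding desc_def
proof (intro conjI allI impI)
  fix j assume "j < t"
  then have "G (k - j) = G (k + j)" using assms by (intro G_parity) auto
  then show "r j \<in> G (k - j)" using Ln_G[OF assms(1,2), of j] by auto
qed (use assms in auto)

text \<open>Where the way down is unique both paths pass the same edges, and each step contributes
  one element of \<open>H\<close>, the difference of the chosen representatives.\<close>

lemma follow0:
  assumes s: "desc p s n k" and r: "desc p r n k" and kN: "k \<le> N"
    and sing: "\<forall>j<n. single (k - j) (walk p s j)"
  shows "\<exists>c. (\<forall>j. c j \<in> H) \<and> c 0 = e \<and> (\<forall>j\<le>n. walk p r j = walk p s j \<odot> c j) \<and> (\<forall>j<n. r j = twist c s j)"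
  using s r sing
proof (induction n)
  case 0
  have "p \<in> V k" using 0 unfolding desc_def by (auto intro: V_E)
  then show ?case using kN act_e by (intro exI[of _ "\<lambda>_. e"]) auto
next
  case (Suc n)
  have "\<exists>c. (\<forall>j. c j \<in> H) \<and> c 0 = e \<and> (\<forall>j\<le>n. walk p r j = walk p s j \<odot> c j) \<and> (\<forall>j<n. r j = twist c s j)"
    using Suc desc_mono by (metis Suc_leD less_Suc_eq order_refl)
  then obtain c where c: "\<forall>j. c j \<in> H" "c 0 = e" "\<forall>j\<le>n. walk p r j = walk p s j \<odot> c j"
    "\<forall>j<n. r j = twist c s j" by blast
  define m where "m = k - n"
  have m: "m \<le> N" "m - 1 = k - Suc n" using kN m_def Suc.prems(1) unfolding desc_def by auto
  have q: "walk p s n \<in> E m" "s n \<in> G m" "r n \<in> G m" "walk p s (Suc n) \<in> E (m - 1)" "walk p r (Suc n) \<in> E (m - 1)"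
    using Suc.prems m unfolding desc_def m_def by (auto simp del: walk.simps)
  have cn: "c n \<in> G m" using c HG by auto
  have w: "walk p r (Suc n) = walk p s n \<odot> (c n \<cdot> r n)"
    using c(3) act_m[OF m(1) _ cn q(3), of "walk p s n"] q V_E by auto
  have "single m (walk p s n)" using Suc.prems(3) m_def by auto
  then obtain d where d: "d \<in> H" "c n \<cdot> r n = s n \<cdot> d"
    using q w cn unfolding single_def by (metis mG walk.simps(2))
  define c' where "c' = c(Suc n := d)"
  have dG: "d \<in> G m" using d HG by auto
  have rn: "r n = iv (c n) \<cdot> s n \<cdot> d"
  proof -
    have "r n = iv (c n) \<cdot> (c n \<cdot> r n)" using cn q by simp
    then show ?thesis using d cn q dG by (simp add: aG[where k=m])
  qed
  have "walk p r (Suc n) = walk p s (Suc n) \<odot> d"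
    using w d act_m[OF m(1) V_E(1)[OF q(1)] q(2) dG] by auto
  then have "\<forall>j\<le>Suc n. walk p r j = walk p s j \<odot> c' j"
    using c(3) unfolding c'_def by (auto simp: le_Suc_eq simp del: walk.simps)
  moreover have "\<forall>j<Suc n. r j = twist c' s j"
    using c(4) rn unfolding c'_def twist_def by (auto simp: less_Suc_eq)
  moreover have "\<forall>j. c' j \<in> H" "c' 0 = e" using c(1,2) d(1) unfolding c'_def by simp_all
  ultimately show ?case by blast
qed

text \<open>\<open>follow0\<close> yields the twist on the first \<open>\<epsilon>\<close>
  syllables. Once it has been applied to \<open>s\<close> the two lines agree there, and
  \<open>SC\<close> takes care of the rest.\<close>

lemma merge0:
  assumes s: "desc p s \<epsilon> k" and r: "desc p r \<epsilon> k" and kN: "k \<le> N" and ln: "s \<in> Ln" "r \<in> Ln"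
    and sing: "\<forall>j<\<epsilon>. single (k - j) (walk p s j)"
  shows "\<exists>c. hper P c \<and> c 0 = e \<and> r = twist c s"
proof -
  obtain c where c: "\<forall>j. c j \<in> H" "c 0 = e" "\<forall>j<\<epsilon>. r j = twist c s j"
    using follow0[OF s r kN sing] by blast
  define c' where "c' = (\<lambda>j. if j mod P \<le> \<epsilon> then c (j mod P) else e)"
  have c': "hper P c'" using hper_fin[OF c(1)] unfolding c'_def .
  have s': "twist c' s \<in> Ln" using Ln_twist ln c' by auto
  have "\<And>i. i < \<epsilon> \<Longrightarrow> twist c' s i = r i"
    using c A_bounds unfolding c'_def twist_def by auto
  from SC[OF s' ln(2) this] obtain d where d: "hper P d" "d 0 = e" "r = twist d (twist c' s)" by auto
  have "r = twist (\<lambda>i. c' i \<cdot> d i) s"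
    using d twist_twist[OF ln(1)] c' unfolding hper_def by auto
  then show ?thesis using hper_mult[OF c' d(1)] d c(2) unfolding c'_def
    by (intro exI[of _ "\<lambda>i. c' i \<cdot> d i"]) (auto simp: c'_def)
qed

text \<open>A peak at the vertex of \<open>p\<close> yields a cell whose side merges with the given line; by \<open>SC\<close> the two lines
  coincide also one step before the peak, which puts \<open>p\<close> on two layers.\<close>

lemma desc_single:
  assumes "r \<in> Ln" "desc p r t k" "Suc \<epsilon> \<le> t" "k \<le> N"
  shows "single k p"
  using assms
proof (induction k arbitrary: p r t rule: less_induct)
  case (less k)
  have k0: "k > 0" using less.prems eps unfolding desc_def by auto
  obtain k' where k': "k = Suc k'" using k0 gr0_implies_Suc by blast
  define p1 where "p1 = p \<odot> r 0"
  have d: "p \<in> E k" "r 0 \<in> G k" "p1 \<in> E k'"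
    using less.prems(2,3) spec[of "\<lambda>j. j \<le> t \<longrightarrow> walk p r j \<in> E (k - j)" "Suc 0"]
      spec[of "\<lambda>j. j \<le> t \<longrightarrow> walk p r j \<in> E (k - j)" 0] unfolding desc_def p1_def by (auto simp: k')
  have pV: "p \<in> V k" using d V_E by auto
  show "single k p"
  proof (rule ccontr)
    assume "\<not> single k p"
    then obtain g g' where g: "g \<in> G k" "g' \<in> G k" "p \<odot> g \<in> E k'" "p \<odot> g' \<in> E k'" "\<not> (\<exists>c\<in>H. g' = g \<cdot> c)"
      unfolding single_def k' by auto
    \<comment> \<open>Of two inequivalent ways down at least one differs from the first step of
      \<open>r\<close>; together with that step it forms a peak.\<close>
    have "\<exists>g0\<in>G k. p \<odot> g0 \<in> E k' \<and> iv g0 \<cdot> r 0 \<notin> H"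
    proof (rule ccontr)
      assume "\<not> ?thesis"
      then have a: "iv g \<cdot> r 0 \<in> H" "iv g' \<cdot> r 0 \<in> H" using g by auto
      have "g' = g \<cdot> ((iv g \<cdot> r 0) \<cdot> iv (iv g' \<cdot> r 0))"
        using g d by (simp add: iv_mult[where k=k] aG[where k=k])
      then show False using g(5) a by auto
    qed
    then obtain g0 where g0: "g0 \<in> G k" "p \<odot> g0 \<in> E k'" "iv g0 \<cdot> r 0 \<notin> H" by blast
    define q where "q = p \<odot> g0"
    define h where "h = iv g0 \<cdot> r 0"
    have h: "h \<in> G (Suc k') - H" using g0 d h_def k' by auto
    have qh: "q \<odot> h = p1"
      using act_m[OF less.prems(4) pV g0(1), of h] g0 d unfolding q_def h_def p1_def by simp
    have qV: "q \<in> V k" using V_cl[OF less.prems(4) pV g0(1)] q_def by simp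
    have "peaks k'" using peaksD less.prems k' by auto
    then obtain s where s: "s \<in> Ln" "s 0 = h" "A \<le> k'" "\<forall>j\<le>A. walk p1 (sh 1 s) j \<in> E (k' - j)"
      unfolding peaks_def using h g0(2) d(3) qh q_def by metis
    have s1: "sh 1 s \<in> Ln" "sh 1 r \<in> Ln" using Ln_sh s less.prems by auto
    have s10: "sh 1 s 0 \<in> G k'" "sh 1 r 0 \<in> G k'"
    proof -
      have "G (Suc k' + 0 + 1) = G k'" by (intro G_parity) auto
      then show "sh 1 s 0 \<in> G k'" "sh 1 r 0 \<in> G k'"
        using Ln_G[OF s(1), of 0 "Suc k'" 1] Ln_G[OF less.prems(1), of 0 "Suc k'" 1] s(2) h d(2) k'
        unfolding sh_def by auto
    qed
    have ds: "desc p1 (sh 1 s) A k'" by (rule desc_Ln) (use s1 s10 s in auto)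
    have dr: "desc p1 (sh 1 r) \<epsilon> k'"
      using desc_mono[OF desc_shift[OF less.prems(2), of 1], of \<epsilon>] less.prems(3) unfolding p1_def k' by simp
    have sing: "\<forall>j<\<epsilon>. single (k' - j) (walk p1 (sh 1 s) j)"
    proof (intro allI impI)
      fix j assume j: "j < \<epsilon>"
      have jA: "j \<le> A" "Suc \<epsilon> \<le> A - j" using j A_bounds(1) eps by auto
      show "single (k' - j) (walk p1 (sh 1 s) j)"
        by (rule less.IH[OF _ _ desc_shift[OF ds jA(1)] jA(2)]) (use s1 Ln_sh less.prems k' in auto)
    qed
    have dse: "desc p1 (sh 1 s) \<epsilon> k'" using desc_mono[OF ds] A_bounds by auto
    obtain c where c: "hper P c" "c 0 = e" "sh 1 r = twist c (sh 1 s)"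
      using merge0[OF dse dr _ s1(1,2) sing] less.prems k' by auto
    \<comment> \<open>The peak syllable comes last in both shifted lines, and by periodicity the
      twist is trivial behind it. So \<open>r 0\<close> and \<open>h\<close> differ by a left factor
      from \<open>H\<close>, which must be the inverse of \<open>g0\<close> up to inversion; thus
      \<open>g0\<close> lies in \<open>H\<close> and cannot lead down.\<close>
    have "sh 1 r (P - 1) = r 0" "sh 1 s (P - 1) = h"
      using Ln_per[of r 0] Ln_per[of s 0] s less.prems A_bounds unfolding sh_def by auto
    moreover have "c (Suc (P - 1)) = e"
      using c A_bounds unfolding hper_def by (metis Suc_diff_1 add.left_neutral)
    ultimately have r0: "r 0 = iv (c (P - 1)) \<cdot> h"
      using c(3) h HG[OF hper_H[OF c(1)]] unfolding twist_def by (metis DiffD1 erG ivG mG)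
    have cH: "c (P - 1) \<in> H" "c (P - 1) \<in> G k" using hper_H[OF c(1)] HG by auto
    have "iv (c (P - 1)) \<cdot> iv g0 \<cdot> r 0 = e \<cdot> r 0"
      using r0 cH g0 d unfolding h_def by (simp add: aG[where k=k])
    then have "iv (c (P - 1)) \<cdot> iv g0 = e"
      using cancel_r[of "r 0" k "iv (c (P - 1)) \<cdot> iv g0" e] cH g0 d by simp
    then have "g0 = iv (c (P - 1))"
      using iv_unique[of "iv (c (P - 1))" k "iv g0"] cH g0 by auto
    then have "g0 \<in> H" using cH by simp
    then have "p \<odot> g0 \<in> E k" using E_H less.prems(4) d by auto
    then show False using disj[of k k'] g0(2) k' less.prems(4) by auto
  qed
qed

text \<open>At each of the first \<open>\<epsilon>\<close> vertices the line \<open>s\<close> still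
  has more than \<open>\<epsilon>\<close> steps to descend, so \<open>desc_single\<close> gives the
  unique ways down that \<open>merge0\<close> asks for.\<close>

lemma merge:
  assumes s: "s \<in> Ln" "desc p s t k" "2 * \<epsilon> \<le> t" and r: "r \<in> Ln" "desc p r t' k" "\<epsilon> \<le> t'" and kN: "k \<le> N"
  shows "\<exists>c. hper P c \<and> c 0 = e \<and> r = twist c s"
proof (rule merge0[OF desc_mono[OF s(2)] desc_mono[OF r(2,3)] kN s(1) r(1)])
  show "\<forall>j<\<epsilon>. single (k - j) (walk p s j)"
  proof (intro allI impI)
    fix j assume j: "j < \<epsilon>"
    have jt: "j \<le> t" "Suc \<epsilon> \<le> t - j" using j s(3) by auto
    show "single (k - j) (walk p s j)"
      by (rule desc_single[OF Ln_sh[OF s(1)] desc_shift[OF s(2) jt(1)] jt(2)]) (use kN in simp)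
  qed
qed (use s in auto)

text \<open>Here \<open>r\<close> is an arbitrary word: a descent has to follow the side of a cell
  as long as \<open>\<epsilon>\<close> further steps of that side remain.\<close>

lemma follow:
  assumes s: "s \<in> Ln" "desc p s t k" and r: "desc p r b k" and b: "b + \<epsilon> \<le> t" and kN: "k \<le> N"
  shows "\<exists>c. (\<forall>j. c j \<in> H) \<and> c 0 = e \<and> (\<forall>j\<le>b. walk p r j = walk p s j \<odot> c j) \<and> (\<forall>j<b. r j = twist c s j)"
proof (rule follow0[OF desc_mono[OF s(2)] r kN])
  show "\<forall>j<b. single (k - j) (walk p s j)"
  proof (intro allI impI)
    fix j assume j: "j < b"
    have jt: "j \<le> t" "Suc \<epsilon> \<le> t - j" using j b by auto
    show "single (k - j) (walk p s j)"
      by (rule desc_single[OF Ln_sh[OF s(1)] desc_shift[OF s(2) jt(1)] jt(2)]) (use kN in simp)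
  qed
qed (use b in auto)

lemma follow_line:
  assumes s: "s \<in> Ln" "desc p s t k" and r: "desc p r b k" and b: "b + \<epsilon> \<le> t" and kN: "k \<le> N"
  shows "\<exists>s'\<in>Ln. desc (walk p r b) s' (t - b) (k - b)"
proof -
  obtain c where c: "\<forall>j. c j \<in> H" "\<forall>j\<le>b. walk p r j = walk p s j \<odot> c j"
    using follow[OF assms] by blast
  have 1: "desc (walk p s b) (sh b s) (t - b) (k - b)" using desc_shift[OF s(2)] b by auto
  have "desc (walk p s b \<odot> c b) (twist (\<lambda>_. c b) (sh b s)) (t - b) (k - b)"
    using desc_twist[OF 1, of "\<lambda>_. c b"] kN c(1) by auto
  moreover have "twist (\<lambda>_. c b) (sh b s) \<in> Ln" using Ln_twist Ln_sh s(1) hper_const c(1) by auto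
  ultimately show ?thesis using c(2) by auto
qed

lemma hper_P: "hper P c \<Longrightarrow> c (Suc (P - 1)) = c 0"
  using A_bounds(3) unfolding hper_def by (metis Suc_diff_1 add.left_neutral)

lemma desc_head:
  assumes "desc p r t k" "1 \<le> t" shows "p \<in> E k" "r 0 \<in> G k" "p \<odot> r 0 \<in> E (k - 1)"
proof -
  have "walk p r 0 \<in> E (k - 0)" "walk p r 1 \<in> E (k - 1)" "r 0 \<in> G (k - 0)"
    using assms unfolding desc_def by (blast, blast) (use assms desc_def in auto)
  then show "p \<in> E k" "r 0 \<in> G k" "p \<odot> r 0 \<in> E (k - 1)" by simp_all
qed

text \<open>Both lines use the only way down, so from the next vertex on they descend together and
  are twists of each other. Comparing the syllables in front of that vertex would put
  \<open>g\<close> into \<open>H\<close>. Hence two long sides of cells never start from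
  inequivalent upper edges of one vertex.\<close>

lemma valley:
  assumes kN: "k \<le> N" and p: "p \<in> E k" and g: "g \<in> G k - H" and r: "r \<in> Ln" "desc p r t k"
    and s: "s \<in> Ln" "desc (p \<odot> g) s t k" and t: "2 * \<epsilon> + 1 \<le> t"
  shows False
proof -
  have t0: "0 < t" "1 \<le> t" "0 < k" using t r(2) unfolding desc_def by auto
  have pV: "p \<in> V k" using p V_E by auto
  have r0: "r 0 \<in> G k" "p \<odot> r 0 \<in> E (k - 1)"
    using desc_head[OF r(2) t0(2)] by auto
  have s0: "s 0 \<in> G k" "p \<odot> g \<odot> s 0 \<in> E (k - 1)"
    using desc_head[OF s(2) t0(2)] by auto
  have gG: "g \<in> G k" using g by simp
  have "single k p" using desc_single[OF r(1,2) _ kN] t eps by simp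
  moreover have "p \<odot> (g \<cdot> s 0) \<in> E (k - 1)" using s0 act_m[OF kN pV gG s0(1)] by simp
  ultimately obtain c where c: "c \<in> H" "g \<cdot> s 0 = r 0 \<cdot> c"
    using r0 s0(1) gG unfolding single_def by (meson mG)
  have cG: "c \<in> G k" using c HG by auto
  define s1 where "s1 = twist (\<lambda>_. iv c) (sh 1 s)"
  have s1L: "s1 \<in> Ln" unfolding s1_def using Ln_twist Ln_sh s(1) hper_const c by auto
  have "p \<odot> g \<odot> s 0 \<odot> iv c = p \<odot> (g \<cdot> s 0) \<odot> iv c" using act_m[OF kN pV gG s0(1)] by simp
  also have "\<dots> = p \<odot> (r 0 \<cdot> c \<cdot> iv c)" using act_m[OF kN pV _ ivG[OF cG], of "r 0 \<cdot> c"] c r0 cG by simp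
  also have "r 0 \<cdot> c \<cdot> iv c = r 0" using r0 cG by (simp add: aG[where k=k])
  finally have p1: "p \<odot> g \<odot> s 0 \<odot> iv c = p \<odot> r 0" .
  have ds: "desc (p \<odot> r 0) s1 (t - 1) (k - 1)"
    using desc_twist[OF desc_shift[OF s(2) t0(2)], of "\<lambda>_. iv c"] kN c(1) p1 unfolding s1_def by simp
  have dr: "desc (p \<odot> r 0) (sh 1 r) (t - 1) (k - 1)" using desc_shift[OF r(2) t0(2)] by simp
  have tt: "2 * \<epsilon> \<le> t - 1" "\<epsilon> \<le> t - 1" "k - 1 \<le> N" using t kN by linarith+
  obtain d where d: "hper P d" "d 0 = e" "sh 1 r = twist d s1"
    using merge[OF s1L ds tt(1) Ln_sh[OF r(1)] dr tt(2,3)] by blast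
  have e1: "sh 1 r (P - 1) = r 0" "sh 1 s (P - 1) = s 0"
    using Ln_per[of r 0] Ln_per[of s 0] r s A_bounds unfolding sh_def by auto
  have dH: "d (P - 1) \<in> H" "d (P - 1) \<in> G k" using hper_H[OF d(1)] HG by auto
  have s1P: "s1 (P - 1) = c \<cdot> s 0 \<cdot> iv c" unfolding s1_def twist_def using e1 c by simp
  have "r 0 = iv (d (P - 1)) \<cdot> s1 (P - 1) \<cdot> d (Suc (P - 1))"
    using fun_cong[OF d(3), of "P - 1"] e1(1) unfolding twist_def by simp
  then have "r 0 = iv (d (P - 1)) \<cdot> (c \<cdot> s 0 \<cdot> iv c)"
    using s1P hper_P[OF d(1)] d(2) dH s0(1) cG by (simp only: gs[where k=k])
  then have "g \<cdot> s 0 = iv (d (P - 1)) \<cdot> (c \<cdot> s 0 \<cdot> iv c) \<cdot> c" using c(2) by simp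
  also have "\<dots> = iv (d (P - 1)) \<cdot> c \<cdot> s 0" using dH s0(1) cG by (simp add: aG[where k=k])
  finally have "g = iv (d (P - 1)) \<cdot> c"
    using cancel_r[of "s 0" k g "iv (d (P - 1)) \<cdot> c"] gG dH cG s0(1) by simp
  then show False using g dH c(1) by simp
qed

definition pk :: "nat \<Rightarrow> 'p \<Rightarrow> 'g \<Rightarrow> bool" where
  "pk k p g \<longleftrightarrow> k < N \<and> p \<in> E k \<and> g \<in> G (Suc k) - H \<and> p \<odot> g \<in> E k"

lemma cell_sides:
  assumes "pk k p g"
  obtains s where "s \<in> Ln" "s 0 = g" "desc (p \<odot> g) (sh 1 s) A k" "desc p (rv P s) A k"
    "walk (p \<odot> g) (sh 1 s) (P - 1) = p" "\<forall>j<P. \<exists>i\<le>k. walk (p \<odot> g) (sh 1 s) j \<in> E i"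
proof -
  have "peaks k" using peaksD assms pk_def by auto
  then obtain s where s: "s \<in> Ln" "s 0 = g" "A \<le> k" "\<forall>j\<le>A. walk (p \<odot> g) (sh 1 s) j \<in> E (k - j)"
    "\<forall>j\<le>A. walk p (rv P s) j \<in> E (k - j)"
    "walk (p \<odot> g) (sh 1 s) (P - 1) = p" "\<forall>j<P. \<exists>i\<le>k. walk (p \<odot> g) (sh 1 s) j \<in> E i"
    using assms unfolding peaks_def pk_def by metis
  have g0: "s 0 \<in> G (Suc k)" using assms s(2) pk_def by auto
  have "sh 1 s 0 \<in> G k"
    using Ln_G[OF s(1) g0, of 1] G_parity[of "Suc k + 0 + 1" k] unfolding sh_def by auto
  then have 1: "desc (p \<odot> g) (sh 1 s) A k" by (intro desc_Ln) (use s Ln_sh in auto)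
  have "even (Suc k + 0 + (P - 1) + k)" using evenP A_bounds(3) by auto
  then have "s (P - 1) \<in> G k" using Ln_G[OF s(1) g0, of "P - 1"] G_parity[of "Suc k + 0 + (P - 1)" k] by auto
  then have "rv P s 0 \<in> G k" unfolding rv_def by simp
  then have 2: "desc p (rv P s) A k" by (intro desc_Ln) (use s Ln_rv in auto)
  show ?thesis using that s 1 2 by blast
qed

text \<open>The sides of the two cells reach at least \<open>3 * \<epsilon> + 1\<close> steps below
  the valley. Carried over to the given path by \<open>follow_line\<close>, they descend from both
  edges of the valley, against \<open>valley\<close>.\<close>

lemma two_peaks:
  assumes 1: "pk k1 p1 g1" "desc (p1 \<odot> g1) r1 b1 k1"
    and v: "walk (p1 \<odot> g1) r1 b1 = v" "g \<in> G k - H" "k = k1 - b1" "v \<odot> g \<in> E k"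
    and 3: "pk k3 p3 g3" "desc p3 r3 b3 k3" "walk p3 r3 b3 = v \<odot> g" "k = k3 - b3"
    and b: "b1 + 3 * \<epsilon> + 1 \<le> A" "b3 + 3 * \<epsilon> + 1 \<le> A"
  shows False
proof -
  obtain s1 where s1: "s1 \<in> Ln" "desc (p1 \<odot> g1) (sh 1 s1) A k1" using cell_sides[OF 1(1)] by metis
  obtain s3 where s3: "s3 \<in> Ln" "desc p3 (rv P s3) A k3" using cell_sides[OF 3(1)] by metis
  have k: "k1 \<le> N" "k3 \<le> N" using 1(1) 3(1) pk_def by auto
  obtain s where s: "s \<in> Ln" "desc v s (A - b1) k"
    using follow_line[OF Ln_sh[OF s1(1)] s1(2) 1(2) _ k(1)] b v by auto
  obtain s' where s': "s' \<in> Ln" "desc (v \<odot> g) s' (A - b3) k"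
    using follow_line[OF Ln_rv[OF s3(1)] s3(2) 3(2) _ k(2)] b 3 by auto
  have "v \<in> E k" using 1(2) v unfolding desc_def by auto
  moreover have "desc v s (2 * \<epsilon> + 1) k" "desc (v \<odot> g) s' (2 * \<epsilon> + 1) k"
    using desc_mono[OF s(2)] desc_mono[OF s'(2)] b by auto
  moreover have "k \<le> N" using k(1) v(3) by simp
  ultimately show False using valley[of k v g s "2 * \<epsilon> + 1" s'] v(2) s(1) s'(1) by blast
qed

text \<open>After \<open>\<epsilon>\<close> steps down from the peak, \<open>r\<close> is a twist of
  the boundary of the cell that hangs there. It therefore runs around the whole cell and
  closes.\<close>

lemma cell_merge:
  assumes p: "pk k p (r 0)" and r: "r \<in> Ln" "desc (p \<odot> r 0) (sh 1 r) \<epsilon> k"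
  shows "(\<forall>j<P. \<exists>i\<le>k. walk p r (Suc j) \<in> E i) \<and> walk p r P = p"
proof -
  obtain s where s: "s \<in> Ln" "s 0 = r 0" "desc (p \<odot> r 0) (sh 1 s) A k"
    "walk (p \<odot> r 0) (sh 1 s) (P - 1) = p" "\<forall>j<P. \<exists>i\<le>k. walk (p \<odot> r 0) (sh 1 s) j \<in> E i"
    using cell_sides[OF p] by metis
  have k: "k < N" "k \<le> N" using p pk_def by auto
  obtain c where c: "hper P c" "c 0 = e" "sh 1 r = twist c (sh 1 s)"
    using merge[OF Ln_sh[OF s(1)] s(3) _ Ln_sh[OF r(1)] r(2)] k A_bounds by auto
  have okt: "\<forall>j<P. ok N (walk (p \<odot> r 0) (sh 1 s) j) (sh 1 s j)"
  proof (intro allI impI)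
    fix j assume "j < P"
    then obtain i where i: "i \<le> k" "walk (p \<odot> r 0) (sh 1 s) j \<in> E i" using s by auto
    show "ok N (walk (p \<odot> r 0) (sh 1 s) j) (sh 1 s j)"
      by (rule ok_E[OF i(2)]) (use i k Ln_LM[OF Ln_sh[OF s(1)]] in auto)
  qed
  have cH: "\<forall>i. c i \<in> H" using c hper_H by auto
  have q: "p \<odot> r 0 \<in> V k" using p V_E unfolding pk_def by auto
  have w: "walk (p \<odot> r 0) (sh 1 r) j = walk (p \<odot> r 0) (sh 1 s) j \<odot> c j" if "j \<le> P" for j
    using twist_walk[OF cH okt that] c(2,3) act_e[OF k(2) q] by simp
  have sw: "walk p r (Suc j) = walk (p \<odot> r 0) (sh 1 r) j" for j using walk_add[of p r 1 j] by simp
  have 1: "\<forall>j<P. \<exists>i\<le>k. walk p r (Suc j) \<in> E i"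
  proof (intro allI impI)
    fix j assume j: "j < P"
    then obtain i where i: "i \<le> k" "walk (p \<odot> r 0) (sh 1 s) j \<in> E i" using s by auto
    then show "\<exists>i\<le>k. walk p r (Suc j) \<in> E i" using sw w[of j] j E_H[of i _ "c j"] cH k by (metis le_trans less_imp_le)
  qed
  have g: "r 0 \<in> G (Suc k)" using p pk_def by auto
  have e1: "sh 1 r (P - 1) = r 0" "sh 1 s (P - 1) = r 0"
    using Ln_per[of r 0] Ln_per[of s 0] r s A_bounds unfolding sh_def by auto
  have cG: "c (P - 1) \<in> G (Suc k)" using cH HG by auto
  \<comment> \<open>Both lines end with the same syllable, which makes the twist trivial in front of
    it as well; so the walk returns to \<open>p\<close> itself and not merely to its orbit under
    \<open>H\<close>.\<close>
  have "r 0 = iv (c (P - 1)) \<cdot> sh 1 s (P - 1) \<cdot> c (Suc (P - 1))"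
    using fun_cong[OF c(3), of "P - 1"] e1(1) unfolding twist_def by simp
  then have "r 0 = iv (c (P - 1)) \<cdot> r 0 \<cdot> e" unfolding e1 hper_P[OF c(1)] c(2) .
  then have "e \<cdot> r 0 = iv (c (P - 1)) \<cdot> r 0" using g cG by (simp only: gs[where k="Suc k"])
  then have "iv (c (P - 1)) = e" using cancel_r[of "r 0" "Suc k" e "iv (c (P-1))"] g cG by simp
  then have "c (P - 1) = e" using iv_ivG[OF cG] by simp
  moreover have "walk p r P = walk p r (Suc (P - 1))" using A_bounds by simp
  ultimately have "walk p r P = p \<odot> e" using sw[of "P - 1"] w[of "P - 1"] s(4) by simp
  then show ?thesis using 1 act_e[OF k(2), of p] p V_E unfolding pk_def by auto
qed

section \<open>Paths that read all but one syllable of a relator begin with a long descent\<close>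

lemma desc_or_valley:
  assumes "q \<in> E k" "k \<le> N" "r \<in> Ln" "r 0 \<in> G k"
  shows "desc q r T k \<or> (\<exists>b<T. desc q r b k \<and> walk q r (Suc b) \<in> E (k - b) \<and> r b \<in> G (k - b))"
proof (induction T)
  case 0 then show ?case using assms unfolding desc_def by auto
next
  case (Suc T)
  show ?case
  proof (cases "desc q r T k")
    case True
    have T: "T \<le> k" "walk q r T \<in> E (k - T)" using True unfolding desc_def by auto
    have "even (k + T + (k - T))" using T by auto
    then have rT: "r T \<in> G (k - T)"
      using Ln_G[OF assms(3,4), of T] G_parity[of "k + 0 + T" "k - T"] by auto
    have "walk q r (Suc T) \<in> V (k - T)" using V_cl[OF _ V_E(1)[OF T(2)] rT] assms(2) by simp
    then show ?thesis
    proof (cases rule: V_cases)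
      case 1 then show ?thesis using True rT by auto
    next
      case 2
      then have "desc q r (Suc T) k" using True rT unfolding desc_def
        by (auto simp: less_Suc_eq le_Suc_eq simp del: walk.simps)
      then show ?thesis by blast
    qed
  next
    case False
    then show ?thesis using Suc less_SucI by blast
  qed
qed

definition asc :: "'p \<Rightarrow> (nat \<Rightarrow> 'g) \<Rightarrow> nat \<Rightarrow> nat \<Rightarrow> bool" where
  "asc p r t k \<longleftrightarrow> (\<forall>j<t. r j \<in> G (Suc (k + j))) \<and> (\<forall>j\<le>t. walk p r j \<in> E (k + j))"

lemma asc_or_peak:
  assumes "q \<in> E k" "k \<le> N" "r \<in> Ln" "r 0 \<in> G (Suc k)" "n \<le> N" "\<forall>j<T. ok n (walk q r j) (r j)"
  shows "asc q r T k \<and> (T = 0 \<or> k + T \<le> n) \<or> (\<exists>b<T. asc q r b k \<and> k + b < n \<and> pk (k + b) (walk q r b) (r b))"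
  using assms(6)
proof (induction T)
  case 0 then show ?case using assms unfolding asc_def by auto
next
  case (Suc T)
  show ?case
  proof (cases "asc q r T k \<and> (T = 0 \<or> k + T \<le> n)")
    case True
    have T: "walk q r T \<in> E (k + T)" using True unfolding asc_def by auto
    have kT: "k + T \<le> N" using True assms by auto
    have rT: "r T \<in> G (Suc (k + T)) - H"
      using Ln_G[OF assms(3,4), of T] by simp
    obtain l where l: "l \<le> n" "walk q r T \<in> V l" "r T \<in> G l" using Suc.prems unfolding ok_def by blast
    have "l = Suc (k + T)"
      using l(2)
    proof (cases rule: V_cases)
      case 1
      then have "l = k + T" using disj[of l "k + T"] T l kT assms(5) by auto
      then show ?thesis using rT l(3) G_both by auto
    next
      case 2
      then have "l - 1 = k + T" using disj[of "l - 1" "k + T"] T l kT assms(5) by auto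
      then show ?thesis using 2 by auto
    qed
    then have kn: "k + T < n" using l by auto
    have "walk q r (Suc T) \<in> V (Suc (k + T))"
      using V_cl[of "Suc (k + T)" "walk q r T" "r T"] V_E(2)[OF T] rT kn assms(5) by auto
    then show ?thesis
    proof (cases rule: V_cases)
      case 1
      then have "asc q r (Suc T) k" using True rT unfolding asc_def
        by (auto simp: less_Suc_eq le_Suc_eq simp del: walk.simps)
      then show ?thesis using kn by auto
    next
      case 2
      then have "pk (k + T) (walk q r T) (r T)" unfolding pk_def using kn assms(5) T rT by auto
      then show ?thesis using True kn by blast
    qed
  next
    case False
    then show ?thesis using Suc less_SucI by (metis less_Suc_eq)
  qed
qed

text \<open>The relator read backwards from position \<open>i\<close>: it begins with the inverse of
  syllable \<open>i - 1\<close>.\<close>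

definition bk :: "nat \<Rightarrow> (nat \<Rightarrow> 'g) \<Rightarrow> nat \<Rightarrow> 'g" where "bk i r = sh (P - i) (rv P r)"

lemma bk_Ln: "r \<in> Ln \<Longrightarrow> bk i r \<in> Ln" unfolding bk_def using Ln_sh Ln_rv by auto

lemma bk_eq: "i \<le> P \<Longrightarrow> j < i \<Longrightarrow> bk i r j = iv (r (i - 1 - j))"
proof -
  assume a: "i \<le> P" "j < i"
  have "(j + (P - i)) mod P = j + (P - i)" using a by auto
  then have "bk i r j = iv (r (P - 1 - (j + (P - i))))" unfolding bk_def sh_def rv_def by simp
  moreover have "P - 1 - (j + (P - i)) = i - 1 - j" using a by auto
  ultimately show ?thesis by simp
qed

lemma bk_walk:
  assumes "r \<in> Ln" "i \<le> P" "\<forall>j<i. ok N (walk p r j) (r j)" "j \<le> i"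
  shows "walk (walk p r i) (bk i r) j = walk p r (i - j)"
  using assms(4)
proof (induction j)
  case (Suc j)
  define m where "m = i - Suc j"
  have m: "i - j = Suc m" "m < i" "i - 1 - j = m" using Suc.prems m_def by auto
  obtain k where k: "k \<le> N" "walk p r m \<in> V k" "r m \<in> G k" using assms(3) m unfolding ok_def by blast
  have "walk (walk p r i) (bk i r) (Suc j) = walk p r m \<odot> r m \<odot> iv (r m)"
    using Suc bk_eq[OF assms(2), of j r] m by simp
  also have "\<dots> = walk p r m" using act_inv[OF k] by simp
  finally show ?case using m_def by simp
qed simp

lemma asc_bk:
  assumes "r \<in> Ln" "i + b \<le> P" "\<forall>j<i + b. ok N (walk p r j) (r j)" "asc (walk p r i) (sh i r) b k" "k + b \<le> N"
  shows "desc (walk p r (i + b)) (bk (i + b) r) b (k + b)"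
  unfolding desc_def
proof (intro conjI allI impI)
  show "b \<le> k + b" by simp
  fix j
  show "bk (i + b) r j \<in> G (k + b - j)" if "j < b"
  proof -
    define m where "m = b - 1 - j"
    have m: "i + b - 1 - j = m + i" "m < b" "k + b - j = Suc (k + m)" using that m_def by auto
    have "r (m + i) \<in> G (Suc (k + m))" using assms(4) m unfolding asc_def sh_def by auto
    then show ?thesis using bk_eq[of "i + b" j r] assms(2) that m by simp
  qed
  show "walk (walk p r (i + b)) (bk (i + b) r) j \<in> E (k + b - j)" if "j \<le> b"
  proof -
    have "walk (walk p r (i + b)) (bk (i + b) r) j = walk p r (i + (b - j))"
      using bk_walk[OF assms(1-3), of j] that by simp
    moreover have "walk p r (i + (b - j)) \<in> E (k + (b - j))"
      using assms(4) unfolding asc_def walk_add by (meson diff_le_self)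
    ultimately show ?thesis using that by (simp del: walk.simps add: Nat.add_diff_assoc)
  qed
qed

lemma ok_mono: "n \<le> N \<Longrightarrow> ok n p g \<Longrightarrow> ok N p g" unfolding ok_def by (meson le_trans)

lemma sh_simps: "sh i r 0 = r i" "sh 0 r = r" unfolding sh_def by auto

lemma sh_at: "sh i r b = r (i + b)" unfolding sh_def by (simp add: add.commute)

text \<open>Otherwise the path runs around the cell below this peak and stays in edge sets up to
  \<open>E k\<close> with \<open>k < n\<close>, whereas it has to end in \<open>E n\<close>.\<close>

lemma no_long_fwd:
  assumes rp: "relpath n p r" "n \<le> N" and i: "i < P - 1" and pk: "pk k (walk p r i) (r i)" "k < n"
    and d: "desc (walk p r (Suc i)) (sh (Suc i) r) \<epsilon> k"
  shows False
proof -
  have r: "r \<in> Ln" using rp relpath_def by auto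
  have 1: "pk k (walk p r i) (sh i r 0)" using pk sh_simps by simp
  have 2: "desc (walk p r i \<odot> sh i r 0) (sh 1 (sh i r)) \<epsilon> k" using d sh_simps by (simp add: shift_shift)
  have j: "P - 2 - i < P" using A_bounds by auto
  obtain l where l: "l \<le> k" "walk (walk p r i) (sh i r) (Suc (P - 2 - i)) \<in> E l"
    using cell_merge[OF 1 Ln_sh[OF r] 2] j by blast
  have "i + Suc (P - 2 - i) = P - 1" using i by auto
  then have "walk p r (P - 1) \<in> E l" using l(2) walk_add[of p r i "Suc (P - 2 - i)"] by (simp only:)
  then show False using disj[of l n] rp l pk unfolding relpath_def by auto
qed

text \<open>The mirror image: here the cell leads back to the start of the path, which lies in
  \<open>E n\<close>.\<close>

lemma no_long_bwd:
  assumes rp: "relpath n p r" "n \<le> N" and i: "i < P - 1" and pk: "pk k (walk p r i) (r i)" "k < n"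
    and d: "desc (walk p r i) (bk i r) \<epsilon> k"
  shows False
proof -
  have r: "r \<in> Ln" using rp relpath_def by auto
  have okN: "\<forall>j<Suc i. ok N (walk p r j) (r j)" using rp i ok_mono unfolding relpath_def by auto
  have iP: "Suc i \<le> P" using i by auto
  have b0: "bk (Suc i) r 0 = iv (r i)" using bk_eq[OF iP, of 0 r] by simp
  have k: "Suc k \<le> N" "walk p r i \<in> V (Suc k)" "r i \<in> G (Suc k)"
    using pk(1) V_E unfolding pk_def by auto
  have w: "walk p r (Suc i) \<odot> iv (r i) = walk p r i" using act_inv[OF k] by simp
  have 1: "pk k (walk p r (Suc i)) (bk (Suc i) r 0)"
    using pk(1) w b0 notH_iv[of "r i" "Suc k"] unfolding pk_def by auto
  have "sh 1 (bk (Suc i) r) = bk i r" unfolding bk_def shift_shift using i by (simp add: Suc_diff_Suc)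
  then have 2: "desc (walk p r (Suc i) \<odot> bk (Suc i) r 0) (sh 1 (bk (Suc i) r)) \<epsilon> k"
    using d w b0 by simp
  have "i < P" using i by auto
  then obtain l where l: "l \<le> k" "walk (walk p r (Suc i)) (bk (Suc i) r) (Suc i) \<in> E l"
    using cell_merge[OF 1 bk_Ln[OF r] 2] by blast
  have "p \<in> E l" using l bk_walk[OF r iP okN, of "Suc i"] by simp
  then show False using disj[of l n] rp l pk unfolding relpath_def by auto
qed

lemma relpathD:
  assumes "relpath n p r"
  shows "r \<in> Ln" "p \<in> E n" "r 0 \<in> G n" "walk p r (P - 1) \<in> E n" "j < P \<Longrightarrow> \<exists>i\<le>n. walk p r j \<in> E i"
    "j < P - 1 \<Longrightarrow> ok n (walk p r j) (r j)"
  using assms relpath_def by auto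

text \<open>Suppose the path turns at depth \<open>a < A\<close>. Peaks with a side of length
  \<open>\<epsilon>\<close> are excluded and so is a second bump, by \<open>two_peaks\<close>. What
  remains is a plain valley or a valley followed by one short bump, and then the path is back in
  \<open>E n\<close> before its \<open>P - 1\<close> syllables are used up.\<close>

lemma relpath_desc:
  assumes rp: "relpath n p r" and nN: "n \<le> N"
  shows "desc p r A n"
proof (rule ccontr)
  assume nd: "\<not> desc p r A n"
  note r = relpathD[OF rp] and okn = relpathD(6)[OF rp]
  have okN: "\<And>j. j < P - 1 \<Longrightarrow> ok N (walk p r j) (r j)" using okn ok_mono nN by auto
  obtain a where a: "a < A" "desc p r a n" "walk p r (Suc a) \<in> E (n - a)" "r a \<in> G (n - a)"
    using desc_or_valley[OF r(2) nN r(1,3), of A] nd by blast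
  note bnd = A_bounds eps
  have an: "a \<le> n" using a(2) desc_def by auto
  define i0 where "i0 = Suc a"
  define k0 where "k0 = n - a"
  have i0: "i0 < P - 1" using a bnd i0_def by auto
  have w0: "walk p r i0 \<in> E k0" using a i0_def k0_def by simp
  have G0: "sh i0 r 0 \<in> G (Suc k0)"
    using Ln_G[OF r(1) a(4), of i0] G_parity[of "n - a + a + i0" "Suc k0"] an
    unfolding sh_simps i0_def k0_def by auto
  have ok0: "\<forall>j<P - 1 - i0. ok n (walk (walk p r i0) (sh i0 r) j) (sh i0 r j)"
  proof (intro allI impI)
    fix j assume "j < P - 1 - i0"
    then show "ok n (walk (walk p r i0) (sh i0 r) j) (sh i0 r j)"
      unfolding walk_add[symmetric] using okn[of "i0 + j"] by (simp only: sh_def add.commute)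
  qed
  have k0N: "k0 \<le> N" using nN k0_def by simp
  from asc_or_peak[OF w0 k0N Ln_sh[OF r(1)] G0 nN ok0]
  show False
  proof
    assume "asc (walk p r i0) (sh i0 r) (P - 1 - i0) k0 \<and> (P - 1 - i0 = 0 \<or> k0 + (P - 1 - i0) \<le> n)"
    then have x: "walk p r (i0 + (P - 1 - i0)) \<in> E (k0 + (P - 1 - i0))" "k0 + (P - 1 - i0) \<le> n"
      using i0 unfolding asc_def walk_add by auto
    then have "k0 + (P - 1 - i0) = n" using disj[of "k0 + (P - 1 - i0)" n] r(4) i0 nN by auto
    then show False using a bnd an unfolding i0_def k0_def by auto
  next
    assume "\<exists>b<P - 1 - i0. asc (walk p r i0) (sh i0 r) b k0 \<and> k0 + b < n \<and>
         pk (k0 + b) (walk (walk p r i0) (sh i0 r) b) (sh i0 r b)"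
    then obtain b1 where b1: "b1 < P - 1 - i0" "asc (walk p r i0) (sh i0 r) b1 k0" "k0 + b1 < n"
      "pk (k0 + b1) (walk p r (i0 + b1)) (r (i0 + b1))"
      by (auto simp only: walk_add sh_at)
    define i1 where "i1 = i0 + b1"
    define k1 where "k1 = k0 + b1"
    have i1: "i1 < P - 1" using b1 i1_def by auto
    have d1: "desc (walk p r i1) (bk i1 r) b1 k1"
      using asc_bk[OF r(1) _ _ b1(2)] i1 okN b1(3) nN unfolding i1_def k1_def by auto
    have p1: "pk k1 (walk p r i1) (r i1)" using b1 unfolding i1_def k1_def by simp
    have b1e: "b1 < \<epsilon>"
    proof (rule ccontr)
      assume "\<not> b1 < \<epsilon>"
      then show False using no_long_bwd[OF rp nN i1 p1 _ desc_mono[OF d1]] b1(3) k1_def by auto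
    qed
    have q1: "walk p r (Suc i1) \<in> E k1" "r i1 \<in> G (Suc k1)" using p1 unfolding pk_def by auto
    have G1: "sh (Suc i1) r 0 \<in> G k1"
      using Ln_G[OF r(1) q1(2), of "Suc i1"] G_parity[of "Suc k1 + i1 + Suc i1" k1]
      unfolding sh_simps by auto
    have k1N: "k1 \<le> N" using b1 nN k1_def by auto
    have nd1: "\<not> desc (walk p r (Suc i1)) (sh (Suc i1) r) \<epsilon> k1"
      using no_long_fwd[OF rp nN i1 p1] b1(3) k1_def by auto
    obtain b2 where b2: "b2 < \<epsilon>" "desc (walk p r (Suc i1)) (sh (Suc i1) r) b2 k1"
      "walk p r (Suc i1 + Suc b2) \<in> E (k1 - b2)" "r (Suc i1 + b2) \<in> G (k1 - b2)"
      using desc_or_valley[OF q1(1) k1N Ln_sh[OF r(1)] G1, of \<epsilon>] nd1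
      unfolding walk_add by (auto simp: sh_def add.commute)
    define i2 where "i2 = Suc i1 + b2"
    define k2 where "k2 = k1 - b2"
    have b2k: "b2 \<le> k1" using b2(2) desc_def by auto
    have i2: "Suc i2 < P - 1" using i1_def i0_def b1e b2 a bnd unfolding i2_def by auto
    have w2: "walk p r i2 = walk (walk p r (Suc i1)) (sh (Suc i1) r) b2" unfolding i2_def walk_add ..
    have v2: "walk p r (Suc i2) \<in> E k2" "r i2 \<in> G k2" using b2 unfolding i2_def k2_def by auto
    have r2: "r i2 \<in> G k2 - H" using v2 Ln_nH[OF r(1)] by auto
    have G2: "sh (Suc i2) r 0 \<in> G (Suc k2)"
      using Ln_G[OF r(1) v2(2), of "Suc i2"] G_parity[of "k2 + i2 + Suc i2" "Suc k2"]
      unfolding sh_simps by auto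
    have ok2: "\<forall>j<P - 1 - Suc i2. ok n (walk (walk p r (Suc i2)) (sh (Suc i2) r) j) (sh (Suc i2) r j)"
    proof (intro allI impI)
      fix j assume "j < P - 1 - Suc i2"
      then show "ok n (walk (walk p r (Suc i2)) (sh (Suc i2) r) j) (sh (Suc i2) r j)"
        unfolding walk_add[symmetric] using okn[of "Suc i2 + j"] by (simp only: sh_def add.commute)
    qed
    have k2N: "k2 \<le> N" using k1N k2_def by simp
    from asc_or_peak[OF v2(1) k2N Ln_sh[OF r(1)] G2 nN ok2]
    show False
    proof
      assume "asc (walk p r (Suc i2)) (sh (Suc i2) r) (P - 1 - Suc i2) k2 \<and>
        (P - 1 - Suc i2 = 0 \<or> k2 + (P - 1 - Suc i2) \<le> n)"
      then have x: "walk p r (Suc i2 + (P - 1 - Suc i2)) \<in> E (k2 + (P - 1 - Suc i2))" "k2 + (P - 1 - Suc i2) \<le> n"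
        using i2 unfolding asc_def walk_add by auto
      have "Suc i2 + (P - 1 - Suc i2) = P - 1" using i2 by linarith
      then have "k2 + (P - 1 - Suc i2) = n"
        using disj[of "k2 + (P - 1 - Suc i2)" n "walk p r (P - 1)"] x r(4) nN by (simp only:)
      then have "int k2 + (int P - 2 - int i2) = int n" using i2 by linarith
      moreover have "int k2 = int n - int a + int b1 - int b2" using b2k an unfolding k2_def k1_def k0_def by auto
      moreover have "int i2 = 2 + int a + int b1 + int b2" unfolding i2_def i1_def i0_def by auto
      \<comment> \<open>The length of a path with one bump. It is too small, as
        \<open>a < A\<close>, \<open>b2 < \<epsilon>\<close> and
        \<open>P = 2 * A + 2 + 2 * \<epsilon>\<close>.\<close>
      ultimately have "int P = 4 + 2 * int a + 2 * int b2" by linarith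
      then show False using a b2 bnd by linarith
    next
      assume "\<exists>b<P - 1 - Suc i2. asc (walk p r (Suc i2)) (sh (Suc i2) r) b k2 \<and> k2 + b < n \<and>
           pk (k2 + b) (walk (walk p r (Suc i2)) (sh (Suc i2) r) b) (sh (Suc i2) r b)"
      then obtain b3 where b3: "b3 < P - 1 - Suc i2" "asc (walk p r (Suc i2)) (sh (Suc i2) r) b3 k2" "k2 + b3 < n"
        "pk (k2 + b3) (walk p r (Suc i2 + b3)) (r (Suc i2 + b3))"
        by (auto simp only: walk_add sh_at)
      define i3 where "i3 = Suc i2 + b3"
      define k3 where "k3 = k2 + b3"
      have i3: "i3 < P - 1" using b3 i3_def by auto
      have ok3: "\<forall>j<Suc i2 + b3. ok N (walk p r j) (r j)" using okN i3 i3_def by auto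
      have d3: "desc (walk p r i3) (bk i3 r) b3 k3"
        using asc_bk[OF r(1) _ ok3 b3(2)] i3 b3(3) nN unfolding i3_def k3_def by auto
      have p3: "pk k3 (walk p r i3) (r i3)" using b3 unfolding i3_def k3_def by simp
      have b3e: "b3 < \<epsilon>"
      proof (rule ccontr)
        assume "\<not> b3 < \<epsilon>"
        then show False using no_long_bwd[OF rp nN i3 p3 _ desc_mono[OF d3]] b3(3) k3_def by auto
      qed
      have v3: "walk (walk p r i3) (bk i3 r) b3 = walk p r i2 \<odot> r i2"
        using bk_walk[OF r(1) _ ok3, of b3] i3 unfolding i3_def by simp
      have q: "walk p r i1 \<odot> r i1 = walk p r (Suc i1)" "walk p r i2 \<odot> r i2 = walk p r (Suc i2)" by simp_all
      have x1: "desc (walk p r i1 \<odot> r i1) (sh (Suc i1) r) b2 k1" unfolding q by (rule b2(2))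
      have x2: "walk (walk p r i1 \<odot> r i1) (sh (Suc i1) r) b2 = walk p r i2" unfolding q w2 ..
      have x3: "walk p r i2 \<odot> r i2 \<in> E k2" unfolding q by (rule v2(1))
      have x4: "k2 = k3 - b3" using k3_def by simp
      have x5: "b2 + 3 * \<epsilon> + 1 \<le> A" "b3 + 3 * \<epsilon> + 1 \<le> A" using b2(1) b3e bnd by linarith+
      show False by (rule two_peaks[OF p1 x1 x2 r2 k2_def x3 p3 d3 v3 x4 x5])
    qed
  qed
qed

end

section \<open>Free actions of \<open>H\<close> extended to free actions of a factor\<close>

context amalgam
begin

text \<open>\<open>Pt\<close> lists the identifications that are forced inside \<open>E\<close>. As
  it is functional up to \<open>H\<close>, the points that must share an orbit of \<open>G k\<close>
  form at most two orbits of \<open>H\<close>. Each such class is completed to one free orbit, and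
  the last clause says that nothing else is identified inside \<open>E\<close>.\<close>

lemma torsor_ext:
  fixes E :: "'g list set" and act :: "'g list \<Rightarrow> 'g \<Rightarrow> 'g list" (infixl "\<odot>" 65)
  assumes cl: "\<And>p h. p \<in> E \<Longrightarrow> h \<in> H \<Longrightarrow> p \<odot> h \<in> E"
    and ae: "\<And>p. p \<in> E \<Longrightarrow> p \<odot> e = p"
    and am: "\<And>p h h'. p \<in> E \<Longrightarrow> h \<in> H \<Longrightarrow> h' \<in> H \<Longrightarrow> p \<odot> h \<odot> h' = p \<odot> (h \<cdot> h')"
    and fr: "\<And>p h. p \<in> E \<Longrightarrow> h \<in> H \<Longrightarrow> p \<odot> h = p \<Longrightarrow> h = e"
    and Pt: "\<And>p b q. Pt p b q \<Longrightarrow> p \<in> E \<and> q \<in> E \<and> b \<in> G k - H"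
    and sym: "\<And>p b q. Pt p b q \<Longrightarrow> Pt q (iv b) p"
    and eqv: "\<And>p b q c. Pt p b q \<Longrightarrow> c \<in> H \<Longrightarrow> Pt p (b \<cdot> c) (q \<odot> c)"
    and func: "\<And>p b q b' q'. Pt p b q \<Longrightarrow> Pt p b' q' \<Longrightarrow> \<exists>c\<in>H. q' = q \<odot> c \<and> b' = b \<cdot> c"
    and irr: "\<And>p b q c. Pt p b q \<Longrightarrow> c \<in> H \<Longrightarrow> q \<noteq> p \<odot> c"
    and len: "\<And>p. p \<in> E \<Longrightarrow> length p = n"
  shows "\<exists>E' act'. (\<forall>p\<in>E'. length p = Suc n)
    \<and> (\<forall>p\<in>E \<union> E'. \<forall>g\<in>G k. act' p g \<in> E \<union> E' \<and> (\<forall>g'\<in>G k. act' (act' p g) g' = act' p (g \<cdot> g')) \<and> (act' p g = p \<longrightarrow> g = e))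
    \<and> (\<forall>p\<in>E \<union> E'. act' p e = p) \<and> (\<forall>p\<in>E. \<forall>h\<in>H. act' p h = p \<odot> h)
    \<and> (\<forall>p\<in>E'. \<exists>g\<in>G k. act' p g \<in> E) \<and> (\<forall>p b q. Pt p b q \<longrightarrow> act' p b = q)
    \<and> (\<forall>p\<in>E. \<forall>g\<in>G k - H. act' p g \<in> E \<longrightarrow> Pt p g (act' p g))"
proof -
  define R where "R p q \<longleftrightarrow> (\<exists>h\<in>H. q = p \<odot> h) \<or> (\<exists>b. Pt p b q)" for p q
  have eqv2: "Pt (p \<odot> c) (iv c \<cdot> b) q" if "Pt p b q" "c \<in> H" for p b q c
  proof -
    have "Pt q (iv b \<cdot> c) (p \<odot> c)" using eqv[OF sym[OF that(1)] that(2)] .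
    from sym[OF this] have "Pt (p \<odot> c) (iv (iv b \<cdot> c)) q" .
    moreover have "iv (iv b \<cdot> c) = iv c \<cdot> b"
      using Pt[OF that(1)] HG[OF that(2), of k] by (simp add: iv_mult[where k=k] iv_ivG[where k=k])
    ultimately show ?thesis by simp
  qed
  have Rsym: "R q p" if pq: "R p q" and pE: "p \<in> E" for p q
  proof -
    consider h where "h \<in> H" "q = p \<odot> h" | b where "Pt p b q" using pq unfolding R_def by blast
    then show ?thesis
    proof cases
      case 1
      then have "p = q \<odot> iv h" using am[OF pE, of h "iv h"] ae[OF pE] by simp
      then show ?thesis using 1 unfolding R_def by auto
    next
      case 2 then show ?thesis using sym unfolding R_def by blast
    qed
  qed
  have Rtrans: "R p s" if pq: "R p q" and qs: "R q s" and pE: "p \<in> E" for p q s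
  proof -
    consider h where "h \<in> H" "q = p \<odot> h" | b where "Pt p b q" using pq unfolding R_def by blast
    then show ?thesis
    proof cases
      case 1
      note c1 = 1
      consider h' where "h' \<in> H" "s = q \<odot> h'" | b where "Pt q b s" using qs unfolding R_def by blast
      then show ?thesis
      proof cases
        case 1 then show ?thesis using c1 am pE mH unfolding R_def by blast
      next
        case 2
        have "p = q \<odot> iv h" using am[OF pE, of h "iv h"] ae[OF pE] c1 by simp
        then show ?thesis using eqv2[OF 2, of "iv h"] c1 unfolding R_def by auto
      qed
    next
      case 2
      consider h' where "h' \<in> H" "s = q \<odot> h'" | b where "Pt q b s" using qs unfolding R_def by blast
      then show ?thesis
      proof cases
        case 1 then show ?thesis using eqv[OF 2] unfolding R_def by auto
      next
        case 3: 2
        obtain c where "c \<in> H" "s = p \<odot> c" using func[OF sym[OF 2] 3] by auto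
        then show ?thesis unfolding R_def by blast
      qed
    qed
  qed
  have RE: "R p q \<Longrightarrow> p \<in> E \<Longrightarrow> q \<in> E" for p q using cl Pt unfolding R_def by blast
  have Rrefl: "R p p" if "p \<in> E" for p unfolding R_def using ae[OF that] eH by metis
  \<comment> \<open>A base point for every class; \<open>\<beta> p\<close> below is the element of
    \<open>G k\<close> that carries the base point to \<open>p\<close>. In these coordinates every
    orbit becomes a copy of \<open>G k\<close>.\<close>
  define \<rho> where "\<rho> p = (SOME x. R p x)" for p
  have \<rho>: "R p (\<rho> p)" if "p \<in> E" for p unfolding \<rho>_def using someI[of "R p" p] Rrefl[OF that] by simp
  have \<rho>E: "\<rho> p \<in> E" if "p \<in> E" for p using RE \<rho> that by blast
  have \<rho>eq: "\<rho> p = \<rho> q" if "R p q" "p \<in> E" for p q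
  proof -
    have "R p x \<longleftrightarrow> R q x" for x using that Rsym Rtrans RE by metis
    then have "R p = R q" by (intro ext)
    then show ?thesis unfolding \<rho>_def by (simp only:)
  qed
  define B where "B x b p \<longleftrightarrow> (b \<in> H \<and> p = x \<odot> b) \<or> Pt x b p" for x b p
  have Bex: "\<exists>b. B x b p" if "R x p" for x p using that unfolding R_def B_def by auto
  have BR: "R x p" if "B x b p" for x b p using that unfolding R_def B_def by auto
  have BG: "b \<in> G k" if "B x b p" for x b p using that HG Pt unfolding B_def by auto
  have Bmul: "B x (b \<cdot> h) (p \<odot> h)" if "B x b p" "x \<in> E" "h \<in> H" for x b p h
    using that am eqv mH unfolding B_def by metis
  have Binj: "p = q" if "B x b p" "B x b q" "x \<in> E" for x b p q
  proof -
    consider "b \<in> H" | "b \<notin> H" by blast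
    then show ?thesis
    proof cases
      case 1 then show ?thesis using that Pt unfolding B_def by blast
    next
      case 2
      then have pt: "Pt x b p" "Pt x b q" using that unfolding B_def by auto
      then obtain c where c: "c \<in> H" "q = p \<odot> c" "b = b \<cdot> c" using func by blast
      have bG: "b \<in> G k" "c \<in> G k" using Pt[OF pt(1)] c HG by auto
      have "b \<cdot> e = b \<cdot> c" using c(3) bG by simp
      then have "c = e" using cancel_l[of b k e c] bG by auto
      then show ?thesis using c ae Pt[OF pt(1)] by simp
    qed
  qed
  have Bfun: "b = b'" if B1: "B x b p" and B2: "B x b' p" and xE: "x \<in> E" for x b b' p
  proof -
    have eqH: "h = h'" if "h \<in> H" "h' \<in> H" "x \<odot> h = x \<odot> h'" for h h'
    proof -
      have "x \<odot> (h' \<cdot> iv h) = x \<odot> (h \<cdot> iv h)" using am[OF \<open>x \<in> E\<close>] that by (metis ivH)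
      then have "x \<odot> (h' \<cdot> iv h) = x" using that ae \<open>x \<in> E\<close> by simp
      then have "h' \<cdot> iv h = e" using fr[OF \<open>x \<in> E\<close>, of "h' \<cdot> iv h"] that by simp
      then have "h' \<cdot> iv h \<cdot> h = e \<cdot> h" by simp
      then show ?thesis using aH[of h' "iv h" h] that by simp
    qed
    consider "b \<in> H" "p = x \<odot> b" "b' \<in> H" "p = x \<odot> b'" | "b \<in> H" "p = x \<odot> b" "Pt x b' p"
      | "b' \<in> H" "p = x \<odot> b'" "Pt x b p" | "Pt x b p" "Pt x b' p" using B1 B2 unfolding B_def by blast
    then show ?thesis
    proof cases
      case 1 then show ?thesis using eqH by auto
    next
      case 2 then show ?thesis using irr by blast
    next
      case 3 then show ?thesis using irr by blast
    next
      case 4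
      then obtain c where c: "c \<in> H" "p = p \<odot> c" "b' = b \<cdot> c" using func by blast
      then have "c = e" using fr[of p c] Pt[OF 4(1)] by metis
      moreover have "b \<cdot> e = b" by (rule erG[of b k]) (use Pt[OF 4(1)] in blast)
      ultimately show ?thesis using c(3) by (simp only:)
    qed
  qed
  define \<beta> where "\<beta> p = (SOME b. B (\<rho> p) b p)" for p
  have \<beta>: "B (\<rho> p) (\<beta> p) p" if "p \<in> E" for p
    unfolding \<beta>_def using someI_ex[OF Bex[OF Rsym[OF \<rho>[OF that] that]]] .
  have \<beta>G: "\<beta> p \<in> G k" if "p \<in> E" for p using BG \<beta> that by blast
  have \<rho>\<beta>: "\<rho> (p \<odot> h) = \<rho> p" "\<beta> (p \<odot> h) = \<beta> p \<cdot> h" if "p \<in> E" "h \<in> H" for p h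
  proof -
    have "R p (p \<odot> h)" using that unfolding R_def by blast
    then show r: "\<rho> (p \<odot> h) = \<rho> p" using \<rho>eq that by metis
    have "B (\<rho> p) (\<beta> p \<cdot> h) (p \<odot> h)" using Bmul[OF \<beta> \<rho>E] that by auto
    then show "\<beta> (p \<odot> h) = \<beta> p \<cdot> h" using Bfun[OF \<beta>[OF cl[OF that]], of "\<beta> p \<cdot> h"] r \<rho>E that by simp
  qed
  have Binv: "Pt p (iv b \<cdot> b') q \<or> (iv b \<cdot> b' \<in> H \<and> q = p \<odot> (iv b \<cdot> b'))" if B1: "B x b p" and B2: "B x b' q" and xE: "x \<in> E" for x b b' p q
  proof -
    have kG: "b \<in> G k" "b' \<in> G k" using BG that by auto
    consider "b \<in> H" "p = x \<odot> b" "b' \<in> H" "q = x \<odot> b'" | "b \<in> H" "p = x \<odot> b" "Pt x b' q"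
      | "b' \<in> H" "q = x \<odot> b'" "Pt x b p" | "Pt x b p" "Pt x b' q" using B1 B2 unfolding B_def by blast
    then show ?thesis
    proof cases
      case 1 then show ?thesis using am[of x b "iv b \<cdot> b'"] that(3) kG by simp
    next
      case 2 then show ?thesis using eqv2 by blast
    next
      case 3 then show ?thesis using eqv[OF sym[OF 3(3)] 3(1)] by auto
    next
      case 4
      then obtain c where c: "c \<in> H" "q = p \<odot> c" "b' = b \<cdot> c" using func by blast
      then have "iv b \<cdot> b' = c" using kG HG[OF c(1), of k] by simp
      then show ?thesis using c by auto
    qed
  qed
  define X where "X = \<rho> ` E"
  define \<phi> where "\<phi> p = (if p \<in> E then (\<rho> p, \<beta> p) else (tl p, hd p))" for p
  \<comment> \<open>The new points are the coordinates that no point of \<open>E\<close> occupies.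
    Putting the group element in front of the base point makes the lists longer by one, hence
    new.\<close>
  define E' where "E' = {b # x | b x. x \<in> X \<and> b \<in> G k \<and> (\<forall>p\<in>E. (\<rho> p, \<beta> p) \<noteq> (x, b))}"
  have XE: "X \<subseteq> E" using \<rho>E X_def by auto
  have lenE': "length p = Suc n" if "p \<in> E'" for p using that XE len unfolding E'_def by auto
  have dis: "p \<notin> E" if "p \<in> E'" for p using lenE'[OF that] len[of p] by auto
  have inj: "inj_on \<phi> (E \<union> E')"
  proof (rule inj_onI)
    fix p q assume a: "p \<in> E \<union> E'" "q \<in> E \<union> E'" "\<phi> p = \<phi> q"
    show "p = q"
    proof (cases "p \<in> E \<and> q \<in> E")
      case True then show ?thesis using a(3) Binj[OF \<beta> _ \<rho>E, of p q] \<beta>[of q] unfolding \<phi>_def by auto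
    next
      case False
      then consider "p \<in> E" "q \<in> E'" "q \<notin> E" | "p \<in> E'" "q \<in> E" "p \<notin> E" | "p \<in> E'" "q \<in> E'" "p \<notin> E" "q \<notin> E"
        using a dis by blast
      then show ?thesis by cases (use a(3) in \<open>auto simp: \<phi>_def E'_def\<close>)
    qed
  qed
  have img: "\<phi> ` (E \<union> E') = X \<times> G k"
  proof
    show "\<phi> ` (E \<union> E') \<subseteq> X \<times> G k"
    proof
      fix y assume "y \<in> \<phi> ` (E \<union> E')"
      then obtain p where p: "p \<in> E \<union> E'" "y = \<phi> p" by auto
      show "y \<in> X \<times> G k"
      proof (cases "p \<in> E")
        case True then show ?thesis using p(2) \<beta>G[OF True] unfolding \<phi>_def X_def by simp
      next
        case False
        then obtain b x where "p = b # x" "x \<in> X" "b \<in> G k" using p(1) unfolding E'_def by blast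
        then show ?thesis using p(2) False unfolding \<phi>_def by simp
      qed
    qed
    show "X \<times> G k \<subseteq> \<phi> ` (E \<union> E')"
    proof
      fix y assume "y \<in> X \<times> G k"
      then obtain x b where y: "y = (x, b)" "x \<in> X" "b \<in> G k" by auto
      show "y \<in> \<phi> ` (E \<union> E')"
      proof (cases "\<exists>p\<in>E. (\<rho> p, \<beta> p) = (x, b)")
        case True then show ?thesis using y unfolding \<phi>_def by (metis (mono_tags, lifting) UnI1 image_eqI)
      next
        case False
        then have "b # x \<in> E'" using y unfolding E'_def by auto
        moreover have "\<phi> (b # x) = y" using dis[OF calculation] y unfolding \<phi>_def by auto
        ultimately show ?thesis by blast
      qed
    qed
  qed
  define \<psi> where "\<psi> = inv_into (E \<union> E') \<phi>"
  have \<psi>1: "\<psi> (\<phi> p) = p" if "p \<in> E \<union> E'" for p unfolding \<psi>_def using inv_into_f_f[OF inj that] .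
  have \<psi>2: "\<phi> (\<psi> y) = y" "\<psi> y \<in> E \<union> E'" if "y \<in> X \<times> G k" for y
    unfolding \<psi>_def using that img f_inv_into_f inv_into_into by metis+
  define act' where "act' p g = \<psi> (fst (\<phi> p), snd (\<phi> p) \<cdot> g)" for p g
  have \<phi>in: "fst (\<phi> p) \<in> X" "snd (\<phi> p) \<in> G k" if "p \<in> E \<union> E'" for p using img that by (metis imageI mem_Times_iff)+
  have \<phi>act: "\<phi> (act' p g) = (fst (\<phi> p), snd (\<phi> p) \<cdot> g)" "act' p g \<in> E \<union> E'" if "p \<in> E \<union> E'" "g \<in> G k" for p g
    unfolding act'_def using \<psi>2 \<phi>in[OF that(1)] that(2) by auto
  have act'_eq: "act' p g = q" if "p \<in> E \<union> E'" "q \<in> E \<union> E'" "fst (\<phi> q) = fst (\<phi> p)" "snd (\<phi> q) = snd (\<phi> p) \<cdot> g" for p q g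
  proof -
    have "(fst (\<phi> p), snd (\<phi> p) \<cdot> g) = \<phi> q" unfolding that(3,4)[symmetric] by simp
    then show ?thesis unfolding act'_def using \<psi>1[OF that(2)] by (simp only:)
  qed
  have fE: "fst (\<phi> p) = \<rho> p" "snd (\<phi> p) = \<beta> p" if "p \<in> E" for p using that unfolding \<phi>_def by auto
  show ?thesis
  proof (intro exI[of _ E'] exI[of _ act'] conjI ballI allI impI)
    fix p assume "p \<in> E'" then show "length p = Suc n" using lenE' by simp
  next
    fix p g assume pg: "p \<in> E \<union> E'" "g \<in> G k"
    show "act' p g \<in> E \<union> E'" using \<phi>act pg by blast
    { fix g' assume g': "g' \<in> G k"
      show "act' (act' p g) g' = act' p (g \<cdot> g')"
        unfolding act'_def[of "act' p g"] act'_def[of p "g \<cdot> g'"] \<phi>act(1)[OF pg]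
        using \<phi>in[OF pg(1)] pg g' by (simp add: aG[where k=k]) }
    { assume "act' p g = p"
      then have "snd (\<phi> p) \<cdot> g = snd (\<phi> p) \<cdot> e" using \<phi>act(1)[OF pg] \<phi>in[OF pg(1)] by (metis erG snd_conv)
      then show "g = e" using cancel_l[of "snd (\<phi> p)" k g e] \<phi>in[OF pg(1)] pg by simp }
  next
    fix p assume p: "p \<in> E \<union> E'"
    show "act' p e = p" by (rule act'_eq) (use p \<phi>in[OF p] in simp_all)
  next
    fix p h assume ph: "p \<in> E" "h \<in> H"
    show "act' p h = p \<odot> h" by (rule act'_eq) (use ph cl fE \<rho>\<beta> in auto)
  next
    fix p assume p: "p \<in> E'"
    then have p': "p \<in> E \<union> E'" by simp
    obtain x where x: "x \<in> E" "fst (\<phi> p) = \<rho> x" using \<phi>in[OF p'] X_def by auto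
    have "act' p (iv (snd (\<phi> p)) \<cdot> \<beta> x) = x"
      by (rule act'_eq) (use p' x fE \<phi>in[OF p'] \<beta>G in auto)
    then show "\<exists>g\<in>G k. act' p g \<in> E" using x \<phi>in[OF p'] \<beta>G by (intro bexI[of _ "iv (snd (\<phi> p)) \<cdot> \<beta> x"]) auto
  next
    fix p b q assume pt: "Pt p b q"
    have pE: "p \<in> E" "q \<in> E" "b \<in> G k" using Pt[OF pt] by auto
    have "R p q" using pt unfolding R_def by blast
    then have "\<rho> q = \<rho> p" using \<rho>eq[of p q] pE by simp
    moreover have "\<beta> q = \<beta> p \<cdot> b"
    proof -
      have B1: "B (\<rho> p) (\<beta> p) p" "B (\<rho> p) (\<beta> q) q" using \<beta> pE calculation by metis+
      have kG: "\<beta> p \<in> G k" "\<beta> q \<in> G k" using \<beta>G pE by auto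
      have "Pt p (iv (\<beta> p) \<cdot> \<beta> q) q"
        using Binv[OF B1 \<rho>E[OF pE(1)]] irr[OF pt] by blast
      then obtain c where c: "c \<in> H" "q = q \<odot> c" "iv (\<beta> p) \<cdot> \<beta> q = b \<cdot> c" using func[OF pt] by blast
      then have "c = e" using fr[of q c] pE by metis
      then have "iv (\<beta> p) \<cdot> \<beta> q = b" using c pE by simp
      then have "\<beta> p \<cdot> (iv (\<beta> p) \<cdot> \<beta> q) = \<beta> p \<cdot> b" by simp
      then show ?thesis using kG by simp
    qed
    ultimately show "act' p b = q" by (intro act'_eq) (use pE fE in auto)
  next
    fix p g assume a: "p \<in> E" "g \<in> G k - H" "act' p g \<in> E"
    define q where "q = act' p g"
    have pU: "p \<in> E \<union> E'" "g \<in> G k" using a by auto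
    have "\<rho> q = \<rho> p" "\<beta> q = \<beta> p \<cdot> g" using \<phi>act(1)[OF pU] fE[OF a(1)] fE[OF a(3)] unfolding q_def by auto
    moreover have "q \<in> E" using a q_def by auto
    ultimately have "Pt p (iv (\<beta> p) \<cdot> \<beta> q) q \<or> (iv (\<beta> p) \<cdot> \<beta> q \<in> H \<and> q = p \<odot> (iv (\<beta> p) \<cdot> \<beta> q))"
      using Binv[of "\<rho> p" "\<beta> p" p "\<beta> q" q] \<beta>[of p] \<beta>[of q] \<rho>E[of p] a(1) by auto
    moreover have "iv (\<beta> p) \<cdot> \<beta> q = g" using \<open>\<beta> q = \<beta> p \<cdot> g\<close> \<beta>G[OF a(1)] pU by simp
    ultimately show "Pt p g (act' p g)" using a(2) q_def by auto
  qed
qed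

end

context smallcanc
begin

lemma rv_rv: "r \<in> Ln \<Longrightarrow> rv P (rv P r) = r"
  by (rule rev_rev) (use A_bounds Ln_per Ln_LM in auto)

end

section \<open>The identifications forced in the next layer\<close>

context gstage
begin

lemma ok_rev: "n \<le> N \<Longrightarrow> ok n q g \<Longrightarrow> ok n (q \<odot> g) (iv g)"
  unfolding ok_def using V_cl ivG by (meson le_trans)

lemma ok_twist: "n \<le> N \<Longrightarrow> ok n q g \<Longrightarrow> c \<in> H \<Longrightarrow> c' \<in> H \<Longrightarrow> ok n (q \<odot> c) (iv c \<cdot> g \<cdot> c')"
  unfolding ok_def using V_cl ivG mG HG by (meson le_trans)

lemma relpath_rev:
  assumes rp: "relpath n p r" and nN: "n \<le> N"
  shows "relpath n (walk p r (P - 1)) (bk (P - 1) r)"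
    and "j \<le> P - 1 \<Longrightarrow> walk (walk p r (P - 1)) (bk (P - 1) r) j = walk p r (P - 1 - j)"
proof -
  note r = relpathD[OF rp] and okn = relpathD(6)[OF rp]
  have bw: "walk (walk p r (P - 1)) (bk (P - 1) r) j = walk p r (P - 1 - j)" if "j \<le> P - 1" for j
    by (rule bk_walk[OF r(1)]) (use okn ok_mono[OF nN] that in auto)
  then show "j \<le> P - 1 \<Longrightarrow> walk (walk p r (P - 1)) (bk (P - 1) r) j = walk p r (P - 1 - j)" .
  have P2: "P - 1 \<le> P" "0 < P - 1" "P - 1 - 1 - 0 = P - 2" using A_bounds eps by auto
  have "even (n + 0 + (P - 2) + n)" using evenP by auto
  then have "r (P - 2) \<in> G n" using Ln_G[OF r(1,3), of "P - 2"] G_parity[of "n + 0 + (P - 2)" n] by auto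
  then have 0: "bk (P - 1) r 0 \<in> G n" using bk_eq[OF P2(1,2), of r] P2(3) by simp
  show "relpath n (walk p r (P - 1)) (bk (P - 1) r)"
    unfolding relpath_def
  proof (intro conjI allI impI)
    fix j
    show "\<exists>i\<le>n. walk (walk p r (P - 1)) (bk (P - 1) r) j \<in> E i" if "j < P"
      using bw[of j] r(5)[of "P - 1 - j"] that by auto
    show "ok n (walk (walk p r (P - 1)) (bk (P - 1) r) j) (bk (P - 1) r j)" if j: "j < P - 1"
    proof -
      have m: "P - 1 - j = Suc (P - 1 - 1 - j)" "P - 1 - 1 - j < P - 1" using j by auto
      show ?thesis using ok_rev[OF nN okn[OF m(2)]] bw[of j] bk_eq[OF P2(1) j, of r] j m(1) by simp
    qed
  qed (use r 0 bk_Ln bw[of "P - 1"] in auto)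
qed

lemma relpath_twist:
  assumes rp: "relpath n p r" and nN: "n \<le> N" and c: "hper P c"
  shows "relpath n (p \<odot> c 0) (twist c r)" "j \<le> P - 1 \<Longrightarrow> walk (p \<odot> c 0) (twist c r) j = walk p r j \<odot> c j"
proof -
  note r = relpathD[OF rp] and okn = relpathD(6)[OF rp]
  have cH: "\<forall>i. c i \<in> H" using c hper_H by auto
  have w: "walk (p \<odot> c 0) (twist c r) j = walk p r j \<odot> c j" if "j \<le> P - 1" for j
    by (rule twist_walk[OF cH _ that]) (use okn ok_mono[OF nN] in auto)
  then show "j \<le> P - 1 \<Longrightarrow> walk (p \<odot> c 0) (twist c r) j = walk p r j \<odot> c j" .
  show "relpath n (p \<odot> c 0) (twist c r)"
    unfolding relpath_def
  proof (intro conjI allI impI)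
    fix j
    show "\<exists>i\<le>n. walk (p \<odot> c 0) (twist c r) j \<in> E i" if "j < P"
      using w[of j] r(5)[of j] that E_H cH nN by (metis Suc_diff_1 Suc_leI less_Suc_eq_le le_trans less_imp_le A_bounds(3))
    show "ok n (walk (p \<odot> c 0) (twist c r) j) (twist c r j)" if j: "j < P - 1"
      using ok_twist[OF nN okn[OF j]] cH w[of j] j unfolding twist_def by auto
    show "twist c r 0 \<in> G n" using r(3) cH HG unfolding twist_def by auto
    show "p \<odot> c 0 \<in> E n" using E_H nN r cH by auto
    show "walk (p \<odot> c 0) (twist c r) (P - 1) \<in> E n" using w E_H nN r cH by auto
  qed (use r Ln_twist c in auto)
qed

text \<open>The missing syllable \<open>r (P - 1)\<close> must lead from the end \<open>q\<close> of
  the path back to \<open>p\<close>; seen from \<open>p\<close>, its inverse leads to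
  \<open>q\<close>.\<close>

definition Pt :: "'p \<Rightarrow> 'g \<Rightarrow> 'p \<Rightarrow> bool" where
  "Pt p b q \<longleftrightarrow> (\<exists>r. relpath N p r \<and> walk p r (P - 1) = q \<and> b = iv (r (P - 1)))"

lemma rP: "relpath n p r \<Longrightarrow> r (P - 1) \<in> G (Suc n) - H"
proof -
  assume rp: "relpath n p r"
  have "even (n + 0 + (P - 1) + Suc n)" using evenP A_bounds(3) by auto
  then show ?thesis using rp Ln_G[of r 0 n "P - 1"] G_parity[of "n + 0 + (P - 1)" "Suc n"] unfolding relpath_def by auto
qed

lemma Pt_in: "Pt p b q \<Longrightarrow> p \<in> E N \<and> q \<in> E N \<and> b \<in> G (Suc N) - H"
  unfolding Pt_def using rP notH_iv unfolding relpath_def by metis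

lemma Pt_sym: "Pt p b q \<Longrightarrow> Pt q (iv b) p"
proof -
  assume "Pt p b q"
  then obtain r where r: "relpath N p r" "walk p r (P - 1) = q" "b = iv (r (P - 1))" unfolding Pt_def by auto
  have P: "P - (P - 1) = 1" "P - 1 + 1 = P" using A_bounds by auto
  have "bk (P - 1) r (P - 1) = iv (r (P - 1))" unfolding bk_def sh_def P rv_def by simp
  then show ?thesis unfolding Pt_def using relpath_rev[OF r(1) order_refl] r
    by (intro exI[of _ "bk (P - 1) r"]) simp
qed

lemma Pt_eqv: "Pt p b q \<Longrightarrow> c \<in> H \<Longrightarrow> Pt p (b \<cdot> c) (q \<odot> c)"
proof -
  assume a: "Pt p b q" "c \<in> H"
  then obtain r where r: "relpath N p r" "walk p r (P - 1) = q" "b = iv (r (P - 1))" unfolding Pt_def by auto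
  define d where "d = (\<lambda>i. if i mod P = P - 1 then c else e)"
  have d: "hper P d" unfolding hper_def d_def using a by auto
  have P: "0 \<noteq> P - 1" "P - 1 < P" "Suc (P - 1) = P" using A_bounds eps by auto
  have d0: "d 0 = e" "d (P - 1) = c" "d (Suc (P - 1)) = e" unfolding d_def using P by auto
  have pV: "p \<in> V N" using r V_E unfolding relpath_def by auto
  have G: "r (P - 1) \<in> G (Suc N)" "c \<in> G (Suc N)" using rP[OF r(1)] HG a by auto
  have "relpath N p (twist d r)" "walk p (twist d r) (P - 1) = q \<odot> c"
    using relpath_twist[OF r(1) order_refl d] d0 act_e[OF order_refl pV] r by auto
  moreover have "iv (twist d r (P - 1)) = b \<cdot> c"
    unfolding twist_def d0 using G r(3) by (simp add: gs[where k="Suc N"])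
  ultimately show ?thesis unfolding Pt_def by (intro exI[of _ "twist d r"]) simp
qed

text \<open>Both paths start with a descent of \<open>A\<close> steps by
  \<open>relpath_desc\<close>, so \<open>merge\<close> makes their lines twists of each
  other.\<close>

lemma Pt_func: "Pt p b q \<Longrightarrow> Pt p b' q' \<Longrightarrow> \<exists>c\<in>H. q' = q \<odot> c \<and> b' = b \<cdot> c"
proof -
  assume a: "Pt p b q" "Pt p b' q'"
  then obtain r r' where r: "relpath N p r" "walk p r (P - 1) = q" "b = iv (r (P - 1))"
    and r': "relpath N p r'" "walk p r' (P - 1) = q'" "b' = iv (r' (P - 1))" unfolding Pt_def by auto
  have rL: "r \<in> Ln" "r' \<in> Ln" using r r' relpath_def by auto
  have Ab: "2 * \<epsilon> \<le> A" "\<epsilon> \<le> A" using A_bounds by auto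
  obtain c where c: "hper P c" "c 0 = e" "r' = twist c r"
    using merge[OF rL(1) relpath_desc[OF r(1) order_refl] Ab(1) rL(2) relpath_desc[OF r'(1) order_refl] Ab(2) order_refl] by blast
  have cH: "c (P - 1) \<in> H" using hper_H[OF c(1)] .
  have pV: "p \<in> V N" using r V_E unfolding relpath_def by auto
  have "q' = q \<odot> c (P - 1)" using relpath_twist(2)[OF r(1) order_refl c(1), of "P - 1"] c act_e[OF order_refl pV] r r' by simp
  moreover have "b' = b \<cdot> c (P - 1)"
    unfolding r' c(3) r twist_def hper_P[OF c(1)] c(2) using rP[OF r(1)] HG[OF cH, of "Suc N"]
    by (simp add: gs[where k="Suc N"])
  ultimately show ?thesis using cH by blast
qed

text \<open>Otherwise the reversed path can be twisted so as to start at \<open>p\<close> too, and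
  merging it with the given one would make the line a twist of a shift of its own reverse, against
  \<open>NR\<close>.\<close>

lemma Pt_irr: "Pt p b q \<Longrightarrow> c \<in> H \<Longrightarrow> q \<noteq> p \<odot> c"
proof
  assume a: "Pt p b q" "c \<in> H" "q = p \<odot> c"
  then obtain r where r: "relpath N p r" "walk p r (P - 1) = q" "b = iv (r (P - 1))" unfolding Pt_def by auto
  have rL: "r \<in> Ln" "p \<in> V N" using r V_E relpath_def by auto
  define s where "s = bk (P - 1) r"
  have sL: "s \<in> Ln" "s = sh 1 (rv P r)" unfolding s_def bk_def using A_bounds rL Ln_sh Ln_rv by auto
  have rs: "relpath N q s" using relpath_rev(1)[OF r(1) order_refl] r s_def by auto
  have "q \<odot> iv c = p" using a act_inv(1)[OF order_refl rL(2) HG[OF a(2)]] by simp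
  then have d: "desc p (twist (\<lambda>_. iv c) s) A N"
    using desc_twist[OF relpath_desc[OF rs order_refl] order_refl, of "\<lambda>_. iv c"] a by simp
  have tL: "twist (\<lambda>_. iv c) s \<in> Ln" using Ln_twist sL hper_const a by auto
  have Ab: "2 * \<epsilon> \<le> A" "\<epsilon> \<le> A" using A_bounds by auto
  obtain x where x: "hper P x" "x 0 = e" "r = twist x (twist (\<lambda>_. iv c) s)"
    using merge[OF tL d Ab(1) rL(1) relpath_desc[OF r(1) order_refl] Ab(2) order_refl] by blast
  have "r = twist (\<lambda>i. iv c \<cdot> x i) (sh 1 (rv P r))"
    using x twist_twist[OF sL(1), of "\<lambda>_. iv c" x] a hper_H sL(2) by auto
  moreover have "hper P (\<lambda>i. iv c \<cdot> x i)" using hper_mult[OF hper_const x(1)] a by auto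
  ultimately show False using NR[OF rL(1), of "\<lambda>i. iv c \<cdot> x i" 1] by metis
qed

lemma cong_ok:
  assumes E': "\<And>k. k \<le> N \<Longrightarrow> E' k = E k" and n: "n \<le> N"
  shows "stage.ok L M E' n q g = ok n q g"
proof -
  interpret S': stage L M f e Ln P \<epsilon> E' act N by unfold_locales
  have "S'.V k = V k" if "k \<le> n" for k using that n E' unfolding V_def S'.V_def by auto
  then show ?thesis unfolding ok_def S'.ok_def by auto
qed

lemma cong_walk:
  assumes act': "\<And>k p g. k \<le> N \<Longrightarrow> p \<in> V k \<Longrightarrow> g \<in> G k \<Longrightarrow> act' p g = p \<odot> g"
    and "\<And>i. i < j \<Longrightarrow> ok N (walk p r i) (r i)"
  shows "stage.walk act' p r j = walk p r j"
proof -
  interpret S': stage L M f e Ln P \<epsilon> E act' N by unfold_locales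
  show ?thesis using assms(2)
  proof (induction j)
    case (Suc j)
    then have "S'.walk p r j = walk p r j" by auto
    moreover obtain k where "k \<le> N" "walk p r j \<in> V k" "r j \<in> G k" using Suc.prems[of j] unfolding ok_def by auto
    ultimately show ?case using act' by auto
  qed simp
qed

lemma cong_relpath:
  assumes E': "\<And>k. k \<le> N \<Longrightarrow> E' k = E k"
    and act': "\<And>k p g. k \<le> N \<Longrightarrow> p \<in> V k \<Longrightarrow> g \<in> G k \<Longrightarrow> act' p g = p \<odot> g" and n: "n \<le> N"
    and rp: "stage.relpath L M Ln P E' act' n p r"
  shows "relpath n p r" "j \<le> P - 1 \<Longrightarrow> stage.walk act' p r j = walk p r j"
proof -
  interpret S': stage L M f e Ln P \<epsilon> E' act' N by unfold_locales
  have r: "S'.walk p r (P - 1) \<in> E' n" "\<And>j. j < P - 1 \<Longrightarrow> S'.ok n (S'.walk p r j) (r j)"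
    using rp S'.relpath_def by auto
  have w: "S'.walk p r j = walk p r j \<and> (\<forall>i<j. ok N (walk p r i) (r i))" if "j \<le> P - 1" for j
    using that
  proof (induction j)
    case (Suc j)
    then have 1: "S'.walk p r j = walk p r j" "\<forall>i<j. ok N (walk p r i) (r i)" by auto
    have "ok n (walk p r j) (r j)" using r(2)[of j] Suc.prems cong_ok[OF E' n] 1 by auto
    then have 2: "\<forall>i<Suc j. ok N (walk p r i) (r i)" using 1 ok_mono[OF n] by (auto simp: less_Suc_eq)
    then show ?case using cong_walk[where j="Suc j" and p=p and r=r, OF act'] by auto
  qed simp
  then show "j \<le> P - 1 \<Longrightarrow> S'.walk p r j = walk p r j" by auto
  show "relpath n p r"
    unfolding relpath_def
  proof (intro conjI allI impI)
    show "p \<in> E n" "r \<in> Ln" "r 0 \<in> G n" "walk p r (P - 1) \<in> E n"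
      using rp w[of "P - 1"] E'[OF n] unfolding S'.relpath_def by auto
    fix j
    show "\<exists>i\<le>n. walk p r j \<in> E i" if "j < P"
    proof -
      have "\<exists>i\<le>n. S'.walk p r j \<in> E' i" using rp that unfolding S'.relpath_def by auto
      then show ?thesis using w[of j] that E' n by (metis Suc_diff_1 less_Suc_eq_le le_trans A_bounds(3))
    qed
    show "ok n (walk p r j) (r j)" if "j < P - 1" using r(2)[OF that] w[of j] that cong_ok[OF E' n] by auto
  qed
qed

end

context smallcanc
begin

abbreviation "gst \<equiv> gstage L M f e Ln P \<epsilon>"

lemma gst_iff: "gst E act N \<longleftrightarrow> stage.good L M f e Ln P \<epsilon> E act N"
  unfolding gstage_def gstage_axioms_def stage_def
  using smallcanc_axioms by simp

end

context gstage
begin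

text \<open>Goodness up to \<open>N\<close> involves nothing beyond layer \<open>N\<close>, so it
  survives the redefinition of \<open>E\<close> and of the action above it.\<close>

lemma good_cong:
  assumes E': "\<And>k. k \<le> N \<Longrightarrow> E' k = E k"
    and act': "\<And>k p g. k \<le> N \<Longrightarrow> p \<in> V k \<Longrightarrow> g \<in> G k \<Longrightarrow> act' p g = p \<odot> g"
  shows "gstage L M f e Ln P \<epsilon> E' act' N"
proof -
  interpret S': stage L M f e Ln P \<epsilon> E' act' N by unfold_locales
  have V': "S'.V k = V k" if "k \<le> N" for k using that E' unfolding V_def S'.V_def by auto
  have aE: "act' p g = p \<odot> g" if "p \<in> E k" "k < N" "g \<in> L \<union> M" for p k g
  proof -
    have "ok N p g" by (rule ok_E[OF that])
    then obtain l where "l \<le> N" "p \<in> V l" "g \<in> G l" unfolding ok_def by auto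
    then show ?thesis using act' by auto
  qed
  have S'good: S'.good
    unfolding S'.good_def
  proof (intro conjI)
    show "\<forall>i\<le>N. \<forall>j\<le>N. i \<noteq> j \<longrightarrow> E' i \<inter> E' j = {}" using E' disj by blast
    show "\<forall>k\<le>N. \<forall>p\<in>S'.V k. \<forall>g\<in>G k. act' p g \<in> S'.V k \<and>
         (\<forall>g'\<in>G k. act' (act' p g) g' = act' p (g \<cdot> g')) \<and> (act' p g = p \<longrightarrow> g = e)"
    proof (intro allI impI ballI)
      fix k p g assume a: "k \<le> N" "p \<in> S'.V k" "g \<in> G k"
      have p: "p \<in> V k" using a V' by simp
      have q: "p \<odot> g \<in> V k" using V_cl a p by simp
      have "act' p g = p \<odot> g" using act'[OF a(1) p a(3)] .
      moreover have "act' (p \<odot> g) g' = act' p (g \<cdot> g')" if "g' \<in> G k" for g'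
        using act'[OF a(1) q that] act'[OF a(1) p mG[OF a(3) that]] act_m[OF a(1) p a(3) that] by simp
      moreover have "p \<odot> g = p \<longrightarrow> g = e" using act_free[OF a(1) p a(3)] by blast
      ultimately show "act' p g \<in> S'.V k \<and>
         (\<forall>g'\<in>G k. act' (act' p g) g' = act' p (g \<cdot> g')) \<and> (act' p g = p \<longrightarrow> g = e)"
        using q V'[OF a(1)] by simp
    qed
    show "\<forall>k\<le>N. \<forall>p\<in>S'.V k. act' p e = p"
    proof (intro allI impI ballI)
      fix k p assume a: "k \<le> N" "p \<in> S'.V k"
      then have "p \<in> V k" using V' by simp
      then show "act' p e = p" using act'[OF a(1) _ eG] act_e[OF a(1)] by simp
    qed
    show "\<forall>k\<le>N. \<forall>p\<in>E' k. \<forall>h\<in>H. act' p h \<in> E' k"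
    proof (intro allI impI ballI)
      fix k p h assume a: "k \<le> N" "p \<in> E' k" "h \<in> H"
      have p: "p \<in> E k" using a E' by simp
      show "act' p h \<in> E' k" using act'[OF a(1) V_E(1)[OF p] HG[OF a(3)]] E_H[OF a(1) p a(3)] E' a by simp
    qed
    show "\<forall>k<N. \<forall>p\<in>E' (Suc k). \<exists>g\<in>G (Suc k). act' p g \<in> E' k"
    proof (intro allI impI ballI)
      fix k p assume a: "k < N" "p \<in> E' (Suc k)"
      have p: "p \<in> E (Suc k)" using a E' by simp
      obtain g where g: "g \<in> G (Suc k)" "p \<odot> g \<in> E k" using down[OF a(1) p] by blast
      have "act' p g = p \<odot> g" using act'[OF _ V_E(1)[OF p] g(1)] a by simp
      then show "\<exists>g\<in>G (Suc k). act' p g \<in> E' k" using g E'[of k] a by auto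
    qed
    show "E' 0 \<noteq> {}" using E' root_ne by simp
    show "\<forall>p\<in>E' 0. \<forall>q\<in>E' 0. \<exists>g\<in>L. q = act' p g"
    proof (intro ballI)
      fix p q assume "p \<in> E' 0" "q \<in> E' 0"
      then have pq: "p \<in> E 0" "q \<in> E 0" using E' by auto
      then obtain g where g: "g \<in> L" "q = p \<odot> g" using root by blast
      have "g \<in> G 0" using g by (simp add: G_def)
      then show "\<exists>g\<in>L. q = act' p g" using g act'[OF _ V_E(1)[OF pq(1)]] by force
    qed
    show "\<forall>k<N. S'.peaks k"
    proof (intro allI impI)
      fix k assume k: "k < N"
      show "S'.peaks k"
        unfolding S'.peaks_def
      proof (intro ballI impI)
        fix p g assume a: "p \<in> E' k" "g \<in> G (Suc k) - H" "act' p g \<in> E' k"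
        have p: "p \<in> E k" "g \<in> L \<union> M" using a E' k GLM by auto
        have ag: "act' p g = p \<odot> g" using aE[OF p(1) k p(2)] .
        have pk: "pk k p g" unfolding pk_def using a p k ag E'[of k] by auto
        obtain r where r: "r \<in> Ln" "r 0 = g" "desc (p \<odot> g) (sh 1 r) A k" "desc p (rv P r) A k"
          "walk (p \<odot> g) (sh 1 r) (P - 1) = p" "\<forall>j<P. \<exists>i\<le>k. walk (p \<odot> g) (sh 1 r) j \<in> E i"
          using cell_sides[OF pk] by metis
        have w1: "S'.walk (p \<odot> g) (sh 1 r) j = walk (p \<odot> g) (sh 1 r) j" if jP: "j \<le> P" for j
        proof (rule cong_walk[OF act'])
          fix i assume "i < j"
          then obtain l where l: "l \<le> k" "walk (p \<odot> g) (sh 1 r) i \<in> E l" using r(6) jP by (meson less_le_trans)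
          show "ok N (walk (p \<odot> g) (sh 1 r) i) (sh 1 r i)"
            by (rule ok_E[OF l(2)]) (use l k Ln_LM[OF Ln_sh[OF r(1)]] in auto)
        qed
        have w2: "S'.walk p (rv P r) j = walk p (rv P r) j" if "j \<le> A" for j
        proof (rule cong_walk[OF act'])
          fix i assume "i < j"
          then show "ok N (walk p (rv P r) i) (rv P r i)" using ok_desc[OF r(4)] k that by auto
        qed
        have AP: "A \<le> P" using A_bounds by auto
        have E1: "E' i = E i" if "i \<le> k" for i using E' k that by auto
        show "\<exists>r\<in>Ln. r 0 = g \<and> A \<le> k \<and> (\<forall>j\<le>A. S'.walk (act' p g) (sh 1 r) j \<in> E' (k - j)) \<and>
             (\<forall>j\<le>A. S'.walk p (rv P r) j \<in> E' (k - j)) \<and> S'.walk (act' p g) (sh 1 r) (P - 1) = p \<and>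
             (\<forall>j<P. \<exists>i\<le>k. S'.walk (act' p g) (sh 1 r) j \<in> E' i)"
        proof (intro bexI[of _ r] conjI allI impI)
          show "A \<le> k" using r(3) desc_def by auto
          show "S'.walk (act' p g) (sh 1 r) (P - 1) = p" using w1 ag r by simp
          fix j
          show "S'.walk (act' p g) (sh 1 r) j \<in> E' (k - j)" if "j \<le> A"
            using w1[of j] ag r(3) that AP E1[of "k - j"] unfolding desc_def by auto
          show "S'.walk p (rv P r) j \<in> E' (k - j)" if "j \<le> A"
            using w2[of j] r(4) that E1[of "k - j"] unfolding desc_def by auto
          show "\<exists>i\<le>k. S'.walk (act' p g) (sh 1 r) j \<in> E' i" if jP: "j < P"
          proof -
            obtain i where "i \<le> k" "walk (p \<odot> g) (sh 1 r) j \<in> E i" using r(6) jP by blast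
            then show ?thesis using w1[of j] ag jP E1[of i] by auto
          qed
        qed (use r in auto)
      qed
    qed
    show "\<forall>n<N. \<forall>p r. S'.relpath n p r \<longrightarrow> S'.walk p r P = p"
    proof (intro allI impI)
      fix n p r assume n: "n < N" and rp: "S'.relpath n p r"
      have rp': "relpath n p r" and w: "S'.walk p r (P - 1) = walk p r (P - 1)"
        using cong_relpath[OF E' act' _ rp] n by auto
      have P1: "P = Suc (P - 1)" using A_bounds by auto
      have q: "walk p r (P - 1) \<in> E n" "r (P - 1) \<in> L \<union> M" using rp' Ln_LM unfolding relpath_def by auto
      have "S'.walk p r (Suc (P - 1)) = walk p r (Suc (P - 1))" using w aE[OF q(1) n q(2)] by simp
      then show "S'.walk p r P = p" using closing[OF n rp'] P1 by simp
    qed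
  qed
  then show ?thesis by unfold_locales
qed

end

section \<open>Adding a layer, and the limit complex\<close>

context smallcanc
begin

text \<open>The layer comes from \<open>torsor_ext\<close>, applied to \<open>E N\<close> and
  \<open>Pt\<close>: the paths with ends in \<open>E N\<close> close by construction, and the last
  clause of \<open>torsor_ext\<close> shows that every new peak comes from such a path. Points of
  \<open>E k\<close> are lists of length \<open>k + 1\<close>, which keeps the layers
  disjoint.\<close>

lemma extend:
  fixes E :: "nat \<Rightarrow> 'g list set"
  assumes gs: "gst E act N" and len: "\<And>k p. k \<le> N \<Longrightarrow> p \<in> E k \<Longrightarrow> length p = Suc k"
  shows "\<exists>E' act'. gst E' act' (Suc N) \<and> (\<forall>k\<le>N. E' k = E k)
    \<and> (\<forall>k\<le>N. \<forall>p\<in>stage.V E k. \<forall>g\<in>G k. act' p g = act p g) \<and> (\<forall>k\<le>Suc N. \<forall>p\<in>E' k. length p = Suc k)"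
proof -
  interpret S: gstage L M f e Ln P \<epsilon> E act N by (rule gs)
  have VN: "p \<in> E N \<Longrightarrow> p \<in> S.V N" for p using S.V_E by auto
  have "\<exists>En act1. (\<forall>p\<in>En. length p = Suc (Suc N))
    \<and> (\<forall>p\<in>E N \<union> En. \<forall>g\<in>G (Suc N). act1 p g \<in> E N \<union> En \<and> (\<forall>g'\<in>G (Suc N). act1 (act1 p g) g' = act1 p (g \<cdot> g')) \<and> (act1 p g = p \<longrightarrow> g = e))
    \<and> (\<forall>p\<in>E N \<union> En. act1 p e = p) \<and> (\<forall>p\<in>E N. \<forall>h\<in>H. act1 p h = act p h)
    \<and> (\<forall>p\<in>En. \<exists>g\<in>G (Suc N). act1 p g \<in> E N) \<and> (\<forall>p b q. S.Pt p b q \<longrightarrow> act1 p b = q)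
    \<and> (\<forall>p\<in>E N. \<forall>g\<in>G (Suc N) - H. act1 p g \<in> E N \<longrightarrow> S.Pt p g (act1 p g))"
  proof (rule torsor_ext)
    show "act (act p h) h' = act p (h \<cdot> h')" if "p \<in> E N" "h \<in> H" "h' \<in> H" for p h h'
      using S.act_m[OF order_refl VN[OF that(1)] HG[OF that(2)] HG[OF that(3)]] .
    show "h = e" if "p \<in> E N" "h \<in> H" "act p h = p" for p h
      using S.act_free[OF order_refl VN[OF that(1)] HG[OF that(2)] that(3)] .
  qed (use S.E_H S.act_e[OF order_refl VN] S.Pt_in S.Pt_sym S.Pt_eqv S.Pt_func S.Pt_irr len in auto)
  then obtain En act1 where lenE: "\<forall>p\<in>En. length p = Suc (Suc N)"
    and b1: "\<forall>p\<in>E N \<union> En. \<forall>g\<in>G (Suc N). act1 p g \<in> E N \<union> En \<and> (\<forall>g'\<in>G (Suc N). act1 (act1 p g) g' = act1 p (g \<cdot> g')) \<and> (act1 p g = p \<longrightarrow> g = e)"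
    and b2: "\<forall>p\<in>E N \<union> En. act1 p e = p" and b3: "\<forall>p\<in>E N. \<forall>h\<in>H. act1 p h = act p h"
    and a4: "\<forall>p\<in>En. \<exists>g\<in>G (Suc N). act1 p g \<in> E N" and b5: "\<forall>p b q. S.Pt p b q \<longrightarrow> act1 p b = q"
    and b6: "\<forall>p\<in>E N. \<forall>g\<in>G (Suc N) - H. act1 p g \<in> E N \<longrightarrow> S.Pt p g (act1 p g)"
    by (elim exE conjE) (rule that; assumption)
  note a2 = b2[rule_format] and a3 = b3[rule_format] and a5 = b5[rule_format] and a6 = b6[rule_format]
  have a1: "act1 p g \<in> E N \<union> En \<and> (\<forall>g'\<in>G (Suc N). act1 (act1 p g) g' = act1 p (g \<cdot> g')) \<and> (act1 p g = p \<longrightarrow> g = e)"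
    if "p \<in> E N \<union> En" "g \<in> G (Suc N)" for p g using bspec[OF bspec[OF b1 that(1)] that(2)] .
  define E' where "E' = E(Suc N := En)"
  \<comment> \<open>On \<open>E N\<close> the elements of \<open>H\<close> act both through
    \<open>G N\<close> and through \<open>G (Suc N)\<close>; the old action is retained for
    them.\<close>
  define act' where "act' p g = (if p \<in> E N \<union> En \<and> g \<in> G (Suc N) \<and> \<not> (p \<in> E N \<and> g \<in> H) then act1 p g else act p g)" for p g
  have E'k: "E' k = E k" if "k \<le> N" for k using that E'_def by auto
  have E'S: "E' (Suc N) = En" using E'_def by auto
  have lenV: "length p \<le> Suc k" "length p \<ge> k" if "k \<le> N" "p \<in> S.V k" for k p
    using that(2)
    by (cases rule: S.V_cases; use len[of k p] len[of "k - 1" p] that(1) in auto)+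
  have act'k: "act' p g = act p g" if "k \<le> N" "p \<in> S.V k" "g \<in> G k" for k p g
  proof -
    have nE: "p \<notin> En" using lenE lenV(1)[OF that(1,2)] that(1) by auto
    have "g \<in> H" if "p \<in> E N" "g \<in> G (Suc N)"
    proof -
      have "length p = Suc N" using len that by auto
      then have "k = N" using lenV[OF \<open>k \<le> N\<close> \<open>p \<in> S.V k\<close>] \<open>k \<le> N\<close> by auto
      then show ?thesis using G_both[of g N] \<open>g \<in> G k\<close> that by auto
    qed
    then show ?thesis using nE unfolding act'_def by auto
  qed
  have gN: "gst E' act' N" by (rule S.good_cong[OF E'k act'k])
  interpret S1: gstage L M f e Ln P \<epsilon> E' act' N by (rule gN)
  interpret S2: stage L M f e Ln P \<epsilon> E' act' "Suc N" by unfold_locales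
  have act'1: "act' p g = act1 p g" if "p \<in> E N \<union> En" "g \<in> G (Suc N)" for p g
    using that a3 unfolding act'_def by auto
  have V2: "S2.V (Suc N) = E N \<union> En" unfolding S2.V_def using E'k E'S by auto
  have V2k: "S2.V k = S1.V k" for k unfolding S1.V_def S2.V_def by simp
  have dN: "E i \<inter> En = {}" if "i \<le> N" for i using that len lenE by fastforce
  have w_eq: "S1.walk p r j = S.walk p r j" if "\<And>i. i < j \<Longrightarrow> S.ok N (S.walk p r i) (r i)" for p r j
    by (rule S.cong_walk[OF act'k]) (use that in auto)
  have inv1: "act1 (act1 p h) (iv h) = p" if "p \<in> E N \<union> En" "h \<in> G (Suc N)" for p h
    using a1[OF that] a2[OF that(1)] ivG[OF that(2)] ivrG[OF that(2)] by metis
  have "S2.good"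
    unfolding S2.good_def
  proof (intro conjI)
    show "\<forall>i\<le>Suc N. \<forall>j\<le>Suc N. i \<noteq> j \<longrightarrow> E' i \<inter> E' j = {}"
    proof (intro allI impI)
      fix i j assume a: "i \<le> Suc N" "j \<le> Suc N" "i \<noteq> j"
      consider "i \<le> N" "j \<le> N" | "i = Suc N" "j \<le> N" | "i \<le> N" "j = Suc N" using a by linarith
      then show "E' i \<inter> E' j = {}"
      proof cases
        case 1 then show ?thesis using S1.disj a by blast
      next
        case 2 then show ?thesis using dN[of j] E'k E'S by auto
      next
        case 3 then show ?thesis using dN[of i] E'k E'S by auto
      qed
    qed
    show "\<forall>k\<le>Suc N. \<forall>p\<in>S2.V k. \<forall>g\<in>G k. act' p g \<in> S2.V k \<and>
         (\<forall>g'\<in>G k. act' (act' p g) g' = act' p (g \<cdot> g')) \<and> (act' p g = p \<longrightarrow> g = e)"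
    proof (intro allI impI ballI)
      fix k p g assume a: "k \<le> Suc N" "p \<in> S2.V k" "g \<in> G k"
      show "act' p g \<in> S2.V k \<and>
         (\<forall>g'\<in>G k. act' (act' p g) g' = act' p (g \<cdot> g')) \<and> (act' p g = p \<longrightarrow> g = e)"
      proof (cases "k = Suc N")
        case True
        then have p: "p \<in> E N \<union> En" "g \<in> G (Suc N)" using a V2 by auto
        have q: "act1 p g \<in> E N \<union> En" using a1[OF p] by blast
        have "act' (act1 p g) g' = act' p (g \<cdot> g')" if "g' \<in> G (Suc N)" for g'
          using act'1[OF q that] act'1[OF p(1) mG[OF p(2) that]] a1[OF p] that by simp
        then show ?thesis using act'1[OF p] q a1[OF p] V2 True by simp
      next
        case False
        then have k: "k \<le> N" using a by simp
        then show ?thesis using a S1.V_cl[OF k] S1.act_m[OF k] S1.act_free[OF k] V2k by blast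
      qed
    qed
    show "\<forall>k\<le>Suc N. \<forall>p\<in>S2.V k. act' p e = p"
    proof (intro allI impI ballI)
      fix k p assume a: "k \<le> Suc N" "p \<in> S2.V k"
      show "act' p e = p"
      proof (cases "k = Suc N")
        case True then show ?thesis using a V2 act'1[of p e] a2[of p] by simp
      next
        case False then show ?thesis using a S1.act_e[of k p] V2k by simp
      qed
    qed
    show "\<forall>k\<le>Suc N. \<forall>p\<in>E' k. \<forall>h\<in>H. act' p h \<in> E' k"
    proof (intro allI impI ballI)
      fix k p h assume a: "k \<le> Suc N" "p \<in> E' k" "h \<in> H"
      show "act' p h \<in> E' k"
      proof (cases "k = Suc N")
        case True
        then have p: "p \<in> E N \<union> En" "p \<in> En" "h \<in> G (Suc N)" "iv h \<in> H" using a E'S HG by auto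
        have "act1 p h \<notin> E N"
        proof
          assume "act1 p h \<in> E N"
          then have "act1 (act1 p h) (iv h) \<in> E N" using a3[OF _ p(4)] S.E_H[OF order_refl _ p(4)] by simp
          then show False using inv1[OF p(1,3)] dN[of N] p(2) by auto
        qed
        then show ?thesis using a1[OF p(1,3)] act'1[OF p(1,3)] True E'S by auto
      next
        case False then show ?thesis using a S1.E_H[of k p h] by simp
      qed
    qed
    show "\<forall>k<Suc N. \<forall>p\<in>E' (Suc k). \<exists>g\<in>G (Suc k). act' p g \<in> E' k"
    proof (intro allI impI ballI)
      fix k p assume a: "k < Suc N" "p \<in> E' (Suc k)"
      show "\<exists>g\<in>G (Suc k). act' p g \<in> E' k"
      proof (cases "k = N")
        case True then show ?thesis using a a4 E'S E'k act'1 by force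
      next
        case False then show ?thesis using a S1.down[of k p] by simp
      qed
    qed
    show "E' 0 \<noteq> {}" by (rule S1.root_ne)
    show "\<forall>p\<in>E' 0. \<forall>q\<in>E' 0. \<exists>g\<in>L. q = act' p g" using S1.root by blast
    show "\<forall>k<Suc N. S2.peaks k"
    proof (intro allI impI)
      fix k assume "k < Suc N"
      show "S2.peaks k"
      proof (cases "k = N")
        case False then show ?thesis using S1.peaksD[of k] \<open>k < Suc N\<close> unfolding S1.peaks_def S2.peaks_def by simp
      next
        case True
        show ?thesis
          unfolding S2.peaks_def True
        proof (intro ballI impI)
          fix p g assume a: "p \<in> E' N" "g \<in> G (Suc N) - H" "act' p g \<in> E' N"
          define q where "q = act' p g"
          have p: "p \<in> E N" "q \<in> E N" "q = act1 p g" using a E'k act'1 unfolding q_def by auto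
          have "S.Pt p g q" using a6[OF p(1) a(2)] p by simp
          then obtain r where r: "S.relpath N p r" "S.walk p r (P - 1) = q" "g = iv (r (P - 1))"
            unfolding S.Pt_def by auto
          \<comment> \<open>The boundary of the new cell must start with \<open>g\<close>, the
            inverse of the missing syllable, and is therefore the reverse of the line of the
            path.\<close>
          define s where "s = rv P r"
          have rL: "r \<in> Ln" "s \<in> Ln" using r Ln_rv s_def unfolding S.relpath_def by auto
          have ss: "sh 1 s = S.bk (P - 1) r" unfolding s_def S.bk_def using A_bounds by auto
          have rs: "S.relpath N q (S.bk (P - 1) r)"
            using S.relpath_rev(1)[OF r(1) order_refl] r(2) by simp
          have ds: "S.desc q (sh 1 s) A N" using S.relpath_desc[OF rs order_refl] ss by simp
          have dr: "S.desc p r A N" using S.relpath_desc[OF r(1) order_refl] .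
          have okr: "S.ok N (S.walk p r j) (r j)" if "j < P - 1" for j
            using r(1) that unfolding S.relpath_def by auto
          have oks: "S.ok N (S.walk q (sh 1 s) j) (sh 1 s j)" if "j < P - 1" for j
            using rs that ss unfolding S.relpath_def by auto
          have w1: "S1.walk p r j = S.walk p r j" if "j \<le> P - 1" for j
            by (rule w_eq) (use that okr in auto)
          have w2: "S1.walk q (sh 1 s) j = S.walk q (sh 1 s) j" if "j \<le> P - 1" for j
            by (rule w_eq) (use that oks in auto)
          have AP: "A \<le> P - 1" using A_bounds by auto
          have E1: "E' (N - j) = E (N - j)" for j using E'k by simp
          show "\<exists>r\<in>Ln. r 0 = g \<and> A \<le> N \<and> (\<forall>j\<le>A. S2.walk (act' p g) (sh 1 r) j \<in> E' (N - j)) \<and>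
             (\<forall>j\<le>A. S2.walk p (rv P r) j \<in> E' (N - j)) \<and> S2.walk (act' p g) (sh 1 r) (P - 1) = p \<and>
             (\<forall>j<P. \<exists>i\<le>N. S2.walk (act' p g) (sh 1 r) j \<in> E' i)"
            unfolding q_def[symmetric]
          proof (intro bexI[of _ s] conjI allI impI)
            show "s 0 = g" unfolding s_def rv_def r(3) by simp
            show "A \<le> N" using dr S.desc_def by auto
            show "S1.walk q (sh 1 s) (P - 1) = p"
              using w2[OF order_refl] S.relpath_rev(2)[OF r(1) order_refl order_refl] r(2) ss by simp
            fix j
            show "S1.walk q (sh 1 s) j \<in> E' (N - j)" if "j \<le> A"
              using w2[of j] ds that AP E1[of j] unfolding S.desc_def by auto
            show "S1.walk p (rv P s) j \<in> E' (N - j)" if "j \<le> A"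
              using w1[of j] dr that AP E1[of j] rv_rv[OF rL(1)] unfolding S.desc_def s_def by auto
            show "\<exists>i\<le>N. S1.walk q (sh 1 s) j \<in> E' i" if jP: "j < P"
            proof -
              obtain i where "i \<le> N" "S.walk q (sh 1 s) j \<in> E i" using rs jP ss unfolding S.relpath_def by auto
              then show ?thesis using w2[of j] jP E'k[of i] by auto
            qed
          qed (use rL in auto)
        qed
      qed
    qed
    show "\<forall>n<Suc N. \<forall>p r. S2.relpath n p r \<longrightarrow> S2.walk p r P = p"
    proof (intro allI impI)
      fix n p r assume n: "n < Suc N" and rp: "S2.relpath n p r"
      have rp1: "S1.relpath n p r" using rp by simp
      show "S2.walk p r P = p"
      proof (cases "n = N")
        case False
        then have "n < N" using n by simp
        then show ?thesis using S1.closing[OF _ rp1] by simp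
      next
        case True
        have nN: "n \<le> N" using n by simp
        have rpS: "S.relpath N p r" using S.cong_relpath(1)[OF E'k act'k nN rp1] True by simp
        have w: "S1.walk p r (P - 1) = S.walk p r (P - 1)"
          using S.cong_relpath(2)[OF E'k act'k nN rp1 order_refl] by simp
        define q where "q = S.walk p r (P - 1)"
        have "S.Pt p (iv (r (P - 1))) q" unfolding S.Pt_def q_def using rpS by blast
        from S.Pt_sym[OF this] have pt: "S.Pt q (r (P - 1)) p" using Ln_LM rpS unfolding S.relpath_def by simp
        have q: "q \<in> E N \<union> En" "r (P - 1) \<in> G (Suc N)" using S.Pt_in[OF pt] by auto
        have "act' q (r (P - 1)) = p" using act'1[OF q] a5[OF pt] by simp
        then have "S1.walk p r (Suc (P - 1)) = p" using w q_def by simp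
        then show ?thesis using A_bounds by simp
      qed
    qed
  qed
  then have "gst E' act' (Suc N)" using gst_iff by blast
  moreover have "\<forall>k\<le>Suc N. \<forall>p\<in>E' k. length p = Suc k"
    using len lenE E'k E'S by (auto simp: le_Suc_eq)
  ultimately show ?thesis using E'k act'k by blast
qed

lemma base_stage:
  defines "E0 \<equiv> (\<lambda>k. if k = (0::nat) then {[l] | l. l \<in> L} else {})"
  defines "a0 \<equiv> (\<lambda>p g. [hd p \<cdot> g])"
  shows "gst E0 a0 0"
proof -
  interpret S: stage L M f e Ln P \<epsilon> E0 a0 0 by unfold_locales
  have G0: "G 0 = L" by (simp add: G_def)
  have V0: "S.V 0 = {[l] | l. l \<in> L}" unfolding S.V_def unfolding E0_def by simp
  have "S.good"
    unfolding S.good_def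
  proof (intro conjI)
    show "\<forall>k\<le>0. \<forall>p\<in>S.V k. \<forall>g\<in>G k. a0 p g \<in> S.V k \<and>
         (\<forall>g'\<in>G k. a0 (a0 p g) g' = a0 p (g \<cdot> g')) \<and> (a0 p g = p \<longrightarrow> g = e)"
    proof (intro allI impI ballI)
      fix k :: nat and p g assume a': "k \<le> 0" "p \<in> S.V k" "g \<in> G k"
      then have a: "k = 0" "p \<in> S.V k" "g \<in> G k" by auto
      then obtain l where l: "p = [l]" "l \<in> G 0" "g \<in> G 0" using V0 G0 by auto
      have "g = e" if "l \<cdot> g = l"
        using cancel_l[of l 0 g e] that l by simp
      then show "a0 p g \<in> S.V k \<and> (\<forall>g'\<in>G k. a0 (a0 p g) g' = a0 p (g \<cdot> g')) \<and> (a0 p g = p \<longrightarrow> g = e)"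
        using l a V0 G0 mG[OF l(2,3)] unfolding a0_def by (auto simp: aG[where k=0])
    qed
    show "\<forall>k\<le>0. \<forall>p\<in>S.V k. a0 p e = p" using V0 G0 erG[where k=0] unfolding a0_def by auto
    show "\<forall>k\<le>0. \<forall>p\<in>E0 k. \<forall>h\<in>H. a0 p h \<in> E0 k"
      using G0 mG[where k=0] HG[where k=0] unfolding a0_def E0_def by auto
    show "E0 0 \<noteq> {}" using grpL unfolding E0_def grp_def by auto
    show "\<forall>p\<in>E0 0. \<forall>q\<in>E0 0. \<exists>g\<in>L. q = a0 p g"
    proof (intro ballI)
      fix p q assume "p \<in> E0 0" "q \<in> E0 0"
      then obtain l l' where l: "p = [l]" "q = [l']" "l \<in> G 0" "l' \<in> G 0" using G0 unfolding E0_def by auto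
      have "l \<cdot> (iv l \<cdot> l') = l'" using l by simp
      then show "\<exists>g\<in>L. q = a0 p g" using l mG[OF ivG[OF l(3)] l(4)] G0 unfolding a0_def by (intro bexI[of _ "iv l \<cdot> l'"]) auto
    qed
  qed auto
  then show ?thesis using gst_iff by blast
qed

text \<open>Later stages do not change earlier layers, so each layer and its action can be taken
  from the stage that introduced them.\<close>

lemma limit_stage: "\<exists>(E :: nat \<Rightarrow> 'g list set) act. \<forall>N. gst E act N"
proof -
  define Q where "Q N S \<longleftrightarrow> gst (fst S) (snd S) N \<and> (\<forall>k\<le>N. \<forall>p\<in>fst S k. length p = Suc k)"
    for N and S :: "(nat \<Rightarrow> 'g list set) \<times> ('g list \<Rightarrow> 'g \<Rightarrow> 'g list)"
  define R where "R N S S' \<longleftrightarrow> (\<forall>k\<le>N. fst S' k = fst S k) \<and>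
     (\<forall>k\<le>N. \<forall>p\<in>stage.V (fst S) k. \<forall>g\<in>G k. snd S' p g = snd S p g)"
    for N and S S' :: "(nat \<Rightarrow> 'g list set) \<times> ('g list \<Rightarrow> 'g \<Rightarrow> 'g list)"
  have "\<exists>F. \<forall>N. Q N (F N) \<and> R N (F N) (F (Suc N))"
  proof (rule dependent_nat_choice)
    show "\<exists>S. Q 0 S"
      unfolding Q_def using base_stage
      by (intro exI[of _ "(\<lambda>k. if k = 0 then {[l] | l. l \<in> L} else {}, \<lambda>p g. [hd p \<cdot> g])"]) auto
    fix S N assume "Q N S"
    then obtain E' act' where "gst E' act' (Suc N)" "\<forall>k\<le>N. E' k = fst S k"
      "\<forall>k\<le>N. \<forall>p\<in>stage.V (fst S) k. \<forall>g\<in>G k. act' p g = snd S p g" "\<forall>k\<le>Suc N. \<forall>p\<in>E' k. length p = Suc k"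
      using extend[of "fst S" "snd S" N] unfolding Q_def by auto
    then show "\<exists>S'. Q (Suc N) S' \<and> R N S S'"
      unfolding Q_def R_def by (intro exI[of _ "(E', act')"]) auto
  qed
  then obtain F where F: "\<And>N. Q N (F N)" "\<And>N. R N (F N) (F (Suc N))" by blast
  define E where "E k = fst (F k) k" for k
  have E: "fst (F N) k = E k" if "k \<le> N" for N k
    using that
  proof (induction N)
    case 0 then show ?case unfolding E_def by simp
  next
    case (Suc N)
    show ?case
    proof (cases "k = Suc N")
      case True then show ?thesis unfolding E_def by simp
    next
      case False
      then show ?thesis using Suc F(2)[of N] unfolding R_def by auto
    qed
  qed
  define VV where "VV k = (if k = 0 then E 0 else E (k - 1) \<union> E k)" for k
  have sV: "stage.V (fst (F N)) k = VV k" if "k \<le> N" for k N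
  proof -
    have "smallcanc L M f e Ln P \<epsilon>" by (rule smallcanc_axioms)
    then have "stage L M f e Ln P \<epsilon>" unfolding stage_def .
    then show ?thesis using E that unfolding stage.V_def[OF \<open>stage L M f e Ln P \<epsilon>\<close>] VV_def by auto
  qed
  have ag: "snd (F N) p g = snd (F k) p g" if "k \<le> N" "p \<in> VV k" "g \<in> G k" for k N p g
    using that(1)
  proof (induction N rule: dec_induct)
    case (step n)
    then show ?case using F(2)[of n] sV[of k n] that unfolding R_def by auto
  qed simp
  \<comment> \<open>An element of \<open>H\<close> acts on an edge through the groups of both its
    vertices. The least layer may be chosen, since the stages beyond it agree there.\<close>
  define act where "act p g = snd (F (LEAST k. p \<in> VV k \<and> g \<in> G k)) p g" for p g
  have act: "act p g = snd (F N) p g" if "k \<le> N" "p \<in> VV k" "g \<in> G k" for k N p g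
  proof -
    define l where "l = (LEAST k. p \<in> VV k \<and> g \<in> G k)"
    have l: "p \<in> VV l \<and> g \<in> G l" "l \<le> k"
      unfolding l_def using that LeastI[of "\<lambda>k. p \<in> VV k \<and> g \<in> G k" k] Least_le[of "\<lambda>k. p \<in> VV k \<and> g \<in> G k" k] by auto
    then show ?thesis using ag[of l N p g] that unfolding act_def l_def by auto
  qed
  have "gst E act N" for N
  proof -
    interpret S: gstage L M f e Ln P \<epsilon> "fst (F N)" "snd (F N)" N using F(1) unfolding Q_def by auto
    show ?thesis
      by (rule S.good_cong) (use E act sV in auto)
  qed
  then show ?thesis by blast
qed

end

section \<open>In the limit complex every relator closes everywhere\<close>

locale complete = smallcanc L M f e Ln P \<epsilon>
  for L M :: "'g set" and f (infixl "\<cdot>" 70) and e and Ln and P \<epsilon> :: nat +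
  fixes E :: "nat \<Rightarrow> 'p set" and act :: "'p \<Rightarrow> 'g \<Rightarrow> 'p" (infixl "\<odot>" 65)
  assumes all_stages: "\<And>N. gstage L M f e Ln P \<epsilon> E act N"
begin

sublocale gstage L M f e Ln P \<epsilon> E act 0 by (rule all_stages)

lemmas at = all_stages

lemma disjE: "p \<in> E i \<Longrightarrow> p \<in> E j \<Longrightarrow> i = j"
  using gstage.disj[OF at[of "max i j"], of i j p] by simp
lemma actV: "p \<in> V k \<Longrightarrow> g \<in> G k \<Longrightarrow> p \<odot> g \<in> V k"
  by (rule gstage.V_cl[OF at[of k] order_refl])
lemma actm: "p \<in> V k \<Longrightarrow> g \<in> G k \<Longrightarrow> g' \<in> G k \<Longrightarrow> p \<odot> g \<odot> g' = p \<odot> (g \<cdot> g')"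
  by (rule gstage.act_m[OF at[of k] order_refl])
lemma acte: "p \<in> V k \<Longrightarrow> p \<odot> e = p"
  by (rule gstage.act_e[OF at[of k] order_refl])
lemma actinv: "p \<in> V k \<Longrightarrow> g \<in> G k \<Longrightarrow> p \<odot> g \<odot> iv g = p" "p \<in> V k \<Longrightarrow> g \<in> G k \<Longrightarrow> p \<odot> iv g \<odot> g = p"
  by (rule gstage.act_inv[OF at[of k] order_refl]; assumption)+

definition \<Omega> :: "'p set" where "\<Omega> = (\<Union>k. E k)"

lemma \<Omega>V: "p \<in> V k \<Longrightarrow> p \<in> \<Omega>" unfolding V_def \<Omega>_def by (auto split: if_splits)

lemma \<Omega>_G: assumes "p \<in> \<Omega>" obtains l where "p \<in> V l" "G l = G k"
proof -
  obtain i where i: "p \<in> E i" using assms \<Omega>_def by auto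
  have "G i = G k \<or> G (Suc i) = G k" by (auto simp: G_def)
  then show ?thesis using that V_E[OF i] by auto
qed

lemma \<Omega>_act: "p \<in> \<Omega> \<Longrightarrow> g \<in> L \<union> M \<Longrightarrow> p \<odot> g \<in> \<Omega>"
proof -
  assume a: "p \<in> \<Omega>" "g \<in> L \<union> M"
  obtain k where k: "g \<in> G k" using a LM_G by blast
  obtain l where "p \<in> V l" "G l = G k" using \<Omega>_G a by blast
  then show ?thesis using \<Omega>V[OF actV] k by blast
qed

lemma okT: "p \<in> \<Omega> \<Longrightarrow> g \<in> L \<union> M \<Longrightarrow> \<exists>N. \<forall>N'\<ge>N. ok N' p g"
proof -
  assume a: "p \<in> \<Omega>" "g \<in> L \<union> M"
  obtain k where k: "g \<in> G k" using a LM_G by blast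
  obtain l where "p \<in> V l" "G l = G k" using \<Omega>_G a by blast
  then show ?thesis using k unfolding ok_def by (intro exI[of _ l]) auto
qed

lemma walk_\<Omega>: "p \<in> \<Omega> \<Longrightarrow> r \<in> Ln \<Longrightarrow> walk p r j \<in> \<Omega>"
  by (induction j) (use \<Omega>_act Ln_LM in \<open>simp, metis walk.simps(2)\<close>)

lemma okT_walk:
  assumes "p \<in> \<Omega>" "r \<in> Ln" shows "\<exists>N\<ge>N0. \<forall>j<n. ok N (walk p r j) (r j)"
proof -
  have "\<exists>N. \<forall>N'\<ge>N. \<forall>j<n. ok N' (walk p r j) (r j)"
  proof (induction n)
    case (Suc n)
    obtain N1 where "\<forall>N'\<ge>N1. ok N' (walk p r n) (r n)" using okT walk_\<Omega>[OF assms] Ln_LM assms by metis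
    moreover obtain N2 where "\<forall>N'\<ge>N2. \<forall>j<n. ok N' (walk p r j) (r j)" using Suc by blast
    ultimately show ?case by (intro exI[of _ "max N1 N2"]) (auto simp: less_Suc_eq)
  qed simp
  then show ?thesis by (metis max.cobounded1 max.cobounded2)
qed

definition closed :: "'p \<Rightarrow> (nat \<Rightarrow> 'g) \<Rightarrow> bool" where "closed p r \<longleftrightarrow> walk p r P = p"

text \<open>Steps are invertible, so the equality of the walk at \<open>k\<close> and
  \<open>k + P\<close> can be moved back one syllable at a time.\<close>

lemma closed_shift:
  assumes "p \<in> \<Omega>" "r \<in> Ln" "closed (walk p r k) (sh k r)" shows "closed p r"
proof -
  have "walk p r (k + P) = walk p r k" using assms(3) unfolding closed_def walk_add .
  then have "walk p r P = walk p r 0"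
  proof (induction k)
    case (Suc k)
    obtain m where m: "r k \<in> G m" using Ln_LM[OF assms(2), of k] unfolding G_def by (metis UnE even_Suc)
    obtain l where l: "walk p r k \<in> V l" "G l = G m" using \<Omega>_G walk_\<Omega>[OF assms(1,2)] by blast
    obtain l' where l': "walk p r (k + P) \<in> V l'" "G l' = G m" using \<Omega>_G walk_\<Omega>[OF assms(1,2)] by blast
    have "walk p r (k + P) \<odot> r k = walk p r k \<odot> r k"
      using Suc.prems Ln_per[OF assms(2), of k] by simp
    then have "walk p r (k + P) = walk p r k"
      using actinv(1)[OF l(1), of "r k"] actinv(1)[OF l'(1), of "r k"] m l l' by (metis (no_types))
    then show ?case using Suc.IH by simp
  qed simp
  then show ?thesis unfolding closed_def by simp
qed

lemma closed_rv:
  assumes "p \<in> \<Omega>" "r \<in> Ln" "closed p (rv P r)" shows "closed p r"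
proof -
  obtain N where N: "\<forall>j<P. ok N (walk p (rv P r) j) (rv P r j)"
    using okT_walk[OF assms(1) Ln_rv[OF assms(2)], of 0 P] by blast
  interpret S: gstage L M f e Ln P \<epsilon> E act N by (rule at)
  have "walk (walk p (rv P r) P) (S.bk P (rv P r)) P = walk p (rv P r) (P - P)"
    by (rule S.bk_walk[OF Ln_rv[OF assms(2)]]) (use N in auto)
  moreover have "S.bk P (rv P r) = r" unfolding S.bk_def using rv_rv[OF assms(2)] by (simp add: sh_def)
  ultimately show ?thesis using assms(3) unfolding closed_def by simp
qed

lemma rv_sh: "s \<in> Ln \<Longrightarrow> k \<le> P \<Longrightarrow> rv P (sh k s) = sh (P - k) (rv P s)"
  by (rule rev_sh) (use A_bounds Ln_per in auto)

definition pkc :: "nat \<Rightarrow> 'p \<Rightarrow> 'g \<Rightarrow> bool" where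
  "pkc k p g \<longleftrightarrow> p \<in> E k \<and> g \<in> G (Suc k) - H \<and> p \<odot> g \<in> E k"

lemma pkc_pk: "pkc k p g \<Longrightarrow> k < N \<Longrightarrow> gstage.pk L M E act N k p g"
proof -
  assume a: "pkc k p g" "k < N"
  interpret S: gstage L M f e Ln P \<epsilon> E act N by (rule at)
  show ?thesis using a unfolding S.pk_def pkc_def by auto
qed

lemma E_\<Omega>: "p \<in> E k \<Longrightarrow> p \<in> \<Omega>" unfolding \<Omega>_def by auto

lemma peak_closed:
  assumes "pkc k p (r 0)" "r \<in> Ln" "desc (p \<odot> r 0) (sh 1 r) \<epsilon> k"
  shows "closed p r"
proof -
  interpret S: gstage L M f e Ln P \<epsilon> E act "Suc k" by (rule at)
  show ?thesis using S.cell_merge[OF pkc_pk[OF assms(1)] assms(2,3)] unfolding closed_def by simp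
qed

lemma two_peaksC:
  assumes 1: "pkc k1 p1 g1" "desc (p1 \<odot> g1) r1 b1 k1"
    and v: "walk (p1 \<odot> g1) r1 b1 = v" "g \<in> G k - H" "k = k1 - b1" "v \<odot> g \<in> E k"
    and 3: "pkc k3 p3 g3" "desc p3 r3 b3 k3" "walk p3 r3 b3 = v \<odot> g" "k = k3 - b3"
    and b: "b1 + 3 * \<epsilon> + 1 \<le> A" "b3 + 3 * \<epsilon> + 1 \<le> A"
  shows False
proof -
  interpret S: gstage L M f e Ln P \<epsilon> E act "Suc (max k1 k3)" by (rule at)
  show ?thesis
    by (rule S.two_peaks[OF pkc_pk[OF 1(1)] 1(2) v pkc_pk[OF 3(1)] 3(2,3,4) b]) auto
qed

lemma desc_or_valleyC:
  assumes "q \<in> E k" "r \<in> Ln" "r 0 \<in> G k"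
  shows "desc q r T k \<or> (\<exists>b<T. desc q r b k \<and> walk q r (Suc b) \<in> E (k - b) \<and> r b \<in> G (k - b))"
  using gstage.desc_or_valley[OF at[of k] assms(1) order_refl assms(2,3)] .

lemma asc_or_peakC:
  assumes "q \<in> E k" "r \<in> Ln" "r 0 \<in> G (Suc k)"
  shows "asc q r T k \<or> (\<exists>b<T. asc q r b k \<and> pkc (k + b) (walk q r b) (r b))"
proof -
  obtain N where N: "N \<ge> k" "\<forall>j<T. ok N (walk q r j) (r j)" using okT_walk[OF E_\<Omega>[OF assms(1)] assms(2)] by blast
  interpret S: gstage L M f e Ln P \<epsilon> E act N by (rule at)
  show ?thesis using S.asc_or_peak[OF assms(1) N(1) assms(2,3) order_refl N(2)] unfolding S.pk_def pkc_def by auto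
qed

lemma bk_walkC:
  assumes "p \<in> \<Omega>" "r \<in> Ln" "i \<le> P" "j \<le> i"
  shows "walk (walk p r i) (bk i r) j = walk p r (i - j)"
proof -
  obtain N where N: "\<forall>j<i. ok N (walk p r j) (r j)" using okT_walk[OF assms(1,2), of 0 i] by blast
  show ?thesis by (rule gstage.bk_walk[OF at[of N] assms(2,3) N assms(4)])
qed

lemma asc_bkC:
  assumes "p \<in> \<Omega>" "r \<in> Ln" "b \<le> P" "asc p r b k"
  shows "desc (walk p r b) (bk b r) b (k + b)"
proof -
  obtain N where N: "N \<ge> k + b" "\<forall>j<b. ok N (walk p r j) (r j)" using okT_walk[OF assms(1,2)] by blast
  show ?thesis using gstage.asc_bk[OF at[of N] assms(2), of 0 b p k] assms(3,4) N by (simp add: sh_simps)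
qed

lemma bk_sh1: "Suc i \<le> P \<Longrightarrow> sh 1 (bk (Suc i) r) = bk i r"
  unfolding bk_def shift_shift by (simp add: Suc_diff_Suc)

lemma bk_rv_sh: "s \<in> Ln \<Longrightarrow> k \<le> P \<Longrightarrow> rv P (sh k s) = bk k s" unfolding bk_def by (rule rv_sh)

lemma long_after_peak:
  assumes "q \<in> \<Omega>" "s \<in> Ln" "pkc k (walk q s i) (s i)" "desc (walk q s (Suc i)) (sh (Suc i) s) \<epsilon> k"
  shows "closed q s"
proof -
  have "closed (walk q s i) (sh i s)"
    by (rule peak_closed) (use assms Ln_sh sh_simps in \<open>auto simp: shift_shift\<close>)
  then show ?thesis by (rule closed_shift[OF assms(1,2)])
qed

lemma long_before_peak:
  assumes q: "q \<in> \<Omega>" "s \<in> Ln" and i: "Suc i \<le> P" and pk: "pkc k (walk q s i) (s i)"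
    and d: "desc (walk q s i) (bk i s) \<epsilon> k"
  shows "closed q s"
proof -
  have b0: "bk (Suc i) s 0 = iv (s i)" using bk_eq[OF i, of 0 s] by simp
  have V: "walk q s i \<in> V (Suc k)" "s i \<in> G (Suc k)" using pk V_E unfolding pkc_def by auto
  have w: "walk q s (Suc i) \<odot> iv (s i) = walk q s i" using actinv(1)[OF V] by simp
  have 1: "pkc k (walk q s (Suc i)) (bk (Suc i) s 0)"
    using pk w b0 notH_iv[of "s i" "Suc k"] unfolding pkc_def by auto
  have "closed (walk q s (Suc i)) (bk (Suc i) s)"
    by (rule peak_closed[OF 1 bk_Ln[OF q(2)]]) (use d w b0 bk_sh1[OF i] in auto)
  then have "closed (walk q s (Suc i)) (rv P (sh (Suc i) s))" using bk_rv_sh[OF q(2) i] by simp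
  then have "closed (walk q s (Suc i)) (sh (Suc i) s)"
    by (rule closed_rv[OF walk_\<Omega>[OF q] Ln_sh[OF q(2)]])
  then show ?thesis by (rule closed_shift[OF q])
qed

text \<open>A climb of \<open>b1\<close> steps, a peak, a descent of \<open>b2\<close> steps, a
  second valley and then an ascent as long as a whole relator. By \<open>b2 \<le> b1\<close> the
  second valley is not below the start.\<close>

definition bump :: "'p \<Rightarrow> (nat \<Rightarrow> 'g) \<Rightarrow> nat \<Rightarrow> nat \<Rightarrow> nat \<Rightarrow> bool" where
  "bump v s l b1 b2 \<longleftrightarrow> b1 < \<epsilon> \<and> b2 < \<epsilon> \<and> b2 \<le> b1 \<and> asc v s b1 l \<and> pkc (l + b1) (walk v s b1) (s b1)
    \<and> desc (walk v s (Suc b1)) (sh (Suc b1) s) b2 (l + b1) \<and> s (Suc b1 + b2) \<in> G (l + b1 - b2)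
    \<and> walk v s (b1 + b2 + 2) \<in> E (l + b1 - b2) \<and> asc (walk v s (b1 + b2 + 2)) (sh (b1 + b2 + 2) s) P (l + b1 - b2)"

text \<open>A path that dips below layer \<open>l\<close> closes by the hypothesis on lower layers.
  A peak with a side of length \<open>\<epsilon>\<close> forces the path around its cell, so it
  closes too. Any other peak is short on both sides, and \<open>two_peaksC\<close> admits only
  one.\<close>

lemma upward:
  assumes v: "v \<in> E l" "s \<in> Ln" "s 0 \<in> G (Suc l)"
    and IH: "\<And>l' q s. l' < l \<Longrightarrow> q \<in> E l' \<Longrightarrow> s \<in> Ln \<Longrightarrow> closed q s"
  shows "asc v s P l \<or> closed v s \<or> (\<exists>b1 b2. bump v s l b1 b2)"
proof (rule ccontr)
  assume "\<not> ?thesis"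
  then have na: "\<not> asc v s P l" "\<not> closed v s" "\<And>b1 b2. \<not> bump v s l b1 b2" by auto
  have v\<Omega>: "v \<in> \<Omega>" using v E_\<Omega> by simp
  note bnd = A_bounds eps
  obtain b1 where b1: "b1 < P" "asc v s b1 l" "pkc (l + b1) (walk v s b1) (s b1)"
    using asc_or_peakC[OF v, of P] na by blast
  have "desc (walk v s b1) (bk b1 s) b1 (l + b1)" by (rule asc_bkC[OF v\<Omega> v(2)]) (use b1 in auto)
  then have b1e: "b1 < \<epsilon>"
    using long_before_peak[OF v\<Omega> v(2) _ b1(3) desc_mono] b1(1) na(2) by (meson Suc_leI not_le)
  define K where "K = l + b1"
  have q: "walk v s (Suc b1) \<in> E K" "s b1 \<in> G (Suc K)" using b1(3) unfolding pkc_def K_def by auto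
  have "sh (Suc b1) s 0 \<in> G K"
    using Ln_G[OF v(2) q(2), of "Suc b1"] G_parity[of "Suc K + b1 + Suc b1" K] unfolding sh_simps by auto
  then obtain b2 where b2: "b2 < \<epsilon>" "desc (walk v s (Suc b1)) (sh (Suc b1) s) b2 K"
    "walk (walk v s (Suc b1)) (sh (Suc b1) s) (Suc b2) \<in> E (K - b2)" "sh (Suc b1) s b2 \<in> G (K - b2)"
    using desc_or_valleyC[OF q(1) Ln_sh[OF v(2)], of "Suc b1" \<epsilon>] long_after_peak[OF v\<Omega> v(2) b1(3)] na(2)
    unfolding K_def by blast
  have b2': "s (Suc b1 + b2) \<in> G (K - b2)" "walk v s (Suc b1 + Suc b2) \<in> E (K - b2)"
    using b2 unfolding walk_add sh_at by auto
  have b2K: "b2 \<le> K" using b2(2) desc_def by auto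
  define i where "i = b1 + b2 + 2"
  have i: "i = Suc b1 + Suc b2" unfolding i_def by simp
  have wi: "walk v s i \<in> E (K - b2)" using b2' i by simp
  have b21: "b2 \<le> b1"
  proof (rule ccontr)
    assume "\<not> b2 \<le> b1"
    then have "K - b2 < l" using b2K unfolding K_def by auto
    then show False using closed_shift[OF v\<Omega> v(2) IH[OF _ wi Ln_sh[OF v(2)]]] na(2) by simp
  qed
  have Gi: "sh i s 0 \<in> G (Suc (K - b2))"
    using Ln_G[OF v(2) b2'(1), of i] G_parity[of "K - b2 + (Suc b1 + b2) + i" "Suc (K - b2)"]
    unfolding sh_simps i by auto
  have "\<not> asc (walk v s i) (sh i s) P (K - b2)"
  proof
    assume a: "asc (walk v s i) (sh i s) P (K - b2)"
    have "bump v s l b1 b2"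
      unfolding bump_def using b1 b1e b2(1,2) b2' b21 a wi unfolding K_def i_def by auto
    then show False using na(3) by blast
  qed
  then obtain b3 where b3: "b3 < P" "asc (walk v s i) (sh i s) b3 (K - b2)"
    "pkc (K - b2 + b3) (walk (walk v s i) (sh i s) b3) (sh i s b3)"
    using asc_or_peakC[OF wi Ln_sh[OF v(2)] Gi] by blast
  have d3: "desc (walk (walk v s i) (sh i s) b3) (bk b3 (sh i s)) b3 (K - b2 + b3)"
    by (rule asc_bkC[OF E_\<Omega>[OF wi] Ln_sh[OF v(2)]]) (use b3 in auto)
  have ncl: "\<not> closed (walk v s i) (sh i s)" using closed_shift[OF v\<Omega> v(2)] na(2) by blast
  have b3e: "b3 < \<epsilon>"
    using long_before_peak[OF E_\<Omega>[OF wi] Ln_sh[OF v(2)] _ b3(3) desc_mono[OF d3]] b3(1) ncl by (meson Suc_leI not_le)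
  define u where "u = walk v s (Suc b1 + b2)"
  have "walk v s i = u \<odot> s (Suc b1 + b2)" unfolding u_def i by simp
  moreover have "walk (walk (walk v s i) (sh i s) b3) (bk b3 (sh i s)) b3 = walk v s i"
    using bk_walkC[OF E_\<Omega>[OF wi] Ln_sh[OF v(2)], of b3 b3] b3(1) by simp
  moreover have "s (Suc b1 + b2) \<in> G (K - b2) - H" using b2'(1) Ln_nH[OF v(2)] by auto
  moreover have "walk (walk v s b1 \<odot> s b1) (sh (Suc b1) s) b2 = u" unfolding u_def walk_add[of v s "Suc b1"] by simp
  moreover have "desc (walk v s b1 \<odot> s b1) (sh (Suc b1) s) b2 (l + b1)" using b2(2) unfolding K_def by simp
  ultimately show False
    using two_peaksC[OF b1(3) _ _ _ _ _ b3(3) d3, of "sh (Suc b1) s" b2 u "s (Suc b1 + b2)" "K - b2"]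
      wi b1e b2(1) b3e bnd K_def by simp
qed

lemma relpath_closed:
  assumes "x \<in> E n" "\<rho> \<in> Ln"
    and st: "\<And>j. j < P - 1 \<Longrightarrow> (\<exists>i<n. walk x \<rho> j \<in> E i) \<or> (\<exists>i\<le>n. walk x \<rho> j \<in> E i \<and> \<rho> j \<in> G i)"
    and "walk x \<rho> (P - 1) \<in> E n"
  shows "closed x \<rho>"
proof -
  have P: "0 < P - 1" using A_bounds eps by auto
  have "relpath n x \<rho>"
    unfolding relpath_def
  proof (intro conjI allI impI)
    show "\<rho> 0 \<in> G n" using st[OF P] disjE[OF assms(1)] by auto
    fix j
    show "\<exists>i\<le>n. walk x \<rho> j \<in> E i" if "j < P"
    proof (cases "j < P - 1")
      case True then show ?thesis using st[OF True] less_imp_le by blast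
    next
      case False
      then have "j = P - 1" using that by simp
      then show ?thesis using assms(4) by blast
    qed
    show "ok n (walk x \<rho> j) (\<rho> j)" if j: "j < P - 1"
      using st[OF j]
    proof
      assume "\<exists>i<n. walk x \<rho> j \<in> E i"
      then obtain i where i: "i < n" "walk x \<rho> j \<in> E i" by blast
      show ?thesis using gstage.ok_E[OF at[of n] i(2,1)] Ln_LM[OF assms(2)] by blast
    qed (unfold ok_def, use V_E in blast)
  qed (use assms in auto)
  then show ?thesis using gstage.closing[OF at[of "Suc n"], of n x \<rho>] unfolding closed_def by simp
qed

text \<open>On the two sides of the valley there are points of equal height at a distance of
  \<open>P - 1\<close> syllables. The path between them is a \<open>relpath\<close>, so it closes,
  and closing does not depend on the starting point.\<close>

lemma main_closed:
  assumes u: "u \<in> E l" "s \<in> Ln" "s 0 \<in> G l" "u \<odot> s 0 \<in> E l"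
    and left: "asc u (rv P s) P l"
    and right: "asc (u \<odot> s 0) (sh 1 s) P l \<or> (\<exists>b1 b2. bump (u \<odot> s 0) (sh 1 s) l b1 b2)"
  shows "closed u s"
proof -
  note bnd = A_bounds eps
  have u\<Omega>: "u \<in> \<Omega>" using u E_\<Omega> by simp
  define v where "v = u \<odot> s 0"
  have uv: "walk u s (Suc j) = walk v (sh 1 s) j" for j using walk_add[of u s 1 j] unfolding v_def by simp
  \<comment> \<open>\<open>a\<close> counts the steps on the left. The syllable of the valley and
    \<open>P - 2 - a\<close> steps on the right bring the total to \<open>P - 1\<close>.\<close>
  have red: "closed u s" if aP: "a < P" and a0: "0 < a"
    and st: "\<And>j. j < P - 2 - a \<Longrightarrow> \<exists>i<l + a. walk v (sh 1 s) j \<in> E i"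
    and en: "walk v (sh 1 s) (P - 2 - a) \<in> E (l + a)" and aP2: "a + 2 \<le> P" for a
  proof -
    define x where "x = walk u (rv P s) a"
    define \<rho> where "\<rho> = sh (P - a) s"
    have \<rho>L: "\<rho> \<in> Ln" using Ln_sh u \<rho>_def by simp
    have \<rho>b: "\<rho> = bk a (rv P s)" unfolding \<rho>_def bk_def rv_rv[OF u(2)] ..
    have W1: "walk x \<rho> j = walk u (rv P s) (a - j)" if "j \<le> a" for j
      unfolding x_def \<rho>b by (rule bk_walkC[OF u\<Omega> Ln_rv[OF u(2)]]) (use aP that in auto)
    have "sh a \<rho> = s" unfolding \<rho>_def shift_shift using sh_P[OF u(2)] aP by simp
    then have W2: "walk x \<rho> (a + j) = walk u s j" for j using walk_add[of x \<rho> a j] W1[of a] by simp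
    have W3: "walk x \<rho> (a + Suc j) = walk v (sh 1 s) j" for j using W2[of "Suc j"] uv by simp
    have cl: "closed x \<rho>"
    proof (rule relpath_closed[of _ "l + a"])
      show "x \<in> E (l + a)" using left aP unfolding x_def asc_def by simp
      have "a + Suc (P - 2 - a) = P - 1" using aP2 by simp
      then show "walk x \<rho> (P - 1) \<in> E (l + a)" using W3[of "P - 2 - a"] en by (simp only:)
      fix j assume j: "j < P - 1"
      consider "j < a" | "j = a" | i where "j = a + Suc i" using less_iff_Suc_add[of a j] by (cases "j < a"; cases "j = a") auto
      then show "(\<exists>i<l + a. walk x \<rho> j \<in> E i) \<or> (\<exists>i\<le>l + a. walk x \<rho> j \<in> E i \<and> \<rho> j \<in> G i)"
      proof cases
        case 1
        have m: "a - 1 - j < P" "Suc (l + (a - 1 - j)) = l + (a - j)" "a - j \<le> P" using 1 aP by auto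
        have "rv P s (a - 1 - j) \<in> G (l + (a - j))" using left m unfolding asc_def by metis
        then have "\<rho> j \<in> G (l + (a - j))" unfolding \<rho>b using bk_eq[of a j "rv P s"] 1 aP by simp
        moreover have "walk x \<rho> j \<in> E (l + (a - j))"
        proof -
          have "walk u (rv P s) (a - j) \<in> E (l + (a - j))" using left m(3) unfolding asc_def by blast
          then show ?thesis using W1[of j] 1 by simp
        qed
        ultimately show ?thesis by (intro disjI2 exI[of _ "l + (a - j)"]) simp
      next
        case 2
        have "\<rho> a = s 0" unfolding \<rho>_def sh_def using aP Ln_per[OF u(2), of 0] by simp
        then show ?thesis using W1[of a] u 2 by (intro disjI2 exI[of _ l]) simp
      next
        case 3
        then have "i < P - 2 - a" using j by simp
        then show ?thesis using st[of i] W3[of i] 3 by simp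
      qed
    qed (rule \<rho>L)
    have "walk u s P = walk x \<rho> (P + a)" using W2[of P] by (simp add: add.commute)
    also have "\<dots> = walk x \<rho> a" using cl walk_add[of x \<rho> P a] sh_P[OF \<rho>L] unfolding closed_def by simp
    also have "\<dots> = u" using W1[of a] by simp
    finally show ?thesis unfolding closed_def .
  qed
  obtain h where h: "P = 2 * h" using evenP by auto
  from right show ?thesis
  proof
    assume a: "asc (u \<odot> s 0) (sh 1 s) P l"
    have e1: "P - 2 - (h - 1) = h - 1" using h by simp
    show ?thesis
    proof (rule red[of "h - 1"])
      fix j assume "j < P - 2 - (h - 1)"
      then show "\<exists>i<l + (h - 1). walk v (sh 1 s) j \<in> E i"
        using a h unfolding asc_def v_def by (intro exI[of _ "l + j"]) auto
    next
      have "h - 1 \<le> P" using h by simp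
      then show "walk v (sh 1 s) (P - 2 - (h - 1)) \<in> E (l + (h - 1))"
        using a unfolding e1 asc_def v_def by blast
    qed (use h bnd in auto)
  next
    assume "\<exists>b1 b2. bump (u \<odot> s 0) (sh 1 s) l b1 b2"
    then obtain b1 b2 where b: "b1 < \<epsilon>" "b2 < \<epsilon>" "b2 \<le> b1" "asc v (sh 1 s) b1 l"
      "desc (walk v (sh 1 s) (Suc b1)) (sh (Suc b1) (sh 1 s)) b2 (l + b1)"
      "asc (walk v (sh 1 s) (b1 + b2 + 2)) (sh (b1 + b2 + 2) (sh 1 s)) P (l + b1 - b2)"
      unfolding bump_def v_def by blast
    \<comment> \<open>On the right the bump costs \<open>b1 + b2 + 2\<close> syllables for a gain of
      \<open>b1 - b2\<close> in height. With \<open>P = 2 * h\<close>, equal heights at a total of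
      \<open>P - 1\<close> syllables determine this value.\<close>
    define a where "a = h - 2 - b2"
    have ha: "h = a + 2 + b2" "b1 < a" using h b bnd unfolding a_def by auto
    have Pa: "P - 2 - a = (b1 + b2 + 2) + (a - b1 + b2)" using h ha by simp
    have up: "walk v (sh 1 s) (b1 + b2 + 2 + i) \<in> E (l + b1 - b2 + i)" if "i \<le> P" for i
      using b(6) that unfolding asc_def walk_add[of v "sh 1 s" "b1 + b2 + 2" i] by blast
    show ?thesis
    proof (rule red[of a])
      have le: "a - b1 + b2 \<le> P" using ha h by simp
      have "l + b1 - b2 + (a - b1 + b2) = l + a" using ha b by simp
      then show "walk v (sh 1 s) (P - 2 - a) \<in> E (l + a)" using up[of "a - b1 + b2"] le Pa by (simp only:)
      fix j assume j: "j < P - 2 - a"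
      consider "j \<le> b1" | i where "j = Suc b1 + i" "i \<le> b2" | i where "j = b1 + b2 + 2 + i" "i < a - b1 + b2"
      proof -
        consider "j \<le> b1" | "b1 < j" "j \<le> Suc b1 + b2" | "b1 + b2 + 2 \<le> j" by linarith
        then show thesis
        proof cases
          case 1 then show thesis using that by blast
        next
          case 2 then show thesis using that(2)[of "j - Suc b1"] by auto
        next
          case 3 then show thesis using that(3)[of "j - (b1 + b2 + 2)"] j Pa by auto
        qed
      qed
      then show "\<exists>i<l + a. walk v (sh 1 s) j \<in> E i"
      proof cases
        case 1 then show ?thesis using b(4) ha unfolding asc_def by (intro exI[of _ "l + j"]) auto
      next
        case 2
        then show ?thesis using b(5) ha unfolding desc_def walk_add[symmetric]
          by (intro exI[of _ "l + b1 - i"]) auto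
      next
        case 3
        then show ?thesis using up[of i] ha h b by (intro exI[of _ "l + b1 - b2 + i"]) auto
      qed
    qed (use ha h in auto)
  qed
qed

lemma rv_sh1: "s \<in> Ln \<Longrightarrow> sh 1 (rv P (sh 1 s)) = rv P s"
proof -
  assume s: "s \<in> Ln"
  have "rv P (sh 1 s) = sh (P - 1) (rv P s)" using rv_sh[OF s, of 1] A_bounds by simp
  then show ?thesis using sh_P[OF Ln_rv[OF s]] A_bounds by (simp add: shift_shift)
qed

text \<open>Induction on the layer. If the path begins with a descent, it meets a lower layer.
  Otherwise it may be assumed to begin with a valley, and both directions lead up from there with at
  most one short bump altogether; \<open>main_closed\<close> then applies to the line or to its
  reverse.\<close>

theorem closed_all: "q \<in> E l \<Longrightarrow> s \<in> Ln \<Longrightarrow> closed q s"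
proof (induction l arbitrary: q s rule: less_induct)
  case (less l)
  have down: "closed u s" if u: "u \<in> E l" and s: "s \<in> Ln" and s0: "s 0 \<in> G l" for u s
  proof -
    have u\<Omega>: "u \<in> \<Omega>" using u E_\<Omega> by simp
    have "\<not> desc u s (Suc l) l" unfolding desc_def by simp
    then obtain b where b: "desc u s b l" "walk u s (Suc b) \<in> E (l - b)"
      using desc_or_valleyC[OF u s s0, of "Suc l"] by blast
    show ?thesis
    proof (cases "b = 0")
      case False
      have "b \<le> l" "walk u s b \<in> E (l - b)" using b(1) unfolding desc_def by auto
      then have "closed (walk u s b) (sh b s)" using less.IH[of "l - b" "walk u s b" "sh b s"] Ln_sh[OF s] False by simp
      then show ?thesis by (rule closed_shift[OF u\<Omega> s])
    next
      case True
      define v where "v = u \<odot> s 0"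
      have v: "v \<in> E l" using b True v_def by simp
      have v\<Omega>: "v \<in> \<Omega>" using v E_\<Omega> by simp
      have s1: "sh 1 s \<in> Ln" "rv P s \<in> Ln" using Ln_sh Ln_rv s by auto
      have g1: "sh 1 s 0 \<in> G (Suc l)" using Ln_G[OF s s0, of 1] unfolding sh_simps by simp
      have "even (l + 0 + (P - 1) + Suc l)" using evenP A_bounds(3) by auto
      then have "s (P - 1) \<in> G (Suc l)" using Ln_G[OF s s0, of "P - 1"] G_parity[of "l + 0 + (P - 1)" "Suc l"] by auto
      then have g2: "rv P s 0 \<in> G (Suc l)" unfolding rv_def by simp
      define t where "t = rv P (sh 1 s)"
      have tL: "t \<in> Ln" using Ln_rv s1 t_def by simp
      have t0: "t 0 = iv (s 0)" unfolding t_def rv_def sh_def using A_bounds Ln_per[OF s, of 0] by simp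
      have vt: "v \<odot> t 0 = u" unfolding v_def t0 using actinv(1)[of u l "s 0"] V_E(1)[OF u] s0 by simp
      have t1: "sh 1 t = rv P s" "rv P t = sh 1 s" unfolding t_def using rv_sh1[OF s] rv_rv[OF s1(1)] by auto
      have cu: "closed v (sh 1 s) \<Longrightarrow> closed u s"
        using closed_shift[OF u\<Omega> s, of 1] unfolding v_def by simp
      have cu2: "closed v t \<Longrightarrow> closed u s" unfolding t_def using closed_rv[OF v\<Omega> s1(1)] cu by blast
      have cu3: "closed u (rv P s) \<Longrightarrow> closed u s" using closed_rv[OF u\<Omega> s] .
      have R: "asc v (sh 1 s) P l \<or> closed v (sh 1 s) \<or> (\<exists>b1 b2. bump v (sh 1 s) l b1 b2)"
        by (rule upward[OF v s1(1) g1 less.IH])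
      have Lf: "asc u (rv P s) P l \<or> closed u (rv P s) \<or> (\<exists>b1 b2. bump u (rv P s) l b1 b2)"
        by (rule upward[OF u s1(2) g2 less.IH])
      \<comment> \<open>Bumps on both sides would enclose the valley \<open>s 0\<close> between two
        nearby peaks, which \<open>two_peaksC\<close> forbids.\<close>
      have both: False if "bump v (sh 1 s) l b1 b2" "bump u (rv P s) l c1 c2" for b1 b2 c1 c2
      proof -
        have B: "b1 < \<epsilon>" "asc v (sh 1 s) b1 l" "pkc (l + b1) (walk v (sh 1 s) b1) (sh 1 s b1)"
          and C: "c1 < \<epsilon>" "asc u (rv P s) c1 l" "pkc (l + c1) (walk u (rv P s) c1) (rv P s c1)"
          using that unfolding bump_def by blast+
        have bP: "b1 < P" "c1 < P" using B C A_bounds by auto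
        define p1 where "p1 = walk u (rv P s) (Suc c1)"
        define g1 where "g1 = iv (rv P s c1)"
        have c1V: "walk u (rv P s) c1 \<in> V (Suc (l + c1))" "rv P s c1 \<in> G (Suc (l + c1))" using C(3) V_E unfolding pkc_def by auto
        have p1g: "p1 \<odot> g1 = walk u (rv P s) c1" unfolding p1_def g1_def using actinv(1)[OF c1V] by simp
        have "pkc (l + c1) p1 g1" using C(3) p1g notH_iv[of "rv P s c1"] unfolding pkc_def p1_def g1_def by auto
        moreover have "desc (p1 \<odot> g1) (bk c1 (rv P s)) c1 (l + c1)"
          unfolding p1g by (rule asc_bkC[OF u\<Omega> s1(2)]) (use C bP in auto)
        moreover have "walk (p1 \<odot> g1) (bk c1 (rv P s)) c1 = u"
          unfolding p1g using bk_walkC[OF u\<Omega> s1(2), of c1 c1] bP by simp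
        moreover have "s 0 \<in> G l - H" using s0 Ln_nH[OF s] by simp
        moreover have "desc (walk v (sh 1 s) b1) (bk b1 (sh 1 s)) b1 (l + b1)"
          by (rule asc_bkC[OF v\<Omega> s1(1)]) (use B bP in auto)
        moreover have "walk (walk v (sh 1 s) b1) (bk b1 (sh 1 s)) b1 = u \<odot> s 0"
          using bk_walkC[OF v\<Omega> s1(1), of b1 b1] bP v_def by simp
        ultimately show False
          using two_peaksC[of "l + c1" p1 g1 "bk c1 (rv P s)" c1 u "s 0" l "l + b1" "walk v (sh 1 s) b1" "sh 1 s b1" "bk b1 (sh 1 s)" b1]
            B C v A_bounds eps v_def by simp
      qed
      show ?thesis
      proof (cases "asc u (rv P s) P l")
        case True
        then show ?thesis using R cu main_closed[OF u s s0] v unfolding v_def by blast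
      next
        case False
        then have Lf': "closed u (rv P s) \<or> (\<exists>b1 b2. bump u (rv P s) l b1 b2)" using Lf by blast
        then show ?thesis
        proof
          assume "\<exists>b1 b2. bump u (rv P s) l b1 b2"
          moreover from this have "asc v (sh 1 s) P l \<or> closed v (sh 1 s)" using R both by blast
          moreover have "closed v t" if "asc v (sh 1 s) P l" "\<exists>b1 b2. bump u (rv P s) l b1 b2"
          proof (rule main_closed[OF v tL])
            show "t 0 \<in> G l" using t0 s0 by simp
            show "v \<odot> t 0 \<in> E l" using vt u by simp
            show "asc v (rv P t) P l" using that t1 by simp
            show "asc (v \<odot> t 0) (sh 1 t) P l \<or> (\<exists>b1 b2. bump (v \<odot> t 0) (sh 1 t) l b1 b2)"
              using that t1 vt by simp
          qed
          ultimately show ?thesis using cu cu2 by blast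
        qed (rule cu3)
      qed
    qed
  qed
  obtain k where k: "alt s k" using Ln_alt less.prems by blast
  have "s 0 \<in> G l \<or> s 0 \<in> G (Suc l)" using k unfolding alt_def G_def by (auto split: if_splits)
  then show ?case
  proof
    assume "s 0 \<in> G l" then show ?thesis using down less.prems by blast
  next
    assume s0: "s 0 \<in> G (Suc l)"
    have "even (Suc l + 0 + (P - 1) + l)" using evenP A_bounds(3) by auto
    then have "s (P - 1) \<in> G l"
      using Ln_G[OF less.prems(2) s0, of "P - 1"] G_parity[of "Suc l + 0 + (P - 1)" l] by auto
    then have "rv P s 0 \<in> G l" unfolding rv_def by simp
    then have "closed q (rv P s)" using down less.prems Ln_rv by blast
    then show ?thesis by (rule closed_rv[OF E_\<Omega>[OF less.prems(1)] less.prems(2)])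
  qed
qed

end

section \<open>Words without large parts of relators do not close\<close>

context smallcanc
begin

text \<open>The part of a cell that is read by a path which climbs \<open>A - 3 * \<epsilon>\<close>
  steps to the peak, crosses it and descends \<open>6 * \<epsilon>\<close> steps. It is slightly
  longer than half a relator.\<close>

definition \<Theta> :: nat where "\<Theta> = P div 2 + 2 * \<epsilon>"

lemma \<Theta>_bounds: "A - 3 * \<epsilon> + 1 + 6 * \<epsilon> = \<Theta>" "\<Theta> < P" "2 * \<Theta> = P + 4 * \<epsilon>"
proof -
  obtain h where "P = 2 * h" using evenP by auto
  then show "A - 3 * \<epsilon> + 1 + 6 * \<epsilon> = \<Theta>" "\<Theta> < P" "2 * \<Theta> = P + 4 * \<epsilon>"
    using A_bounds eps P40 unfolding \<Theta>_def by auto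
qed

end

context complete
begin

lemmas followC = gstage.follow[OF at _ _ _ _ order_refl]

lemmas follow_lineC = gstage.follow_line[OF at _ _ _ _ order_refl]

lemma cell_sidesC:
  assumes "pkc k p g"
  obtains s where "s \<in> Ln" "s 0 = g" "desc (p \<odot> g) (sh 1 s) A k" "desc p (rv P s) A k"
  using gstage.cell_sides[OF at[of "Suc k"] pkc_pk[OF assms lessI]] by metis

lemmas valleyC = gstage.valley[OF at order_refl]

lemma desc_monoC: "desc p r t k \<Longrightarrow> t' \<le> t \<Longrightarrow> desc p r t' k" unfolding desc_def by auto

definition rw :: "(nat \<Rightarrow> 'g) \<Rightarrow> nat \<Rightarrow> nat \<Rightarrow> 'g" where "rw w i = (\<lambda>j. iv (w (i - 1 - j)))"

lemma walk_\<Omega>w: "p \<in> \<Omega> \<Longrightarrow> \<forall>j<n. w j \<in> L \<union> M \<Longrightarrow> j \<le> n \<Longrightarrow> walk p w j \<in> \<Omega>"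
  by (induction j) (use \<Omega>_act in auto)

lemma rw_walk:
  assumes "p \<in> \<Omega>" "\<forall>j<n. w j \<in> L \<union> M" "i \<le> n" "j \<le> i"
  shows "walk (walk p w i) (rw w i) j = walk p w (i - j)"
  using assms(4)
proof (induction j)
  case (Suc j)
  define m where "m = i - Suc j"
  have m: "i - j = Suc m" "i - 1 - j = m" "m < n" using Suc.prems assms(3) m_def by auto
  obtain k where k: "w m \<in> G k" using assms(2) m unfolding G_def by (metis UnE even_Suc)
  obtain l where "walk p w m \<in> V l" "G l = G k" using \<Omega>_G walk_\<Omega>w[OF assms(1,2)] m by (metis less_imp_le)
  then have "walk p w m \<odot> w m \<odot> iv (w m) = walk p w m" using actinv(1) k by simp
  then show ?case using Suc m unfolding rw_def m_def[symmetric] by simp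
qed simp

lemma asc_rw:
  assumes "p \<in> \<Omega>" "\<forall>j<n. w j \<in> L \<union> M" "i + a \<le> n" "asc (walk p w i) (sh i w) a k"
  shows "desc (walk p w (i + a)) (rw w (i + a)) a (k + a)"
  unfolding desc_def
proof (intro conjI allI impI)
  show "a \<le> k + a" by simp
  fix j
  show "rw w (i + a) j \<in> G (k + a - j)" if "j < a"
  proof -
    define m where "m = a - 1 - j"
    have m: "i + a - 1 - j = m + i" "m < a" "k + a - j = Suc (k + m)" using that m_def by auto
    have "w (m + i) \<in> G (Suc (k + m))" using assms(4) m unfolding asc_def sh_def by auto
    then show ?thesis unfolding rw_def m by simp
  qed
  show "walk (walk p w (i + a)) (rw w (i + a)) j \<in> E (k + a - j)" if "j \<le> a"
  proof -
    have "walk (walk p w (i + a)) (rw w (i + a)) j = walk p w (i + (a - j))"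
      using rw_walk[OF assms(1-3), of j] that by simp
    moreover have "walk p w (i + (a - j)) \<in> E (k + (a - j))"
      using assms(4) unfolding asc_def walk_add by (meson diff_le_self)
    ultimately show ?thesis using that by (simp del: walk.simps add: Nat.add_diff_assoc)
  qed
qed

text \<open>The word follows both sides of the cell at the peak up to twists. Both twists are
  trivial at the peak, so they combine to a single twist of the boundary line.\<close>

lemma share:
  assumes pk: "pkc K (walk p w j0) (w j0)" and fw: "desc (walk p w (Suc j0)) (sh (Suc j0) w) (6 * \<epsilon>) K"
    and m: "m \<le> j0" "m = A - 3 * \<epsilon>" and bw: "desc (walk p w j0) (rw w j0) m K"
    and w: "\<forall>j\<le>j0. w j \<in> L \<union> M"
  shows "\<exists>r\<in>Ln. \<forall>j<\<Theta>. w (j0 - m + j) = r j"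
proof -
  note bnd = A_bounds eps
  obtain s where s: "s \<in> Ln" "s 0 = w j0" "desc (walk p w (Suc j0)) (sh 1 s) A K" "desc (walk p w j0) (rv P s) A K"
    using cell_sidesC[OF pk] by (metis walk.simps(2))
  obtain c where c: "\<forall>j. c j \<in> H" "c 0 = e" "\<forall>j<6 * \<epsilon>. sh (Suc j0) w j = twist c (sh 1 s) j"
    using followC[OF Ln_sh[OF s(1)] s(3) fw] bnd by auto
  obtain d where d: "\<forall>j. d j \<in> H" "d 0 = e" "\<forall>j<m. rw w j0 j = twist d (rv P s) j"
    using followC[OF Ln_rv[OF s(1)] s(4) bw] bnd m(2) by auto
  define t where "t = sh (P - m) s"
  have mP: "m < P" using m(2) bnd by auto
  \<comment> \<open>The peak is the syllable with index \<open>m\<close>. The elements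
    \<open>d\<close> belong to the side that was read backwards and appear in reverse order.\<close>
  define C where "C i = (if i \<le> m then d (m - i) else c (i - m - 1))" for i
  have CH: "\<forall>i. C i \<in> H" using c d C_def by auto
  define C' where "C' = (\<lambda>j. if j mod P \<le> \<Theta> then C (j mod P) else e)"
  have hC: "hper P C'" unfolding C'_def by (rule hper_fin[OF CH])
  have CC: "C' i = C i" if "i \<le> \<Theta>" for i unfolding C'_def using that \<Theta>_bounds by auto
  have "twist C' t \<in> Ln" using Ln_twist Ln_sh s hC t_def by simp
  moreover have "w (j0 - m + j) = twist C' t j" if j: "j < \<Theta>" for j
  proof -
    have tw: "twist C' t j = iv (C j) \<cdot> t j \<cdot> C (Suc j)" unfolding twist_def using CC j by simp
    consider i where "j = m - 1 - i" "i < m" | "j = m" | i where "j = m + 1 + i"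
    proof -
      consider "j < m" | "j = m" | "m < j" by linarith
      then show thesis
      proof cases
        case 1 then show thesis using that(1)[of "m - 1 - j"] by auto
      next
        case 2 then show thesis using that(2) by blast
      next
        case 3 then show thesis using that(3)[of "j - m - 1"] by auto
      qed
    qed
    then show ?thesis
    proof cases
      case 1
      have x: "j0 - m + j = j0 - 1 - i" "m - j = Suc i" "m - Suc j = i" "j \<le> m" "Suc j \<le> m" using 1 m by auto
      have "j + (P - m) = P - 1 - i" using 1 mP by auto
      then have tj: "t j = s (P - 1 - i)" unfolding t_def sh_def by simp
      have iP: "i mod P = i" using 1 mP by simp
      obtain k where k: "s (P - 1 - i) \<in> G k" using Ln_LM[OF s(1), of "P - 1 - i"] unfolding G_def by (metis UnE even_Suc)
      have dG: "d i \<in> G k" "d (Suc i) \<in> G k" using d HG by auto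
      have "iv (w (j0 - 1 - i)) = iv (d i) \<cdot> iv (s (P - 1 - i)) \<cdot> d (Suc i)"
        using d(3)[rule_format, OF 1(2)] unfolding rw_def twist_def rv_def iP .
      then have "iv (iv (w (j0 - 1 - i))) = iv (iv (d i) \<cdot> iv (s (P - 1 - i)) \<cdot> d (Suc i))" by simp
      also have "iv (iv (w (j0 - 1 - i))) = w (j0 - 1 - i)" using w iv_iv by simp
      also have "iv (iv (d i) \<cdot> iv (s (P - 1 - i)) \<cdot> d (Suc i)) = iv (d (Suc i)) \<cdot> s (P - 1 - i) \<cdot> d i"
        using k dG by (simp add: gs[where k=k])
      finally show ?thesis using tw x tj unfolding C_def by simp
    next
      case 2
      have "t j = s 0" unfolding t_def sh_def using 2 mP Ln_per[OF s(1), of 0] by simp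
      moreover have "C j = e" "C (Suc j) = e" unfolding C_def using 2 c d by auto
      ultimately have "twist C' t j = e \<cdot> w j0 \<cdot> e" using tw s(2) by simp
      moreover have "w j0 \<in> L \<union> M" using w by simp
      ultimately show ?thesis using 2 m el er by simp
    next
      case 3
      have i: "i < 6 * \<epsilon>" using 3 j m(2) \<Theta>_bounds(1) by linarith
      have x: "j0 - m + j = i + Suc j0" using 3 m by auto
      have "j + (P - m) = i + 1 + P" using 3 mP by auto
      then have tj: "t j = s (i + 1)" unfolding t_def sh_def using Ln_per[OF s(1), of "i + 1"] by simp
      have "C j = c i" "C (Suc j) = c (Suc i)" unfolding C_def using 3 by auto
      then show ?thesis using tw tj x c(3) i unfolding sh_def twist_def by simp
    qed
  qed
  ultimately show ?thesis by blast
qed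

text \<open>Along a word without large parts of lines every ascent is long and every descent is short, so a path
  starting at the root never comes back to it.\<close>

theorem dehn:
  assumes p0: "p0 \<in> E 0" and n: "1 \<le> n" and w: "\<And>j. j < n \<Longrightarrow> w j \<in> G (m0 + j) - H"
    and nopart: "\<And>i r. r \<in> Ln \<Longrightarrow> i + \<Theta> \<le> n \<Longrightarrow> \<exists>j<\<Theta>. w (i + j) \<noteq> r j"
  shows "walk p0 w n \<noteq> p0"
proof -
  note bnd = A_bounds eps
  define m where "m = A - 3 * \<epsilon>"
  have wLM: "\<forall>j<n. w j \<in> L \<union> M" using w GLM by blast
  have p\<Omega>: "p0 \<in> \<Omega>" using p0 E_\<Omega> by simp
  have alt: "w j \<in> G k \<Longrightarrow> Suc j < n \<Longrightarrow> w (Suc j) \<in> G (Suc k)" for j k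
  proof -
    assume a: "w j \<in> G k" "Suc j < n"
    have "even (m0 + j + k)"
    proof (rule ccontr)
      assume "odd (m0 + j + k)"
      then have "G (m0 + j) = G (Suc k)" by (intro G_parity) auto
      then show False using w[of j] a G_both[of "w j" k] by auto
    qed
    then have "G (m0 + Suc j) = G (Suc k)" by (intro G_parity) auto
    then show "w (Suc j) \<in> G (Suc k)" using w[of "Suc j"] a by auto
  qed
  \<comment> \<open>The state during a climb of \<open>a\<close> steps so far. The climb began at
    the root, possibly after a first letter from \<open>L\<close>, or at a valley whose other edge
    starts a descending line; in the second case the climb can only end after many steps.\<close>
  define S1 where "S1 i k a \<longleftrightarrow> a \<le> i \<and> a \<le> k \<and> asc (walk p0 w (i - a)) (sh (i - a) w) a (k - a)
      \<and> (i < n \<longrightarrow> w i \<in> G (Suc k))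
      \<and> ((k = a \<and> (i = a \<or> (i = Suc a \<and> w 0 \<in> G 0))) \<or> (a < i \<and> w (i - a - 1) \<in> G (k - a) - H \<and>
         (\<exists>s\<in>Ln. desc (walk p0 w (i - a - 1)) s (2 * \<epsilon> + 1) (k - a))))" for i k a
  \<comment> \<open>The state during a descent: \<open>b\<close> steps below a peak that was reached
    by at least \<open>m\<close> steps upwards.\<close>
  define S2 where "S2 i K b \<longleftrightarrow> b < 6 * \<epsilon> \<and> b < i \<and> pkc K (walk p0 w (i - 1 - b)) (w (i - 1 - b))
      \<and> desc (walk p0 w (i - b)) (sh (i - b) w) b K \<and> m \<le> i - 1 - b
      \<and> desc (walk p0 w (i - 1 - b)) (rw w (i - 1 - b)) m K \<and> (i < n \<longrightarrow> w i \<in> G (K - b))" for i K b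
  have main: "(i \<ge> 1 \<or> w 0 \<in> G 1) \<longrightarrow> (\<exists>k a. S1 i k a) \<or> (\<exists>K b. S2 i K b)" if "i \<le> n" for i
    using that
  proof (induction i)
    case 0
    show ?case
    proof
      assume "1 \<le> (0::nat) \<or> w 0 \<in> G 1"
      then have "S1 0 0 0" unfolding S1_def asc_def using p0 by simp
      then show "(\<exists>k a. S1 0 k a) \<or> (\<exists>K b. S2 0 K b)" by blast
    qed
  next
    case (Suc i)
    have i: "i < n" using Suc.prems by simp
    have wi: "w i \<notin> H" "w i \<in> L \<union> M" using w[OF i] wLM i by auto
    show ?case
    proof (cases "i = 0 \<and> w 0 \<notin> G 1")
      case True
      have w0: "w 0 \<in> G 0" using True wi unfolding G_def by auto
      have "p0 \<odot> w 0 \<in> V 0" using actV[of p0 0 "w 0"] w0 V_E[OF p0] by simp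
      then have "p0 \<odot> w 0 \<in> E 0" unfolding V_def by simp
      moreover have "Suc 0 < n \<longrightarrow> w (Suc 0) \<in> G (Suc 0)" using alt[OF w0] by simp
      ultimately have "S1 1 0 0" unfolding S1_def asc_def using w0 by simp
      then show ?thesis using True by auto
    next
      case False
      then have "(\<exists>k a. S1 i k a) \<or> (\<exists>K b. S2 i K b)" using Suc.IH i by (cases i) auto
      then show ?thesis
      proof
        assume "\<exists>k a. S1 i k a"
        then obtain k a where s1: "S1 i k a" by blast
        have a: "a \<le> i" "a \<le> k" "asc (walk p0 w (i - a)) (sh (i - a) w) a (k - a)" "w i \<in> G (Suc k)"
          using s1 i unfolding S1_def by auto
        have q: "walk p0 w i \<in> E k"
        proof -
          have "walk (walk p0 w (i - a)) (sh (i - a) w) a \<in> E (k - a + a)" using a(3) unfolding asc_def by blast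
          then show ?thesis unfolding walk_add[symmetric] using a by simp
        qed
        have "walk p0 w (Suc i) \<in> V (Suc k)" using actV[OF V_E(2)[OF q] a(4)] by simp
        then show ?thesis
        proof (cases rule: V_cases)
          case 1
          have "asc (walk p0 w (Suc i - Suc a)) (sh (Suc i - Suc a) w) (Suc a) (Suc k - Suc a)"
            unfolding asc_def
          proof (intro conjI allI impI)
            fix j
            show "sh (Suc i - Suc a) w j \<in> G (Suc (Suc k - Suc a + j))" if "j < Suc a"
            proof (cases "j = a")
              case True then show ?thesis using a by (simp add: sh_at)
            next
              case False then show ?thesis using that a(3) unfolding asc_def by simp
            qed
            show "walk (walk p0 w (Suc i - Suc a)) (sh (Suc i - Suc a) w) j \<in> E (Suc k - Suc a + j)" if "j \<le> Suc a"
            proof (cases "j = Suc a")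
              case True
              have "Suc i - Suc a + Suc a = Suc i" "Suc k - Suc a + Suc a = Suc k" using a by auto
              then show ?thesis unfolding walk_add[symmetric] True using 1 by (simp only:)
            next
              case False then show ?thesis using that a(3) unfolding asc_def by simp
            qed
          qed
          moreover have "Suc i < n \<longrightarrow> w (Suc i) \<in> G (Suc (Suc k))" using alt[OF a(4)] by blast
          moreover have "Suc i - Suc a - 1 = i - a - 1" "Suc k - Suc a = k - a" by auto
          ultimately have "S1 (Suc i) (Suc k) (Suc a)" using s1 unfolding S1_def by auto
          then show ?thesis by blast
        next
          case 2
          then have pk: "pkc k (walk p0 w i) (w i)" unfolding pkc_def using q a(4) wi by simp
          obtain s where s: "s \<in> Ln" "desc (walk p0 w i) (rv P s) A k" using cell_sidesC[OF pk] by metis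
          have dr: "desc (walk p0 w i) (rw w i) a k"
            using asc_rw[OF p\<Omega> wLM _ a(3)] a(1,2) i by simp
          \<comment> \<open>After a shorter climb the side of the new cell would reach more than
            \<open>3 * \<epsilon>\<close> steps below the last valley, where a line already descends
            from the other edge. A climb from the root is excluded because the cell needs
            \<open>A\<close> layers.\<close>
          have am: "m \<le> a"
          proof (rule ccontr)
            assume "\<not> m \<le> a"
            then have am: "a < A - 3 * \<epsilon>" unfolding m_def by simp
            then have am2: "a + \<epsilon> \<le> A" using bnd by linarith
            have "A \<le> k" using s(2) unfolding desc_def by simp
            then have ne: "k \<noteq> a" using am by auto
            then obtain s' where s': "a < i" "w (i - a - 1) \<in> G (k - a) - H" "s' \<in> Ln"
              "desc (walk p0 w (i - a - 1)) s' (2 * \<epsilon> + 1) (k - a)" using s1 unfolding S1_def by auto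
            obtain t where t: "t \<in> Ln" "desc (walk (walk p0 w i) (rw w i) a) t (A - a) (k - a)"
              using follow_lineC[OF Ln_rv[OF s(1)] s(2) dr] am2 by blast
            have "walk (walk p0 w i) (rw w i) a = walk p0 w (i - a)"
              using rw_walk[OF p\<Omega> wLM _ a(1)] i by simp
            also have "\<dots> = walk p0 w (Suc (i - a - 1))" using s'(1) by (simp add: Suc_diff_Suc)
            also have "\<dots> = walk p0 w (i - a - 1) \<odot> w (i - a - 1)" by simp
            finally have t2: "desc (walk p0 w (i - a - 1) \<odot> w (i - a - 1)) t (2 * \<epsilon> + 1) (k - a)"
              using desc_monoC[OF t(2)] am by simp
            have "walk p0 w (i - a - 1) \<in> E (k - a)"
              using s'(4) unfolding desc_def by (metis diff_zero walk.simps(1) zero_le)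
            then show False using valleyC[OF _ s'(2,3,4) t(1) t2] by simp
          qed
          have "Suc i < n \<longrightarrow> w (Suc i) \<in> G k" using alt[OF a(4)] G_parity[of "Suc (Suc k)" k] by auto
          moreover have "desc (walk p0 w (Suc i)) (sh (Suc i) w) 0 k" unfolding desc_def using 2 by simp
          moreover have "desc (walk p0 w i) (rw w i) m k" using desc_monoC[OF dr am] .
          ultimately have "S2 (Suc i) k 0" unfolding S2_def using pk am a(1) eps by simp
          then show ?thesis by blast
        qed
      next
        assume "\<exists>K b. S2 i K b"
        then obtain K b where s2: "S2 i K b" by blast
        define j0 where "j0 = i - 1 - b"
        have b: "b < 6 * \<epsilon>" "b < i" "i - b = Suc j0" using s2 unfolding S2_def j0_def by auto
        have pk: "pkc K (walk p0 w j0) (w j0)" and ds: "desc (walk p0 w (Suc j0)) (sh (Suc j0) w) b K"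
          and mj: "m \<le> j0" and db: "desc (walk p0 w j0) (rw w j0) m K" and wK: "w i \<in> G (K - b)"
          using s2 i b(3) unfolding S2_def j0_def[symmetric] by auto
        have ij: "i = Suc j0 + b" using b by simp
        have bK: "b \<le> K" using ds unfolding desc_def by simp
        have q: "walk p0 w i \<in> E (K - b)" using ds unfolding desc_def ij walk_add by blast
        obtain s where s: "s \<in> Ln" "desc (walk p0 w (Suc j0)) (sh 1 s) A K"
          using cell_sidesC[OF pk] by (metis walk.simps(2))
        have AK: "A \<le> K" using s(2) unfolding desc_def by simp
        have "walk p0 w (Suc i) \<in> V (K - b)" using actV[OF V_E(1)[OF q] wK] by simp
        then show ?thesis
        proof (cases rule: V_cases)
          case 1
          \<comment> \<open>The path leaves the side of the cell. As
            \<open>b < 6 * \<epsilon>\<close>, the rest of that side provides the descending line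
            that the climbing state records at the new valley.\<close>
          have "b + \<epsilon> \<le> A" "2 * \<epsilon> + 1 \<le> A - b" using b bnd by auto
          then obtain s' where s': "s' \<in> Ln" "desc (walk p0 w i) s' (2 * \<epsilon> + 1) (K - b)"
            using follow_lineC[OF Ln_sh[OF s(1)] s(2) ds] desc_monoC unfolding ij walk_add by meson
          moreover have "Suc i < n \<longrightarrow> w (Suc i) \<in> G (Suc (K - b))" using alt[OF wK] by blast
          ultimately have "S1 (Suc i) (K - b) 0" unfolding S1_def asc_def using 1 wK wi by auto
          then show ?thesis by blast
        next
          case 2
          have ds': "desc (walk p0 w (Suc j0)) (sh (Suc j0) w) (Suc b) K"
            unfolding desc_def
          proof (intro conjI allI impI)
            show "Suc b \<le> K" using 2 by simp
            fix j
            show "sh (Suc j0) w j \<in> G (K - j)" if "j < Suc b"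
              using that ds wK ij unfolding desc_def by (cases "j = b") (auto simp: sh_at)
            show "walk (walk p0 w (Suc j0)) (sh (Suc j0) w) j \<in> E (K - j)" if "j \<le> Suc b"
            proof (cases "j = Suc b")
              case True
              have "Suc j0 + Suc b = Suc i" "K - Suc b = K - b - 1" using ij by auto
              then show ?thesis unfolding walk_add[symmetric] True using 2 by (simp only:)
            next
              case False then show ?thesis using that ds unfolding desc_def by simp
            qed
          qed
          have "Suc b < 6 * \<epsilon>"
          proof (rule ccontr)
            assume "\<not> Suc b < 6 * \<epsilon>"
            then have b6: "Suc b = 6 * \<epsilon>" using b by simp
            have wj: "\<forall>j\<le>j0. w j \<in> L \<union> M" using wLM i ij by auto
            obtain r where r: "r \<in> Ln" "\<forall>j<\<Theta>. w (j0 - m + j) = r j"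
              using share[OF pk ds'[unfolded b6] mj m_def db wj] by blast
            have "j0 - m + \<Theta> \<le> n" using ij b6 i mj \<Theta>_bounds(1) unfolding m_def by linarith
            then show False using nopart[OF r(1)] r(2) by blast
          qed
          moreover have "Suc i < n \<longrightarrow> w (Suc i) \<in> G (K - Suc b)"
            using alt[OF wK] G_parity[of "Suc (K - b)" "K - Suc b"] 2 by auto
          moreover have "Suc i - Suc b = Suc j0" "Suc i - 1 - Suc b = j0" using ij by auto
          ultimately have "S2 (Suc i) K (Suc b)"
            unfolding S2_def using pk ds' mj db b(2) by simp
          then show ?thesis by blast
        qed
      qed
    qed
  qed
  have "(\<exists>k a. S1 n k a) \<or> (\<exists>K b. S2 n K b)" using main[OF order_refl] n by blast
  then show ?thesis
  proof
    assume "\<exists>k a. S1 n k a"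
    then obtain k a where s1: "S1 n k a" by blast
    have a: "a \<le> n" "a \<le> k" "asc (walk p0 w (n - a)) (sh (n - a) w) a (k - a)"
      using s1 unfolding S1_def by auto
    have q: "walk p0 w n \<in> E k"
    proof -
      have "walk (walk p0 w (n - a)) (sh (n - a) w) a \<in> E (k - a + a)" using a(3) unfolding asc_def by blast
      then show ?thesis unfolding walk_add[symmetric] using a by simp
    qed
    show ?thesis
    proof
      assume eq: "walk p0 w n = p0"
      \<comment> \<open>Layer 0 occurs in this state only at the very start or after a single letter
        of \<open>L\<close>, and that letter acts freely.\<close>
      then have k0: "k = 0" using q p0 disjE by metis
      then have a0: "a = 0" using a by simp
      have "(n = 0 \<or> (n = 1 \<and> w 0 \<in> G 0)) \<or> (\<exists>s\<in>Ln. desc (walk p0 w (n - a - 1)) s (2 * \<epsilon> + 1) 0)"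
        using s1 unfolding S1_def k0 a0 by auto
      then have n1: "n = 1" "w 0 \<in> G 0" using n unfolding desc_def by auto
      then have "p0 \<odot> w 0 = p0" using eq by simp
      then have "w 0 = e" using gstage.act_free[OF at[of 0] _ V_E(1)[OF p0] n1(2)] by simp
      then show False using w[of 0] n by auto
    qed
  next
    assume "\<exists>K b. S2 n K b"
    then obtain K b where s2: "S2 n K b" by blast
    define j0 where "j0 = n - 1 - b"
    have b: "b < 6 * \<epsilon>" "n = Suc j0 + b" and pk: "pkc K (walk p0 w j0) (w j0)"
      and ds: "desc (walk p0 w (n - b)) (sh (n - b) w) b K"
      using s2 unfolding S2_def j0_def by auto
    have "n - b = Suc j0" using b by simp
    then have q: "walk p0 w n \<in> E (K - b)" using ds unfolding desc_def b(2) walk_add by simp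
    have "A \<le> K" using cell_sidesC[OF pk] unfolding desc_def by metis
    then have "0 < K - b" using b bnd by simp
    then show ?thesis using q p0 disjE by (metis less_irrefl)
  qed
qed

section \<open>The group of transformations generated by the two factors\<close>

definition F :: "'g list \<Rightarrow> 'p \<Rightarrow> 'p" where
  "F xs = (\<lambda>p. if p \<in> \<Omega> then foldl (\<odot>) p xs else p)"

abbreviation W :: "'g list set" where "W \<equiv> lists (L \<union> M)"

definition inw :: "'g list \<Rightarrow> 'g list" where "inw xs = rev (map iv xs)"

lemma foldl_\<Omega>: "xs \<in> W \<Longrightarrow> p \<in> \<Omega> \<Longrightarrow> foldl (\<odot>) p xs \<in> \<Omega>"
  by (induction xs arbitrary: p) (use \<Omega>_act in auto)

lemma F_append: "xs \<in> W \<Longrightarrow> F (xs @ ys) = F ys \<circ> F xs"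
  unfolding F_def by (auto simp: foldl_\<Omega> fun_eq_iff)

lemma inw_W: "xs \<in> W \<Longrightarrow> inw xs \<in> W"
  unfolding inw_def using LM_iv by (auto simp: in_lists_conv_set)

lemma F_mult: "x \<in> G k \<Longrightarrow> y \<in> G k \<Longrightarrow> F [x, y] = F [x \<cdot> y]"
proof
  fix p assume a: "x \<in> G k" "y \<in> G k"
  show "F [x, y] p = F [x \<cdot> y] p"
  proof (cases "p \<in> \<Omega>")
    case True
    obtain l where l: "p \<in> V l" "G l = G k" using \<Omega>_G[OF True] by blast
    then show ?thesis using actm[OF l(1)] a True unfolding F_def by simp
  qed (simp add: F_def)
qed

lemma F_e: "F [e] = F []"
proof
  fix p show "F [e] p = F [] p"
  proof (cases "p \<in> \<Omega>")
    case True
    obtain l where l: "p \<in> V l" "G l = G 0" using \<Omega>_G[OF True] by blast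
    then show ?thesis using acte[OF l(1)] True unfolding F_def by simp
  qed (simp add: F_def)
qed

lemma F_Nil: "F [] = id" unfolding F_def by auto

lemma F_sub: "x \<in> W \<Longrightarrow> u \<in> W \<Longrightarrow> u' \<in> W \<Longrightarrow> F u = F u' \<Longrightarrow> F (x @ u @ y) = F (x @ u' @ y)"
  by (simp add: F_append)

lemma F_sub_l: "u \<in> W \<Longrightarrow> u' \<in> W \<Longrightarrow> F u = F u' \<Longrightarrow> F (u @ y) = F (u' @ y)"
  by (simp add: F_append)

lemma F_sub_r: "x \<in> W \<Longrightarrow> F u = F u' \<Longrightarrow> F (x @ u) = F (x @ u')"
  by (simp add: F_append)

lemma F_inw: "xs \<in> W \<Longrightarrow> F (inw xs @ xs) = id"
proof (induction xs)
  case (Cons x xs)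
  obtain k where k: "x \<in> G k" using LM_G[of x] Cons.prems by auto
  have W: "xs \<in> W" "[x] \<in> W" "[iv x] \<in> W" "inw xs \<in> W" using Cons inw_W LM_iv by auto
  have "F [iv x, x] = F []" using F_mult[OF ivG[OF k] k] F_e k by simp
  then have "F (inw xs @ [iv x, x] @ xs) = F (inw xs @ [] @ xs)" using W by (intro F_sub) auto
  then show ?case using Cons unfolding inw_def by simp
qed (simp add: F_Nil inw_def)

lemma inw_inw: "xs \<in> W \<Longrightarrow> inw (inw xs) = xs"
  unfolding inw_def by (induction xs) auto

lemma F_inw_r: "xs \<in> W \<Longrightarrow> F (xs @ inw xs) = id"
  using F_inw[OF inw_W] inw_inw by metis

lemma F_cancel: "x \<in> W \<Longrightarrow> u \<in> W \<Longrightarrow> u' \<in> W \<Longrightarrow> F (x @ u) = F (x @ u') \<Longrightarrow> F u = F u'"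
proof -
  assume a: "x \<in> W" "u \<in> W" "u' \<in> W" "F (x @ u) = F (x @ u')"
  have "F (inw x @ x @ u) = F (inw x @ x @ u')" using F_sub_r[OF inw_W[OF a(1)] a(4)] .
  moreover have "F (inw x @ x @ u) = F u" for u
    using F_append[of "inw x @ x" u] inw_W[OF a(1)] a(1) F_inw by simp
  ultimately show ?thesis by simp
qed

lemma walk_foldl: "n \<le> length xs \<Longrightarrow> walk p (\<lambda>j. xs ! j) n = foldl (\<odot>) p (take n xs)"
  by (induction n) (auto simp: take_Suc_conv_app_nth)

lemma walk_map: "walk p r n = foldl (\<odot>) p (map r [0..<n])" by (induction n) auto

lemma root_ex: obtains p0 where "p0 \<in> E 0" "p0 \<in> \<Omega>" using root_ne E_\<Omega> by blast

lemma dehn_list: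
  assumes "u \<noteq> []" "\<And>j. j < length u \<Longrightarrow> u ! j \<in> G (m0 + j) - H"
    and "\<And>i r. r \<in> Ln \<Longrightarrow> i + \<Theta> \<le> length u \<Longrightarrow> \<exists>j<\<Theta>. u ! (i + j) \<noteq> r j"
  shows "F u \<noteq> id"
proof -
  obtain p0 where p0: "p0 \<in> E 0" "p0 \<in> \<Omega>" by (rule root_ex)
  have "walk p0 (\<lambda>j. u ! j) (length u) \<noteq> p0"
    by (rule dehn[OF p0(1), of _ _ m0]) (use assms in \<open>auto simp: Suc_le_eq\<close>)
  then have "F u p0 \<noteq> p0" unfolding F_def using p0 walk_foldl[of "length u" u p0] by simp
  then show ?thesis by auto
qed

lemma F_line: "r \<in> Ln \<Longrightarrow> F (map r [0..<P]) = id"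
proof
  fix p assume r: "r \<in> Ln"
  show "F (map r [0..<P]) p = id p"
  proof (cases "p \<in> \<Omega>")
    case True
    then obtain l where "p \<in> E l" unfolding \<Omega>_def by blast
    then have "walk p r P = p" using closed_all[OF _ r] unfolding closed_def by blast
    then show ?thesis unfolding F_def walk_map by simp
  qed (simp add: F_def)
qed

text \<open>Within one factor the action is free. Elements of different factors with the same action
  would give a trivial reduced word of one or two letters, too short to contain a large
  part.\<close>

lemma F_inj: assumes "x \<in> L \<union> M" "y \<in> L \<union> M" "F [x] = F [y]" shows "x = y"
proof -
  obtain p0 where p0: "p0 \<in> E 0" "p0 \<in> \<Omega>" by (rule root_ex)
  obtain k where k: "x \<in> G k" by (rule LM_G[OF assms(1)])
  show ?thesis
  proof (cases "y \<in> G k")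
    case True
    obtain l where l: "p0 \<in> V l" "G l = G k" using \<Omega>_G[OF p0(2)] by blast
    have "p0 \<odot> x = p0 \<odot> y" using fun_cong[OF assms(3), of p0] p0 unfolding F_def by simp
    then show ?thesis using gstage.act_inj2[OF at[of l] order_refl l(1)] l k True by simp
  next
    case False
    have y: "y \<in> G (Suc k)" using False assms(2) unfolding G_def by (auto split: if_splits)
    have yH: "y \<notin> H" using False HG by blast
    have W: "[x] \<in> W" "[y] \<in> W" "[iv x] \<in> W" using assms LM_iv by auto
    have id: "F [iv x, y] = id"
      using F_sub_r[OF W(3) assms(3)] F_inw[OF W(1)] unfolding inw_def by simp
    show ?thesis
    proof (cases "x \<in> H")
      case True
      have x: "x \<in> G (Suc k)" using True HG by blast
      have "F [iv x \<cdot> y] = id" using id F_mult[OF ivG[OF x] y] by simp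
      moreover have "F [iv x \<cdot> y] \<noteq> id"
        by (rule dehn_list[of _ "Suc k"]) (use notH_mult2[of y "Suc k" "iv x"] y yH True \<Theta>_bounds eps in \<open>auto simp: \<Theta>_def\<close>)
      ultimately show ?thesis by simp
    next
      case False
      have "F [iv x, y] \<noteq> id"
      proof (rule dehn_list[of _ k])
        show "[iv x, y] ! j \<in> G (k + j) - H" if "j < length [iv x, y]" for j
          using that notH_iv[of x k] k False y yH by (cases j) auto
      qed (use eps in \<open>auto simp: \<Theta>_def\<close>)
      then show ?thesis using id by simp
    qed
  qed
qed

section \<open>Shortest words, folds and malnormality of the factors\<close>

definition short :: "'g list \<Rightarrow> bool" where
  "short w \<longleftrightarrow> (\<forall>r\<in>Ln. \<forall>i t. i + t \<le> length w \<longrightarrow> (\<forall>j<t. w ! (i + j) = r j) \<longrightarrow> t \<le> P div 2)"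

text \<open>A common part of the inverse word and a line is a common part of the word and the
  reversed line. Cutting it to length \<open>P\<close> keeps it within one period, where the
  reversal is explicit.\<close>

lemma short_inw:
  assumes "w \<in> W" "short w" shows "short (inw w)"
  unfolding short_def
proof (intro ballI allI impI)
  fix r i t assume r: "r \<in> Ln" "i + t \<le> length (inw w)" "\<forall>j<t. inw w ! (i + j) = r j"
  have l: "length (inw w) = length w" unfolding inw_def by simp
  show "t \<le> P div 2"
  proof (rule ccontr)
    assume t: "\<not> t \<le> P div 2"
    define t' where "t' = min t P"
    have t': "t' \<le> t" "t' \<le> P" "\<not> t' \<le> P div 2" using t A_bounds unfolding t'_def by auto
    define s where "s = sh (P - t') (rv P r)"
    have s: "s \<in> Ln" unfolding s_def using Ln_sh Ln_rv r by blast
    have "w ! (length w - i - t' + j) = s j" if j: "j < t'" for j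
    proof -
      have x: "i + (t' - 1 - j) < length w" "length w - Suc (i + (t' - 1 - j)) = length w - i - t' + j"
        using j t' r(2) l by auto
      have "iv (w ! (length w - i - t' + j)) = inw w ! (i + (t' - 1 - j))"
        using x unfolding inw_def by (simp add: rev_nth)
      also have "\<dots> = r (t' - 1 - j)"
      proof -
        have "t' - 1 - j < t" using j t' by linarith
        then show ?thesis using r(3) by blast
      qed
      finally have "iv (iv (w ! (length w - i - t' + j))) = iv (r (t' - 1 - j))" by simp
      moreover have "w ! (length w - i - t' + j) \<in> L \<union> M"
      proof -
        have "length w - i - t' + j < length w" using x j by linarith
        then show ?thesis using assms(1) by (meson in_lists_conv_set nth_mem)
      qed
      moreover have "s j = iv (r (t' - 1 - j))"
      proof -
        have "(j + (P - t')) mod P = j + (P - t')" using j t' by auto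
        moreover have "P - 1 - (j + (P - t')) = t' - 1 - j" using j t' by auto
        ultimately show ?thesis unfolding s_def sh_def rv_def by simp
      qed
      ultimately show ?thesis using iv_iv by simp
    qed
    moreover have "length w - i - t' + t' \<le> length w" using t' r(2) l by auto
    ultimately show False using assms(2) s t'(3) unfolding short_def by blast
  qed
qed

text \<open>This is \<open>NR\<close> for the shifted line: its reverse is a shift of the reverse of
  \<open>r\<close>, and \<open>NR\<close> allows an arbitrary shift.\<close>

lemma no_fold:
  assumes r: "r \<in> Ln" and K: "K \<le> P" shows "\<exists>j<\<epsilon>. sh K r j \<noteq> sh k (rv P r) j"
proof -
  have "sh K r \<in> Ln" using Ln_sh r by blast
  from NR[OF this hper_const[OF eH], of "k + K"]
  obtain j where j: "j < \<epsilon>" "sh K r j \<noteq> twist (\<lambda>_. e) (sh (k + K) (rv P (sh K r))) j" by blast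
  have "sh K (rv P (sh K r)) = rv P r"
    unfolding rv_sh[OF r K] shift_shift using K sh_P[OF Ln_rv[OF r]] by simp
  then have "sh (k + K) (rv P (sh K r)) = sh k (rv P r)" using shift_shift[of k K] by metis
  then show ?thesis using j twist_one Ln_LM[OF Ln_sh[OF Ln_rv[OF r]]] by auto
qed

text \<open>A part of a line cannot run deeply into both halves of a fold, as the line would then agree with its
  own reverse.\<close>

lemma part_bound:
  assumes w: "w \<in> W" "short w" and r: "r \<in> Ln"
    and T: "i + T \<le> length (inw w @ [c] @ w)" "\<forall>j<T. (inw w @ [c] @ w) ! (i + j) = r j"
  shows "T \<le> P div 2 + \<epsilon>"
proof (rule ccontr)
  assume "\<not> T \<le> P div 2 + \<epsilon>"
  then have T': "P div 2 + \<epsilon> + 1 \<le> T" by simp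
  define n where "n = length w"
  have len: "length (inw w) = n" "length (inw w @ [c] @ w) = 2 * n + 1" unfolding inw_def n_def by auto
  have left: "inw w ! x = r (x - i)" if "i \<le> x" "x < n" "x < i + T" for x
    using T(2)[rule_format, of "x - i"] that len(1) by (simp add: nth_append)
  have right: "w ! x = r (n + 1 + x - i)" if "i \<le> n + 1 + x" "x < n" "n + 1 + x < i + T" for x
  proof -
    have "(inw w @ [c] @ w) ! (n + 1 + x) = w ! x" using len(1) by (simp add: nth_append)
    moreover have "i + (n + 1 + x - i) = n + 1 + x" using that by simp
    moreover have "n + 1 + x - i < T" using that by linarith
    ultimately show ?thesis using T(2) by metis
  qed
  have shortD: "s \<in> Ln \<Longrightarrow> i + t \<le> n \<Longrightarrow> (\<forall>j<t. w ! (i + j) = s j) \<Longrightarrow> t \<le> P div 2" for s i t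
    using w(2) unfolding short_def n_def by blast
  have shortDi: "s \<in> Ln \<Longrightarrow> i + t \<le> n \<Longrightarrow> (\<forall>j<t. inw w ! (i + j) = s j) \<Longrightarrow> t \<le> P div 2" for s i t
    using short_inw[OF w] len(1) unfolding short_def by metis
  consider "i + T \<le> n" | "n < i" | "i \<le> n" "n < i + T" by linarith
  then show False
  proof cases
    case 1
    then have "T \<le> P div 2" using shortDi[OF r, of i T] left by simp
    then show False using T' by simp
  next
    case 2
    have "T \<le> P div 2" by (rule shortD[OF r, of "i - n - 1"]) (use right T(1) len 2 in auto)
    then show False using T' by simp
  next
    case 3
    have t1: "n - i \<le> P div 2" using shortDi[OF r, of i "n - i"] left 3 by simp
    define t2 where "t2 = i + T - n - 1"
    have t2: "t2 \<le> P div 2"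
    proof (rule shortD[of "sh (n + 1 - i) r" 0])
      show "sh (n + 1 - i) r \<in> Ln" using Ln_sh r by blast
      show "0 + t2 \<le> n" using T(1) len unfolding t2_def by simp
      show "\<forall>j<t2. w ! (0 + j) = sh (n + 1 - i) r j"
      proof (intro allI impI)
        fix j assume j: "j < t2"
        have "n + 1 + j < i + T" "j < n" using j T(1) len unfolding t2_def by auto
        moreover have "j + (n + 1 - i) = n + 1 + j - i" using 3 by simp
        ultimately show "w ! (0 + j) = sh (n + 1 - i) r j" using right[of j] 3 unfolding sh_def by simp
      qed
    qed
    have e2: "\<epsilon> \<le> n - i" "\<epsilon> \<le> t2" using t1 t2 T' 3 unfolding t2_def by auto
    have KP: "n + 1 - i \<le> P" using t1 A_bounds by linarith
    obtain j where j: "j < \<epsilon>" "sh (n + 1 - i) r j \<noteq> sh (P - (n - i)) (rv P r) j"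
      using no_fold[OF r KP] by blast
    have jn: "j < n" using j e2 by linarith
    have a: "w ! j = sh (n + 1 - i) r j"
    proof -
      have "n + 1 + j < i + T" using j e2(2) unfolding t2_def by simp
      moreover have "j + (n + 1 - i) = n + 1 + j - i" using 3 by simp
      ultimately show ?thesis using right[of j] 3 jn unfolding sh_def by simp
    qed
    have b: "inw w ! (n - 1 - j) = iv (w ! j)" unfolding inw_def using jn n_def by (simp add: rev_nth)
    have "inw w ! (n - 1 - j) = r (n - 1 - j - i)" using left[of "n - 1 - j"] j e2 3 jn by auto
    then have "iv (iv (w ! j)) = iv (r (n - 1 - j - i))" using b by simp
    moreover have "w ! j \<in> L \<union> M" using w(1) jn n_def by (meson in_lists_conv_set nth_mem)
    moreover have "sh (P - (n - i)) (rv P r) j = iv (r (n - 1 - j - i))"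
    proof -
      have "j + (P - (n - i)) < P" using j e2 KP by linarith
      moreover have "P - 1 - (j + (P - (n - i))) = n - 1 - j - i" using j e2 KP 3 by linarith
      ultimately show ?thesis unfolding sh_def rv_def by simp
    qed
    ultimately show False using a j(2) iv_iv by simp
  qed
qed

lemma fold_alt:
  assumes "\<And>j. j < length w \<Longrightarrow> w ! j \<in> G (k + j) - H" "c \<in> G (k + 1) - H" "j < length (inw w @ [c] @ w)"
  shows "(inw w @ [c] @ w) ! j \<in> G (k + 1 + length w + j) - H"
proof -
  define n where "n = length w"
  have len: "length (inw w) = n" unfolding inw_def n_def by simp
  consider "j < n" | "j = n" | x where "j = n + 1 + x" "x < n"
  proof -
    have "j < 2 * n + 1" using assms(3) len n_def by simp
    then show thesis using that(1,2) that(3)[of "j - n - 1"] by linarith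
  qed
  then show ?thesis
  proof cases
    case 1
    have "(inw w @ [c] @ w) ! j = iv (w ! (n - 1 - j))"
      using 1 len unfolding inw_def n_def by (simp add: nth_append rev_nth)
    moreover have "iv (w ! (n - 1 - j)) \<in> G (k + (n - 1 - j)) - H"
      by (rule notH_iv) (use assms(1)[of "n - 1 - j"] 1 n_def in auto)
    moreover have "G (k + (n - 1 - j)) = G (k + 1 + n + j)" by (rule G_parity) (use 1 in auto)
    ultimately show ?thesis unfolding n_def by metis
  next
    case 2
    have "(inw w @ [c] @ w) ! j = c" using 2 len by (simp add: nth_append)
    moreover have "G (k + 1) = G (k + 1 + n + j)" by (rule G_parity) (use 2 in auto)
    ultimately show ?thesis using assms(2) unfolding n_def by metis
  next
    case 3
    have "(inw w @ [c] @ w) ! j = w ! x" using 3 len by (simp add: nth_append)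
    moreover have "G (k + x) = G (k + 1 + n + j)" by (rule G_parity) (use 3 in auto)
    ultimately show ?thesis using assms(1)[of x] 3 unfolding n_def by metis
  qed
qed

text \<open>Only the last letter may deviate from the fold. A part of length \<open>\<Theta>\<close>
  would therefore leave one of length at least \<open>\<Theta> - 1\<close> inside the fold, more
  than the bound \<open>P div 2 + \<epsilon>\<close>.\<close>

lemma fold_nontriv:
  assumes w: "w \<in> W" "short w" and u: "u \<noteq> []" "\<And>j. j < length u \<Longrightarrow> u ! j \<in> G (mu + j) - H"
    and l: "length u \<le> Suc (length (inw w @ [c] @ w))"
    and y: "\<And>j. Suc j < length u \<Longrightarrow> u ! j = (inw w @ [c] @ w) ! j"
  shows "F u \<noteq> id"
proof (rule dehn_list[OF u])
  fix i r assume r: "r \<in> Ln" "i + \<Theta> \<le> length u"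
  show "\<exists>j<\<Theta>. u ! (i + j) \<noteq> r j"
  proof (rule ccontr)
    assume "\<not> ?thesis"
    then have a: "\<forall>j<\<Theta>. u ! (i + j) = r j" by blast
    have "\<Theta> - 1 \<le> P div 2 + \<epsilon>"
    proof (rule part_bound[OF w r(1)])
      show "i + (\<Theta> - 1) \<le> length (inw w @ [c] @ w)" using r(2) l eps unfolding \<Theta>_def by linarith
      show "\<forall>j<\<Theta> - 1. (inw w @ [c] @ w) ! (i + j) = r j"
      proof (intro allI impI)
        fix j assume j: "j < \<Theta> - 1"
        have "u ! (i + j) = (inw w @ [c] @ w) ! (i + j)" by (rule y) (use j r(2) in linarith)
        then show "(inw w @ [c] @ w) ! (i + j) = r j" using a[rule_format, of j] j by simp
      qed
    qed
    then show False using eps unfolding \<Theta>_def by simp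
  qed
qed auto

lemma short_tl: "short (g # w) \<Longrightarrow> short w"
  unfolding short_def
proof (intro ballI allI impI)
  fix r i t assume a: "\<forall>r\<in>Ln. \<forall>i t. i + t \<le> length (g # w) \<longrightarrow> (\<forall>j<t. (g # w) ! (i + j) = r j) \<longrightarrow> t \<le> P div 2"
    and r: "r \<in> Ln" "i + t \<le> length w" "\<forall>j<t. w ! (i + j) = r j"
  show "t \<le> P div 2" using a[rule_format, OF r(1), of "Suc i" t] r by simp
qed

text \<open>Dehn's algorithm: more than half of a relator could be replaced by the inverse of the
  shorter rest.\<close>

lemma minimal_short:
  assumes v: "v \<in> W" and min: "\<And>v'. v' \<in> W \<Longrightarrow> length v' < length v \<Longrightarrow> F v' \<noteq> F v"
  shows "short v"
  unfolding short_def
proof (intro ballI allI impI)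
  fix r i t assume r: "r \<in> Ln" "i + t \<le> length v" "\<forall>j<t. v ! (i + j) = r j"
  show "t \<le> P div 2"
  proof (rule ccontr)
    assume t: "\<not> t \<le> P div 2"
    define t' where "t' = min t P"
    have t': "t' \<le> t" "t' \<le> P" "P - t' < t'" using t A_bounds evenP unfolding t'_def by auto
    define x y z where "x = take i v" and "y = take t' (drop i v)" and "z = drop (i + t') v"
    have v': "v = x @ y @ z" unfolding x_def y_def z_def
      by (metis append_take_drop_id drop_drop add.commute)
    have y: "y = map r [0..<t']"
      by (rule nth_equalityI) (use r t' in \<open>auto simp: y_def\<close>)
    have W: "x \<in> W" "y \<in> W" "z \<in> W" using v v' by auto
    define y' where "y' = map r [t'..<P]"
    have y'W: "y' \<in> W" unfolding y'_def using Ln_LM[OF r(1)] by (auto simp: in_lists_conv_set)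
    have "y @ y' = map r [0..<P]" unfolding y y'_def map_append[symmetric]
      using t' upt_add_eq_append[of 0 t' "P - t'"] by simp
    then have "F (y @ y') = id" using F_line r by simp
    then have "F (y @ y' @ inw y') = F (inw y')" using F_append[of "y @ y'" "inw y'"] W y'W by simp
    moreover have "F (y @ y' @ inw y') = F (y @ [])"
      by (rule F_sub_r) (use W F_inw_r[OF y'W] F_Nil in auto)
    ultimately have "F (inw y') = F y" by simp
    then have "F (x @ inw y' @ z) = F v" unfolding v' using F_sub[OF W(1) inw_W[OF y'W] W(2)] by blast
    moreover have "x @ inw y' @ z \<in> W" using W inw_W[OF y'W] by simp
    moreover have "length (x @ inw y' @ z) < length v"
      using t' unfolding v' y y'_def inw_def by simp
    ultimately show False using min by blast
  qed
qed

text \<open>Two neighbouring letters from the same factor could be multiplied into one.\<close>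

lemma minimal_alt:
  assumes v: "v \<in> W" and min: "\<And>v'. v' \<in> W \<Longrightarrow> length v' < length v \<Longrightarrow> F v' \<noteq> F v"
    and v0: "v \<noteq> []" "v ! 0 \<in> G m - H" and j: "j < length v"
  shows "v ! j \<in> G (m + j) - H"
proof -
  have red: False if "Suc i < length v" "v ! i \<in> G l" "v ! Suc i \<in> G l" for i l
  proof -
    define x z where "x = take i v" and "z = drop (Suc (Suc i)) v"
    have v': "v = x @ [v ! i, v ! Suc i] @ z" unfolding x_def z_def
      using that(1) by (simp add: Cons_nth_drop_Suc)
    have W: "x \<in> W" "z \<in> W" "[v ! i, v ! Suc i] \<in> W" "[v ! i \<cdot> v ! Suc i] \<in> W"
      using v v' GLM[OF mG[OF that(2,3)]] by (metis append_in_lists_conv lists.intros)+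
    have "F (x @ [v ! i \<cdot> v ! Suc i] @ z) = F v"
      by (subst v', rule F_sub[OF W(1,4,3)]) (rule F_mult[OF that(2,3), symmetric])
    moreover have "length (x @ [v ! i \<cdot> v ! Suc i] @ z) < length v" using that unfolding x_def z_def by simp
    ultimately show False using min W by (metis append_in_lists_conv)
  qed
  show ?thesis using j
  proof (induction j)
    case 0 then show ?case using v0 by simp
  next
    case (Suc j)
    have a: "v ! j \<in> G (m + j)" using Suc by simp
    then have b: "v ! Suc j \<notin> G (m + j)" using red[OF Suc.prems] by blast
    have "v ! Suc j \<in> L \<union> M" using v Suc.prems by (meson in_lists_conv_set nth_mem)
    then have "v ! Suc j \<in> G (m + Suc j)" using b unfolding G_def by (auto split: if_splits)
    then show ?case using b HG by blast
  qed
qed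

text \<open>A shortest counterexample \<open>v\<close> neither begins nor ends with a letter from
  \<open>G k\<close>, as such a letter could be absorbed into \<open>a\<close> or \<open>a'\<close>.
  Hence the inverse of \<open>v\<close> followed by \<open>a\<close>, \<open>v\<close> and the
  inverse of \<open>a'\<close> becomes, after absorbing \<open>a\<close> and \<open>a'\<close> where
  they lie in \<open>H\<close>, a reduced word that is a fold up to its last letter. It is
  nontrivial by \<open>fold_nontriv\<close>.\<close>

theorem malnormal_F:
  assumes mal: "\<And>k g h. g \<in> G k - H \<Longrightarrow> h \<in> H \<Longrightarrow> h \<noteq> e \<Longrightarrow> iv g \<cdot> h \<cdot> g \<notin> H"
  assumes "v \<in> W" "a \<in> G k" "a' \<in> G k" "a \<noteq> e" "F ([a] @ v) = F (v @ [a'])"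
  shows "\<exists>g\<in>G k. F v = F [g]"
  using assms(2-)
proof (induction "length v" arbitrary: v a a' rule: less_induct)
  case less
  note v = less.prems(1) and a = less.prems(2-4) and eq = less.prems(5)
  have aW: "[a] \<in> W" "[a'] \<in> W" "[iv a'] \<in> W" using a GLM LM_iv by auto
  show ?case
  proof (rule ccontr)
    assume neg: "\<not> ?case"
    have min: "F v' \<noteq> F v" if v': "v' \<in> W" "length v' < length v" for v'
    proof
      assume e1: "F v' = F v"
      have "F ([a] @ v') = F (v' @ [a'])"
        using eq F_sub_r[OF aW(1) e1] F_sub_l[OF v'(1) v e1] by metis
      then show False using less.hyps[OF v'(2,1) a] e1 neg by simp
    qed
    have ne: "v \<noteq> []" using neg F_e eG[of k] by metis
    then obtain g w where gw: "v = g # w" by (cases v) auto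
    have gW: "[g] \<in> W" "w \<in> W" "g \<in> L \<union> M" using v gw by auto
    have gk: "g \<notin> G k"
    proof
      assume g: "g \<in> G k"
      define b where "b = iv g \<cdot> a \<cdot> g"
      have b: "b \<in> G k" "g \<cdot> b = a \<cdot> g" unfolding b_def using g a by (auto simp: gs[where k=k])
      have "b \<noteq> e"
      proof
        assume "b = e"
        then have "a \<cdot> g = g" using b(2) erG[OF g] by metis
        then have "e \<cdot> g = a \<cdot> g" using elG[OF g] by metis
        then show False using cancel_r[OF g eG a(1)] a(3) by blast
      qed
      moreover have "F ([b] @ w) = F (w @ [a'])"
      proof (rule F_cancel[OF gW(1)])
        show "[b] @ w \<in> W" "w @ [a'] \<in> W" using b GLM gW aW by auto
        have "F [g, b] = F [a, g]" using F_mult[OF g b(1)] F_mult[OF a(1) g] b by simp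
        then have "F ([g, b] @ w) = F ([a, g] @ w)" by (intro F_sub_l) (use gW b GLM aW in auto)
        then show "F ([g] @ [b] @ w) = F ([g] @ w @ [a'])" using eq gw by simp
      qed
      ultimately obtain x where x: "x \<in> G k" "F w = F [x]" using less.hyps[OF _ gW(2) b(1) a(2)] gw by auto
      have "F ([g] @ w) = F ([g] @ [x])" using F_sub_r[OF gW(1) x(2)] .
      then have "F v = F [g \<cdot> x]" unfolding gw append_Cons append_Nil using F_mult[OF g x(1)] by (rule trans)
      then show False using neg mG[OF g x(1)] by (meson bexI)
    qed
    have g1: "g \<in> G (Suc k) - H"
      using gk gW(3) HG[of g k] unfolding G_def by (auto split: if_splits)
    have alt: "v ! j \<in> G (Suc k + j) - H" if "j < length v" for j
      by (rule minimal_alt[OF v min ne _ that]) (use g1 gw in auto)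
    have lst: "last v \<notin> G k"
    proof
      assume g: "last v \<in> G k"
      define h w' where "h = last v" and "w' = butlast v"
      have vw: "v = w' @ [h]" "h \<in> G k" using ne g unfolding h_def w'_def by auto
      have W: "w' \<in> W" "[h] \<in> W" "[iv h] \<in> W" using v vw LM_iv by auto
      define b where "b = h \<cdot> a' \<cdot> iv h"
      have b: "b \<in> G k" "h \<cdot> a' = b \<cdot> h" unfolding b_def using vw a by (auto simp: gs[where k=k])
      have "F ([a] @ w') = F (w' @ [b])"
      proof -
        have "F [h, a'] = F [b, h]" using F_mult[OF vw(2) a(2)] F_mult[OF b(1) vw(2)] b by simp
        then have "F (w' @ [h, a']) = F (w' @ [b, h])" by (intro F_sub_r W)
        then have "F (([a] @ w') @ [h]) = F ((w' @ [b]) @ [h])" using eq vw by simp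
        moreover have "([a] @ w') @ [h] \<in> W" "(w' @ [b]) @ [h] \<in> W" using W aW b(1) GLM by auto
        ultimately have "F ((([a] @ w') @ [h]) @ [iv h]) = F (((w' @ [b]) @ [h]) @ [iv h])"
          using F_sub_l by blast
        moreover have "F ((x @ [h]) @ [iv h]) = F x" if "x \<in> W" for x
          using F_sub_r[OF that, of "[h] @ inw [h]" "[]"] F_inw_r[OF W(2)] F_Nil unfolding inw_def by simp
        ultimately show ?thesis using W aW b GLM by (metis append_in_lists_conv lists.intros)
      qed
      then obtain x where x: "x \<in> G k" "F w' = F [x]"
        using less.hyps[OF _ W(1) a(1) b(1) a(3)] vw by auto
      have "F (w' @ [h]) = F ([x] @ [h])" by (rule F_sub_l[OF W(1) _ x(2)]) (use x GLM in auto)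
      then have "F v = F [x \<cdot> h]" unfolding vw(1) append_Cons append_Nil using F_mult[OF x(1) vw(2)] by (rule trans)
      then show False using neg mG[OF x(1) vw(2)] by (meson bexI)
    qed
    have odd: "odd (length v)"
    proof
      assume ev: "even (length v)"
      have "last v \<in> G (Suc k + (length v - 1)) - H" using alt[of "length v - 1"] ne by (simp add: last_conv_nth)
      moreover have "G (Suc k + (length v - 1)) = G k" by (rule G_parity) (use ev ne in auto)
      ultimately show False using lst by simp
    qed
    have sv: "short v" by (rule minimal_short[OF v min])
    obtain x c m where x: "x \<in> W" "short x" "\<And>j. j < length x \<Longrightarrow> x ! j \<in> G (m + j) - H"
      and c: "c \<in> G (m + 1) - H" and par: "even (m + length x + k)"
      and Fx: "F (inw x @ [c] @ x) = F (inw v @ [a] @ v)"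
    proof (cases "a \<in> H")
      case False
      have "G (Suc k + 1) = G k" by (rule G_parity) simp
      then show thesis by (intro that[of v "Suc k" a] v sv alt) (use False a odd in auto)
    next
      case True
      have ak: "a \<in> G (Suc k)" using True HG by blast
      \<comment> \<open>An \<open>a\<close> in \<open>H\<close> merges with its two neighbours.
        Malnormality of \<open>H\<close> in the factor keeps their product outside \<open>H\<close>,
        so it can serve as the new centre of the fold.\<close>
      define b where "b = iv g \<cdot> a \<cdot> g"
      have b: "b \<in> G (Suc k) - H" unfolding b_def using mal[OF g1 True a(3)] g1 ak by simp
      have gk': "iv g \<in> G (Suc k)" "iv g \<cdot> a \<in> G (Suc k)" using g1 ak by auto
      then have "[iv g, a] \<in> W" "[iv g \<cdot> a] \<in> W" using ak GLM[OF gk'(1)] GLM[OF gk'(2)] GLM[OF ak] by auto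
      from F_sub_l[OF this F_mult[OF gk'(1) ak], of "[g]"]
      have "F [iv g, a, g] = F ([iv g \<cdot> a] @ [g])" by simp
      then have "F [iv g, a, g] = F [b]" using F_mult[of "iv g \<cdot> a" "Suc k" g] g1 ak b_def by simp
      then have "F (inw w @ [b] @ w) = F (inw w @ [iv g, a, g] @ w)"
        by (intro F_sub) (use inw_W[OF gW(2)] b GLM LM_iv g1 ak in auto)
      then have "F (inw w @ [b] @ w) = F (inw v @ [a] @ v)" unfolding gw inw_def by simp
      moreover have "w ! j \<in> G (Suc (Suc k) + j) - H" if "j < length w" for j
        using alt[of "Suc j"] that unfolding gw by simp
      moreover have "G (Suc (Suc k) + 1) = G (Suc k)" by (rule G_parity) simp
      ultimately show thesis
        by (intro that[of w "Suc (Suc k)" b] gW(2)) (use sv short_tl b odd gw in auto)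
    qed
    define y where "y = inw x @ [c] @ x"
    have yW: "y \<in> W" unfolding y_def using inw_W[OF x(1)] x(1) c GLM by auto
    have ly: "length y = 2 * length x + 1" "y \<noteq> []" unfolding y_def inw_def by auto
    have yalt: "y ! j \<in> G (m + 1 + length x + j) - H" if "j < length y" for j
      using fold_alt[OF x(3) c] that unfolding y_def by simp
    have Fy: "F y = F [a']"
    proof -
      have "F (inw v @ [a] @ v) = F (inw v @ v @ [a'])" by (rule F_sub_r[OF inw_W[OF v] eq])
      also have "\<dots> = F ((inw v @ v) @ [a'])" by simp
      also have "\<dots> = F [a']" using F_append[of "inw v @ v" "[a']"] F_inw[OF v] inw_W[OF v] v by simp
      finally show ?thesis using Fx unfolding y_def by simp
    qed
    have Fid: "F (y @ [iv a']) = id"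
      using F_sub_l[OF yW aW(2) Fy, of "[iv a']"] F_inw_r[OF aW(2)] unfolding inw_def by simp
    show False
    proof (cases "a' \<in> H")
      case False
      have "F (y @ [iv a']) \<noteq> id"
      proof (rule fold_nontriv[OF x(1,2), where c=c and mu="m + 1 + length x"])
        fix j assume j: "j < length (y @ [iv a'])"
        show "(y @ [iv a']) ! j \<in> G (m + 1 + length x + j) - H"
        proof (cases "j < length y")
          case True then show ?thesis using yalt by (simp add: nth_append)
        next
          case jl: False
          then have jl: "j = length y" using j by simp
          have "G k = G (m + 1 + length x + j)" by (rule G_parity) (use par jl ly in auto)
          then show ?thesis using jl notH_iv[of a' k] a False by (simp add: nth_append)
        qed
      next
        show "Suc j < length (y @ [iv a']) \<Longrightarrow> (y @ [iv a']) ! j = (inw x @ [c] @ x) ! j" for j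
          unfolding y_def[symmetric] by (simp add: nth_append)
      qed (auto simp: y_def)
      then show False using Fid by blast
    next
      case True
      \<comment> \<open>An \<open>a'\<close> in \<open>H\<close> is absorbed into the last letter,
        which stays outside \<open>H\<close>.\<close>
      define y' z where "y' = butlast y" and "z = last y"
      have yz: "y = y' @ [z]" using ly unfolding y'_def z_def by simp
      define l where "l = m + 1 + length x + length y'"
      have zl: "z \<in> G l - H" using yalt[of "length y'"] unfolding yz l_def by simp
      have al: "iv a' \<in> G l" "iv a' \<in> H" using True HG[of "iv a'" l] by auto
      have "F (y' @ [z, iv a']) = F (y' @ [z \<cdot> iv a'])"
        by (rule F_sub_r) (use yW yz F_mult[of z l "iv a'"] zl al in auto)
      then have "F (y' @ [z \<cdot> iv a']) = id" using Fid unfolding yz by simp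
      moreover have "F (y' @ [z \<cdot> iv a']) \<noteq> id"
      proof (rule fold_nontriv[OF x(1,2), where c=c and mu="m + 1 + length x"])
        fix j assume j: "j < length (y' @ [z \<cdot> iv a'])"
        show "(y' @ [z \<cdot> iv a']) ! j \<in> G (m + 1 + length x + j) - H"
        proof (cases "j < length y'")
          case True then show ?thesis using yalt[of j] unfolding yz by (simp add: nth_append)
        next
          case jl: False
          then have "j = length y'" using j by simp
          then show ?thesis using notH_mult[OF zl al(2)] unfolding l_def by (simp add: nth_append)
        qed
      next
        show "Suc j < length (y' @ [z \<cdot> iv a']) \<Longrightarrow> (y' @ [z \<cdot> iv a']) ! j = (inw x @ [c] @ x) ! j" for j
          unfolding y_def[symmetric] yz by (simp add: nth_append)
        show "length (y' @ [z \<cdot> iv a']) \<le> Suc (length (inw x @ [c] @ x))" unfolding y_def[symmetric] yz by simp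
      qed auto
      ultimately show False by blast
    qed
  qed
qed

end

section \<open>The quotient, realized on a prescribed set\<close>

lemma card_of_lists_le:
  assumes "infinite N" "|A| \<le>o |N|" shows "|lists A| \<le>o |N|"
proof -
  have "|{xs \<in> lists A. length xs = n}| \<le>o |N|" for n
  proof (induction n)
    case 0
    have "{xs \<in> lists A. length xs = 0} = {[]}" by auto
    moreover have "N \<noteq> {}" using assms(1) by auto
    ultimately show ?case using card_of_singl_ordLeq by metis
  next
    case (Suc n)
    have "{xs \<in> lists A. length xs = Suc n} \<subseteq> (\<lambda>(x, xs). x # xs) ` (A \<times> {xs \<in> lists A. length xs = n})"
    proof
      fix ys assume "ys \<in> {xs \<in> lists A. length xs = Suc n}"
      then show "ys \<in> (\<lambda>(x, xs). x # xs) ` (A \<times> {xs \<in> lists A. length xs = n})" by (cases ys) auto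
    qed
    then have "|{xs \<in> lists A. length xs = Suc n}| \<le>o |A \<times> {xs \<in> lists A. length xs = n}|"
      by (rule ordLeq_transitive[OF card_of_mono1 card_of_image])
    moreover have "|A \<times> {xs \<in> lists A. length xs = n}| \<le>o |N|"
      by (rule card_of_Times_ordLeq_infinite_Field) (use assms Suc card_of_card_order_on Field_card_of[of N] in auto)
    ultimately show ?case using ordLeq_transitive by blast
  qed
  then have "|\<Union>n\<in>UNIV. {xs \<in> lists A. length xs = n}| \<le>o |N|"
    using assms(1) by (intro card_of_UNION_ordLeq_infinite) (auto simp: infinite_iff_card_of_nat[symmetric])
  moreover have "(\<Union>n\<in>UNIV. {xs \<in> lists A. length xs = n}) = lists A" by auto
  ultimately show ?thesis by simp
qed

text \<open>Free of inverses: \<open>m a v = m v b\<close> says that \<open>v\<close> conjugates \<open>a\<close> to \<open>b\<close>.\<close>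

definition malnormal :: "'g set \<Rightarrow> 'g set \<Rightarrow> ('g \<Rightarrow> 'g \<Rightarrow> 'g) \<Rightarrow> 'g \<Rightarrow> bool" where
  "malnormal A Q m e \<longleftrightarrow> (\<forall>v\<in>Q. \<forall>a\<in>A. \<forall>b\<in>A. a \<noteq> e \<longrightarrow> m a v = m v b \<longrightarrow> v \<in> A)"

definition common_ext :: "'g set \<Rightarrow> 'g set \<Rightarrow> ('g \<Rightarrow> 'g \<Rightarrow> 'g) \<Rightarrow> 'g \<Rightarrow> 'g set \<Rightarrow> ('g \<Rightarrow> 'g \<Rightarrow> 'g) \<Rightarrow> bool" where
  "common_ext L M f e Q m \<longleftrightarrow> L \<union> M \<subseteq> Q \<and> grp Q m e \<and> (\<forall>x\<in>L. \<forall>y\<in>L. m x y = f x y) \<and>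
     (\<forall>x\<in>M. \<forall>y\<in>M. m x y = f x y) \<and> malnormal L Q m e \<and> malnormal M Q m e"

context complete
begin

text \<open>The renaming \<open>\<psi>\<close> gives the transformations of single elements of
  \<open>L \<union> M\<close> back their old names and takes names from \<open>N\<close> for all
  others. Thus the quotient contains the factors literally, and the tower never has to rename
  elements.\<close>

lemma transport:
  assumes N: "infinite N" "|L \<union> M| \<le>o |N|" "N \<inter> (L \<union> M) = {}"
    and malL: "malnormal (L \<inter> M) L f e" and malM: "malnormal (L \<inter> M) M f e"
  shows "\<exists>Q m. common_ext L M f e Q m \<and> Q \<subseteq> L \<union> M \<union> N \<and> (\<forall>r\<in>Ln. foldl m e (map r [0..<P]) = e)"
proof -
  define \<iota> where "\<iota> x = F [x]" for x
  define Q0 where "Q0 = F ` W"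
  have "|Q0| \<le>o |N|" unfolding Q0_def
    by (rule ordLeq_transitive[OF card_of_image card_of_lists_le[OF N(1,2)]])
  then obtain j where j: "inj_on j Q0" "j ` Q0 \<subseteq> N" using card_of_ordLeq by metis
  have \<iota>inj: "inj_on \<iota> (L \<union> M)" unfolding \<iota>_def inj_on_def using F_inj by blast
  have \<iota>Q: "\<iota> ` (L \<union> M) \<subseteq> Q0" unfolding \<iota>_def Q0_def by auto
  define \<psi> where "\<psi> q = (if q \<in> \<iota> ` (L \<union> M) then inv_into (L \<union> M) \<iota> q else j q)" for q
  have \<psi>\<iota>: "\<psi> (\<iota> x) = x" if "x \<in> L \<union> M" for x unfolding \<psi>_def using that \<iota>inj by simp
  have \<psi>N: "\<psi> q \<in> N" if "q \<in> Q0" "q \<notin> \<iota> ` (L \<union> M)" for q unfolding \<psi>_def using that j by auto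
  have \<psi>LM: "\<psi> q \<in> L \<union> M" if "q \<in> \<iota> ` (L \<union> M)" for q using that \<psi>\<iota> by auto
  have \<psi>inj: "inj_on \<psi> Q0"
  proof (rule inj_onI)
    fix a b assume ab: "a \<in> Q0" "b \<in> Q0" "\<psi> a = \<psi> b"
    consider "a \<in> \<iota> ` (L \<union> M)" "b \<in> \<iota> ` (L \<union> M)" | "a \<notin> \<iota> ` (L \<union> M)" "b \<notin> \<iota> ` (L \<union> M)"
      using \<psi>N \<psi>LM ab N(3) by (metis IntI empty_iff)
    then show "a = b"
    proof cases
      case 1 then show ?thesis using ab \<psi>\<iota> by auto
    next
      case 2 then show ?thesis using ab j unfolding \<psi>_def inj_on_def by auto
    qed
  qed
  define Q where "Q = \<psi> ` Q0"
  define \<chi> where "\<chi> = inv_into Q0 \<psi>"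
  define m where "m x y = \<psi> (\<chi> y \<circ> \<chi> x)" for x y
  have \<chi>\<psi>: "\<chi> (\<psi> q) = q" if "q \<in> Q0" for q unfolding \<chi>_def using \<psi>inj that by simp
  have \<psi>F: "m (\<psi> (F xs)) (\<psi> (F ys)) = \<psi> (F (xs @ ys))" if "xs \<in> W" "ys \<in> W" for xs ys
    unfolding m_def using that \<chi>\<psi> F_append unfolding Q0_def by simp
  have QE: "\<exists>xs\<in>W. x = \<psi> (F xs)" if "x \<in> Q" for x using that unfolding Q_def Q0_def by auto
  have inQ: "xs \<in> W \<Longrightarrow> \<psi> (F xs) \<in> Q" for xs unfolding Q_def Q0_def by blast
  have single: "\<psi> (F [x]) = x" if "x \<in> L \<union> M" for x using \<psi>\<iota>[OF that] unfolding \<iota>_def .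
  have eLM: "e \<in> L \<union> M" using eG[of 0] GLM by blast
  have e: "e = \<psi> (F [])" using single[OF eLM] F_e by simp
  have ext: "m x y = x \<cdot> y" if "x \<in> G k" "y \<in> G k" for x y k
  proof -
    have "m x y = \<psi> (F [x, y])" using \<psi>F[of "[x]" "[y]"] single that GLM by auto
    then show ?thesis using F_mult[OF that] single[OF GLM[OF mG[OF that]]] by simp
  qed
  have grpQ: "grp Q m e"
    unfolding grp_def
  proof (intro conjI ballI)
    show "e \<in> Q" using inQ e by simp
  next
    fix x y assume "x \<in> Q" "y \<in> Q"
    then show "m x y \<in> Q" using QE \<psi>F inQ by (metis append_in_lists_conv)
  next
    fix x y z assume "x \<in> Q" "y \<in> Q" "z \<in> Q"
    then obtain a b c where "a \<in> W" "b \<in> W" "c \<in> W" "x = \<psi> (F a)" "y = \<psi> (F b)" "z = \<psi> (F c)" using QE by metis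
    then show "m (m x y) z = m x (m y z)" using \<psi>F by simp
  next
    fix x assume "x \<in> Q"
    then obtain a where a: "a \<in> W" "x = \<psi> (F a)" using QE by metis
    show "m e x = x" "m x e = x" using \<psi>F[of "[]" a] \<psi>F[of a "[]"] a e by auto
    show "\<exists>y\<in>Q. m x y = e \<and> m y x = e"
      using \<psi>F[OF a(1) inw_W[OF a(1)]] \<psi>F[OF inw_W[OF a(1)] a(1)] F_inw[OF a(1)] F_inw_r[OF a(1)] a(2) e
        inQ[OF inw_W[OF a(1)]] F_Nil by auto
  qed
  have mal: "iv g \<cdot> h \<cdot> g \<notin> H" if g: "g \<in> G k - H" and h: "h \<in> H" "h \<noteq> e" for k g h
  proof
    assume b: "iv g \<cdot> h \<cdot> g \<in> H"
    have hk: "h \<in> G k" using h HG by blast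
    have eq: "h \<cdot> g = g \<cdot> (iv g \<cdot> h \<cdot> g)" using g hk by (simp add: gs[where k=k])
    have "malnormal H (G k) f e" unfolding G_def H_def using malL malM by simp
    then have "g \<in> H"
      using g h(1) b h(2) eq unfolding malnormal_def by blast
    then show False using g by blast
  qed
  have malG: "malnormal (G k) Q m e" for k
    unfolding malnormal_def
  proof (intro ballI impI)
    fix v a b assume v: "v \<in> Q" and ab: "a \<in> G k" "b \<in> G k" "a \<noteq> e" and eq: "m a v = m v b"
    obtain xs where xs: "xs \<in> W" "v = \<psi> (F xs)" using QE v by blast
    have W: "[a] \<in> W" "[b] \<in> W" using ab GLM by auto
    have "\<psi> (F ([a] @ xs)) = \<psi> (F (xs @ [b]))"
      using \<psi>F[OF W(1) xs(1)] \<psi>F[OF xs(1) W(2)] eq xs(2) single W by simp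
    moreover have "[a] @ xs \<in> W" "xs @ [b] \<in> W" using W xs by auto
    ultimately have "F ([a] @ xs) = F (xs @ [b])"
      using \<psi>inj unfolding inj_on_def Q0_def by (meson imageI)
    then obtain g where "g \<in> G k" "F xs = F [g]" using malnormal_F[OF _ xs(1) ab] mal by blast
    then show "v \<in> G k" using xs(2) single GLM by simp
  qed
  have "foldl m e (map r [0..<P]) = e" if r: "r \<in> Ln" for r
  proof -
    have "foldl m e xs = \<psi> (F xs)" if "xs \<in> W" for xs
      using that
    proof (induction xs rule: rev_induct)
      case (snoc x xs)
      then show ?case using \<psi>F[of xs "[x]"] single[of x] by simp
    qed (use e in simp)
    moreover have "map r [0..<P] \<in> W" using Ln_LM[OF r] by (auto simp: in_lists_conv_set)
    ultimately show ?thesis using F_line[OF r] e F_Nil by simp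
  qed
  moreover have "L \<union> M \<subseteq> Q"
  proof
    fix x assume "x \<in> L \<union> M"
    then show "x \<in> Q" using inQ[of "[x]"] single[of x] by simp
  qed
  moreover have "Q \<subseteq> L \<union> M \<union> N" unfolding Q_def using \<psi>N \<psi>LM by blast
  moreover have "G 0 = L" "G 1 = M" by (auto simp: G_def)
  ultimately show ?thesis using grpQ ext[of _ 0] ext[of _ 1] malG[of 0] malG[of 1]
    unfolding common_ext_def by (intro exI[of _ Q] exI[of _ m]) simp
qed

end

context smallcanc
begin

theorem amalgam_quotient:
  assumes N: "infinite N" "|L \<union> M| \<le>o |N|" "N \<inter> (L \<union> M) = {}"
    and malL: "malnormal (L \<inter> M) L f e" and malM: "malnormal (L \<inter> M) M f e"
  shows "\<exists>Q m. common_ext L M f e Q m \<and> Q \<subseteq> L \<union> M \<union> N \<and> (\<forall>r\<in>Ln. foldl m e (map r [0..<P]) = e)"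
proof -
  obtain E :: "nat \<Rightarrow> 'g list set" and act where gst: "\<forall>N. gst E act N" using limit_stage by (elim exE) (rule that)
  interpret complete L M f e Ln P \<epsilon> E act by unfold_locales (use gst gst_iff in blast)
  show ?thesis by (rule transport[OF assms])
qed

end

context amalgam
begin

lemma malD:
  assumes "malnormal (L \<inter> M) L f e" "malnormal (L \<inter> M) M f e"
    and "g \<in> G k - H" "a \<in> H" "b \<in> H" "a \<cdot> g = g \<cdot> b"
  shows "a = e" "b = e"
proof -
  have "malnormal H (G k) f e" unfolding G_def H_def using assms by simp
  then show 1: "a = e" using assms(3-) unfolding malnormal_def by blast
  have "g \<cdot> b = g \<cdot> e" using assms(3,6) 1 elG[of g k] erG[of g k] by simp
  then show "b = e" using cancel_l[of g k b e] assms(3,5) HG by simp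
qed

end

section \<open>Relators spelled with four letters\<close>

text \<open>Each block of 13 letters begins with the only repetition \<open>0 0\<close>, which locates the block; the letters \<open>0 1 3 2\<close>
  following it tell the four letters apart; the last eight letters spell the number of the block in binary, odd places choosing
  between \<open>0\<close> and \<open>3\<close> and even places between \<open>1\<close> and \<open>2\<close> so that no further repetition arises.\<close>

definition pat :: "nat \<Rightarrow> nat" where
  "pat j = (let i = j mod 13; k = (j div 13) mod 256 in
     if i \<le> 1 then 0 else if i = 2 then 1 else if i = 3 then 3 else if i = 4 then 2
     else if odd (k div 2 ^ (i - 5)) then (if odd i then 3 else 2) else (if odd i then 0 else 1))"

lemma pat_less: "pat j < 4" unfolding pat_def Let_def by simp

lemma pat_per: "pat (j + 3328) = pat j"
proof -
  have "(j + 3328) mod 13 = j mod 13" "(j + 3328) div 13 = 256 + j div 13"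
    using mod_mult_self2[of j 13 256] div_mult_self2[of 13 j 256] by simp_all
  then show ?thesis unfolding pat_def by simp
qed

lemma pat_class:
  "j mod 13 \<le> 1 \<Longrightarrow> pat j = 0" "j mod 13 = 2 \<Longrightarrow> pat j = 1" "j mod 13 = 3 \<Longrightarrow> pat j = 3"
  "j mod 13 = 4 \<Longrightarrow> pat j = 2"
  "5 \<le> j mod 13 \<Longrightarrow> odd (j mod 13) \<Longrightarrow> pat j = 0 \<or> pat j = 3"
  "5 \<le> j mod 13 \<Longrightarrow> even (j mod 13) \<Longrightarrow> pat j = 1 \<or> pat j = 2"
  unfolding pat_def Let_def by simp_all

lemma pat_adj: "pat j = pat (Suc j) \<longleftrightarrow> j mod 13 = 0"
proof -
  define i where "i = j mod 13"
  have i: "i < 13" unfolding i_def by simp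
  have i': "Suc j mod 13 = (if i = 12 then 0 else Suc i)" unfolding i_def by (simp add: mod_Suc)
  note c = pat_class[of j, folded i_def] and c' = pat_class[of "Suc j", unfolded i']
  consider "i = 0" | "i = 1" | "i = 2" | "i = 3" | "i = 4" | "5 \<le> i" "i < 12" "odd i" | "5 \<le> i" "i < 12" "even i" | "i = 12"
    using i by linarith
  then show ?thesis unfolding i_def[symmetric]
  proof cases
    case 6 then show "pat j = pat (Suc j) \<longleftrightarrow> i = 0" using c(5) c'(6) by auto
  next
    case 7 then show "pat j = pat (Suc j) \<longleftrightarrow> i = 0" using c(6) c'(5) by auto
  qed (use c c' in auto)
qed

lemma pat_block:
  assumes "j mod 13 = 0"
  shows "pat j = 0" "pat (j + 2) = 1" "pat (j + 3) = 3" "pat (j + 4) = 2"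
    and "5 \<le> b \<Longrightarrow> b \<le> 12 \<Longrightarrow> pat (j + b) = (if odd ((j div 13) mod 256 div 2 ^ (b - 5)) then (if odd b then 3 else 2) else (if odd b then 0 else 1))"
proof -
  obtain q where q: "j = 13 * q" using assms by (metis mod_0_imp_dvd dvdE)
  have 1: "(j + b) mod 13 = b" "(j + b) div 13 = j div 13" if "b < 13" for b using q that by simp_all
  show "pat j = 0" "pat (j + 2) = 1" "pat (j + 3) = 3" "pat (j + 4) = 2"
    using 1[of 2] 1[of 3] 1[of 4] assms unfolding pat_def by simp_all
  show "5 \<le> b \<Longrightarrow> b \<le> 12 \<Longrightarrow> pat (j + b) = (if odd ((j div 13) mod 256 div 2 ^ (b - 5)) then (if odd b then 3 else 2) else (if odd b then 0 else 1))"
    using 1[of b] unfolding pat_def Let_def by simp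
qed

lemma nat_mod_cancel:
  assumes "(x + a) mod n = (y + a) mod n" "a \<le> (n :: nat)" shows "x mod n = y mod n"
proof -
  have "((x + a) mod n + (n - a)) mod n = ((y + a) mod n + (n - a)) mod n" using assms(1) by simp
  then have "(x + a + (n - a)) mod n = (y + a + (n - a)) mod n" unfolding mod_add_left_eq .
  then show ?thesis using assms(2) by simp
qed

lemma bits_eq:
  assumes "k < 256" "k' < (256::nat)" "\<And>i. i < 8 \<Longrightarrow> odd (k div 2 ^ i) \<longleftrightarrow> odd (k' div 2 ^ i)"
  shows "k = k'"
proof -
  have "\<forall>k k'. k < 2 ^ n \<longrightarrow> k' < 2 ^ n \<longrightarrow> (\<forall>i<n. odd (k div 2 ^ i) \<longleftrightarrow> odd (k' div 2 ^ i)) \<longrightarrow> k = (k' :: nat)" for n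
  proof (induction n)
    case (Suc n)
    show ?case
    proof (intro allI impI)
      fix k k' :: nat assume a: "k < 2 ^ Suc n" "k' < 2 ^ Suc n" "\<forall>i<Suc n. odd (k div 2 ^ i) \<longleftrightarrow> odd (k' div 2 ^ i)"
      have "k div 2 < 2 ^ n" "k' div 2 < 2 ^ n" using a by auto
      moreover have "\<forall>i<n. odd (k div 2 div 2 ^ i) \<longleftrightarrow> odd (k' div 2 div 2 ^ i)"
        using a(3) by (auto simp: div_mult2_eq[symmetric] power_Suc[symmetric] simp del: power_Suc)
      ultimately have "k div 2 = k' div 2" using Suc by blast
      moreover have "odd k \<longleftrightarrow> odd k'" using a(3)[rule_format, of 0] by simp
      ultimately show "k = k'" by presburger
    qed
  qed simp
  from this[of 8] show ?thesis using assms by auto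
qed

lemma pat_start: obtains a where "a < 13" "(j + a) mod 13 = (0 :: nat)"
proof
  show "(12 * j) mod 13 < 13" by simp
  have "(j + (12 * j) mod 13) mod 13 = (j + 12 * j) mod 13" by (rule mod_add_right_eq)
  also have "j + 12 * j = 13 * j" by simp
  finally show "(j + (12 * j) mod 13) mod 13 = 0" by simp
qed

text \<open>Only equalities between letters are compared, as the letters of the other word may be
  different elements. The repetition marks the start of a block, its header names the four letters,
  and the binary places give its number. A block starts within 13 places and is complete within 25,
  so a window of 27 is enough.\<close>

lemma pat_recover:
  assumes "\<And>a b. a < 27 \<Longrightarrow> b < 27 \<Longrightarrow> pat (j + a) = pat (j + b) \<longleftrightarrow> pat (j' + a) = pat (j' + b)"
  shows "j mod 3328 = j' mod 3328"
proof -
  obtain a where a: "a < 13" "(j + a) mod 13 = 0" by (rule pat_start)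
  have "pat (j' + a) = pat (j' + Suc a)"
    using assms[of a "Suc a"] a pat_adj[of "j + a"] by simp
  then have a': "(j' + a) mod 13 = 0" using pat_adj[of "j' + a"] by simp
  note p = pat_block[OF a(2)] and p' = pat_block[OF a']
  have same: "pat (j + a + b) = pat (j' + a + b)" if b: "5 \<le> b" "b \<le> 12" for b
  proof -
    have q: "pat (j + a + b) = pat (j + a + c) \<longleftrightarrow> pat (j' + a + b) = pat (j' + a + c)" if "c \<le> 12" for c
      using assms[of "a + b" "a + c"] a b that by (simp add: add.assoc)
    have le: "0 \<le> (12::nat)" "2 \<le> (12::nat)" "3 \<le> (12::nat)" "4 \<le> (12::nat)" by simp_all
    have eq: "X = Y" if "X = 0 \<longleftrightarrow> Y = 0" "X = 1 \<longleftrightarrow> Y = 1" "X = 3 \<longleftrightarrow> Y = 3" "X = 2 \<longleftrightarrow> Y = 2" "X < 4" "Y < 4"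
      for X Y :: nat using that by linarith
    show ?thesis
      by (rule eq[OF q[of 0, OF le(1), unfolded add_0_right p(1) p'(1)] q[of 2, OF le(2), unfolded p(2) p'(2)]
        q[of 3, OF le(3), unfolded p(3) p'(3)] q[of 4, OF le(4), unfolded p(4) p'(4)] pat_less pat_less])
  qed
  have "(j + a) div 13 mod 256 = (j' + a) div 13 mod 256"
  proof (rule bits_eq)
    fix i :: nat assume i: "i < 8"
    show "odd ((j + a) div 13 mod 256 div 2 ^ i) \<longleftrightarrow> odd ((j' + a) div 13 mod 256 div 2 ^ i)"
      using same[of "i + 5"] p(5)[of "i + 5"] p'(5)[of "i + 5"] i by (auto split: if_splits)
  qed auto
  then have "(j + a) mod (13 * 256) = (j' + a) mod (13 * 256)" using a(2) a' unfolding mod_mult2_eq by simp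
  then show ?thesis using nat_mod_cancel[of j a 3328 j'] a(1) by simp
qed

lemma pat_all: assumes "x < 4" obtains b where "b < 27" "pat (j + b) = x"
proof -
  obtain a where a: "a < 13" "(j + a) mod 13 = 0" by (rule pat_start)
  note p = pat_block(1-4)[OF a(2)]
  have "x = 0 \<or> x = 1 \<or> x = 2 \<or> x = 3" using assms by auto
  then show thesis using that[of a] that[of "a + 2"] that[of "a + 3"] that[of "a + 4"] p a
    by (auto simp: add.assoc)
qed

text \<open>Three disjoint windows of 27 places fit into the places from 1 to 83, and each of the
  two sets spoils at most one of them. The sets will be the places of the letter that carries
  \<open>z\<close> in two relators.\<close>

lemma free_window:
  fixes Z Z' :: "nat set"
  assumes "\<And>a b. a \<in> Z \<Longrightarrow> b \<in> Z \<Longrightarrow> a < 84 \<Longrightarrow> b < 84 \<Longrightarrow> a = b"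
    and "\<And>a b. a \<in> Z' \<Longrightarrow> b \<in> Z' \<Longrightarrow> a < 84 \<Longrightarrow> b < 84 \<Longrightarrow> a = b"
  obtains s where "1 \<le> s" "s + 27 \<le> 84" "\<And>a. a < 27 \<Longrightarrow> s + a \<notin> Z \<and> s + a \<notin> Z'"
proof (rule ccontr)
  assume neg: "\<not> thesis"
  note thatI = that
  have "\<exists>a<27. s + a \<in> Z \<or> s + a \<in> Z'" if "1 \<le> s" "s + 27 \<le> 84" for s
    using that neg thatI by blast
  from this[of 1] this[of 28] this[of 55] obtain a b c where
    "a < 27" "1 + a \<in> Z \<or> 1 + a \<in> Z'" "b < 27" "28 + b \<in> Z \<or> 28 + b \<in> Z'" "c < 27" "55 + c \<in> Z \<or> 55 + c \<in> Z'"
    by auto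
  then show False using assms(1)[of "1 + a" "28 + b"] assms(1)[of "1 + a" "55 + c"] assms(1)[of "28 + b" "55 + c"]
      assms(2)[of "1 + a" "28 + b"] assms(2)[of "1 + a" "55 + c"] assms(2)[of "28 + b" "55 + c"] by auto
qed

text \<open>The tuple \<open>(u, x, h, z)\<close> stands for the relation that equates \<open>z\<close> with the product of the \<open>u (pat j) \<cdot> x \<cdot> h\<close>.\<close>

locale presentation = amalgam L M f e
  for L M :: "'g set" and f (infixl "\<cdot>" 70) and e +
  fixes T :: "((nat \<Rightarrow> 'g) \<times> 'g \<times> 'g \<times> 'g) set"
  assumes T_wf: "(u, x, h, z) \<in> T \<Longrightarrow>
      (\<forall>a<4. u a \<in> L \<inter> M) \<and> inj_on u {..<4} \<and> u 0 = e \<and> x \<in> L - M \<and> h \<in> M - L \<and> z \<in> L \<inter> M"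
    and T_coh: "(u, x, h, z) \<in> T \<Longrightarrow> (u', x', h', z') \<in> T \<Longrightarrow> p \<in> L \<inter> M \<Longrightarrow> q \<in> L \<inter> M \<Longrightarrow>
      (\<And>a. a < 4 \<Longrightarrow> p \<cdot> u' a = u a \<cdot> p) \<Longrightarrow> p \<cdot> x' = x \<cdot> q \<Longrightarrow> q \<cdot> h' = h \<cdot> p \<Longrightarrow> p \<cdot> z' = z \<cdot> p"
    and malL: "malnormal (L \<inter> M) L f e" and malM: "malnormal (L \<inter> M) M f e"
begin

lemmas mD = malD[OF malL malM]

text \<open>The inverse of \<open>z\<close> is multiplied into the first letter of each period, so
  the relation becomes a cyclic word whose syllables still alternate.\<close>

fun ltr :: "(nat \<Rightarrow> 'g) \<times> 'g \<times> 'g \<times> 'g \<Rightarrow> nat \<Rightarrow> 'g" where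
  "ltr (u, x, h, z) j = (if j mod 3328 = 0 then iv z \<cdot> (u (pat j) \<cdot> x) else u (pat j) \<cdot> x)"

definition line :: "(nat \<Rightarrow> 'g) \<times> 'g \<times> 'g \<times> 'g \<Rightarrow> nat \<Rightarrow> 'g" where
  "line t i = (if even i then ltr t (i div 2) else fst (snd (snd t)))"

definition Ln0 :: "(nat \<Rightarrow> 'g) set" where
  "Ln0 = {twist c (sh k (line t)) | c k t. hper 6656 c \<and> t \<in> T}"

definition Ln :: "(nat \<Rightarrow> 'g) set" where "Ln = Ln0 \<union> rv 6656 ` Ln0"

lemma G01: "G 0 = L" "G 1 = M" "G (Suc 0) = M" by (auto simp: G_def)

lemma T_D:
  assumes "(u, x, h, z) \<in> T"
  shows "a < 4 \<Longrightarrow> u a \<in> H" "inj_on u {..<4}" "u 0 = e" "x \<in> G 0 - H" "h \<in> G 1 - H" "z \<in> H"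
  using T_wf[OF assms] by (auto simp: H_def G_def)

lemma T_e: assumes "(u, x, h, z) \<in> T" shows "u (pat j) \<in> H" using T_D(1)[OF assms pat_less] .

lemma ltr_G: assumes "t \<in> T" shows "ltr t j \<in> G 0 - H"
proof -
  obtain u x h z where t: "t = (u, x, h, z)" by (cases t) auto
  note d = T_D[OF assms[unfolded t]]
  show ?thesis using t notH_mult2[OF d(4) T_e[OF assms[unfolded t], of j]]
    notH_mult2[OF notH_mult2[OF d(4) T_e[OF assms[unfolded t], of j]], of "iv z"] d(6) by simp
qed

lemma line_G: assumes "t \<in> T" shows "line t i \<in> G i - H"
proof (cases "even i")
  case True
  then have "G i = G 0" by (intro G_parity) simp
  then show ?thesis unfolding line_def using ltr_G[OF assms] True by simp
next
  case False
  then have "G i = G 1" by (intro G_parity) simp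
  then show ?thesis unfolding line_def using assms T_D(5) False by (cases t) auto
qed

lemma line_LM: "t \<in> T \<Longrightarrow> line t i \<in> L \<union> M" using line_G GLM by blast

lemma ltr_per: "ltr t (j + 3328) = ltr t j" by (cases t) (simp add: pat_per)

lemma line_per: "line t (i + 6656) = line t i"
proof -
  have "(i + 6656) div 2 = i div 2 + 3328" by simp
  then show ?thesis unfolding line_def using ltr_per[of t "i div 2"] by simp
qed

section \<open>Small cancellation for the relator lines\<close>

lemma Ln0_alt:
  assumes "r \<in> Ln0" obtains k where "alt r k"
proof -
  obtain c k t where r: "r = twist c (sh k (line t))" "hper 6656 c" "t \<in> T" using assms unfolding Ln0_def by blast
  have "r i \<in> G (k + i) - H" for i
  proof -
    have "sh k (line t) i \<in> G (k + i) - H" using line_G[OF r(3), of "i + k"] unfolding sh_def by (simp add: add.commute)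
    then show ?thesis unfolding r(1) twist_def using notH_mult notH_mult2 r(2) ivH unfolding hper_def by metis
  qed
  then show ?thesis using that unfolding alt_def by blast
qed

lemma Ln0_LM: "r \<in> Ln0 \<Longrightarrow> r i \<in> L \<union> M"
  using Ln0_alt GLM unfolding alt_def by (metis DiffD1)

lemma Ln0_per: assumes "r \<in> Ln0" shows "r (i + 6656) = r i"
proof -
  obtain c k t where r: "r = twist c (sh k (line t))" "hper 6656 c" "t \<in> T" using assms unfolding Ln0_def by blast
  have "line t (i + 6656 + k) = line t (i + k)" using line_per[of t "i + k"] by (simp add: add.assoc add.commute add.left_commute)
  moreover have "c (Suc i + 6656) = c (Suc i)" "c (i + 6656) = c i" using r(2) unfolding hper_def by blast+
  ultimately show ?thesis unfolding r(1) twist_def sh_def by simp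
qed

lemma Ln0_sh: assumes "r \<in> Ln0" shows "sh k r \<in> Ln0"
proof -
  obtain c j t where r: "r = twist c (sh j (line t))" "hper 6656 c" "t \<in> T" using assms unfolding Ln0_def by blast
  have "sh k r = twist (sh k c) (sh (k + j) (line t))" unfolding r(1) shift_twist shift_shift ..
  then show ?thesis using hper_shift[OF r(2)] r(3) unfolding Ln0_def by blast
qed

lemma Ln0_twist: assumes "r \<in> Ln0" "hper 6656 d" shows "twist d r \<in> Ln0"
proof -
  obtain c j t where r: "r = twist c (sh j (line t))" "hper 6656 c" "t \<in> T" using assms unfolding Ln0_def by blast
  have "twist d r = twist (\<lambda>i. c i \<cdot> d i) (sh j (line t))"
    unfolding r(1) by (rule twist_comp) (use line_LM[OF r(3)] r(2) assms(2) in \<open>auto simp: sh_def hper_def\<close>)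
  moreover have "hper 6656 (\<lambda>i. c i \<cdot> d i)" using r(2) assms(2) unfolding hper_def by auto
  ultimately show ?thesis using r(3) unfolding Ln0_def by blast
qed

lemma Ln0_rr: "r \<in> Ln0 \<Longrightarrow> rv 6656 (rv 6656 r) = r"
  by (rule rev_rev) (use Ln0_per Ln0_LM in auto)

text \<open>Malnormality of \<open>H\<close> forces the twisting elements to be constant in the interior of a common part.\<close>

lemma window:
  assumes h: "h \<in> G 1 - H" "h' \<in> G 1" and d: "\<And>i. d i \<in> H"
    and eq: "\<And>i. i < 170 \<Longrightarrow> even (k + i) \<Longrightarrow> r' i = iv (d i) \<cdot> r i \<cdot> d (Suc i)"
      "\<And>i. i < 170 \<Longrightarrow> odd (k + i) \<Longrightarrow> h' = iv (d i) \<cdot> h \<cdot> d (Suc i)"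
    and R: "\<And>i. even (k + i) \<Longrightarrow> r i \<in> G 0"
    and i0: "i0 < 2" "even (k + i0)"
  obtains p q where "p \<in> H" "q \<in> H" "h' = iv q \<cdot> h \<cdot> p"
    "\<And>j. 1 \<le> j \<Longrightarrow> j < 84 \<Longrightarrow> r' (i0 + 2 * j) = iv p \<cdot> r (i0 + 2 * j) \<cdot> q"
proof -
  \<comment> \<open>\<open>p\<close> sits in front of the syllables with \<open>x\<close>, and
    \<open>q\<close> in front of the syllables \<open>h\<close>.\<close>
  define p q where "p j = d (i0 + 2 * j)" and "q j = d (Suc (i0 + 2 * j))" for j
  have pq: "p j \<in> H" "q j \<in> H" "p j \<in> G 1" "q j \<in> G 1" for j unfolding p_def q_def using d HG by auto
  have hj: "h' = iv (q j) \<cdot> h \<cdot> p (Suc j)" if "j < 84" for j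
    using eq(2)[of "Suc (i0 + 2 * j)"] that i0 unfolding p_def q_def by simp
  have rj: "r' (i0 + 2 * j) = iv (p j) \<cdot> r (i0 + 2 * j) \<cdot> q j" if "j < 84" for j
    using eq(1)[of "i0 + 2 * j"] that i0 unfolding p_def q_def by simp
  have step: "q (Suc j) = q j \<and> p (Suc (Suc j)) = p (Suc j)" if j: "Suc j < 84" for j
  proof -
    \<comment> \<open>Two successive occurrences of \<open>h\<close> are twisted into the same
      \<open>h'\<close>. Solving for \<open>h\<close> shows that \<open>h\<close> conjugates one
      quotient of twisting elements to another, and malnormality makes both trivial.\<close>
    have e1: "iv (q j) \<cdot> h \<cdot> p (Suc j) = iv (q (Suc j)) \<cdot> h \<cdot> p (Suc (Suc j))" using hj[of j] hj[of "Suc j"] j by simp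
    have "q (Suc j) \<cdot> iv (q j) \<cdot> h = q (Suc j) \<cdot> (iv (q j) \<cdot> h \<cdot> p (Suc j)) \<cdot> iv (p (Suc j))"
      using pq h by (simp add: gs[where k=1])
    also have "\<dots> = h \<cdot> (p (Suc (Suc j)) \<cdot> iv (p (Suc j)))"
      unfolding e1 using pq h by (simp add: gs[where k=1])
    finally have eq: "q (Suc j) \<cdot> iv (q j) \<cdot> h = h \<cdot> (p (Suc (Suc j)) \<cdot> iv (p (Suc j)))" .
    have "q (Suc j) \<cdot> iv (q j) = e" "p (Suc (Suc j)) \<cdot> iv (p (Suc j)) = e"
      using mD[OF h(1) _ _ eq] pq by auto
    then have "q (Suc j) \<cdot> iv (q j) = q j \<cdot> iv (q j)" "p (Suc (Suc j)) \<cdot> iv (p (Suc j)) = p (Suc j) \<cdot> iv (p (Suc j))"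
      using pq by auto
    then show ?thesis using cancel_r[of "iv (q j)" 1 "q (Suc j)" "q j"] cancel_r[of "iv (p (Suc j))" 1 "p (Suc (Suc j))" "p (Suc j)"] pq by simp
  qed
  have qc: "q j = q 0" if "j < 84" for j using that by (induction j) (use step in auto)
  have pc: "p (Suc j) = p 1" if "j < 84" for j using that
  proof (induction j)
    case (Suc j) then show ?case using step[of j] by simp
  qed simp
  show thesis
  proof (rule that[of "p 1" "q 0"])
    show "h' = iv (q 0) \<cdot> h \<cdot> p 1" using hj[of 0] by simp
    fix j :: nat assume j: "1 \<le> j" "j < 84"
    have "p j = p 1" using pc[of "j - 1"] j by simp
    then show "r' (i0 + 2 * j) = iv (p 1) \<cdot> r (i0 + 2 * j) \<cdot> q 0" using rj[OF j(2)] qc[OF j(2)] by simp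
  qed (use pq in auto)
qed

lemma mod_free: "(J + a) mod 3328 = 0 \<Longrightarrow> (J + b) mod 3328 = 0 \<Longrightarrow> a < 84 \<Longrightarrow> b < 84 \<Longrightarrow> a = (b :: nat)"
proof -
  have *: False if "(J + a) mod 3328 = 0" "(J + b) mod 3328 = 0" "a < b" "b < 84" for a b :: nat
  proof -
    have "3328 dvd (J + b) - (J + a)" using that by (intro dvd_diff_nat) auto
    then have "3328 dvd b - a" by simp
    then show False using that by (auto dest!: dvd_imp_le)
  qed
  assume "(J + a) mod 3328 = 0" "(J + b) mod 3328 = 0" "a < 84" "b < 84"
  then show "a = b" using *[of a b] *[of b a] by (cases a b rule: linorder_cases) auto
qed

lemma line_even: "even (k + i) \<Longrightarrow> sh k (line t) i = ltr t ((k + i) div 2)"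
  unfolding sh_def line_def by (simp add: add.commute)
lemma line_odd: "odd (k + i) \<Longrightarrow> sh k (line (u, x, h, z)) i = h"
  unfolding sh_def line_def by (simp add: add.commute)

text \<open>On the common part the twist is constant by \<open>window\<close>, so away from the
  letter with \<open>z\<close> two letters of one line are equal exactly when those of the other
  are. Then \<open>pat_recover\<close> aligns the positions, and comparing the four letters yields
  the premises of \<open>T_coh\<close>.\<close>

lemma compare:
  assumes t: "t = (u, x, h, z)" "t \<in> T" "t' = (u', x', h', z')" "t' \<in> T" and d: "\<And>i. d i \<in> H"
    and eq: "\<And>i. i < 170 \<Longrightarrow> sh k' (line t') i = iv (d i) \<cdot> sh k (line t) i \<cdot> d (Suc i)"
  shows "sh k' (line t') = sh k (line t') \<and>
    (\<exists>p\<in>H. \<exists>q\<in>H. (\<forall>a<4. p \<cdot> u' a = u a \<cdot> p) \<and> p \<cdot> x' = x \<cdot> q \<and> q \<cdot> h' = h \<cdot> p)"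
proof -
  note D = T_D[OF t(2)[unfolded t(1)]] and D' = T_D[OF t(4)[unfolded t(3)]]
  have par: "even (k + k')"
  proof (rule ccontr)
    assume odd: "odd (k + k')"
    have "sh k' (line t') 0 \<in> G k' - H" using line_G[OF t(4), of k'] unfolding sh_def by simp
    moreover have "iv (d 0) \<cdot> sh k (line t) 0 \<cdot> d (Suc 0) \<in> G k - H"
      using notH_mult notH_mult2 d ivH line_G[OF t(2), of k] unfolding sh_def by (metis add_0)
    moreover have "G k' = G (Suc k)" by (rule G_parity) (use odd in auto)
    ultimately show False using eq[of 0] G_both by auto
  qed
  define i0 where "i0 = k mod 2"
  have i0: "i0 < 2" "even (k + i0)" "even (k' + i0)" unfolding i0_def using par by (auto simp: mod2_eq_if)
  obtain p q where pq: "p \<in> H" "q \<in> H" "h' = iv q \<cdot> h \<cdot> p"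
    "\<And>j. 1 \<le> j \<Longrightarrow> j < 84 \<Longrightarrow> sh k' (line t') (i0 + 2 * j) = iv p \<cdot> sh k (line t) (i0 + 2 * j) \<cdot> q"
  proof (rule window[of h h' d k "sh k' (line t')" "sh k (line t)" i0])
    show "h \<in> G 1 - H" "h' \<in> G 1" using D D' by auto
    show "h' = iv (d i) \<cdot> h \<cdot> d (Suc i)" if "i < 170" "odd (k + i)" for i
      using eq[OF that(1)] line_odd[OF that(2), of u x h z] line_odd[of k' i u' x' h' z'] that(2) par t by simp
    show "sh k (line t) i \<in> G 0" if "even (k + i)" for i
      using line_even[OF that] ltr_G[OF t(2)] by simp
  qed (use d eq i0 in auto)
  define J J' where "J = (k + i0) div 2" and "J' = (k' + i0) div 2"
  have JJ: "k + i0 = 2 * J" "k' + i0 = 2 * J'" unfolding J_def J'_def using i0 by auto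
  have L: "ltr t' (J' + j) = iv p \<cdot> ltr t (J + j) \<cdot> q" if "1 \<le> j" "j < 84" for j
    using pq(4)[OF that] line_even[of k' "i0 + 2 * j" t'] line_even[of k "i0 + 2 * j" t] i0
    by (simp add: JJ add.assoc[symmetric])
  have Z: "a \<in> {a. (J + a) mod 3328 = 0} \<Longrightarrow> b \<in> {a. (J + a) mod 3328 = 0} \<Longrightarrow> a < 84 \<Longrightarrow> b < 84 \<Longrightarrow> a = b" for J a b :: nat
    unfolding mem_Collect_eq by (rule mod_free)
  obtain s where s: "1 \<le> s" "s + 27 \<le> 84"
    "\<And>a. a < 27 \<Longrightarrow> s + a \<notin> {a. (J + a) mod 3328 = 0} \<and> s + a \<notin> {a. (J' + a) mod 3328 = 0}"
  proof (rule free_window[of "{a. (J + a) mod 3328 = 0}" "{a. (J' + a) mod 3328 = 0}"])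
    show "a \<in> {a. (J + a) mod 3328 = 0} \<Longrightarrow> b \<in> {a. (J + a) mod 3328 = 0} \<Longrightarrow> a < 84 \<Longrightarrow> b < 84 \<Longrightarrow> a = b" for a b by (rule Z)
    show "a \<in> {a. (J' + a) mod 3328 = 0} \<Longrightarrow> b \<in> {a. (J' + a) mod 3328 = 0} \<Longrightarrow> a < 84 \<Longrightarrow> b < 84 \<Longrightarrow> a = b" for a b by (rule Z)
  qed (rule that)
  define B B' where "B = J + s" and "B' = J' + s"
  have pG: "p \<in> G 0" "q \<in> G 0" "x \<in> G 0" "x' \<in> G 0" using pq D D' HG by auto
  have uG: "u (pat j) \<in> G 0" "u' (pat j) \<in> G 0" for j using D(1)[OF pat_less] D'(1)[OF pat_less] HG by auto
  have W: "u' (pat (B' + a)) \<cdot> x' = iv p \<cdot> (u (pat (B + a)) \<cdot> x) \<cdot> q" if "a < 27" for a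
    using L[of "s + a"] s(1,2) s(3)[OF that] that unfolding t B_def B'_def by (simp add: add.assoc)
  have inj: "u a = u b \<longleftrightarrow> a = b" "u' a = u' b \<longleftrightarrow> a = b" if "a < 4" "b < 4" for a b
    using D(2) D'(2) that unfolding inj_on_def by auto
  have "B mod 3328 = B' mod 3328"
  proof (rule pat_recover)
    fix a b :: nat assume ab: "a < 27" "b < 27"
    have c: "g \<cdot> x = g' \<cdot> x \<Longrightarrow> g = g'" "g \<cdot> x' = g' \<cdot> x' \<Longrightarrow> g = g'" if "g \<in> G 0" "g' \<in> G 0" for g g'
      using cancel_r[OF pG(3) that] cancel_r[OF pG(4) that] by blast+
    have c2: "g = g'" if g: "g \<in> G 0" "g' \<in> G 0" and e: "iv p \<cdot> g \<cdot> q = iv p \<cdot> g' \<cdot> q" for g g'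
      using cancel_l[OF _ g, of "iv p"] cancel_r[OF pG(2) _ _ e] pG g by simp
    show "pat (B + a) = pat (B + b) \<longleftrightarrow> pat (B' + a) = pat (B' + b)"
    proof
      assume "pat (B + a) = pat (B + b)"
      then have "u' (pat (B' + a)) \<cdot> x' = u' (pat (B' + b)) \<cdot> x'" using W ab by simp
      then show "pat (B' + a) = pat (B' + b)" using c(2)[OF uG(2) uG(2)] inj(2)[OF pat_less pat_less] by blast
    next
      assume "pat (B' + a) = pat (B' + b)"
      then have "iv p \<cdot> (u (pat (B + a)) \<cdot> x) \<cdot> q = iv p \<cdot> (u (pat (B + b)) \<cdot> x) \<cdot> q" using W[OF ab(1)] W[OF ab(2)] by simp
      then have "u (pat (B + a)) \<cdot> x = u (pat (B + b)) \<cdot> x" using c2[of "u (pat (B + a)) \<cdot> x"] uG pG by simp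
      then show "pat (B + a) = pat (B + b)" using c(1)[OF uG(1) uG(1)] inj(1)[OF pat_less pat_less] by blast
    qed
  qed
  then have BB: "B mod 3328 = B' mod 3328" .
  have patB: "pat (B' + a) = pat (B + a)" for a
  proof -
    have "pat (y mod 3328) = pat y" for y by (rule per_mod[of pat 3328, OF pat_per])
    then show ?thesis using BB by (metis mod_add_left_eq)
  qed
  \<comment> \<open>Since \<open>u 0 = e\<close>, a place with letter 0 shows \<open>x\<close>
    alone.\<close>
  obtain a0 where a0: "a0 < 27" "pat (B + a0) = 0" by (rule pat_all[of 0]) auto
  have x': "x' = iv p \<cdot> x \<cdot> q"
    using W[OF a0(1)] patB[of a0] a0(2) D(3) D'(3) pG elG[of x 0] elG[of x' 0] by simp
  have "p \<cdot> u' a = u a \<cdot> p" if a: "a < 4" for a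
  proof -
    obtain b where b: "b < 27" "pat (B + b) = a" using pat_all[OF a] by blast
    have ug: "u a \<in> G 0" "u' a \<in> G 0" using D(1)[OF a] D'(1)[OF a] HG by auto
    have e: "u' a \<cdot> (iv p \<cdot> x \<cdot> q) = iv p \<cdot> (u a \<cdot> x) \<cdot> q" using W[OF b(1)] patB[of b] b(2) x' by simp
    have "p \<cdot> u' a \<cdot> iv p \<cdot> (x \<cdot> q) = p \<cdot> (u' a \<cdot> (iv p \<cdot> x \<cdot> q))" using pG ug by (simp add: gs[where k=0])
    also have "\<dots> = u a \<cdot> (x \<cdot> q)" unfolding e using pG ug by (simp add: gs[where k=0])
    finally have "p \<cdot> u' a \<cdot> iv p = u a" using cancel_r[of "x \<cdot> q" 0 "p \<cdot> u' a \<cdot> iv p" "u a"] pG ug by simp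
    then have "p \<cdot> u' a \<cdot> iv p \<cdot> p = u a \<cdot> p" by simp
    then show ?thesis using pG ug by (simp add: gs[where k=0])
  qed
  moreover have "p \<cdot> x' = x \<cdot> q" unfolding x' using pG by (simp add: gs[where k=0])
  moreover have "q \<cdot> h' = h \<cdot> p" unfolding pq(3) using pq D HG[of p 1] HG[of q 1] by (simp add: gs[where k=1])
  moreover have "sh k' (line t') = sh k (line t')"
  proof -
    have "(J + s) mod 3328 = (J' + s) mod 3328" using BB unfolding B_def B'_def .
    then have "J mod 3328 = J' mod 3328" by (rule nat_mod_cancel) (use s(2) in simp)
    then have "(2 * J) mod (2 * 3328) = (2 * J') mod (2 * 3328)" unfolding mult_mod_right[symmetric] by simp
    then have "(k + i0) mod 6656 = (k' + i0) mod 6656" using JJ by simp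
    then have "k mod 6656 = k' mod 6656" by (rule nat_mod_cancel) (use i0(1) in simp)
    then show ?thesis using sh_mod[of "line t'" 6656, OF line_per] by metis
  qed
  ultimately show ?thesis using pq(1,2) by blast
qed

text \<open>Against an inverse line the elements \<open>x\<close> and \<open>x'\<close> meet in
  opposite order. Two neighbouring letters then give a quotient in \<open>H\<close> that
  \<open>x\<close> conjugates into \<open>H\<close>; it is trivial, so the letters coincide. But
  repetitions occur only at the start of a block.\<close>

lemma no_mixed:
  assumes t: "t \<in> T" "t' \<in> T" and d: "\<And>i. d i \<in> H" and K: "170 \<le> K"
    and eq: "\<And>i. i < 170 \<Longrightarrow> iv (line t' (K - i)) = iv (d i) \<cdot> sh k (line t) i \<cdot> d (Suc i)"
  shows False
proof -
  obtain u x h z where tt: "t = (u, x, h, z)" by (cases t) auto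
  obtain u' x' h' z' where tt': "t' = (u', x', h', z')" by (cases t') auto
  note D = T_D[OF t(1)[unfolded tt]] and D' = T_D[OF t(2)[unfolded tt']]
  have par: "even (k + K)"
  proof (rule ccontr)
    assume odd: "odd (k + K)"
    have "iv (line t' (K - 0)) \<in> G K - H" using notH_iv[OF line_G[OF t(2), of K]] by simp
    moreover have "iv (d 0) \<cdot> sh k (line t) 0 \<cdot> d (Suc 0) \<in> G k - H"
      using notH_mult notH_mult2 d ivH line_G[OF t(1), of k] unfolding sh_def by (metis add_0)
    moreover have "G K = G (Suc k)" by (rule G_parity) (use odd in auto)
    ultimately show False using eq[of 0] G_both by auto
  qed
  define i0 where "i0 = k mod 2"
  have i0: "i0 < 2" "even (k + i0)" "even (K - i0)" "i0 \<le> K" unfolding i0_def using par K by (auto simp: mod2_eq_if)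
  obtain p q where pq: "p \<in> H" "q \<in> H" "iv h' = iv q \<cdot> h \<cdot> p"
    "\<And>j. 1 \<le> j \<Longrightarrow> j < 84 \<Longrightarrow> iv (line t' (K - (i0 + 2 * j))) = iv p \<cdot> sh k (line t) (i0 + 2 * j) \<cdot> q"
  proof (rule window[of h "iv h'" d k "\<lambda>i. iv (line t' (K - i))" "sh k (line t)" i0])
    show "h \<in> G 1 - H" "iv h' \<in> G 1" using D D' by auto
    show "iv h' = iv (d i) \<cdot> h \<cdot> d (Suc i)" if i: "i < 170" "odd (k + i)" for i
    proof -
      have "odd (K - i)" using i par K by auto
      then show ?thesis using eq[OF i(1)] line_odd[OF i(2), of u x h z] unfolding tt tt' by (simp add: line_def)
    qed
    show "sh k (line t) i \<in> G 0" if "even (k + i)" for i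
      using line_even[OF that] ltr_G[OF t(1)] by simp
  qed (use d eq i0 in auto)
  define J J' where "J = (k + i0) div 2" and "J' = (K - i0) div 2"
  have JJ: "k + i0 = 2 * J" "K = 2 * J' + i0" "84 \<le> J'" unfolding J_def J'_def using i0 K by auto
  have L: "iv (ltr t' (J' - j)) = iv p \<cdot> ltr t (J + j) \<cdot> q" if "1 \<le> j" "j < 84" for j
  proof -
    have "K - (i0 + 2 * j) = 2 * (J' - j)" using JJ that by simp
    then have "line t' (K - (i0 + 2 * j)) = ltr t' (J' - j)" by (simp add: line_def)
    then show ?thesis using pq(4)[OF that] line_even[of k "i0 + 2 * j" t] i0
      by (simp add: JJ add.assoc[symmetric])
  qed
  have Z: "a \<in> {a. (J + a) mod 3328 = 0} \<Longrightarrow> b \<in> {a. (J + a) mod 3328 = 0} \<Longrightarrow> a < 84 \<Longrightarrow> b < 84 \<Longrightarrow> a = b" for a b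
    unfolding mem_Collect_eq by (rule mod_free)
  have Z': "a \<in> {a. (J' - a) mod 3328 = 0} \<Longrightarrow> b \<in> {a. (J' - a) mod 3328 = 0} \<Longrightarrow> a < 84 \<Longrightarrow> b < 84 \<Longrightarrow> a = b" for a b
  proof -
    assume a: "a \<in> {a. (J' - a) mod 3328 = 0}" "b \<in> {a. (J' - a) mod 3328 = 0}" "a < 84" "b < 84"
    then have e: "J' - a = J' - 83 + (83 - a)" "J' - b = J' - 83 + (83 - b)" using JJ(3) by simp_all
    have "(J' - 83 + (83 - a)) mod 3328 = 0" "(J' - 83 + (83 - b)) mod 3328 = 0"
      using a(1,2) unfolding mem_Collect_eq e[symmetric] by blast+
    then have "83 - a = 83 - b" by (rule mod_free) auto
    then show "a = b" using a(3,4) by linarith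
  qed
  obtain s where s: "1 \<le> s" "s + 27 \<le> 84"
    "\<And>a. a < 27 \<Longrightarrow> s + a \<notin> {a. (J + a) mod 3328 = 0} \<and> s + a \<notin> {a. (J' - a) mod 3328 = 0}"
    by (rule free_window[of "{a. (J + a) mod 3328 = 0}" "{a. (J' - a) mod 3328 = 0}"]; (rule Z Z' that; assumption))
  have pG: "p \<in> G 0" "q \<in> G 0" "x \<in> G 0" "x' \<in> G 0" using pq D D' HG by auto
  have uH: "u (pat j) \<in> H" "u' (pat j) \<in> H" for j using D(1)[OF pat_less] D'(1)[OF pat_less] by auto
  have uG: "u (pat j) \<in> G 0" "u' (pat j) \<in> G 0" for j using uH HG by auto
  have W: "iv (u' (pat (J' - (s + a))) \<cdot> x') = iv p \<cdot> (u (pat (J + s + a)) \<cdot> x) \<cdot> q" if "a < 27" for a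
    using L[of "s + a"] s(1,2) s(3)[OF that] that unfolding tt tt' by (simp add: add.assoc)
  obtain a where a: "a < 2" "(J + s + a) mod 13 \<noteq> 0"
  proof (cases "(J + s) mod 13 = 0")
    case True
    then have "(J + s + 1) mod 13 \<noteq> 0" by (simp add: mod_Suc)
    then show thesis using that[of 1] by simp
  next
    case False then show thesis using that[of 0] by simp
  qed
  define y y2 v v2 where "y = u (pat (J + s + a))" and "y2 = u (pat (J + s + Suc a))"
    and "v = u' (pat (J' - (s + a)))" and "v2 = u' (pat (J' - (s + Suc a)))"
  have yG: "y \<in> G 0" "y2 \<in> G 0" "v \<in> G 0" "v2 \<in> G 0" "y \<in> H" "y2 \<in> H" "v \<in> H" "v2 \<in> H"
    unfolding y_def y2_def v_def v2_def using uG uH by auto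
  have W1: "iv (v \<cdot> x') = iv p \<cdot> (y \<cdot> x) \<cdot> q" "iv (v2 \<cdot> x') = iv p \<cdot> (y2 \<cdot> x) \<cdot> q"
    using W[of a] W[of "Suc a"] a unfolding y_def y2_def v_def v2_def by simp_all
  have "y \<noteq> y2"
  proof
    assume "y = y2"
    then have "pat (J + s + a) = pat (Suc (J + s + a))"
      using D(2) pat_less[of "J + s + a"] pat_less[of "Suc (J + s + a)"] unfolding y_def y2_def inj_on_def add_Suc_right by simp
    then have "(J + s + a) mod 13 = 0" by (rule iffD1[OF pat_adj])
    then show False using a(2) by contradiction
  qed
  have "v \<cdot> iv v2 = (v \<cdot> x') \<cdot> iv (v2 \<cdot> x')" using yG pG by (simp add: gs[where k=0])
  also have "v \<cdot> x' = iv (iv p \<cdot> (y \<cdot> x) \<cdot> q)" using W1(1) yG pG iv_ivG[of "v \<cdot> x'" 0] by simp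
  also have "iv (iv p \<cdot> (y \<cdot> x) \<cdot> q) \<cdot> iv (v2 \<cdot> x') = iv q \<cdot> (iv x \<cdot> (iv y \<cdot> y2 \<cdot> (x \<cdot> q)))"
    unfolding W1 using yG pG by (simp add: gs[where k=0])
  finally have e: "v \<cdot> iv v2 = iv q \<cdot> (iv x \<cdot> (iv y \<cdot> y2 \<cdot> (x \<cdot> q)))" .
  have "x \<cdot> (q \<cdot> (v \<cdot> iv v2) \<cdot> iv q) = iv y \<cdot> y2 \<cdot> x"
    unfolding e using yG pG by (simp add: gs[where k=0])
  then have "iv y \<cdot> y2 = e" using mD(1)[OF D(4), of "iv y \<cdot> y2" "q \<cdot> (v \<cdot> iv v2) \<cdot> iv q"] yG pq by simp
  then have "iv y \<cdot> y2 = iv y \<cdot> y" by (simp only: ivlG[OF yG(1)])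
  then have "y2 = y" by (rule cancel_l[OF ivG[OF yG(1)] yG(2,1)])
  then show False using \<open>y \<noteq> y2\<close> by simp
qed

lemma twist_eqD:
  assumes s: "s i \<in> L \<union> M" and c: "\<And>i. c i \<in> H" "\<And>i. c' i \<in> H" and eq: "twist c s i = twist c' s' i" and s': "s' i \<in> L \<union> M"
  shows "s' i = iv (c i \<cdot> iv (c' i)) \<cdot> s i \<cdot> (c (Suc i) \<cdot> iv (c' (Suc i)))"
proof -
  obtain k where k: "s i \<in> G k" using s LM_G by blast
  obtain l where l: "s' i \<in> G l" using s' LM_G by blast
  have cG: "c j \<in> G n" "c' j \<in> G n" for j n using c HG by auto
  have "s' i = c' i \<cdot> twist c' s' i \<cdot> iv (c' (Suc i))" unfolding twist_def using l cG by (simp add: gs[where k=l])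
  also have "\<dots> = c' i \<cdot> twist c s i \<cdot> iv (c' (Suc i))" unfolding eq ..
  also have "\<dots> = iv (c i \<cdot> iv (c' i)) \<cdot> s i \<cdot> (c (Suc i) \<cdot> iv (c' (Suc i)))"
    unfolding twist_def using k cG by (simp add: gs[where k=k])
  finally show ?thesis .
qed

text \<open>If the first syllable is unchanged, it conjugates \<open>c 0\<close> to
  \<open>c 1\<close>, and malnormality applies.\<close>

lemma twist_root:
  assumes "r 0 \<in> G k - H" "\<And>i. c i \<in> H" "twist c r 0 = r 0" shows "c 0 = e"
proof -
  have cG: "c i \<in> G k" for i using assms(2) HG by blast
  have "iv (c 0) \<cdot> r 0 \<cdot> c (Suc 0) = r 0" using assms(3) unfolding twist_def .
  then have "c 0 \<cdot> (iv (c 0) \<cdot> r 0 \<cdot> c (Suc 0)) = c 0 \<cdot> r 0" by (rule arg_cong)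
  then have "c 0 \<cdot> r 0 = r 0 \<cdot> c (Suc 0)" using assms(1) cG by (simp add: gs[where k=k])
  then show ?thesis using mD(1)[OF assms(1)] assms(2) by blast
qed

text \<open>\<open>compare\<close> gives a constant twist for \<open>u\<close>, \<open>x\<close> and
  \<open>h\<close>. The letter with \<open>z\<close> was avoided there; \<open>T_coh\<close>
  supplies it, so the twist is valid along the whole line.\<close>

lemma SC_forward:
  assumes "r \<in> Ln0" "s \<in> Ln0" "\<And>i. i < 170 \<Longrightarrow> r i = s i"
  shows "\<exists>c. hper 6656 c \<and> s = twist c r"
proof -
  obtain c k t where r: "r = twist c (sh k (line t))" "hper 6656 c" "t \<in> T" using assms(1) unfolding Ln0_def by blast
  obtain c' k' t' where s: "s = twist c' (sh k' (line t'))" "hper 6656 c'" "t' \<in> T" using assms(2) unfolding Ln0_def by blast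
  obtain u x h z where tt: "t = (u, x, h, z)" by (cases t) auto
  obtain u' x' h' z' where tt': "t' = (u', x', h', z')" by (cases t') auto
  have cH: "c i \<in> H" "c' i \<in> H" for i using r s unfolding hper_def by auto
  have LM: "sh k (line t) i \<in> L \<union> M" "sh k (line t') i \<in> L \<union> M" "sh k' (line t') i \<in> L \<union> M" for i
    using line_LM r s unfolding sh_def by blast+
  have "sh k' (line t') = sh k (line t') \<and>
    (\<exists>p\<in>H. \<exists>q\<in>H. (\<forall>a<4. p \<cdot> u' a = u a \<cdot> p) \<and> p \<cdot> x' = x \<cdot> q \<and> q \<cdot> h' = h \<cdot> p)"
  proof (rule compare[OF tt r(3) tt' s(3)])
    show "c i \<cdot> iv (c' i) \<in> H" for i using cH by simp
    show "sh k' (line t') i = iv (c i \<cdot> iv (c' i)) \<cdot> sh k (line t) i \<cdot> (c (Suc i) \<cdot> iv (c' (Suc i)))" if "i < 170" for i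
      by (rule twist_eqD[of "sh k (line t)" i c c', OF LM(1) cH _ LM(3)]) (use assms(3)[OF that] r s in simp)
  qed
  then obtain p q where k: "sh k' (line t') = sh k (line t')" and pq: "p \<in> H" "q \<in> H"
    "\<And>a. a < 4 \<Longrightarrow> p \<cdot> u' a = u a \<cdot> p" "p \<cdot> x' = x \<cdot> q" "q \<cdot> h' = h \<cdot> p" by blast
  have z: "p \<cdot> z' = z \<cdot> p"
    using T_coh[OF r(3)[unfolded tt] s(3)[unfolded tt'] _ _ pq(3-5)] pq(1,2) unfolding H_def by blast
  note D = T_D[OF r(3)[unfolded tt]] and D' = T_D[OF s(3)[unfolded tt']]
  define d where "d i = (if even i then p else q)" for i :: nat
  have hd: "hper 6656 d" unfolding hper_def d_def using pq by simp
  have pG: "p \<in> G n" "q \<in> G n" for n using pq HG by auto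
  have swap: "y' = iv a \<cdot> y \<cdot> b" if "a \<cdot> y' = y \<cdot> b" "a \<in> G n" "y' \<in> G n" "y \<in> G n" "b \<in> G n" for y y' a b n
  proof -
    have "y' = iv a \<cdot> (a \<cdot> y')" by (rule iv_cancel_l[OF that(2,3), symmetric])
    then show ?thesis unfolding that(1) using that(2-) by (simp add: gs[where k=n])
  qed
  have "line t' = twist d (line t)"
  proof
    fix i
    show "line t' i = twist d (line t) i"
    proof (cases "even i")
      case True
      define j where "j = i div 2"
      have ug: "u (pat j) \<in> G 0" "u' (pat j) \<in> G 0" "x \<in> G 0" "x' \<in> G 0" "z \<in> G 0" "z' \<in> G 0"
        using D(1)[OF pat_less] D'(1)[OF pat_less] D D' HG by auto
      have e1: "u' (pat j) = iv p \<cdot> u (pat j) \<cdot> p" by (rule swap[OF pq(3)[OF pat_less] pG(1) ug(2,1) pG(1)])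
      have e2: "x' = iv p \<cdot> x \<cdot> q" by (rule swap[OF pq(4) pG(1) ug(4,3) pG(2)])
      have e3: "z' = iv p \<cdot> z \<cdot> p" by (rule swap[OF z pG(1) ug(6,5) pG(1)])
      have "ltr t' j = iv p \<cdot> ltr t j \<cdot> q"
        unfolding tt tt' ltr.simps e1 e2 e3 using ug pG[of 0] by (simp add: gs[where k=0])
      then show ?thesis using True unfolding line_def twist_def d_def j_def by simp
    next
      case False
      have "h' = iv q \<cdot> h \<cdot> p" by (rule swap[OF pq(5) pG(2), of 1]) (use D D' pG in auto)
      then show ?thesis using False unfolding line_def twist_def d_def tt tt' by simp
    qed
  qed
  then have "sh k' (line t') = twist (sh k d) (sh k (line t))" using k shift_twist by simp
  moreover have "sh k (line t) = twist (\<lambda>i. iv (c i)) r" unfolding r(1)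
    by (rule twist_undo[symmetric]) (use LM cH in auto)
  ultimately have s': "s = twist c' (twist (sh k d) (twist (\<lambda>i. iv (c i)) r))" using s(1) by simp
  have hs: "hper 6656 (sh k d)" by (rule hper_shift[OF hd])
  have rLM: "\<forall>i. r i \<in> L \<union> M" using Ln0_LM[OF assms(1)] by blast
  have "twist (sh k d) (twist (\<lambda>i. iv (c i)) r) = twist (\<lambda>i. iv (c i) \<cdot> sh k d i) r"
    by (rule twist_comp[OF rLM]) (use cH hs in \<open>auto simp: hper_def\<close>)
  moreover have "twist c' (twist (\<lambda>i. iv (c i) \<cdot> sh k d i) r) = twist (\<lambda>i. iv (c i) \<cdot> sh k d i \<cdot> c' i) r"
    by (rule twist_comp[OF rLM]) (use cH hs in \<open>auto simp: hper_def\<close>)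
  moreover have "hper 6656 (\<lambda>i. iv (c i) \<cdot> sh k d i \<cdot> c' i)" using r(2) s(2) hs unfolding hper_def by auto
  ultimately show ?thesis using s' by metis
qed

lemma no_mixed0:
  assumes r: "r \<in> Ln0" and s: "s \<in> Ln0" shows "\<exists>i<170. r i \<noteq> rv 6656 s i"
proof (rule ccontr)
  assume "\<not> ?thesis"
  then have eq: "r i = rv 6656 s i" if "i < 170" for i using that by blast
  obtain c k t where r: "r = twist c (sh k (line t))" "hper 6656 c" "t \<in> T" using assms(1) unfolding Ln0_def by blast
  obtain c' k' t' where s: "s = twist c' (sh k' (line t'))" "hper 6656 c'" "t' \<in> T" using assms(2) unfolding Ln0_def by blast
  have cH: "c i \<in> H" "c' i \<in> H" for i using r s unfolding hper_def by auto
  show False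
  proof (rule no_mixed[OF r(3) s(3)])
    show "c i \<cdot> iv (c' (6656 - i)) \<in> H" for i using cH by simp
    show "170 \<le> 6655 + k'" by simp
    fix i :: nat assume i: "i < 170"
    define l where "l = 6655 - i"
    have ll: "6656 - i = Suc l" "6656 - Suc i = l" "i mod 6656 = i" unfolding l_def using i by auto
    obtain n where n: "line t' (l + k') \<in> G n" using line_G[OF s(3)] by blast
    have nG: "c j \<in> G m" "c' j \<in> G m" for j m using cH HG by auto
    have "rv 6656 s i = iv (s l)" unfolding rv_def ll(3) l_def by simp
    also have "\<dots> = iv (c' (Suc l)) \<cdot> iv (line t' (l + k')) \<cdot> c' l"
      unfolding s(1) twist_def sh_def using n nG by (simp add: gs[where k=n])
    finally have "twist c (sh k (line t)) i = twist (\<lambda>i. c' (6656 - i)) (\<lambda>i. iv (line t' (6655 + k' - i))) i"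
      using eq[OF i] r(1) ll i unfolding twist_def l_def by simp
    from twist_eqD[OF _ cH(1) _ this]
    show "iv (line t' (6655 + k' - i)) = iv (c i \<cdot> iv (c' (6656 - i))) \<cdot> sh k (line t) i \<cdot> (c (Suc i) \<cdot> iv (c' (6656 - Suc i)))"
      using line_LM[OF r(3)] line_LM[OF s(3)] LM_iv cH unfolding sh_def by blast
  qed
qed

lemma rv_Ln: "r \<in> Ln \<Longrightarrow> rv 6656 r \<in> Ln" unfolding Ln_def using Ln0_rr by auto

lemma Ln_twist0:
  assumes "r \<in> Ln" "hper 6656 c" shows "twist c r \<in> Ln"
proof (cases "r \<in> Ln0")
  case True then show ?thesis using Ln0_twist assms unfolding Ln_def by blast
next
  case False
  then obtain r0 where r0: "r0 \<in> Ln0" "r = rv 6656 r0" using assms unfolding Ln_def by blast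
  obtain d where "hper 6656 d" "twist c r = rv 6656 (twist d r0)"
    using twist_rev[of 6656 r0 c] Ln0_LM[OF r0(1)] assms(2) r0(2) by auto
  then show ?thesis using Ln0_twist[OF r0(1)] unfolding Ln_def by blast
qed

lemma Ln_sh0:
  assumes "r \<in> Ln" shows "sh k r \<in> Ln"
proof (cases "r \<in> Ln0")
  case True then show ?thesis using Ln0_sh assms unfolding Ln_def by blast
next
  case False
  then obtain r0 where r0: "r0 \<in> Ln0" "r = rv 6656 r0" using assms unfolding Ln_def by blast
  obtain j where "sh k r = rv 6656 (sh j r0)" using sh_rev[of 6656 r0 k] Ln0_per[OF r0(1)] r0(2) by auto
  then show ?thesis using Ln0_sh[OF r0(1)] unfolding Ln_def by blast
qed

lemma Ln_alt0: assumes "r \<in> Ln" shows "\<exists>k. alt r k"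
proof (cases "r \<in> Ln0")
  case True then show ?thesis using Ln0_alt by blast
next
  case False
  then obtain r0 where r0: "r0 \<in> Ln0" "r = rv 6656 r0" using assms unfolding Ln_def by blast
  obtain k where k: "alt r0 k" using Ln0_alt[OF r0(1)] by blast
  have "r i \<in> G (Suc k + i) - H" for i
  proof -
    have "r i \<in> G (k + (6655 - i mod 6656)) - H"
      unfolding r0(2) rv_def using notH_iv[OF k[unfolded alt_def, rule_format, of "6655 - i mod 6656"]] by simp
    moreover have "even (k + (6655 - i mod 6656) + (Suc k + i))"
    proof -
      have "i mod 6656 \<le> 6655" "even (i mod 6656) = even i" by (auto simp: dvd_mod_iff)
      then show ?thesis by auto
    qed
    ultimately show ?thesis using G_parity by metis
  qed
  then show ?thesis unfolding alt_def by blast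
qed

lemma SC_all:
  assumes "r \<in> Ln" "s \<in> Ln" "\<And>i. i < 170 \<Longrightarrow> r i = s i"
  shows "\<exists>c. hper 6656 c \<and> c 0 = e \<and> s = twist c r"
proof -
  have "\<exists>c. hper 6656 c \<and> s = twist c r"
  proof (cases "r \<in> Ln0"; cases "s \<in> Ln0")
    assume "r \<in> Ln0" "s \<in> Ln0" then show ?thesis using SC_forward assms(3) by blast
  next
    assume a: "r \<in> Ln0" "s \<notin> Ln0"
    then obtain s0 where s0: "s0 \<in> Ln0" "s = rv 6656 s0" using assms(2) unfolding Ln_def by blast
    then show ?thesis using no_mixed0[OF a(1) s0(1)] assms(3) by auto
  next
    assume a: "r \<notin> Ln0" "s \<in> Ln0"
    then obtain r0 where r0: "r0 \<in> Ln0" "r = rv 6656 r0" using assms(1) unfolding Ln_def by blast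
    then show ?thesis using no_mixed0[OF a(2) r0(1)] assms(3) by metis
  next
    assume a: "r \<notin> Ln0" "s \<notin> Ln0"
    then obtain r0 s0 where r0: "r0 \<in> Ln0" "r = rv 6656 r0" and s0: "s0 \<in> Ln0" "s = rv 6656 s0"
      using assms unfolding Ln_def by blast
    \<comment> \<open>The first 170 syllables of the reverses are the last 170 of the lines
      themselves, which begin at 6656 - 170 = 6486.\<close>
    have "sh 6486 r0 i = sh 6486 s0 i" if "i < 170" for i
    proof -
      have "r (169 - i) = s (169 - i)" using assms(3) by simp
      moreover have "6655 - (169 - i) mod 6656 = i + 6486" using that by simp
      ultimately have "iv (r0 (i + 6486)) = iv (s0 (i + 6486))" unfolding r0(2) s0(2) rv_def by (simp add: add.commute)
      then have "iv (iv (r0 (i + 6486))) = iv (iv (s0 (i + 6486)))" by simp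
      then show ?thesis unfolding sh_def using Ln0_LM[OF r0(1)] Ln0_LM[OF s0(1)] by simp
    qed
    then obtain c where c: "hper 6656 c" "sh 6486 s0 = twist c (sh 6486 r0)"
      using SC_forward[OF Ln0_sh[OF r0(1)] Ln0_sh[OF s0(1)]] by blast
    have full: "sh 170 (sh 6486 q) = q" if "q \<in> Ln0" for q
      unfolding shift_shift sh_def using Ln0_per[OF that] by (simp add: add.commute)
    have "s0 = sh 170 (twist c (sh 6486 r0))" using full[OF s0(1)] c(2) by simp
    then have "s0 = twist (sh 170 c) r0" unfolding shift_twist full[OF r0(1)] .
    then obtain d where "hper 6656 d" "rv 6656 s0 = twist d (rv 6656 r0)"
      using rev_twist[of 6656 r0 "sh 170 c"] Ln0_LM[OF r0(1)] Ln0_per[OF r0(1)] hper_shift[OF c(1)] by auto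
    then show ?thesis unfolding r0(2) s0(2) by blast
  qed
  then obtain c where c: "hper 6656 c" "s = twist c r" by blast
  obtain k where "alt r k" using Ln_alt0[OF assms(1)] by blast
  then have "r 0 \<in> G k - H" unfolding alt_def by (metis add_0_right)
  then have "c 0 = e" by (rule twist_root) (use c assms(3)[of 0] in \<open>auto simp: hper_def\<close>)
  then show ?thesis using c by blast
qed

text \<open>Shifting and twisting a reversed line gives the reverse of a line of \<open>Ln0\<close>,
  and \<open>no_mixed0\<close> separates such reverses from \<open>Ln0\<close>.\<close>

lemma NR_all:
  assumes r: "r \<in> Ln" and c: "hper 6656 c" shows "\<exists>i<170. r i \<noteq> twist c (sh k (rv 6656 r)) i"
proof (cases "r \<in> Ln0")
  case True
  obtain j where j: "sh k (rv 6656 r) = rv 6656 (sh j r)" using sh_rev[of 6656 r k] Ln0_per[OF True] by auto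
  have q: "sh j r \<in> Ln0" using Ln0_sh[OF True] .
  obtain d where d: "hper 6656 d" "twist c (rv 6656 (sh j r)) = rv 6656 (twist d (sh j r))"
    using twist_rev[of 6656 "sh j r" c] Ln0_LM[OF q] c by auto
  show ?thesis using no_mixed0[OF True Ln0_twist[OF q d(1)]] unfolding j d(2) .
next
  case False
  then obtain r0 where r0: "r0 \<in> Ln0" "r = rv 6656 r0" using r unfolding Ln_def by blast
  have "twist c (sh k (rv 6656 r)) \<in> Ln0" unfolding r0(2) Ln0_rr[OF r0(1)] using Ln0_twist Ln0_sh r0(1) c by blast
  then show ?thesis using no_mixed0[OF _ r0(1)] r0(2) by metis
qed

sublocale smallcanc L M f e Ln 6656 170
proof
  show "r (i + 6656) = r i" if "r \<in> Ln" for r i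
    using that Ln0_per unfolding Ln_def by (auto simp: rv_def)
qed (use Ln_alt0 Ln_sh0 rv_Ln Ln_twist0 SC_all NR_all in auto)

lemma line_Ln: "t \<in> T \<Longrightarrow> line t \<in> Ln"
proof -
  assume t: "t \<in> T"
  have "line t = twist (\<lambda>_. e) (sh 0 (line t))" using twist_one[of "line t"] line_LM[OF t] by (simp add: sh_def)
  moreover have "hper 6656 (\<lambda>_. e)" unfolding hper_def by simp
  ultimately show ?thesis using t unfolding Ln_def Ln0_def by blast
qed

end

text \<open>The letters are listed without multiplying \<open>u (pat j)\<close> and
  \<open>x\<close>, because they will be separate elements of a set of full size.\<close>

definition spell :: "(nat \<Rightarrow> 'g) \<Rightarrow> 'g \<Rightarrow> 'g \<Rightarrow> 'g list" where
  "spell u x h = concat (map (\<lambda>j. [u (pat j), x, h]) [0..<3328])"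

lemma set_spell: "set (spell u x h) \<subseteq> insert x (insert h (u ` {..<4}))"
  unfolding spell_def using pat_less by auto

context presentation
begin

text \<open>Over one period the line multiplies to the product of \<open>spell\<close> with the
  inverse of \<open>z\<close> in front, since that inverse enters only the first letter.\<close>

theorem presentation_quotient:
  assumes N: "infinite N" "|L \<union> M| \<le>o |N|" "N \<inter> (L \<union> M) = {}"
  shows "\<exists>Q m. common_ext L M f e Q m \<and> Q \<subseteq> L \<union> M \<union> N \<and> (\<forall>(u, x, h, z)\<in>T. foldl m e (spell u x h) = z)"
proof -
  obtain Q m where ext: "common_ext L M f e Q m" and QN: "Q \<subseteq> L \<union> M \<union> N"
    and rel: "\<forall>r\<in>Ln. foldl m e (map r [0..<6656]) = e"
    using amalgam_quotient[OF N malL malM] by blast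
  note Q = ext[unfolded common_ext_def, THEN conjunct1] ext[unfolded common_ext_def, THEN conjunct2, THEN conjunct1]
    ext[unfolded common_ext_def, THEN conjunct2, THEN conjunct2, THEN conjunct1]
  have cl: "m x y \<in> Q" and ass: "m (m x y) z = m x (m y z)" and id: "m e x = x" "m x e = x" and eQ: "e \<in> Q"
    if "x \<in> Q" "y \<in> Q" "z \<in> Q" for x y z using that Q(2) unfolding grp_def by auto
  have "foldl m e (spell u x h) = z" if T: "(u, x, h, z) \<in> T" for u x h z
  proof -
    define t where "t = (u, x, h, z)"
    note D = T_D[OF T]
    have in0: "u (pat j) \<in> G 0" "x \<in> G 0" "z \<in> G 0" "iv z \<in> G 0" for j
      using D D(1)[OF pat_less] HG by auto
    have inL: "u (pat j) \<in> L" "x \<in> L" "z \<in> L" "iv z \<in> L" "u (pat j) \<cdot> x \<in> L" for j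
      using in0 mG[of "u (pat j)" 0 x for j] unfolding G01 by auto
    have inQ: "u (pat j) \<in> Q" "x \<in> Q" "h \<in> Q" "z \<in> Q" "iv z \<in> Q" for j
      using inL D(5) Q(1) unfolding G01 by auto
    define W where "W n = foldl m e (concat (map (\<lambda>j. [u (pat j), x, h]) [0..<n]))" for n
    define R where "R n = foldl m e (map (line t) [0..<2 * n])" for n
    have W0: "W 0 = e" and WS: "W (Suc n) = m (m (m (W n) (u (pat n))) x) h" for n unfolding W_def by simp_all
    have RS: "R (Suc n) = m (m (R n) (ltr t n)) h" for n
      unfolding R_def by (simp add: line_def t_def)
    have WQ: "W n \<in> Q" for n using W0 WS cl inQ eQ by (induction n) auto
    have "R (Suc n) = m (iv z) (W (Suc n))" if "Suc n \<le> 3328" for n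
      using that
    proof (induction n)
      case 0
      have "R 1 = m (m e (iv z \<cdot> (u (pat 0) \<cdot> x))) h" using RS[of 0] by (simp add: R_def t_def)
      also have "iv z \<cdot> (u (pat 0) \<cdot> x) = m (iv z) (m (u (pat 0)) x)" using Q(3) inL by simp
      finally show ?case using inQ cl id eQ ass WS[of 0] W0 by simp
    next
      case (Suc n)
      have "ltr t (Suc n) = m (u (pat (Suc n))) x" using Suc.prems Q(3) inL unfolding t_def by simp
      then show ?case using RS[of "Suc n"] WS[of "Suc n"] Suc inQ WQ[of "Suc n"] cl ass by simp
    qed
    from this[of 3327] have "R 3328 = m (iv z) (W 3328)" by simp
    moreover have "R 3328 = e" using rel line_Ln[OF T] unfolding R_def t_def by simp
    ultimately have "e = m (iv z) (W 3328)" by simp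
    then have "m z e = m (m z (iv z)) (W 3328)" using ass inQ WQ by simp
    moreover have "m z (iv z) = e" using Q(3) inL in0 by simp
    ultimately show ?thesis unfolding spell_def W_def[symmetric] using id inQ WQ by simp
  qed
  then show ?thesis using ext QN by (intro exI[of _ Q] exI[of _ m]) auto
qed

end

section \<open>Distances and colourings on a successor cardinal\<close>

text \<open>\<open>I\<close> plays the role of \<lambda> and \<open>K\<close> that of its successor.
  The well-orders are those of whole types, and only the subsets \<open>I\<close> and
  \<open>K\<close> carry the cardinal arithmetic.\<close>

locale cardinals = I: wellorder leI ltI + K: wellorder leK ltK
  for leI :: "'i \<Rightarrow> 'i \<Rightarrow> bool" (infix "\<unlhd>" 50) and ltI (infix "\<lhd>" 50)
    and leK :: "'k \<Rightarrow> 'k \<Rightarrow> bool" (infix "\<preceq>" 50) and ltK (infix "\<prec>" 50) +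
  fixes I :: "'i set" and K :: "'k set"
  assumes I_inf: "infinite I" and I_stable: "stable |I|"
    and I_bd: "B \<subseteq> I \<Longrightarrow> |B| <o |I| \<Longrightarrow> \<exists>i\<in>I. \<forall>b\<in>B. b \<lhd> i"
    and I_seg: "i \<in> I \<Longrightarrow> |{j \<in> I. j \<unlhd> i}| <o |I|"
    and K_seg: "b \<in> K \<Longrightarrow> |{a \<in> K. a \<prec> b}| \<le>o |I|"
    and K_bd: "X \<subseteq> K \<Longrightarrow> |X| \<le>o |I| \<Longrightarrow> \<exists>k\<in>K. \<forall>b\<in>X. b \<prec> k"
    and K_big: "X \<subseteq> K \<Longrightarrow> \<not> |X| \<le>o |I| \<Longrightarrow> |K| \<le>o |X|"
begin

lemma card_lt_sub: "A \<subseteq> B \<Longrightarrow> |B| <o |I| \<Longrightarrow> |A| <o |I|"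
  using card_of_mono1 ordLeq_ordLess_trans by blast

lemma card_lt_image: "|B| <o |I| \<Longrightarrow> |f ` B| <o |I|"
  using card_of_image ordLeq_ordLess_trans by blast

lemma card_lt_insert: "|B| <o |I| \<Longrightarrow> |insert x B| <o |I|"
proof -
  assume a: "|B| <o |I|"
  have "|{x}| <o |I|" using card_of_ordLeq_finite[of I "{x}"] I_inf
    not_ordLess_iff_ordLeq[OF card_of_Well_order card_of_Well_order] by blast
  then have "|{x} \<union> B| <o |I|" using a I_inf card_of_Un_ordLess_infinite by blast
  then show ?thesis by simp
qed

lemma card_lt_UN: "|A| <o |I| \<Longrightarrow> (\<And>a. a \<in> A \<Longrightarrow> |F a| <o |I| ) \<Longrightarrow> |\<Union>a\<in>A. F a| <o |I|"
  using stable_UNION[OF I_stable] by blast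

lemma I_up: "i \<in> I \<Longrightarrow> \<exists>j\<in>I. i \<lhd> j" using I_bd[OF _ I_seg[of i]] by auto

text \<open>\<open>r\<close> is an admissible new column of a distance whose earlier columns are
  \<open>F c\<close>: the two middle clauses are the ultrametric inequalities for
  \<open>a \<prec> a' \<prec> b\<close>, and the last says that balls have size less than \<lambda>.
  Together these columns form a locally small subadditive function in the sense of
  Todorcevic.\<close>

definition emap :: "('k \<Rightarrow> 'k \<Rightarrow> 'i) \<Rightarrow> 'k \<Rightarrow> ('k \<Rightarrow> 'i) \<Rightarrow> bool" where
  "emap F b r \<longleftrightarrow> (\<forall>a\<in>K. a \<prec> b \<longrightarrow> r a \<in> I) \<and>
    (\<forall>a\<in>K. \<forall>a'\<in>K. \<forall>i\<in>I. a \<prec> a' \<longrightarrow> a' \<prec> b \<longrightarrow> r a' \<unlhd> i \<longrightarrow> F a' a \<unlhd> i \<longrightarrow> r a \<unlhd> i) \<and>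
    (\<forall>a\<in>K. \<forall>a'\<in>K. \<forall>i\<in>I. a \<prec> a' \<longrightarrow> a' \<prec> b \<longrightarrow> r a \<unlhd> i \<longrightarrow> r a' \<unlhd> i \<longrightarrow> F a' a \<unlhd> i) \<and>
    (\<forall>i\<in>I. |{a \<in> K. a \<prec> b \<and> r a \<unlhd> i}| <o |I| )"

lemmas emapD = emap_def[THEN iffD1, THEN conjunct1, rule_format]
  emap_def[THEN iffD1, THEN conjunct2, THEN conjunct1, rule_format]
  emap_def[THEN iffD1, THEN conjunct2, THEN conjunct2, THEN conjunct1, rule_format]
  emap_def[THEN iffD1, THEN conjunct2, THEN conjunct2, THEN conjunct2, rule_format]

text \<open>The sets \<open>D i\<close> below are the sections \<open>{a. r a \<unlhd> i}\<close> of the new column \<open>r\<close>. The set \<open>C\<close>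
  is cofinal below \<open>b\<close>, and an injection \<open>k\<close> of the predecessors of \<open>b\<close> into \<open>I\<close> is increasing on it.\<close>

lemma emap_step:
  assumes b: "b \<in> K" and IH: "\<And>c. c \<in> K \<Longrightarrow> c \<prec> b \<Longrightarrow> emap F c (F c)"
  shows "\<exists>r. emap F b r"
proof -
  define B where "B = {a \<in> K. a \<prec> b}"
  obtain k where k: "inj_on k B" "k ` B \<subseteq> I" using iffD2[OF card_of_ordLeq K_seg[OF b], folded B_def] by blast
  define C where "C = {x \<in> B. \<forall>x'\<in>B. k x' \<lhd> k x \<longrightarrow> x' \<prec> x}"
  \<comment> \<open>An initial segment of \<open>C\<close> whose points have mutual distances at
    most \<open>i\<close>. Balls of radius \<open>i\<close> around such points are nested, and
    \<open>D i\<close> is their union.\<close>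
  define Ci where "Ci i = {x \<in> C. k x \<unlhd> i \<and> (\<forall>n\<in>C. \<forall>n'\<in>C. n \<prec> n' \<longrightarrow> n' \<preceq> x \<longrightarrow> F n' n \<unlhd> i)}" for i
  define D where "D i = (\<Union>c\<in>Ci i. insert c {x \<in> B. x \<prec> c \<and> F c x \<unlhd> i})" for i
  have CB: "C \<subseteq> B" unfolding C_def by auto
  have CiC: "Ci i \<subseteq> C" for i unfolding Ci_def by auto
  have DB: "D i \<subseteq> B" for i unfolding D_def using CiC CB by auto
  have BD: "c \<in> K" "c \<prec> b" "emap F c (F c)" if "c \<in> B" for c using that IH unfolding B_def by auto
  have FI: "F c a \<in> I" if "c \<in> B" "a \<in> B" "a \<prec> c" for a c
    using emapD(1)[OF BD(3)[OF that(1)] BD(1)[OF that(2)] that(3)] .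
  have F1: "F c a \<unlhd> i" if "c \<in> B" "a' \<in> B" "a \<in> B" "a \<prec> a'" "a' \<prec> c" "F c a' \<unlhd> i" "F a' a \<unlhd> i" "i \<in> I" for a a' c i
    using emapD(2)[OF BD(3)[OF that(1)] BD(1)[OF that(3)] BD(1)[OF that(2)] that(8,4-7)] .
  have F2: "F a' a \<unlhd> i" if "c \<in> B" "a' \<in> B" "a \<in> B" "a \<prec> a'" "a' \<prec> c" "F c a \<unlhd> i" "F c a' \<unlhd> i" "i \<in> I" for a a' c i
    using emapD(3)[OF BD(3)[OF that(1)] BD(1)[OF that(3)] BD(1)[OF that(2)] that(8,4-7)] .
  have F3: "|{a \<in> B. a \<prec> c \<and> F c a \<unlhd> i}| <o |I|" if "c \<in> B" "i \<in> I" for c i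
  proof (rule card_lt_sub)
    show "|{a \<in> K. a \<prec> c \<and> F c a \<unlhd> i}| <o |I|" by (rule emapD(4)[OF BD(3)[OF that(1)] that(2)])
  qed (auto simp: B_def)
  have ksmall: "|{x \<in> B. k x \<unlhd> i}| <o |I|" if "i \<in> I" for i
  proof -
    have "k ` {x \<in> B. k x \<unlhd> i} \<subseteq> {j \<in> I. j \<unlhd> i}" "inj_on k {x \<in> B. k x \<unlhd> i}"
      using k unfolding inj_on_def by auto
    then have "|{x \<in> B. k x \<unlhd> i}| \<le>o |{j \<in> I. j \<unlhd> i}|" using card_of_ordLeq by blast
    then show ?thesis using I_seg[OF that] ordLeq_ordLess_trans by blast
  qed
  \<comment> \<open>A point with least \<open>k\<close> among those from \<open>x\<close> on lies in
    \<open>C\<close>.\<close>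
  have Cfin: "\<exists>c\<in>C. x \<preceq> c" if x: "x \<in> B" for x
  proof -
    define m where "m = I.Least (\<lambda>i. \<exists>c. c \<in> B \<and> x \<preceq> c \<and> k c = i)"
    have "\<exists>i. \<exists>c. c \<in> B \<and> x \<preceq> c \<and> k c = i" using x by blast
    then have "\<exists>c. c \<in> B \<and> x \<preceq> c \<and> k c = m" unfolding m_def by (rule I.LeastI_ex)
    then obtain c where c: "c \<in> B" "x \<preceq> c" "k c = m" by blast
    have "x' \<prec> c" if "x' \<in> B" "k x' \<lhd> k c" for x'
    proof (rule ccontr)
      assume "\<not> x' \<prec> c"
      then have "x \<preceq> x'" using c(2) by (meson K.leI K.order_trans)
      then have "m \<unlhd> k x'" unfolding m_def using that by (intro I.Least_le) blast
      then show False using that c(3) by (simp add: I.leD)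
    qed
    then show ?thesis using c unfolding C_def by blast
  qed
  have kC: "k n \<lhd> k n'" if "n \<in> C" "n' \<in> C" "n \<prec> n'" for n n'
  proof (rule ccontr)
    assume "\<not> k n \<lhd> k n'"
    then have "k n' \<unlhd> k n" by (simp add: I.leI)
    moreover have "k n' \<noteq> k n" using k(1) that CB unfolding inj_on_def by auto
    ultimately have "n' \<prec> n" using that CB unfolding C_def by auto
    then show False using that(3) by (meson K.less_asym)
  qed
  have Cicov: "\<exists>i\<in>I. c \<in> Ci i" if c: "c \<in> C" for c
  proof -
    define X where "X = {n \<in> C. n \<preceq> c}"
    have "X \<subseteq> {x \<in> B. k x \<unlhd> k c}" unfolding X_def using kC c CB by (auto simp: K.le_less I.le_less)
    moreover have "k c \<in> I" using c CB k by auto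
    ultimately have X: "|X| <o |I|" using ksmall card_lt_sub by blast
    define Y where "Y = insert (k c) (\<Union>n\<in>X. (\<lambda>n'. F n' n) ` {n' \<in> X. n \<prec> n'})"
    have "|(\<lambda>n'. F n' n) ` {n' \<in> X. n \<prec> n'}| <o |I|" for n
      by (rule card_lt_image, rule card_lt_sub[OF _ X]) auto
    then have "|Y| <o |I|" unfolding Y_def by (intro card_lt_insert card_lt_UN X)
    moreover have "Y \<subseteq> I" unfolding Y_def X_def using FI CB \<open>k c \<in> I\<close> by auto
    ultimately obtain i where i: "i \<in> I" "\<forall>y\<in>Y. y \<lhd> i" using I_bd by blast
    have "k c \<unlhd> i" using i unfolding Y_def by (simp add: I.less_imp_le)
    moreover have "F n' n \<unlhd> i" if "n \<in> C" "n' \<in> C" "n \<prec> n'" "n' \<preceq> c" for n n'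
    proof -
      have "n \<preceq> c" using that by (meson K.less_imp_le K.order_trans)
      then have "F n' n \<in> Y" unfolding Y_def X_def using that by auto
      then show ?thesis using i by (simp add: I.less_imp_le)
    qed
    ultimately show ?thesis using i c unfolding Ci_def by blast
  qed
  have Cimono: "Ci i \<subseteq> Ci j" if "i \<unlhd> j" for i j unfolding Ci_def using that by (auto intro: I.order_trans)
  have Dmono: "D i \<subseteq> D j" if "i \<unlhd> j" for i j
    unfolding D_def using Cimono[OF that] that by (fastforce intro: I.order_trans)
  have Dcov: "\<exists>i\<in>I. x \<in> D i" if x: "x \<in> B" for x
  proof -
    obtain c where c: "c \<in> C" "x \<preceq> c" using Cfin[OF x] by blast
    obtain i where i: "i \<in> I" "c \<in> Ci i" using Cicov[OF c(1)] by blast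
    show ?thesis
    proof (cases "x = c")
      case True then show ?thesis using i unfolding D_def by auto
    next
      case False
      then have xc: "x \<prec> c" using c(2) by (simp add: K.le_less)
      have Fx: "F c x \<in> I" using FI xc x c CB by blast
      obtain j where j: "j \<in> I" "i \<unlhd> j" "F c x \<unlhd> j"
        using that i Fx I.linear[of i "F c x"] I.order_refl by metis
      then have "c \<in> Ci j" using Cimono i by blast
      then show ?thesis unfolding D_def using j x xc by blast
    qed
  qed
  have Dsmall: "|D i| <o |I|" if i: "i \<in> I" for i
    unfolding D_def
  proof (rule card_lt_UN)
    show "|Ci i| <o |I|" by (rule card_lt_sub[OF _ ksmall[OF i]]) (use CB in \<open>auto simp: Ci_def\<close>)
    show "|insert c {x \<in> B. x \<prec> c \<and> F c x \<unlhd> i}| <o |I|" if "c \<in> Ci i" for c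
      by (rule card_lt_insert, rule F3) (use that CiC CB i in auto)
  qed
  have Ddown: "a \<in> D i" if da: "a' \<in> D i" "a \<in> B" "a \<prec> a'" "F a' a \<unlhd> i" "i \<in> I" for a a' i
  proof -
    obtain c where c: "c \<in> Ci i" "a' = c \<or> (a' \<in> B \<and> a' \<prec> c \<and> F c a' \<unlhd> i)" using da unfolding D_def by auto
    have "a \<prec> c \<and> F c a \<unlhd> i"
      using c(2)
    proof
      assume "a' = c" then show ?thesis using that by simp
    next
      assume a': "a' \<in> B \<and> a' \<prec> c \<and> F c a' \<unlhd> i"
      then have "F c a \<unlhd> i" by (intro F1[of c a' a]) (use that c CiC CB in auto)
      then show ?thesis using a' that by (meson K.less_trans)
    qed
    then show ?thesis unfolding D_def using c that(2) by blast
  qed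
  \<comment> \<open>The nesting of the balls: by the ultrametric inequality the ball around the
    smaller centre is part of that around the larger one.\<close>
  have Dtop: "a = c' \<or> (a \<prec> c' \<and> F c' a \<unlhd> i)" if c: "c \<in> Ci i" "c' \<in> Ci i" "c \<preceq> c'" and a: "a \<in> B" "a = c \<or> (a \<prec> c \<and> F c a \<unlhd> i)" and i: "i \<in> I" for a c c' i
  proof (cases "c = c'")
    case True then show ?thesis using a by simp
  next
    case False
    then have cc: "c \<prec> c'" using c(3) by (simp add: K.le_less)
    then have "F c' c \<unlhd> i" using c CiC unfolding Ci_def by blast
    then show ?thesis using a cc F1[of c' c a i] c CiC CB i by (metis K.less_trans subsetD)
  qed
  have Dpair: "F a' a \<unlhd> i" if a: "a \<in> D i" "a' \<in> D i" "a \<prec> a'" and i: "i \<in> I" for a a' i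
  proof -
    obtain c where c: "c \<in> Ci i" "a = c \<or> (a \<prec> c \<and> F c a \<unlhd> i)" using a(1) unfolding D_def by auto
    obtain c' where c': "c' \<in> Ci i" "a' = c' \<or> (a' \<prec> c' \<and> F c' a' \<unlhd> i)" using a(2) unfolding D_def by auto
    have aB: "a \<in> B" "a' \<in> B" using a DB by auto
    obtain d where d: "d \<in> Ci i" "a = d \<or> (a \<prec> d \<and> F d a \<unlhd> i)" "a' = d \<or> (a' \<prec> d \<and> F d a' \<unlhd> i)"
      using Dtop[OF c(1) c'(1) _ aB(1) c(2) i] Dtop[OF c'(1) c(1) _ aB(2) c'(2) i] c c' K.linear[of c c'] by blast
    have dB: "d \<in> B" using d CiC CB by auto
    show ?thesis using d(2,3) F2[OF dB aB(2,1) a(3) _ _ _ i] a(3) by (metis K.less_asym)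
  qed
  define r where "r x = I.Least (\<lambda>i. i \<in> I \<and> x \<in> D i)" for x
  have r: "r x \<in> I \<and> x \<in> D (r x)" if "x \<in> B" for x
    unfolding r_def by (rule I.LeastI_ex) (use Dcov[OF that] in blast)
  have rD: "r x \<unlhd> i \<longleftrightarrow> x \<in> D i" if "x \<in> B" "i \<in> I" for x i
    using r[OF that(1)] Dmono[of "r x" i] I.Least_le[of "\<lambda>i. i \<in> I \<and> x \<in> D i" i] that unfolding r_def by blast
  have "emap F b r"
    unfolding emap_def
  proof (intro conjI ballI impI)
    show "r a \<in> I" if "a \<in> K" "a \<prec> b" for a using r[of a] that unfolding B_def by auto
    show "r a \<unlhd> i" if "a \<in> K" "a' \<in> K" "i \<in> I" "a \<prec> a'" "a' \<prec> b" "r a' \<unlhd> i" "F a' a \<unlhd> i" for a a' i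
    proof -
      have "a \<in> B" "a' \<in> B" using that K.less_trans unfolding B_def by auto
      then show ?thesis using rD Ddown that by blast
    qed
    show "F a' a \<unlhd> i" if "a \<in> K" "a' \<in> K" "i \<in> I" "a \<prec> a'" "a' \<prec> b" "r a \<unlhd> i" "r a' \<unlhd> i" for a a' i
    proof -
      have "a \<in> B" "a' \<in> B" using that K.less_trans unfolding B_def by auto
      then show ?thesis using rD Dpair that by blast
    qed
    show "|{a \<in> K. a \<prec> b \<and> r a \<unlhd> i}| <o |I|" if "i \<in> I" for i
      by (rule card_lt_sub[OF _ Dsmall[OF that]]) (use rD that B_def in auto)
  qed
  then show ?thesis by blast
qed

definition wfK :: "('k \<times> 'k) set" where "wfK = {(a, b). a \<prec> b}"

lemma wf_wfK: "wf wfK" unfolding wfK_def by (rule K.wf)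

lemma emap_ex: "\<exists>F. \<forall>b\<in>K. emap F b (F b)"
proof -
  have "\<exists>F. \<forall>b. b \<in> K \<longrightarrow> emap F b (F b)"
  proof (rule dependent_wf_choice[OF wf_wfK, of "\<lambda>F b r. b \<in> K \<longrightarrow> emap F b r"])
    fix F G :: "'k \<Rightarrow> 'k \<Rightarrow> 'i" and x r assume "\<And>z. (z, x) \<in> wfK \<Longrightarrow> F z = G z"
    then have "F a' a = G a' a" if "a' \<prec> x" for a a' using that unfolding wfK_def by simp
    then show "(x \<in> K \<longrightarrow> emap F x r) = (x \<in> K \<longrightarrow> emap G x r)" unfolding emap_def by auto
  next
    fix x and F :: "'k \<Rightarrow> 'k \<Rightarrow> 'i" assume "\<And>y. (y, x) \<in> wfK \<Longrightarrow> y \<in> K \<longrightarrow> emap F y (F y)"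
    then show "\<exists>r. x \<in> K \<longrightarrow> emap F x r" using emap_step[of x F] unfolding wfK_def by auto
  qed
  then show ?thesis by blast
qed

section \<open>Limit points of unbounded sets, and colourings that meet them\<close>

definition unb :: "'k set \<Rightarrow> bool" where "unb A \<longleftrightarrow> A \<subseteq> K \<and> (\<forall>k\<in>K. \<exists>a\<in>A. k \<prec> a)"

definition lim :: "'k set \<Rightarrow> 'k \<Rightarrow> bool" where
  "lim A \<delta> \<longleftrightarrow> (\<forall>\<zeta>\<in>K. \<zeta> \<prec> \<delta> \<longrightarrow> (\<exists>a\<in>A. \<zeta> \<prec> a \<and> a \<prec> \<delta>))"

text \<open>Cofinality at least \<lambda>. At such a point the balls of the distance, being small,
  are bounded strictly below.\<close>

definition reg :: "'k \<Rightarrow> bool" where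
  "reg \<delta> \<longleftrightarrow> \<delta> \<in> K \<and> (\<forall>B. B \<subseteq> K \<longrightarrow> (\<forall>b\<in>B. b \<prec> \<delta>) \<longrightarrow> |B| <o |I| \<longrightarrow> (\<exists>\<zeta>\<in>K. \<zeta> \<prec> \<delta> \<and> (\<forall>b\<in>B. b \<prec> \<zeta>)))"

text \<open>An increasing sequence of length \<lambda> is chosen with a point of every
  \<open>X j\<close> between any two of its members. Its supremum is a limit of all
  \<open>X j\<close>, and regularity of \<lambda> gives it the required cofinality.\<close>

lemma limit_point:
  assumes X: "\<And>j. j \<in> I \<Longrightarrow> unb (X j)" and \<xi>: "\<xi> \<in> K"
  shows "\<exists>\<delta>. reg \<delta> \<and> \<xi> \<prec> \<delta> \<and> (\<forall>j\<in>I. lim (X j) \<delta>)"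
proof -
  define R where "R f \<nu> r \<longleftrightarrow> (\<nu> \<in> I \<longrightarrow> r \<in> K \<and> \<xi> \<prec> r \<and> (\<forall>\<mu>\<in>I. \<mu> \<lhd> \<nu> \<longrightarrow> (\<forall>j\<in>I. \<exists>a\<in>X j. f \<mu> \<prec> a \<and> a \<prec> r)))"
    for f :: "'i \<Rightarrow> 'k" and \<nu> r
  have "\<exists>b. \<forall>\<nu>. R b \<nu> (b \<nu>)"
  proof (rule dependent_wf_choice[of "{(a, b). a \<lhd> b}" R])
    show "wf {(a, b). a \<lhd> b}" by (rule I.wf)
    show "R f x r = R g x r" if "\<And>z. (z, x) \<in> {(a, b). a \<lhd> b} \<Longrightarrow> f z = g z" for f g :: "'i \<Rightarrow> 'k" and x r
      using that unfolding R_def by simp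
    show "\<exists>r. R f x r" if f: "\<And>y. (y, x) \<in> {(a, b). a \<lhd> b} \<Longrightarrow> R f y (f y)" for x f
    proof -
      define W where "W = {\<mu> \<in> I. \<mu> \<lhd> x}"
      have "\<exists>a. a \<in> X j \<and> f \<mu> \<prec> a" if "\<mu> \<in> W" "j \<in> I" for \<mu> j
        using f[of \<mu>] that X[of j] unfolding R_def W_def unb_def by auto
      then obtain s where s: "\<And>\<mu> j. \<mu> \<in> W \<Longrightarrow> j \<in> I \<Longrightarrow> s \<mu> j \<in> X j \<and> f \<mu> \<prec> s \<mu> j" by metis
      have "|W \<times> I| \<le>o |I|" by (rule card_of_Times_ordLeq_infinite_Field)
        (use I_inf in \<open>auto simp: W_def Field_card_of card_of_card_order_on intro: card_of_mono1 ordLeq_reflexive card_of_Well_order\<close>)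
      then have "|(\<lambda>(\<mu>, j). s \<mu> j) ` (W \<times> I)| \<le>o |I|" using card_of_image ordLeq_transitive by blast
      moreover have "|{\<xi>}| \<le>o |I|" using I_inf by (intro card_of_singl_ordLeq) auto
      ultimately have "|(\<lambda>(\<mu>, j). s \<mu> j) ` (W \<times> I) \<union> {\<xi>}| \<le>o |I|"
        by (intro card_of_Un_ordLeq_infinite_Field) (auto simp: I_inf Field_card_of card_of_card_order_on)
      moreover have "(\<lambda>(\<mu>, j). s \<mu> j) ` (W \<times> I) \<union> {\<xi>} \<subseteq> K" using s X \<xi> unfolding unb_def by auto
      ultimately obtain k where k: "k \<in> K" "\<forall>b\<in>(\<lambda>(\<mu>, j). s \<mu> j) ` (W \<times> I) \<union> {\<xi>}. b \<prec> k" using K_bd by blast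
      have "R f x k" unfolding R_def using k s unfolding W_def by fastforce
      then show ?thesis by blast
    qed
  qed
  then obtain b where b: "\<And>\<nu>. R b \<nu> (b \<nu>)" by blast
  have bK: "b \<nu> \<in> K" "\<xi> \<prec> b \<nu>" if "\<nu> \<in> I" for \<nu> using b that unfolding R_def by auto
  have bX: "\<exists>a\<in>X j. b \<mu> \<prec> a \<and> a \<prec> b \<nu>" if "\<mu> \<in> I" "\<nu> \<in> I" "\<mu> \<lhd> \<nu>" "j \<in> I" for \<mu> \<nu> j
    using b that unfolding R_def by blast
  obtain j0 where j0: "j0 \<in> I" using infinite_imp_nonempty[OF I_inf] by blast
  have bm: "b \<mu> \<prec> b \<nu>" if "\<mu> \<in> I" "\<nu> \<in> I" "\<mu> \<lhd> \<nu>" for \<mu> \<nu> using bX[OF that j0] K.less_trans by blast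
  define \<delta> where "\<delta> = K.Least (\<lambda>d. d \<in> K \<and> (\<forall>\<nu>\<in>I. b \<nu> \<prec> d))"
  have "b ` I \<subseteq> K" using bK by blast
  from K_bd[OF this card_of_image] have "\<exists>d. d \<in> K \<and> (\<forall>\<nu>\<in>I. b \<nu> \<prec> d)" by blast
  then have \<delta>: "\<delta> \<in> K" "\<And>\<nu>. \<nu> \<in> I \<Longrightarrow> b \<nu> \<prec> \<delta>"
    unfolding \<delta>_def using K.LeastI_ex[of "\<lambda>d. d \<in> K \<and> (\<forall>\<nu>\<in>I. b \<nu> \<prec> d)"] by blast+
  have below: "\<exists>\<nu>\<in>I. \<zeta> \<preceq> b \<nu>" if "\<zeta> \<in> K" "\<zeta> \<prec> \<delta>" for \<zeta>
    using K.not_less_Least[of \<zeta> "\<lambda>d. d \<in> K \<and> (\<forall>\<nu>\<in>I. b \<nu> \<prec> d)"] that unfolding \<delta>_def by (meson K.leI)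
  have "lim (X j) \<delta>" if j: "j \<in> I" for j
    unfolding lim_def
  proof (intro ballI impI)
    fix \<zeta> assume "\<zeta> \<in> K" "\<zeta> \<prec> \<delta>"
    then obtain \<nu> where \<nu>: "\<nu> \<in> I" "\<zeta> \<preceq> b \<nu>" using below by blast
    obtain \<nu>' where \<nu>': "\<nu>' \<in> I" "\<nu> \<lhd> \<nu>'" using I_up[OF \<nu>(1)] by blast
    obtain a where "a \<in> X j" "b \<nu> \<prec> a" "a \<prec> b \<nu>'" using bX[OF \<nu>(1) \<nu>' j] by blast
    then show "\<exists>a\<in>X j. \<zeta> \<prec> a \<and> a \<prec> \<delta>" using \<nu>(2) \<delta>(2)[OF \<nu>'(1)] by (meson K.le_less_trans K.less_trans)
  qed
  moreover have "reg \<delta>"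
    unfolding reg_def
  proof (intro conjI allI impI)
    fix B assume B: "B \<subseteq> K" "\<forall>b\<in>B. b \<prec> \<delta>" "|B| <o |I|"
    then have "\<forall>x\<in>B. \<exists>\<nu>. \<nu> \<in> I \<and> x \<preceq> b \<nu>" using below by blast
    then obtain n where n: "\<And>x. x \<in> B \<Longrightarrow> n x \<in> I \<and> x \<preceq> b (n x)" by metis
    obtain i where i: "i \<in> I" "\<forall>y\<in>n ` B. y \<lhd> i" using I_bd[of "n ` B"] card_lt_image[OF B(3)] n by blast
    have "x \<prec> b i" if "x \<in> B" for x using n[OF that] bm[of "n x" i] i that by (meson K.le_less_trans imageI)
    then show "\<exists>\<zeta>\<in>K. \<zeta> \<prec> \<delta> \<and> (\<forall>b\<in>B. b \<prec> \<zeta>)" using bK(1) \<delta>(2) i(1) by blast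
  qed (rule \<delta>)
  moreover have "\<xi> \<prec> \<delta>" using bK(2)[OF j0] \<delta>(2)[OF j0] by (rule K.less_trans)
  ultimately show ?thesis by blast
qed

lemma unb_pigeon:
  assumes "unb A" "A \<subseteq> (\<Union>i\<in>I. X i)" obtains i where "i \<in> I" "unb (A \<inter> X i)"
proof (rule ccontr)
  assume neg: "\<not> thesis"
  have "\<forall>i\<in>I. \<exists>k. k \<in> K \<and> (\<forall>a\<in>A \<inter> X i. \<not> k \<prec> a)"
    using neg that assms(1) unfolding unb_def by blast
  then obtain k where k: "\<And>i. i \<in> I \<Longrightarrow> k i \<in> K \<and> (\<forall>a\<in>A \<inter> X i. \<not> k i \<prec> a)" by metis
  have "k ` I \<subseteq> K" using k by blast
  from K_bd[OF this card_of_image] obtain b where b: "b \<in> K" "\<forall>y\<in>k ` I. y \<prec> b" by blast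
  obtain a where a: "a \<in> A" "b \<prec> a" using assms(1) b unfolding unb_def by blast
  obtain i where "i \<in> I" "a \<in> X i" using a assms(2) by blast
  then show False using k a b by (meson IntI K.less_trans imageI)
qed

lemma unb_card: "unb A \<Longrightarrow> |K| \<le>o |A|"
proof (rule K_big)
  assume A: "unb A"
  then show "A \<subseteq> K" unfolding unb_def by simp
  show "\<not> |A| \<le>o |I|"
  proof
    assume "|A| \<le>o |I|"
    moreover have "A \<subseteq> K" using A unfolding unb_def by simp
    ultimately obtain k where k: "k \<in> K" "\<forall>a\<in>A. a \<prec> k" using K_bd by blast
    then obtain a where "a \<in> A" "k \<prec> a" using A unfolding unb_def by blast
    then show False using k(2) K.less_asym by blast
  qed
qed

lemma unb_K: "unb K"
  unfolding unb_def
proof (intro conjI ballI subset_refl)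
  fix k assume "k \<in> K"
  then have "|{k}| \<le>o |I|" "{k} \<subseteq> K" using I_inf by (auto intro!: card_of_singl_ordLeq)
  then show "\<exists>a\<in>K. k \<prec> a" using K_bd by blast
qed

text \<open>An Ulam matrix: for some row \<open>\<nu>\<^sub>0\<close> unboundedly many of the disjoint sets \<open>U \<nu>\<^sub>0 \<xi>\<close> meet the limit points
  of every unbounded set, and each of them is given its own colour.\<close>

lemma colouring_ex:
  assumes C: "|C| \<le>o |K|"
  shows "\<exists>\<pi>. \<forall>A c \<xi>. unb A \<longrightarrow> c \<in> C \<longrightarrow> \<xi> \<in> K \<longrightarrow> (\<exists>\<delta>. reg \<delta> \<and> \<xi> \<prec> \<delta> \<and> lim A \<delta> \<and> \<pi> \<delta> = c)"
proof (cases "C = {}")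
  case False
  have "\<exists>f. inj_on f {a \<in> K. a \<prec> \<delta>} \<and> f ` {a \<in> K. a \<prec> \<delta>} \<subseteq> I" if "\<delta> \<in> K" for \<delta>
    using K_seg[OF that] unfolding card_of_ordLeq[symmetric] .
  then obtain f where f: "\<And>\<delta>. \<delta> \<in> K \<Longrightarrow> inj_on (f \<delta>) {a \<in> K. a \<prec> \<delta>} \<and> f \<delta> ` {a \<in> K. a \<prec> \<delta>} \<subseteq> I" by metis
  define U where "U \<nu> \<xi> = {\<delta>. reg \<delta> \<and> \<xi> \<prec> \<delta> \<and> f \<delta> \<xi> = \<nu>}" for \<nu> \<xi>
  have "\<exists>\<nu>. \<nu> \<in> I \<and> (\<forall>A. unb A \<longrightarrow> (\<exists>\<delta>\<in>U \<nu> \<xi>. lim A \<delta>))" if \<xi>: "\<xi> \<in> K" for \<xi>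
  proof (rule ccontr)
    assume "\<not> ?thesis"
    then have "\<forall>\<nu>. \<exists>A. \<nu> \<in> I \<longrightarrow> unb A \<and> (\<forall>\<delta>\<in>U \<nu> \<xi>. \<not> lim A \<delta>)" by blast
    then obtain X where X: "\<And>\<nu>. \<nu> \<in> I \<Longrightarrow> unb (X \<nu>) \<and> (\<forall>\<delta>\<in>U \<nu> \<xi>. \<not> lim (X \<nu>) \<delta>)" by metis
    \<comment> \<open>If every row failed, with a witness \<open>X \<nu>\<close>, a common limit
      point \<open>\<delta>\<close> of the witnesses would contradict the failure of the row
      \<open>f \<delta> \<xi>\<close>.\<close>
    obtain \<delta> where \<delta>: "reg \<delta>" "\<xi> \<prec> \<delta>" "\<forall>j\<in>I. lim (X j) \<delta>" using limit_point[of X \<xi>] X \<xi> by blast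
    have "f \<delta> \<xi> \<in> I" using f[of \<delta>] \<delta> \<xi> unfolding reg_def by blast
    then show False using X \<delta> unfolding U_def by blast
  qed
  then obtain n where n: "\<And>\<xi>. \<xi> \<in> K \<Longrightarrow> n \<xi> \<in> I \<and> (\<forall>A. unb A \<longrightarrow> (\<exists>\<delta>\<in>U (n \<xi>) \<xi>. lim A \<delta>))" by metis
  obtain \<nu>0 where \<nu>0: "\<nu>0 \<in> I" "unb (K \<inter> {\<xi>. n \<xi> = \<nu>0})"
    using unb_pigeon[OF unb_K, of "\<lambda>i. {\<xi>. n \<xi> = i}"] n by blast
  define B where "B = K \<inter> {\<xi>. n \<xi> = \<nu>0}"
  have "|C| \<le>o |B|" using C unb_card[OF \<nu>0(2)] ordLeq_transitive unfolding B_def by blast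
  then obtain g where g: "g ` B = C" using iffD2[OF card_of_ordLeq2[OF False]] by blast
  define \<pi> where "\<pi> \<delta> = g (SOME \<xi>. \<xi> \<in> B \<and> \<xi> \<prec> \<delta> \<and> f \<delta> \<xi> = \<nu>0)" for \<delta>
  have "\<exists>\<delta>. reg \<delta> \<and> \<xi>0 \<prec> \<delta> \<and> lim A \<delta> \<and> \<pi> \<delta> = c" if A: "unb A" and c: "c \<in> C" and \<xi>0: "\<xi>0 \<in> K" for A c \<xi>0
  proof -
    obtain \<xi> where \<xi>: "\<xi> \<in> B" "g \<xi> = c" using c g by blast
    \<comment> \<open>Removing the part of \<open>A\<close> up to \<open>\<xi>0\<close> forces its
      limit points above \<open>\<xi>0\<close>.\<close>
    have "unb {a \<in> A. \<xi>0 \<prec> a}"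
      unfolding unb_def
    proof (intro conjI ballI)
      show "{a \<in> A. \<xi>0 \<prec> a} \<subseteq> K" using A unfolding unb_def by auto
      fix k assume k: "k \<in> K"
      have "\<exists>a\<in>A. k \<prec> a \<and> \<xi>0 \<prec> a"
      proof (cases "k \<preceq> \<xi>0")
        case True
        then show ?thesis using A \<xi>0 K.le_less_trans unfolding unb_def by blast
      next
        case False
        then have "\<xi>0 \<prec> k" by (simp add: K.not_le)
        then show ?thesis using A k K.less_trans unfolding unb_def by blast
      qed
      then show "\<exists>a\<in>{a \<in> A. \<xi>0 \<prec> a}. k \<prec> a" by blast
    qed
    then obtain \<delta> where \<delta>: "\<delta> \<in> U \<nu>0 \<xi>" "lim {a \<in> A. \<xi>0 \<prec> a} \<delta>" using n \<xi>(1) unfolding B_def by blast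
    have d: "reg \<delta>" "\<xi> \<prec> \<delta>" "f \<delta> \<xi> = \<nu>0" "\<delta> \<in> K" "\<xi> \<in> K" using \<delta>(1) \<xi>(1) unfolding U_def reg_def B_def by auto
    obtain a where "\<xi>0 \<prec> a" "a \<prec> \<delta>" using \<delta>(2) d unfolding lim_def by blast
    then have "\<xi>0 \<prec> \<delta>" by (rule K.less_trans)
    moreover have "lim A \<delta>" using \<delta>(2) unfolding lim_def by blast
    moreover have "(SOME \<xi>. \<xi> \<in> B \<and> \<xi> \<prec> \<delta> \<and> f \<delta> \<xi> = \<nu>0) = \<xi>"
    proof (rule some_equality)
      show "\<xi> \<in> B \<and> \<xi> \<prec> \<delta> \<and> f \<delta> \<xi> = \<nu>0" using \<xi> d by blast
      fix \<eta> assume "\<eta> \<in> B \<and> \<eta> \<prec> \<delta> \<and> f \<delta> \<eta> = \<nu>0"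
      then show "\<eta> = \<xi>" using inj_onD[OF conjunct1[OF f[OF d(4)]], of \<eta> \<xi>] d unfolding B_def by simp
    qed
    ultimately show ?thesis using d(1) \<xi>(2) unfolding \<pi>_def by blast
  qed
  then show ?thesis by (intro exI[of _ \<pi>] allI impI)
qed simp

end

section \<open>The tower of amalgams\<close>

lemma grp_directed_union:
  assumes "\<F> \<noteq> {}" "\<And>X. X \<in> \<F> \<Longrightarrow> grp X m e" "\<And>X Y. X \<in> \<F> \<Longrightarrow> Y \<in> \<F> \<Longrightarrow> \<exists>Z\<in>\<F>. X \<subseteq> Z \<and> Y \<subseteq> Z"
  shows "grp (\<Union>\<F>) m e"
  unfolding grp_def
proof (intro conjI ballI)
  show "e \<in> \<Union>\<F>" using assms(1,2) unfolding grp_def by auto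
  have up2: "\<exists>Z\<in>\<F>. x \<in> Z \<and> y \<in> Z" if xy: "x \<in> \<Union>\<F>" "y \<in> \<Union>\<F>" for x y
  proof -
    obtain X Y where "X \<in> \<F>" "x \<in> X" "Y \<in> \<F>" "y \<in> Y" using xy by auto
    then show ?thesis using assms(3)[of X Y] by blast
  qed
  have up3: "\<exists>Z\<in>\<F>. x \<in> Z \<and> y \<in> Z \<and> z \<in> Z" if xyz: "x \<in> \<Union>\<F>" "y \<in> \<Union>\<F>" "z \<in> \<Union>\<F>" for x y z
  proof -
    obtain Z where Z: "Z \<in> \<F>" "x \<in> Z" "y \<in> Z" using up2[OF xyz(1,2)] by blast
    obtain Y where "Y \<in> \<F>" "z \<in> Y" using xyz(3) by auto
    then show ?thesis using assms(3)[of Z Y] Z by blast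
  qed
  fix x assume x: "x \<in> \<Union>\<F>"
  then obtain X where X: "X \<in> \<F>" "x \<in> X" by blast
  show "m e x = x" "m x e = x" using assms(2)[OF X(1)] X(2) unfolding grp_def by auto
  show "\<exists>y\<in>\<Union>\<F>. m x y = e \<and> m y x = e" using assms(2)[OF X(1)] X unfolding grp_def by blast
  fix y assume y: "y \<in> \<Union>\<F>"
  obtain Z where "Z \<in> \<F>" "x \<in> Z" "y \<in> Z" using up2[OF x y] by blast
  then show "m x y \<in> \<Union>\<F>" using assms(2) unfolding grp_def by blast
  fix z assume z: "z \<in> \<Union>\<F>"
  obtain Z' where "Z' \<in> \<F>" "x \<in> Z'" "y \<in> Z'" "z \<in> Z'" using up3[OF x y z] by blast
  then show "m (m x y) z = m x (m y z)" using assms(2) unfolding grp_def by blast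
qed

lemma grp_solve_r:
  assumes "grp X m e" "grp Y m e" "X \<subseteq> Y" "p \<in> X" "c \<in> X" "v \<in> Y" "m p v = c" shows "v \<in> X"
proof -
  obtain p' where p': "p' \<in> X" "m p' p = e" using assms(1,4) unfolding grp_def by blast
  have "m p' c = m (m p' p) v" using assms p' unfolding grp_def by (metis subsetD)
  then have "m p' c = v" using p' assms(2,6) unfolding grp_def by simp
  then show ?thesis using assms(1,5) p'(1) unfolding grp_def by blast
qed

lemma grp_solve_l:
  assumes "grp X m e" "grp Y m e" "X \<subseteq> Y" "q \<in> X" "c \<in> X" "v \<in> Y" "m v q = c" shows "v \<in> X"
proof -
  obtain q' where q': "q' \<in> X" "m q q' = e" using assms(1,4) unfolding grp_def by blast
  have "m c q' = m v (m q q')" using assms q' unfolding grp_def by (metis subsetD)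
  then have "m c q' = v" using q' assms(2,6) unfolding grp_def by simp
  then show ?thesis using assms(1,5) q'(1) unfolding grp_def by blast
qed

lemma grp_closed: "grp X m e \<Longrightarrow> x \<in> X \<Longrightarrow> y \<in> X \<Longrightarrow> m x y \<in> X" unfolding grp_def by blast

text \<open>An element \<open>El k i n\<close> of level \<open>k\<close> is created at step \<open>(k, i)\<close>, and \<open>Tp k\<close> is the first element of level \<open>k\<close>. The recursion
  amalgamates, at step \<open>(b, i)\<close>, the groups \<open>S f b i\<close> (levels below \<open>b\<close>) and \<open>Mm f b i\<close> (earlier steps at \<open>b\<close>) over \<open>Sm f b i\<close>.\<close>

datatype ('k, 'i) elem = One | Tp 'k | El 'k 'i 'i

primrec lv :: "('k, 'i) elem \<Rightarrow> 'k" where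
  "lv One = undefined" | "lv (Tp k) = k" | "lv (El k i n) = k"

context cardinals
begin

definition elems :: "('k, 'i) elem set" where
  "elems = insert One (Tp ` K \<union> (\<lambda>(k, i, n). El k i n) ` (K \<times> I \<times> I))"

end

section \<open>The state of the recursion and the groups read off from it\<close>

locale tower = cardinals leI ltI leK ltK I K
  for leI :: "'i \<Rightarrow> 'i \<Rightarrow> bool" (infix "\<unlhd>" 50) and ltI (infix "\<lhd>" 50)
    and leK :: "'k \<Rightarrow> 'k \<Rightarrow> bool" (infix "\<preceq>" 50) and ltK (infix "\<prec>" 50)
    and I K +
  fixes e :: "'k \<Rightarrow> 'k \<Rightarrow> 'i" and \<pi> :: "'k \<Rightarrow> ('k, 'i) elem \<times> ('k, 'i) elem \<times> ('k, 'i) elem"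
  assumes e_col: "b \<in> K \<Longrightarrow> emap (\<lambda>b a. e a b) b (\<lambda>a. e a b)"
begin

lemma e_I: "a \<in> K \<Longrightarrow> b \<in> K \<Longrightarrow> a \<prec> b \<Longrightarrow> e a b \<in> I"
  using emapD(1)[OF e_col] .

lemma e_trans:
  assumes "a \<in> K" "b \<in> K" "c \<in> K" "i \<in> I" "a \<prec> b" "b \<prec> c" "e a b \<unlhd> i" "e b c \<unlhd> i"
  shows "e a c \<unlhd> i"
  by (rule emapD(2)[OF e_col[OF assms(3)] assms(1,2,4-6,8,7)])

lemma e_back:
  assumes "a \<in> K" "b \<in> K" "c \<in> K" "i \<in> I" "a \<prec> b" "b \<prec> c" "e a c \<unlhd> i" "e b c \<unlhd> i"
  shows "e a b \<unlhd> i"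
  by (rule emapD(3)[OF e_col[OF assms(3)] assms(1,2,4-8)])

lemma e_small: "b \<in> K \<Longrightarrow> i \<in> I \<Longrightarrow> |{a \<in> K. a \<prec> b \<and> e a b \<unlhd> i}| <o |I|"
  using emapD(4)[OF e_col] .

text \<open>The element is available from index \<open>i\<close> on at its level; the identity and
  the first elements are available from the start.\<close>

primrec tg :: "('k, 'i) elem \<Rightarrow> 'i \<Rightarrow> bool" where
  "tg One i = True" | "tg (Tp k) i = True" | "tg (El k j n) i = (j \<unlhd> i)"

definition bl :: "'k \<Rightarrow> 'i \<Rightarrow> 'k \<Rightarrow> bool" where "bl b i k \<longleftrightarrow> k \<in> K \<and> k \<prec> b \<and> e k b \<unlhd> i"

type_synonym ('x, 'y) state = "'x \<times> 'y \<Rightarrow> ('x, 'y) elem set \<times> (('x, 'y) elem \<Rightarrow> ('x, 'y) elem \<Rightarrow> ('x, 'y) elem)"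

primrec alive :: "('k, 'i) state \<Rightarrow> ('k, 'i) elem \<Rightarrow> bool" where
  "alive f One = True" | "alive f (Tp k) = (k \<in> K)"
| "alive f (El k i n) = (k \<in> K \<and> i \<in> I \<and> n \<in> I \<and> El k i n \<in> fst (f (k, i)))"

text \<open>\<open>One\<close> has no meaningful level and is therefore listed apart. For all other
  elements \<open>i\<close> bounds both the distance of the level to \<open>b\<close> and the index
  of creation.\<close>

definition S :: "('k, 'i) state \<Rightarrow> 'k \<Rightarrow> 'i \<Rightarrow> ('k, 'i) elem set" where
  "S f b i = insert One {x. x \<noteq> One \<and> alive f x \<and> tg x i \<and> bl b i (lv x)}"

definition M :: "('k, 'i) state \<Rightarrow> 'k \<Rightarrow> 'i \<Rightarrow> ('k, 'i) elem set" where
  "M f b i = S f b i \<union> {x. x \<noteq> One \<and> alive f x \<and> tg x i \<and> lv x = b}"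

definition Sm :: "('k, 'i) state \<Rightarrow> 'k \<Rightarrow> 'i \<Rightarrow> ('k, 'i) elem set" where
  "Sm f b i = insert One (\<Union>j\<in>{j \<in> I. j \<lhd> i}. S f b j)"

text \<open>\<open>Tp b\<close> is an involution supplied at the start of level \<open>b\<close>. It
  ensures that every level is occupied, so that the final group has size \<kappa>.\<close>

definition Mm :: "('k, 'i) state \<Rightarrow> 'k \<Rightarrow> 'i \<Rightarrow> ('k, 'i) elem set" where
  "Mm f b i = {One, Tp b} \<union> (\<Union>j\<in>{j \<in> I. j \<lhd> i}. M f b j)"

definition top_lv :: "('k, 'i) elem \<Rightarrow> ('k, 'i) elem \<Rightarrow> 'k" where
  "top_lv x y = (if lv x \<preceq> lv y then lv y else lv x)"

text \<open>The least index at which both factors are present at the higher of their levels. The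
  product is stored there, and later steps extend it.\<close>

definition idx :: "('k, 'i) elem \<Rightarrow> ('k, 'i) elem \<Rightarrow> 'i" where
  "idx x y = (let d = top_lv x y in I.Least (\<lambda>i. i \<in> I \<and> tg x i \<and> tg y i \<and> (lv x = d \<or> e (lv x) d \<unlhd> i) \<and> (lv y = d \<or> e (lv y) d \<unlhd> i)))"

definition gop :: "('k, 'i) state \<Rightarrow> ('k, 'i) elem \<Rightarrow> ('k, 'i) elem \<Rightarrow> ('k, 'i) elem" where
  "gop f x y = (if x = One then y else if y = One then x else if x = y \<and> x = Tp (lv x) then One
     else snd (f (top_lv x y, idx x y)) x y)"

text \<open>The first point from \<open>a\<close> on within distance \<open>q\<close> of
  \<open>b\<close>. In \<open>capture\<close> it recovers the guessing point from the levels of the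
  letters.\<close>

definition del :: "'k \<Rightarrow> 'i \<Rightarrow> 'k \<Rightarrow> 'k" where
  "del b q a = K.Least (\<lambda>\<xi>. a \<preceq> \<xi> \<and> bl b q \<xi>)"

text \<open>The ordinal \<open>del\<close> depends only on the levels of \<open>u 3\<close> and \<open>x\<close>, which a twist cannot change; hence the colour makes
  equivalent tuples share \<open>u 1\<close>, \<open>u 2\<close> and \<open>z\<close>, and malnormality leaves only the trivial twist.\<close>

definition Tup :: "('k, 'i) state \<Rightarrow> 'k \<Rightarrow> 'i \<Rightarrow>
    ((nat \<Rightarrow> ('k, 'i) elem) \<times> ('k, 'i) elem \<times> ('k, 'i) elem \<times> ('k, 'i) elem) set" where
  "Tup f b i = {(u, x, h, z). u 0 = One \<and> (\<forall>a\<in>{1,2,3}. u a \<in> Sm f b i - {One}) \<and>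
     lv (u 1) \<prec> lv (u 2) \<and> lv (u 2) \<prec> lv (u 3) \<and> lv (u 3) \<prec> lv x \<and>
     x \<in> S f b i - {One} \<and> e (lv x) b = i \<and> h \<in> Mm f b i - {One} \<and> lv h = b \<and> z \<in> Sm f b i \<and>
     \<pi> (del b (e (lv (u 3)) b) (lv x)) = (u 1, u 2, z)}"

definition Step :: "('k, 'i) state \<Rightarrow> 'k \<times> 'i \<Rightarrow> ('k, 'i) elem set \<times> (('k, 'i) elem \<Rightarrow> ('k, 'i) elem \<Rightarrow> ('k, 'i) elem) \<Rightarrow> bool" where
  "Step f p r \<longleftrightarrow> (case p of (b, i) \<Rightarrow> case r of (D, m) \<Rightarrow> b \<in> K \<longrightarrow> i \<in> I \<longrightarrow>
     D \<subseteq> {El b i n | n. n \<in> I} \<and> common_ext (S f b i) (Mm f b i) (gop f) One (S f b i \<union> Mm f b i \<union> D) m \<and>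
     (\<forall>(u, x, h, z)\<in>Tup f b i. foldl m One (spell u x h) = z))"

text \<open>What later steps use of a step, expressed by the global operation instead of the local
  table.\<close>

definition Good :: "('k, 'i) state \<Rightarrow> 'k \<Rightarrow> 'i \<Rightarrow> bool" where
  "Good f b i \<longleftrightarrow> grp (M f b i) (gop f) One \<and> malnormal (S f b i) (M f b i) (gop f) One \<and>
     malnormal (Mm f b i) (M f b i) (gop f) One \<and> (\<forall>(u, x, h, z)\<in>Tup f b i. foldl (gop f) One (spell u x h) = z)"

definition lessp :: "(('k \<times> 'i) \<times> ('k \<times> 'i)) set" where
  "lessp = {((b, i), (b', i')). b \<prec> b' \<or> (b = b' \<and> i \<lhd> i')}"

lemma wf_lessp: "wf lessp"
proof -
  have "lessp = {(a, b). a \<prec> b} <*lex*> {(a, b). a \<lhd> b}" unfolding lessp_def lex_prod_def by auto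
  then show ?thesis using K.wf I.wf by auto
qed

lemma tg_mono: "tg x j \<Longrightarrow> j \<unlhd> i \<Longrightarrow> tg x i" by (cases x) (auto intro: I.order_trans)

lemma bl_mono: "bl b j k \<Longrightarrow> j \<unlhd> i \<Longrightarrow> bl b i k" unfolding bl_def by (auto intro: I.order_trans)

lemma bl_trans: "bl d i k \<Longrightarrow> bl b i d \<Longrightarrow> b \<in> K \<Longrightarrow> i \<in> I \<Longrightarrow> bl b i k"
  unfolding bl_def using e_trans[of k d b i] K.less_trans by blast

lemma bl_back: "bl b i k \<Longrightarrow> bl b i d \<Longrightarrow> k \<prec> d \<Longrightarrow> b \<in> K \<Longrightarrow> i \<in> I \<Longrightarrow> bl d i k"
  unfolding bl_def using e_back[of k d b i] by blast

lemma S_mono: "j \<unlhd> i \<Longrightarrow> S f b j \<subseteq> S f b i" unfolding S_def using tg_mono bl_mono by blast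
lemma M_mono: "j \<unlhd> i \<Longrightarrow> M f b j \<subseteq> M f b i" unfolding M_def using S_mono tg_mono by blast
lemma S_M: "S f b i \<subseteq> M f b i" unfolding M_def by blast
lemma One_in[simp]: "One \<in> S f b i" "One \<in> M f b i" "One \<in> Sm f b i" "One \<in> Mm f b i"
  unfolding M_def S_def Sm_def Mm_def by auto
lemma Sm_S: "Sm f b i \<subseteq> S f b i"
proof -
  have "S f b j \<subseteq> S f b i" if "j \<lhd> i" for j using S_mono I.less_imp_le[OF that] .
  then show ?thesis unfolding Sm_def by auto
qed
lemma Mm_M: "b \<in> K \<Longrightarrow> Mm f b i \<subseteq> M f b i"
proof -
  assume "b \<in> K"
  then have "{One, Tp b} \<subseteq> M f b i" unfolding M_def S_def by auto
  moreover have "M f b j \<subseteq> M f b i" if "j \<lhd> i" for j using M_mono I.less_imp_le[OF that] .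
  ultimately show ?thesis unfolding Mm_def by blast
qed
lemma Sm_Mm: "Sm f b i \<subseteq> Mm f b i" unfolding Sm_def Mm_def using S_M by blast

lemma S_lv: "x \<in> S f b i \<Longrightarrow> x \<noteq> One \<Longrightarrow> bl b i (lv x)" unfolding S_def by auto
lemma S_lt: "x \<in> S f b i \<Longrightarrow> x \<noteq> One \<Longrightarrow> lv x \<prec> b" unfolding S_def bl_def by auto
lemma M_cases: "x \<in> M f b i \<Longrightarrow> x \<in> S f b i \<or> (x \<noteq> One \<and> lv x = b)" unfolding M_def by auto

lemma M_sub_S: "bl b i d \<Longrightarrow> b \<in> K \<Longrightarrow> i \<in> I \<Longrightarrow> M f d i \<subseteq> S f b i"
  unfolding M_def S_def using bl_trans by auto

text \<open>The second ultrametric inequality: levels within distance \<open>i\<close> of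
  \<open>b\<close> are within distance \<open>i\<close> of each other.\<close>

lemma S_M_at: "x \<in> S f b i \<Longrightarrow> x \<noteq> One \<Longrightarrow> bl b i d \<Longrightarrow> lv x \<preceq> d \<Longrightarrow> b \<in> K \<Longrightarrow> i \<in> I \<Longrightarrow> x \<in> M f d i"
  unfolding M_def S_def using bl_back by (auto simp: K.le_less)

lemma S_S_at: "x \<in> S f b i \<Longrightarrow> x \<noteq> One \<Longrightarrow> bl b i d \<Longrightarrow> lv x \<prec> d \<Longrightarrow> b \<in> K \<Longrightarrow> i \<in> I \<Longrightarrow> x \<in> S f d i"
  unfolding S_def using bl_back by auto

lemma S_own: "x \<in> S f b i \<Longrightarrow> x \<noteq> One \<Longrightarrow> b \<in> K \<Longrightarrow> i \<in> I \<Longrightarrow> x \<in> M f (lv x) i"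
  using S_M_at S_lv by blast

text \<open>An element of \<open>Mm\<close> other than \<open>One\<close> either has level
  \<open>b\<close> or comes from some \<open>S\<close> of smaller index. So the amalgamated subgroup
  is the union of the earlier \<open>S\<close>.\<close>

lemma S_inter_Mm:
  assumes "b \<in> K" "i \<in> I" shows "S f b i \<inter> Mm f b i = Sm f b i"
proof
  show "Sm f b i \<subseteq> S f b i \<inter> Mm f b i" using Sm_S Sm_Mm by blast
  show "S f b i \<inter> Mm f b i \<subseteq> Sm f b i"
  proof
    fix x assume x: "x \<in> S f b i \<inter> Mm f b i"
    show "x \<in> Sm f b i"
    proof (cases "x = One")
      case False
      then have "lv x \<noteq> b" using x S_lt by blast
      then have "\<exists>j\<in>I. j \<lhd> i \<and> x \<in> S f b j" using x False M_cases unfolding Mm_def by fastforce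
      then show ?thesis unfolding Sm_def by blast
    qed simp
  qed
qed

lemma Sm_in: "a \<in> Sm f b i \<Longrightarrow> a \<noteq> One \<Longrightarrow> \<exists>j\<in>I. j \<lhd> i \<and> a \<in> S f b j" unfolding Sm_def by blast

lemma I_max: "j \<in> I \<Longrightarrow> j' \<in> I \<Longrightarrow> \<exists>l\<in>{j, j'}. j \<unlhd> l \<and> j' \<unlhd> l" using I.linear by auto

lemma Sm_in2: "a \<in> Sm f b i \<Longrightarrow> a' \<in> Sm f b i \<Longrightarrow> a \<noteq> One \<Longrightarrow> \<exists>j\<in>I. j \<lhd> i \<and> a \<in> S f b j \<and> a' \<in> S f b j"
proof (cases "a' = One")
  case False
  assume a: "a \<in> Sm f b i" "a' \<in> Sm f b i" "a \<noteq> One"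
  obtain j j' where j: "j \<in> I" "j \<lhd> i" "a \<in> S f b j" "j' \<in> I" "j' \<lhd> i" "a' \<in> S f b j'"
    using Sm_in[OF a(1,3)] Sm_in[OF a(2) False] by blast
  obtain l where "l \<in> {j, j'}" "j \<unlhd> l" "j' \<unlhd> l" using I_max j by blast
  then show ?thesis using j S_mono by blast
qed (use Sm_in One_in in blast)

end

lemma grp_family:
  assumes X0: "grp X0 m e" and X: "\<And>j. j \<in> J \<Longrightarrow> grp (X j) m e"
    and chain: "\<And>j j'. j \<in> J \<Longrightarrow> j' \<in> J \<Longrightarrow> X j \<subseteq> X j' \<or> X j' \<subseteq> X j" and sub: "\<And>j. j \<in> J \<Longrightarrow> X0 \<subseteq> X j"
  shows "grp (X0 \<union> (\<Union>j\<in>J. X j)) m e"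
proof -
  have "grp (\<Union>(insert X0 (X ` J))) m e"
  proof (rule grp_directed_union)
    show "grp Y m e" if "Y \<in> insert X0 (X ` J)" for Y using that X0 X by auto
    fix Y Z assume YZ: "Y \<in> insert X0 (X ` J)" "Z \<in> insert X0 (X ` J)"
    have "Y \<subseteq> Z \<or> Z \<subseteq> Y"
    proof (cases "Y = X0 \<or> Z = X0")
      case True then show ?thesis using YZ sub by auto
    next
      case False
      then obtain j j' where "j \<in> J" "j' \<in> J" "Y = X j" "Z = X j'" using YZ by auto
      then show ?thesis using chain by blast
    qed
    then show "\<exists>W\<in>insert X0 (X ` J). Y \<subseteq> W \<and> Z \<subseteq> W" using YZ by blast
  qed simp
  then show ?thesis by simp
qed

context tower
begin

section \<open>Both factors of a step are groups, and their intersection is malnormal in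
  each\<close>

lemma gop_One: "gop f One y = y" "gop f x One = x" unfolding gop_def by auto

lemma GoodD:
  assumes "Good f d j"
  shows "grp (M f d j) (gop f) One" "malnormal (S f d j) (M f d j) (gop f) One"
    "malnormal (Mm f d j) (M f d j) (gop f) One"
  using assms unfolding Good_def by auto

lemma M_chain:
  assumes "bl b i d" "bl b i d'" "d \<preceq> d'" "b \<in> K" "i \<in> I" shows "M f d i \<subseteq> M f d' i"
proof (cases "d = d'")
  case False
  then have "bl d' i d" using bl_back[OF assms(1,2)] assms by (simp add: K.le_less)
  then show ?thesis using M_sub_S[of d' i d] S_M assms(2,5) unfolding bl_def by blast
qed simp

text \<open>The groups at the levels within distance \<open>i\<close> of \<open>b\<close> form a
  chain, so this presents \<open>S f b i\<close> as the union of a chain of groups.\<close>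

lemma S_union:
  assumes "b \<in> K" "i \<in> I" shows "S f b i = {One} \<union> (\<Union>d\<in>{d. bl b i d}. M f d i)"
proof
  show "S f b i \<subseteq> {One} \<union> (\<Union>d\<in>{d. bl b i d}. M f d i)"
  proof
    fix x assume x: "x \<in> S f b i"
    show "x \<in> {One} \<union> (\<Union>d\<in>{d. bl b i d}. M f d i)"
    proof (cases "x = One")
      case False
      have "bl b i (lv x)" "x \<in> M f (lv x) i" using S_lv[OF x False] S_own[OF x False assms] .
      then show ?thesis by blast
    qed simp
  qed
  have "M f d i \<subseteq> S f b i" if "bl b i d" for d using M_sub_S[OF that assms] .
  then show "{One} \<union> (\<Union>d\<in>{d. bl b i d}. M f d i) \<subseteq> S f b i" using One_in(1)[of f b i] by auto
qed

lemma grp_S: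
  assumes "b \<in> K" "i \<in> I" "\<And>d. bl b i d \<Longrightarrow> Good f d i" shows "grp (S f b i) (gop f) One"
  unfolding S_union[OF assms(1,2)]
proof (rule grp_family)
  show "grp {One} (gop f) One" unfolding grp_def by (simp add: gop_One)
  show "grp (M f d i) (gop f) One" if "d \<in> {d. bl b i d}" for d using that assms(3) GoodD(1) by auto
  show "M f d i \<subseteq> M f d' i \<or> M f d' i \<subseteq> M f d i" if d: "d \<in> {d. bl b i d}" "d' \<in> {d. bl b i d}" for d d'
  proof (cases "d \<preceq> d'")
    case True then show ?thesis using M_chain[of b i d d'] d assms by auto
  next
    case False
    then have "d' \<preceq> d" using K.linear by blast
    then show ?thesis using M_chain[of b i d' d] d assms by auto
  qed
qed simp

lemma grp_Sm:
  assumes b: "b \<in> K" "i \<in> I" and G: "\<And>d j. d \<in> K \<Longrightarrow> j \<in> I \<Longrightarrow> d \<prec> b \<Longrightarrow> Good f d j"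
  shows "grp (Sm f b i) (gop f) One"
proof -
  have "grp ({One} \<union> (\<Union>j\<in>{j \<in> I. j \<lhd> i}. S f b j)) (gop f) One"
  proof (rule grp_family)
    show "grp {One} (gop f) One" unfolding grp_def by (simp add: gop_One)
    show "grp (S f b j) (gop f) One" if "j \<in> {j \<in> I. j \<lhd> i}" for j
      by (rule grp_S) (use that b G in \<open>auto simp: bl_def\<close>)
    show "S f b j \<subseteq> S f b j' \<or> S f b j' \<subseteq> S f b j" for j j' using S_mono I.linear by blast
  qed simp
  then show ?thesis unfolding Sm_def by simp
qed

lemma grp_Mm:
  assumes b: "b \<in> K" "i \<in> I" and G: "\<And>j. j \<in> I \<Longrightarrow> j \<lhd> i \<Longrightarrow> Good f b j"
  shows "grp (Mm f b i) (gop f) One"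
  unfolding Mm_def
proof (rule grp_family)
  have "gop f (Tp b) (Tp b) = One" unfolding gop_def by simp
  then show "grp {One, Tp b} (gop f) One" unfolding grp_def by (simp add: gop_One)
  show "grp (M f b j) (gop f) One" if "j \<in> {j \<in> I. j \<lhd> i}" for j using that G GoodD(1) by auto
  show "M f b j \<subseteq> M f b j' \<or> M f b j' \<subseteq> M f b j" for j j' using M_mono I.linear by blast
  show "{One, Tp b} \<subseteq> M f b j" for j using b unfolding M_def S_def by auto
qed

lemma S_in_M_sub: "x \<in> S f d i \<Longrightarrow> x \<in> M f d i" using S_M by blast

text \<open>The conjugation involves only three elements, so it takes place in a single
  \<open>M f b l\<close> with \<open>l \<lhd> i\<close>, where \<open>S f b l\<close> is
  malnormal.\<close>

lemma mal_Sm_Mm: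
  assumes b: "b \<in> K" "i \<in> I" and G: "\<And>j. j \<in> I \<Longrightarrow> j \<lhd> i \<Longrightarrow> Good f b j"
  shows "malnormal (Sm f b i) (Mm f b i) (gop f) One"
  unfolding malnormal_def
proof (intro ballI impI)
  fix v a a' assume v: "v \<in> Mm f b i" and a: "a \<in> Sm f b i" "a' \<in> Sm f b i" "a \<noteq> One" and eq: "gop f a v = gop f v a'"
  obtain j where j: "j \<in> I" "j \<lhd> i" "a \<in> S f b j" "a' \<in> S f b j" using Sm_in2[OF a] by blast
  obtain l where l: "l \<in> I" "l \<lhd> i" "j \<unlhd> l" "v \<in> M f b l"
  proof (cases "v \<in> {One, Tp b}")
    case True
    then have "v \<in> M f b j" using b unfolding M_def S_def by auto
    then show thesis using that[of j] j by simp
  next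
    case False
    then obtain j' where j': "j' \<in> I" "j' \<lhd> i" "v \<in> M f b j'" using v unfolding Mm_def by auto
    obtain l where "l \<in> {j, j'}" "j \<unlhd> l" "j' \<unlhd> l" using I_max j j' by blast
    then show thesis using that[of l] j j' M_mono by blast
  qed
  have "a \<in> S f b l" "a' \<in> S f b l" using j S_mono[OF l(3)] by auto
  then have "v \<in> S f b l" using GoodD(2)[OF G[OF l(1,2)]] l(4) a(3) eq unfolding malnormal_def by blast
  then show "v \<in> Sm f b i" using l unfolding Sm_def by blast
qed

text \<open>Let \<open>\<gamma>\<close> be the level of \<open>v\<close> and \<open>\<delta>\<close>
  the larger level of \<open>a\<close> and \<open>a'\<close>. The conjugation takes place at the
  larger of the two, where \<open>Mm\<close> is malnormal; hence \<open>v\<close> was present there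
  at an index below \<open>i\<close>, and the ultrametric inequality carries this to
  \<open>b\<close>. One case needs malnormality of \<open>S\<close> instead.\<close>

lemma mal_Sm_S:
  assumes b: "b \<in> K" "i \<in> I" and G: "\<And>d j. d \<in> K \<Longrightarrow> j \<in> I \<Longrightarrow> d \<prec> b \<Longrightarrow> Good f d j"
  shows "malnormal (Sm f b i) (S f b i) (gop f) One"
  unfolding malnormal_def
proof (intro ballI impI)
  fix v a a' assume v: "v \<in> S f b i" and a: "a \<in> Sm f b i" "a' \<in> Sm f b i" "a \<noteq> One" and eq: "gop f a v = gop f v a'"
  obtain j where j: "j \<in> I" "j \<lhd> i" "a \<in> S f b j" "a' \<in> S f b j" using Sm_in2[OF a] by blast
  have ji: "j \<unlhd> i" using j(2) by (rule I.less_imp_le)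
  have inSm: "x \<in> Sm f b i" if "x \<in> S f b l" "l \<in> I" "l \<lhd> i" for x l using that unfolding Sm_def by blast
  have GI: "Good f d l" if "bl b i d" "l \<in> I" for d l using G that unfolding bl_def by blast
  have grpS: "grp (S f d i) (gop f) One" if d: "bl b i d" for d
    by (rule grp_S) (use d b G K.less_trans in \<open>auto simp: bl_def\<close>)
  show "v \<in> Sm f b i"
  proof (cases "v = One")
    case False
    define \<gamma> where "\<gamma> = lv v"
    have \<gamma>: "bl b i \<gamma>" "v \<in> M f \<gamma> i" "tg v i" "alive f v"
      using S_lv[OF v False] S_own[OF v False b] v False unfolding \<gamma>_def S_def by auto
    have \<gamma>K: "\<gamma> \<in> K" using \<gamma> unfolding bl_def by simp
    have vat: "v \<in> S f b l" if "tg v l" "bl b l \<gamma>" for l using \<gamma> False that unfolding S_def \<gamma>_def by auto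
    have vatM: "v \<in> M f \<gamma> l \<Longrightarrow> tg v l" for l using False unfolding M_def S_def by auto
    obtain \<delta> where \<delta>: "bl b j \<delta>" "a \<in> M f \<delta> j" "a' \<in> M f \<delta> j" "lv a = \<delta> \<or> (a' \<noteq> One \<and> lv a' = \<delta>)"
    proof (cases "a' = One \<or> lv a' \<preceq> lv a")
      case True
      have 1: "bl b j (lv a)" using S_lv j(3) a(3) by blast
      have "a' \<in> M f (lv a) j"
      proof (cases "a' = One")
        case False
        then show ?thesis using S_M_at[OF j(4) False 1] True b(1) j(1) by blast
      qed simp
      then show thesis using that[of "lv a"] 1 S_own[OF j(3) a(3) b(1) j(1)] by blast
    next
      case False
      then have 1: "bl b j (lv a')" using S_lv j(4) by blast
      have "lv a \<preceq> lv a'" using False K.linear by blast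
      then have "a \<in> M f (lv a') j" by (rule S_M_at[OF j(3) a(3) 1 _ b(1) j(1)])
      then show thesis using that[of "lv a'"] 1 S_own[OF j(4) _ b(1) j(1)] False by blast
    qed
    have \<delta>i: "bl b i \<delta>" using bl_mono[OF \<delta>(1) ji] .
    have \<delta>K: "\<delta> \<in> K" using \<delta>(1) unfolding bl_def by simp
    have mal: "v \<in> Mm f d i" if d: "d \<in> {\<gamma>, \<delta>}" "v \<in> M f d i" "l \<in> I" "l \<lhd> i" "a \<in> M f d l" "a' \<in> M f d l" for d l
    proof -
      have "a \<in> Mm f d i" "a' \<in> Mm f d i" using d unfolding Mm_def by auto
      moreover have "malnormal (Mm f d i) (M f d i) (gop f) One" using GoodD(3) GI \<gamma>(1) \<delta>i b(2) d(1) by blast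
      ultimately show ?thesis using d(2) a(3) eq unfolding malnormal_def by blast
    qed
    show ?thesis
    proof (cases "\<delta> \<preceq> \<gamma>")
      case True
      show ?thesis
      proof (cases "e \<gamma> b \<lhd> i")
        case ei: True
        have eI: "e \<gamma> b \<in> I" using \<gamma>(1) b e_I unfolding bl_def by blast
        obtain l where l: "l \<in> {j, e \<gamma> b}" "j \<unlhd> l" "e \<gamma> b \<unlhd> l" using I_max[OF j(1) eI] by blast
        have lI: "l \<in> I" "l \<lhd> i" using l(1) j eI ei by auto
        have bll: "bl b l \<gamma>" "bl b l \<delta>" using \<gamma>(1) l \<delta>(1) bl_mono unfolding bl_def by auto
        have "M f \<delta> j \<subseteq> M f \<gamma> l" using M_mono[OF l(2)] M_chain[OF bll(2,1) True b(1) lI(1)] by blast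
        then have vm: "v \<in> Mm f \<gamma> i" using mal[of \<gamma> l] \<gamma>(2) lI \<delta> by blast
        show ?thesis
        proof (cases "v = Tp \<gamma>")
          case True
          then have "tg v l" by simp
          then show ?thesis using inSm[OF vat[OF _ bll(1)] lI] by blast
        next
          case vT: False
          then obtain l' where l': "l' \<in> I" "l' \<lhd> i" "v \<in> M f \<gamma> l'" using vm False unfolding Mm_def by blast
          obtain n where n: "n \<in> {l, l'}" "l \<unlhd> n" "l' \<unlhd> n" using I_max[OF lI(1) l'(1)] by blast
          have "v \<in> S f b n" using vat tg_mono[OF vatM[OF l'(3)] n(3)] bl_mono[OF bll(1) n(2)] by blast
          then show ?thesis using inSm n lI l' by blast
        qed
      next
        case ei: False
        \<comment> \<open>The level of \<open>v\<close> comes within range of \<open>b\<close> only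
          at \<open>i\<close>. Then \<open>a\<close> and \<open>a'\<close> have smaller levels, and
          malnormality of \<open>S f \<gamma> i\<close> would place \<open>v\<close> below its own
          level.\<close>
        then have ei: "e \<gamma> b = i" using \<gamma>(1) unfolding bl_def by (simp add: I.le_less)
        have "\<delta> \<noteq> \<gamma>" using \<delta>(1) j(2) ei unfolding bl_def by (auto dest: I.leD)
        then have lt: "\<delta> \<prec> \<gamma>" using True by (simp add: K.le_less)
        have "M f \<delta> i \<subseteq> S f \<gamma> i" using M_sub_S[OF bl_back[OF \<delta>i \<gamma>(1) lt b] \<gamma>K b(2)] .
        then have "a \<in> S f \<gamma> i" "a' \<in> S f \<gamma> i" using \<delta> M_mono[OF ji] by blast+
        then have "v \<in> S f \<gamma> i" using GoodD(2)[OF GI[OF \<gamma>(1) b(2)]] \<gamma>(2) a(3) eq unfolding malnormal_def by blast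
        then show ?thesis using S_lt[OF _ False] unfolding \<gamma>_def by blast
      qed
    next
      case False
      then have lt: "\<gamma> \<prec> \<delta>" by (simp add: K.not_le)
      have vS: "v \<in> S f \<delta> i" using S_S_at[OF v \<open>v \<noteq> One\<close> \<delta>i _ b] lt unfolding \<gamma>_def by blast
      have gS: "grp (S f \<delta> i) (gop f) One" by (rule grpS[OF \<delta>i])
      have gM: "grp (M f \<delta> i) (gop f) One" using GoodD(1) GI[OF \<delta>i b(2)] .
      have aM: "a \<in> M f \<delta> i" "a' \<in> M f \<delta> i" using \<delta> M_mono[OF ji] by blast+
      have top: "x \<in> S f \<delta> i \<Longrightarrow> x \<noteq> One \<Longrightarrow> lv x \<noteq> \<delta>" for x using S_lt by blast
      have iff: "a \<in> S f \<delta> i \<longleftrightarrow> a' \<in> S f \<delta> i"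
      proof
        assume as: "a \<in> S f \<delta> i"
        show "a' \<in> S f \<delta> i" by (rule grp_solve_r[OF gS gM S_M vS grp_closed[OF gS as vS] aM(2) eq[symmetric]])
      next
        assume as: "a' \<in> S f \<delta> i"
        show "a \<in> S f \<delta> i" by (rule grp_solve_l[OF gS gM S_M vS grp_closed[OF gS vS as] aM(1) eq])
      qed
      have "v \<in> Mm f \<delta> i" using mal[of \<delta> j] S_in_M_sub[OF vS] j \<delta> by blast
      moreover have "v \<noteq> Tp \<delta>" using top[OF vS] \<open>v \<noteq> One\<close> by auto
      ultimately obtain l where l: "l \<in> I" "l \<lhd> i" "v \<in> M f \<delta> l" using \<open>v \<noteq> One\<close> unfolding Mm_def by blast
      have vl: "tg v l" "bl \<delta> l \<gamma>"
        using l(3) \<open>v \<noteq> One\<close> top[OF vS] unfolding M_def S_def \<gamma>_def by auto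
      obtain n where n: "n \<in> {j, l}" "j \<unlhd> n" "l \<unlhd> n" using I_max[OF j(1) l(1)] by blast
      have nI: "n \<in> I" "n \<lhd> i" using n(1) j l by auto
      have "bl b n \<gamma>" by (rule bl_trans[OF bl_mono[OF vl(2) n(3)] bl_mono[OF \<delta>(1) n(2)] b(1) nI(1)])
      then have "v \<in> S f b n" using vat tg_mono[OF vl(1) n(3)] by blast
      then show ?thesis using inSm nI by blast
    qed
  qed simp
qed

lemma S_at: "p \<in> S f b i \<Longrightarrow> bl b i d \<Longrightarrow> p = One \<or> lv p \<prec> d \<Longrightarrow> b \<in> K \<Longrightarrow> i \<in> I \<Longrightarrow> p \<in> S f d i"
  using S_S_at by (cases "p = One") auto

lemma TupD:
  assumes "(u, x, h, z) \<in> Tup f b i"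
  shows "u 0 = One" "u 1 \<in> Sm f b i - {One}" "u 2 \<in> Sm f b i - {One}" "u 3 \<in> Sm f b i - {One}"
    "lv (u 1) \<prec> lv (u 2)" "lv (u 2) \<prec> lv (u 3)" "lv (u 3) \<prec> lv x" "x \<in> S f b i" "x \<noteq> One" "e (lv x) b = i"
    "h \<in> Mm f b i" "h \<noteq> One" "lv h = b" "z \<in> Sm f b i" "\<pi> (del b (e (lv (u 3)) b) (lv x)) = (u 1, u 2, z)"
  using assms unfolding Tup_def by auto

text \<open>Levels at distance exactly \<open>i\<close> enter at step \<open>i\<close>; this keeps
  the letter \<open>x\<close> of a tuple out of the amalgamated subgroup.\<close>

lemma Sm_lv: "q \<in> Sm f b i \<Longrightarrow> q \<noteq> One \<Longrightarrow> e (lv q) b \<noteq> i"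
  using Sm_in[of q f b i] S_lv unfolding bl_def by (metis I.leD)

text \<open>Levels bound the twist: \<open>p\<close> conjugates \<open>u' 1\<close> to \<open>u 1\<close>, so its level is at most theirs; then \<open>u 2\<close>, \<open>u 3\<close> and \<open>x\<close> keep
  their levels, and \<open>p\<close> centralizes \<open>u 2\<close>, which has a higher level.\<close>

lemma Tup_coherent:
  assumes b: "b \<in> K" "i \<in> I" and G: "\<And>d j. d \<in> K \<Longrightarrow> j \<in> I \<Longrightarrow> d \<prec> b \<Longrightarrow> Good f d j"
    and T: "(u, x, h, z) \<in> Tup f b i" and T': "(u', x', h', z') \<in> Tup f b i"
    and p: "p \<in> Sm f b i" and q: "q \<in> Sm f b i"
    and eu: "\<And>a. a < 4 \<Longrightarrow> gop f p (u' a) = gop f (u a) p" and ex: "gop f p x' = gop f x q"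
  shows "gop f p z' = gop f z p"
proof -
  note D = TupD[OF T] and D' = TupD[OF T']
  have SmS: "a \<in> S f b i" if "a \<in> Sm f b i" for a using that Sm_S by blast
  have GI: "Good f d i" if "bl b i d" for d using G that b(2) unfolding bl_def by blast
  have gS: "grp (S f d i) (gop f) One" if "bl b i d" for d
    by (rule grp_S) (use that b G K.less_trans in \<open>auto simp: bl_def\<close>)
  have gM: "grp (M f d i) (gop f) One" if "bl b i d" for d using GoodD(1)[OF GI[OF that]] .
  have mal: "v \<in> S f d i" if "bl b i d" "v \<in> M f d i" "a \<in> S f d i" "a' \<in> S f d i" "a \<noteq> One" "gop f a v = gop f v a'" for d v a a'
    using GoodD(2)[OF GI[OF that(1)]] that unfolding malnormal_def by blast
  have top: "v \<notin> S f (lv v) i" if "v \<noteq> One" for v using S_lt[OF _ that] K.less_irrefl by blast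
  \<comment> \<open>In a product a single factor of highest level cannot be balanced by factors of
    lower level. With the mirror image \<open>LC'\<close> this gives equal levels of
    \<open>v\<close> and \<open>v'\<close> whenever \<open>a\<close> and \<open>c\<close> lie below
    them.\<close>
  have LC: False if "v \<in> S f b i" "v' \<in> S f b i" "v \<noteq> One" "v' \<noteq> One" "gop f a v' = gop f v c" "lv v \<prec> lv v'"
    "a \<in> S f (lv v') i" "c \<in> S f (lv v') i" for v v' a c
  proof -
    have bv: "bl b i (lv v')" using S_lv that by blast
    have "v \<in> S f (lv v') i" using S_at[OF that(1) bv] that(6) b by blast
    then have "gop f v c \<in> S f (lv v') i" using grp_closed[OF gS[OF bv]] that(8) by blast
    then have "v' \<in> S f (lv v') i"
      by (rule grp_solve_r[OF gS[OF bv] gM[OF bv] S_M that(7) _ S_own[OF that(2,4) b] that(5)])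
    then show False using top[OF that(4)] by blast
  qed
  have LC': False if "v \<in> S f b i" "v' \<in> S f b i" "v \<noteq> One" "v' \<noteq> One" "gop f a v' = gop f v c" "lv v' \<prec> lv v"
    "a \<in> S f (lv v) i" "c \<in> S f (lv v) i" for v v' a c
  proof -
    have bv: "bl b i (lv v)" using S_lv that by blast
    have "v' \<in> S f (lv v) i" using S_at[OF that(2) bv] that(6) b by blast
    then have "gop f a v' \<in> S f (lv v) i" using grp_closed[OF gS[OF bv]] that(7) by blast
    then have "v \<in> S f (lv v) i"
      by (rule grp_solve_l[OF gS[OF bv] gM[OF bv] S_M that(8) _ S_own[OF that(1,3) b] that(5)[symmetric]])
    then show False using top[OF that(3)] by blast
  qed
  have pS: "p \<in> S f b i" and qS: "q \<in> S f b i" using SmS p q by blast+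
  have uS: "u 1 \<in> S f b i" "u' 1 \<in> S f b i" "u 2 \<in> S f b i" "u' 2 \<in> S f b i" "u 3 \<in> S f b i" "u' 3 \<in> S f b i"
    and un: "u 1 \<noteq> One" "u' 1 \<noteq> One" "u 2 \<noteq> One" "u' 2 \<noteq> One" "u 3 \<noteq> One" "u' 3 \<noteq> One"
    using D D' SmS by auto
  have pl: "p = One \<or> lv p \<preceq> lv (u 1) \<or> lv p \<preceq> lv (u' 1)"
  proof (rule ccontr)
    assume "\<not> ?thesis"
    then have n: "p \<noteq> One" "lv (u 1) \<prec> lv p" "lv (u' 1) \<prec> lv p" by (auto simp: K.not_le)
    have bp: "bl b i (lv p)" using S_lv[OF pS n(1)] .
    have "p \<in> S f (lv p) i"
      by (rule mal[OF bp S_own[OF pS n(1) b] S_at[OF uS(1) bp _ b] S_at[OF uS(2) bp _ b] un(1)]) (use n eu[of 1] in auto)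
    then show False using top[OF n(1)] by blast
  qed
  have pS_at: "p \<in> S f d i" if "bl b i d" "lv (u 1) \<prec> d" "lv (u' 1) \<prec> d" for d
    by (rule S_at[OF pS that(1) _ b]) (use pl that K.le_less_trans in blast)
  have l2: "lv (u 2) = lv (u' 2)"
  proof (cases "lv (u 2)" "lv (u' 2)" rule: K.linorder_cases)
    case less
    have "p \<in> S f (lv (u' 2)) i"
      by (rule pS_at[OF S_lv[OF uS(4) un(4)] K.less_trans[OF D(5) less] D'(5)])
    then show ?thesis using LC[OF uS(3,4) un(3,4) eu[of 2] less] by simp
  next
    case greater
    have "p \<in> S f (lv (u 2)) i"
      by (rule pS_at[OF S_lv[OF uS(3) un(3)] D(5) K.less_trans[OF D'(5) greater]])
    then show ?thesis using LC'[OF uS(3,4) un(3,4) eu[of 2] greater] by simp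
  qed
  have l3: "lv (u 3) = lv (u' 3)"
  proof (cases "lv (u 3)" "lv (u' 3)" rule: K.linorder_cases)
    case less
    have "p \<in> S f (lv (u' 3)) i"
      by (rule pS_at[OF S_lv[OF uS(6) un(6)] K.less_trans[OF D(5)[unfolded l2] D'(6)] K.less_trans[OF D'(5,6)]])
    then show ?thesis using LC[OF uS(5,6) un(5,6) eu[of 3] less] by simp
  next
    case greater
    have "p \<in> S f (lv (u 3)) i"
      by (rule pS_at[OF S_lv[OF uS(5) un(5)] K.less_trans[OF D(5,6)] K.less_trans[OF D'(5) D(6)[unfolded l2]]])
    then show ?thesis using LC'[OF uS(5,6) un(5,6) eu[of 3] greater] by simp
  qed
  have px: "p \<in> S f d i" if "bl b i d" "lv (u 3) \<prec> d" for d
  proof (rule pS_at[OF that(1)])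
    show "lv (u 1) \<prec> d" using D(5,6) that(2) by (meson K.less_trans)
    show "lv (u' 1) \<prec> d" using D'(5,6) that(2) unfolding l3[symmetric] by (meson K.less_trans)
  qed
  have xb: "bl b i (lv x)" "bl b i (lv x')" using S_lv D D' by blast+
  have qx: "lv q \<preceq> lv x \<or> lv q \<preceq> lv x'" if qn: "q \<noteq> One"
  proof (rule ccontr)
    assume "\<not> ?thesis"
    then have n: "lv x \<prec> lv q" "lv x' \<prec> lv q" by (auto simp: K.not_le)
    have bq: "bl b i (lv q)" using S_lv[OF qS qn] .
    have a: "p \<in> S f (lv q) i" by (rule px[OF bq K.less_trans[OF D(7) n(1)]])
    have "x \<in> S f (lv q) i" "x' \<in> S f (lv q) i"
      using S_at[OF D(8) bq _ b] S_at[OF D'(8) bq _ b] n by auto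
    then have "q \<in> S f (lv q) i"
      using grp_solve_r[OF gS[OF bq] gM[OF bq] S_M _ _ S_own[OF qS qn b] ex[symmetric]] grp_closed[OF gS[OF bq] a] by blast
    then show False using top[OF qn] by blast
  qed
  \<comment> \<open>The levels of \<open>x\<close> and \<open>x'\<close> are at distance exactly
    \<open>i\<close>, whereas that of \<open>q\<close> is nearer.\<close>
  have qne: "q \<noteq> One \<Longrightarrow> lv q \<noteq> lv x \<and> lv q \<noteq> lv x'" using Sm_lv[OF q] D(10) D'(10) by auto
  have lx: "lv x = lv x'"
  proof (cases "lv x" "lv x'" rule: K.linorder_cases)
    case less
    have "q \<in> S f (lv x') i"
    proof (rule S_at[OF qS xb(2) _ b])
      show "q = One \<or> lv q \<prec> lv x'" using qx qne less by (metis K.le_less K.less_trans)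
    qed
    then show ?thesis
      using LC[OF D(8) D'(8) D(9) D'(9) ex less px[OF xb(2) K.less_trans[OF D(7) less]]] by blast
  next
    case greater
    have "q \<in> S f (lv x) i"
    proof (rule S_at[OF qS xb(1) _ b])
      show "q = One \<or> lv q \<prec> lv x" using qx qne greater by (metis K.le_less K.less_trans)
    qed
    then show ?thesis using LC'[OF D(8) D'(8) D(9) D'(9) ex greater px[OF xb(1) D(7)]] by blast
  qed
  \<comment> \<open>Equal levels give the same point \<open>del\<close>, hence the same
    colour.\<close>
  have eq: "u 1 = u' 1" "u 2 = u' 2" "z = z'" using D(15) D'(15) unfolding l3 lx by auto
  have "p = One"
  proof (rule ccontr)
    assume pn: "p \<noteq> One"
    have b2: "bl b i (lv (u 2))" using S_lv[OF uS(3) un(3)] .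
    have p2: "p \<in> S f (lv (u 2)) i" using pS_at[OF b2] D(5) eq by simp
    have "u 2 \<in> S f (lv (u 2)) i"
      by (rule mal[OF b2 S_own[OF uS(3) un(3) b] p2 p2 pn]) (use eu[of 2] eq in simp)
    then show False using top[OF un(3)] by blast
  qed
  then show ?thesis using eq gop_One by simp
qed

section \<open>A single step of the recursion\<close>

lemma card_levels:
  assumes "b \<in> K" "A \<subseteq> {x. alive f x}" "\<And>x. x \<in> A \<Longrightarrow> x \<noteq> One \<Longrightarrow> lv x \<preceq> b"
  shows "|A| \<le>o |I|"
proof -
  define B where "B = {k \<in> K. k \<preceq> b}"
  have cI: "Card_order |I|" by (rule card_of_Card_order)
  have fI: "infinite (Field |I| )" using I_inf by (simp add: Field_card_of)
  have "|{k \<in> K. k \<prec> b}| \<le>o |I|" "|{b}| \<le>o |I|" using K_seg[OF assms(1)] I_inf by (auto intro: card_of_singl_ordLeq)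
  then have "|{k \<in> K. k \<prec> b} \<union> {b}| \<le>o |I|" using card_of_Un_ordLeq_infinite_Field[OF fI _ _ cI] by blast
  moreover have "B \<subseteq> {k \<in> K. k \<prec> b} \<union> {b}" unfolding B_def by (auto simp: K.le_less)
  ultimately have B: "|B| \<le>o |I|" using card_of_mono1 ordLeq_transitive by blast
  have II: "|I \<times> I| \<le>o |I|" using card_of_Times_ordLeq_infinite_Field[OF fI _ _ cI] ordLeq_reflexive[OF card_of_Well_order] by blast
  have "|B \<times> (I \<times> I)| \<le>o |I|" by (rule card_of_Times_ordLeq_infinite_Field[OF fI B II cI])
  then have E: "|(\<lambda>(k, i, n). El k i n) ` (B \<times> (I \<times> I))| \<le>o |I|" using card_of_image ordLeq_transitive by blast
  have T: "|Tp ` B| \<le>o |I|" using B card_of_image ordLeq_transitive by blast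
  have O: "|{One :: ('k, 'i) elem}| \<le>o |I|" using I_inf by (auto intro: card_of_singl_ordLeq)
  note Un = card_of_Un_ordLeq_infinite_Field[OF fI _ _ cI]
  have "A \<subseteq> ((\<lambda>(k, i, n). El k i n) ` (B \<times> (I \<times> I)) \<union> Tp ` B) \<union> {One}"
  proof
    fix x assume x: "x \<in> A"
    have "alive f x" "x \<noteq> One \<Longrightarrow> lv x \<preceq> b" using assms x by auto
    then show "x \<in> ((\<lambda>(k, i, n). El k i n) ` (B \<times> (I \<times> I)) \<union> Tp ` B) \<union> {One}"
      unfolding B_def by (cases x) (auto simp: image_iff)
  qed
  then show ?thesis using Un[OF Un[OF E T] O] card_of_mono1 ordLeq_transitive by blast
qed

lemma Step_ex:
  assumes b: "b \<in> K" "i \<in> I"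
    and G: "\<And>d j. d \<in> K \<Longrightarrow> j \<in> I \<Longrightarrow> d \<prec> b \<Longrightarrow> Good f d j" and Gb: "\<And>j. j \<in> I \<Longrightarrow> j \<lhd> i \<Longrightarrow> Good f b j"
  shows "\<exists>r. Step f (b, i) r"
proof -
  note cap = S_inter_Mm[OF b, of f]
  have gS: "grp (S f b i) (gop f) One" by (rule grp_S) (use b G in \<open>auto simp: bl_def\<close>)
  interpret P: presentation "S f b i" "Mm f b i" "gop f" One "Tup f b i"
  proof
    show "grp (S f b i) (gop f) One" by (rule gS)
    show "grp (Mm f b i) (gop f) One" by (rule grp_Mm[OF b Gb])
    show "grp (S f b i \<inter> Mm f b i) (gop f) One" unfolding cap by (rule grp_Sm[OF b G])
    show "malnormal (S f b i \<inter> Mm f b i) (S f b i) (gop f) One" unfolding cap by (rule mal_Sm_S[OF b G])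
    show "malnormal (S f b i \<inter> Mm f b i) (Mm f b i) (gop f) One" unfolding cap by (rule mal_Sm_Mm[OF b Gb])
    show "gop f p z' = gop f z p" if "(u, x, h, z) \<in> Tup f b i" "(u', x', h', z') \<in> Tup f b i"
      "p \<in> S f b i \<inter> Mm f b i" "q \<in> S f b i \<inter> Mm f b i" "\<And>a. a < 4 \<Longrightarrow> gop f p (u' a) = gop f (u a) p"
      "gop f p x' = gop f x q" "gop f q h' = gop f h p" for u x h z u' x' h' z' p q
      by (rule Tup_coherent[OF b G that(1,2) that(3,4)[unfolded cap] that(5,6)])
    show "(\<forall>a<4. u a \<in> S f b i \<inter> Mm f b i) \<and> inj_on u {..<4} \<and> u 0 = One \<and> x \<in> S f b i - Mm f b i \<and>
      h \<in> Mm f b i - S f b i \<and> z \<in> S f b i \<inter> Mm f b i" if T: "(u, x, h, z) \<in> Tup f b i" for u x h z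
      unfolding cap
    proof (intro conjI)
      note D = TupD[OF T]
      have four: "a = 0 \<or> a = 1 \<or> a = 2 \<or> a = 3" if "a < 4" for a :: nat using that by auto
      show "\<forall>a<4. u a \<in> Sm f b i"
      proof (intro allI impI)
        fix a :: nat assume "a < 4"
        then show "u a \<in> Sm f b i" using four[of a] D(1-4) by auto
      qed
      have l: "lv (u 1) \<noteq> lv (u 2)" "lv (u 1) \<noteq> lv (u 3)" "lv (u 2) \<noteq> lv (u 3)"
        using D(5,6) K.less_trans by (metis K.less_irrefl)+
      show "inj_on u {..<4}"
      proof (rule inj_onI)
        fix a a' :: nat assume a: "a \<in> {..<4}" "a' \<in> {..<4}" "u a = u a'"
        then show "a = a'" using four[of a] four[of a'] D(1-4) l by auto
      qed
      show "u 0 = One" by (rule D)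
      show "x \<in> S f b i - Mm f b i"
      proof
        show "x \<notin> Mm f b i"
        proof
          assume "x \<in> Mm f b i"
          then have "x \<in> Sm f b i" using D(8) cap by blast
          then show False using Sm_lv D(9,10) by blast
        qed
      qed (rule D)
      show "h \<in> Mm f b i - S f b i" using D(11-13) S_lt by blast
      show "z \<in> Sm f b i" by (rule D)
    qed
  qed
  \<comment> \<open>The names reserved for step \<open>(b, i)\<close>. There are \<lambda> of them,
    which suffices because at most \<lambda> elements have level up to \<open>b\<close>.\<close>
  define N where "N = {El b i n | n. n \<in> I}"
  have N_im: "N = El b i ` I" unfolding N_def by auto
  have inj: "inj_on (El b i) I" unfolding inj_on_def by auto
  have 1: "infinite N" unfolding N_im using I_inf inj by (simp add: finite_image_iff)
  have MmM: "Mm f b i \<subseteq> M f b i" by (rule Mm_M[OF b(1)])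
  have 2: "|S f b i \<union> Mm f b i| \<le>o |N|"
  proof -
    have "|S f b i \<union> Mm f b i| \<le>o |I|"
    proof (rule card_levels[OF b(1), of _ f])
      have M: "x \<in> M f b i" if "x \<in> S f b i \<union> Mm f b i" for x using that MmM S_M by blast
      have "alive f x" if "x \<in> M f b i" for x using that unfolding M_def S_def by (cases "x = One") auto
      then show "S f b i \<union> Mm f b i \<subseteq> {x. alive f x}" using M by blast
      show "lv x \<preceq> b" if "x \<in> S f b i \<union> Mm f b i" "x \<noteq> One" for x
        using M_cases[OF M[OF that(1)]] S_lt[OF _ that(2)] by (auto intro: K.less_imp_le)
    qed
    moreover have "|I| \<le>o |N|" unfolding N_im
      by (rule iffD1[OF card_of_ordLeq, OF exI[of _ "El b i"]]) (simp add: inj)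
    ultimately show ?thesis using ordLeq_transitive by blast
  qed
  have 3: "N \<inter> (S f b i \<union> Mm f b i) = {}"
  proof -
    have "El b i n \<notin> S f b i" for n using S_lt[of "El b i n" f b i] K.less_irrefl by auto
    moreover have "El b i n \<notin> Mm f b i" for n
    proof
      assume "El b i n \<in> Mm f b i"
      then obtain j where "j \<lhd> i" "El b i n \<in> M f b j" unfolding Mm_def by auto
      then have "j \<lhd> i" "i \<unlhd> j" unfolding M_def S_def by auto
      then show False by (simp add: I.leD)
    qed
    ultimately show ?thesis unfolding N_def by blast
  qed
  obtain Q m where Q: "common_ext (S f b i) (Mm f b i) (gop f) One Q m" "Q \<subseteq> S f b i \<union> Mm f b i \<union> N"
    "\<forall>(u, x, h, z)\<in>Tup f b i. foldl m One (spell u x h) = z"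
    using P.presentation_quotient[OF 1 2 3] by blast
  define D where "D = Q - (S f b i \<union> Mm f b i)"
  have QD: "Q = S f b i \<union> Mm f b i \<union> D" unfolding D_def using Q(1) unfolding common_ext_def by blast
  have DN: "D \<subseteq> {El b i n | n. n \<in> I}" using Q(2) unfolding D_def N_def by blast
  have "Step f (b, i) (D, m)" unfolding Step_def split QD[symmetric] using Q(1,3) DN by (intro impI conjI)
  then show ?thesis by blast
qed

end

lemma grp_cong:
  assumes eq: "\<And>x y. x \<in> Q \<Longrightarrow> y \<in> Q \<Longrightarrow> m x y = m' x y" and g: "grp Q m e"
  shows "grp Q m' e"
  unfolding grp_def
proof (intro conjI ballI)
  have cl: "m x y \<in> Q" if "x \<in> Q" "y \<in> Q" for x y using grp_closed[OF g that] .
  show eQ: "e \<in> Q" using g unfolding grp_def by blast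
  fix x assume x: "x \<in> Q"
  show "m' e x = x" "m' x e = x" using eq[OF eQ x] eq[OF x eQ] g x unfolding grp_def by auto
  obtain y where "y \<in> Q" "m x y = e" "m y x = e" using g x unfolding grp_def by blast
  then show "\<exists>y\<in>Q. m' x y = e \<and> m' y x = e" using eq x by auto
  fix y assume y: "y \<in> Q"
  show "m' x y \<in> Q" using cl eq x y by metis
  fix z assume z: "z \<in> Q"
  have "m (m x y) z = m x (m y z)" using g x y z unfolding grp_def by blast
  then show "m' (m' x y) z = m' x (m' y z)" using eq cl x y z by metis
qed

lemma malnormal_cong:
  "A \<subseteq> Q \<Longrightarrow> (\<And>x y. x \<in> Q \<Longrightarrow> y \<in> Q \<Longrightarrow> m x y = m' x y) \<Longrightarrow> malnormal A Q m e \<Longrightarrow> malnormal A Q m' e"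
  unfolding malnormal_def by (metis subsetD)

lemma foldl_grp_cong:
  assumes "grp Q m e" "\<And>x y. x \<in> Q \<Longrightarrow> y \<in> Q \<Longrightarrow> m x y = m' x y" "set w \<subseteq> Q"
  shows "foldl m' e w = foldl m e w \<and> foldl m e w \<in> Q"
  using assms(3)
proof (induction w rule: rev_induct)
  case (snoc x w)
  then show ?case using assms(2)[of "foldl m e w" x] grp_closed[OF assms(1), of "foldl m e w" x] by simp
qed (use assms(1) in \<open>simp add: grp_def\<close>)

section \<open>The global operation agrees with the local tables\<close>

context tower
begin

lemma M_at: "x \<in> M f b i \<Longrightarrow> x \<noteq> One \<Longrightarrow> alive f x \<and> tg x i \<and> (lv x = b \<or> bl b i (lv x))"
  unfolding M_def S_def by auto

lemma M_I: "alive f x \<Longrightarrow> tg x i \<Longrightarrow> lv x = b \<or> bl b i (lv x) \<Longrightarrow> x \<in> M f b i"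
  unfolding M_def S_def by (cases "x = One") auto

lemma idx_props:
  assumes x: "x \<in> M f b i" "y \<in> M f b i" "x \<noteq> One" "y \<noteq> One" and b: "i \<in> I" "top_lv x y = b"
  shows "idx x y \<in> I" "idx x y \<unlhd> i" "x \<in> M f b (idx x y)" "y \<in> M f b (idx x y)"
proof -
  define R where "R i \<longleftrightarrow> i \<in> I \<and> tg x i \<and> tg y i \<and> (lv x = b \<or> e (lv x) b \<unlhd> i) \<and> (lv y = b \<or> e (lv y) b \<unlhd> i)" for i
  have idx: "idx x y = I.Least R" unfolding idx_def b(2) Let_def R_def ..
  note a = M_at[OF x(1,3)] M_at[OF x(2,4)]
  have Ri: "R i" unfolding R_def using a b(1) unfolding bl_def by blast
  have R: "R (idx x y)" unfolding idx using Ri by (rule I.LeastI)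
  then show "idx x y \<in> I" unfolding R_def by simp
  show "idx x y \<unlhd> i" unfolding idx using Ri by (rule I.Least_le)
  show "x \<in> M f b (idx x y)" by (rule M_I) (use R a in \<open>auto simp: R_def bl_def\<close>)
  show "y \<in> M f b (idx x y)" by (rule M_I) (use R a in \<open>auto simp: R_def bl_def\<close>)
qed

lemma Step_M:
  assumes b: "b \<in> K" "i \<in> I" and D: "fst (f (b, i)) \<subseteq> {El b i n | n. n \<in> I}"
  shows "M f b i = S f b i \<union> Mm f b i \<union> fst (f (b, i))"
proof
  show "S f b i \<union> Mm f b i \<union> fst (f (b, i)) \<subseteq> M f b i"
  proof (intro Un_least S_M Mm_M b subsetI)
    fix x assume x: "x \<in> fst (f (b, i))"
    then obtain n where "x = El b i n" "n \<in> I" using D by blast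
    then show "x \<in> M f b i" using x b by (intro M_I) auto
  qed
  show "M f b i \<subseteq> S f b i \<union> Mm f b i \<union> fst (f (b, i))"
  proof
    fix x assume x: "x \<in> M f b i"
    show "x \<in> S f b i \<union> Mm f b i \<union> fst (f (b, i))"
    proof (cases "x \<in> S f b i")
      case False
      then have "x \<noteq> One" using One_in(1)[of f b i] by blast
      then have a: "alive f x" "tg x i" "lv x = b" using M_at[OF x] False unfolding S_def by auto
      show ?thesis
      proof (cases x)
        case (Tp k) then show ?thesis using a unfolding Mm_def by simp
      next
        case (El k j n)
        show ?thesis
        proof (cases "j = i")
          case True then show ?thesis using a El by simp
        next
          case False
          then have "j \<lhd> i" "j \<in> I" using a El by (auto simp: I.le_less)
          moreover have "x \<in> M f b j" using a El by (intro M_I) auto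
          ultimately show ?thesis unfolding Mm_def by blast
        qed
      qed (use \<open>x \<noteq> One\<close> in simp)
    qed simp
  qed
qed

lemma top_lv_cases: "top_lv x y = lv x \<and> lv y \<preceq> lv x \<or> top_lv x y = lv y \<and> lv x \<preceq> lv y"
  unfolding top_lv_def using K.linear by auto

text \<open>If both levels are below \<open>b\<close>, the factors lie in \<open>S\<close>; if their
  product is stored at an index before \<open>i\<close>, they lie in \<open>Mm\<close>. In both
  cases the new table extends the old operation, and otherwise the product is read from the new
  table itself.\<close>

lemma Step_Good:
  assumes b: "b \<in> K" "i \<in> I" and st: "Step f (b, i) (f (b, i))"
  shows "Good f b i"
proof -
  obtain D m where Dm: "f (b, i) = (D, m)" by fastforce
  define Q where "Q = S f b i \<union> Mm f b i \<union> D"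
  have s: "D \<subseteq> {El b i n | n. n \<in> I}" "grp Q m One" "\<forall>x\<in>S f b i. \<forall>y\<in>S f b i. m x y = gop f x y"
    "\<forall>x\<in>Mm f b i. \<forall>y\<in>Mm f b i. m x y = gop f x y" "malnormal (S f b i) Q m One"
    "malnormal (Mm f b i) Q m One" "\<forall>(u, x, h, z)\<in>Tup f b i. foldl m One (spell u x h) = z"
    using st b unfolding Step_def common_ext_def Dm Q_def by auto
  have QM: "M f b i = Q" using Step_M[OF b, of f] s(1) unfolding Dm Q_def by simp
  have ag: "m x y = gop f x y" if xy: "x \<in> Q" "y \<in> Q" for x y
  proof (cases "x = One \<or> y = One")
    case True
    then show ?thesis using s(2) xy gop_One unfolding grp_def by auto
  next
    case n: False
    show ?thesis
    proof (cases "x \<in> S f b i \<and> y \<in> S f b i")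
      case True then show ?thesis using s(3) by blast
    next
      case False
      have a: "lv x = b \<or> bl b i (lv x)" "lv y = b \<or> bl b i (lv y)" using M_at[of x f b i] M_at[of y f b i] xy n unfolding QM by auto
      have "lv x = b \<or> lv y = b" using False M_cases[of x f b i] M_cases[of y f b i] xy unfolding QM by auto
      then have top: "top_lv x y = b"
        using a unfolding top_lv_def bl_def by (auto dest: K.leD)
      note ip = idx_props[OF xy[folded QM] _ _ b(2) top]
      show ?thesis
      proof (cases "x = y \<and> x = Tp (lv x)")
        case True
        then have "x = Tp b" "y = Tp b" using \<open>lv x = b \<or> lv y = b\<close> by auto
        then show ?thesis using s(4) unfolding Mm_def by blast
      next
        case sp: False
        show ?thesis
        proof (cases "idx x y = i")
          case True
          have "gop f x y = (if x = y \<and> x = Tp (lv x) then One else snd (f (b, i)) x y)"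
            unfolding gop_def top True using n by presburger
          also have "\<dots> = snd (f (b, i)) x y" using sp by (rule if_not_P)
          finally have "gop f x y = snd (f (b, i)) x y" .
          then show ?thesis unfolding Dm by simp
        next
          case False
          then have "idx x y \<lhd> i" using ip(2) n by (simp add: I.le_less)
          then have "x \<in> Mm f b i" "y \<in> Mm f b i" using ip n unfolding Mm_def by blast+
          then show ?thesis using s(4) by blast
        qed
      qed
    qed
  qed
  have sub: "S f b i \<subseteq> Q" "Mm f b i \<subseteq> Q" unfolding Q_def by auto
  have "grp Q (gop f) One" by (rule grp_cong[OF ag s(2)])
  moreover have "malnormal (S f b i) Q (gop f) One" by (rule malnormal_cong[OF sub(1) ag s(5)])
  moreover have "malnormal (Mm f b i) Q (gop f) One" by (rule malnormal_cong[OF sub(2) ag s(6)])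
  moreover have "foldl (gop f) One (spell u x h) = z" if T: "(u, x, h, z) \<in> Tup f b i" for u x h z
  proof -
    note D = TupD[OF T]
    have four: "a = 0 \<or> a = 1 \<or> a = 2 \<or> a = 3" if "a < 4" for a :: nat using that by auto
    have "u a \<in> Q" if "a < 4" for a
      using four[OF that] D(1-4) Sm_S[of f b i] One_in(1)[of f b i] sub by auto
    moreover have "x \<in> Q" "h \<in> Q" using D sub by auto
    ultimately have "set (spell u x h) \<subseteq> Q" using set_spell[of u x h] by auto
    then have "foldl (gop f) One (spell u x h) = foldl m One (spell u x h)"
      using foldl_grp_cong[OF s(2) ag] by blast
    then show ?thesis using s(7) T by auto
  qed
  ultimately show ?thesis unfolding Good_def QM by auto
qed

section \<open>A step depends only on earlier steps; the recursion\<close>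

definition agree :: "('k, 'i) state \<Rightarrow> ('k, 'i) state \<Rightarrow> 'k \<Rightarrow> 'i \<Rightarrow> bool" where
  "agree f g b i \<longleftrightarrow> (\<forall>d j. d \<prec> b \<or> (d = b \<and> j \<lhd> i) \<longrightarrow> f (d, j) = g (d, j))"

lemma alive_agree:
  assumes "agree f g b i" "lv x \<prec> b \<or> (lv x = b \<and> tg x j \<and> j \<lhd> i)" shows "alive f x = alive g x"
proof (cases x)
  case (El k l n)
  then have "k \<prec> b \<or> (k = b \<and> l \<lhd> i)" using assms(2) by (auto intro: I.le_less_trans)
  then have "f (k, l) = g (k, l)" using assms(1) unfolding agree_def by blast
  then show ?thesis using El by simp
qed simp_all

lemma S_agree: "agree f g b i \<Longrightarrow> S f b l = S g b l"
  unfolding S_def bl_def using alive_agree by blast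

lemma M_agree: "agree f g b i \<Longrightarrow> j \<lhd> i \<Longrightarrow> M f b j = M g b j"
  unfolding M_def using S_agree alive_agree by blast

lemma Sm_agree: "agree f g b i \<Longrightarrow> Sm f b i = Sm g b i"
  unfolding Sm_def using S_agree[of f g b i] by simp

lemma Mm_agree: "agree f g b i \<Longrightarrow> Mm f b i = Mm g b i"
proof -
  assume "agree f g b i"
  then have "(\<Union>j\<in>{j \<in> I. j \<lhd> i}. M f b j) = (\<Union>j\<in>{j \<in> I. j \<lhd> i}. M g b j)"
    by (intro SUP_cong refl M_agree) auto
  then show "Mm f b i = Mm g b i" unfolding Mm_def by simp
qed

lemma gop_agree_S:
  assumes "agree f g b i" "x \<in> S f b l" "y \<in> S f b l" shows "gop f x y = gop g x y"
proof (cases "x = One \<or> y = One \<or> x = y \<and> x = Tp (lv x)")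
  case False
  then have "lv x \<prec> b" "lv y \<prec> b" using S_lt assms by blast+
  then have "top_lv x y \<prec> b" using top_lv_cases[of x y] by auto
  then have "f (top_lv x y, idx x y) = g (top_lv x y, idx x y)" using assms(1) unfolding agree_def by blast
  then show ?thesis unfolding gop_def by (simp only:)
qed (auto simp: gop_def)

lemma gop_agree_Mm:
  assumes ag: "agree f g b i" and b: "b \<in> K" "i \<in> I" and xy: "x \<in> Mm f b i" "y \<in> Mm f b i" shows "gop f x y = gop g x y"
proof (cases "x = One \<or> y = One \<or> x = y \<and> x = Tp (lv x)")
  case False
  have "\<exists>j\<in>I. j \<lhd> i \<and> x \<in> M f b j \<and> y \<in> M f b j"
  proof -
    have T: "Tp b \<in> M f b j" for j using b by (intro M_I) auto
    have "x \<noteq> Tp b \<or> y \<noteq> Tp b" using False by auto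
    moreover have "z = Tp b \<or> (\<exists>j\<in>I. j \<lhd> i \<and> z \<in> M f b j)" if "z \<in> Mm f b i" "z \<noteq> One" for z
      using that unfolding Mm_def by blast
    ultimately have "(\<exists>j\<in>I. j \<lhd> i \<and> x \<in> M f b j \<and> y = Tp b) \<or> (\<exists>j\<in>I. j \<lhd> i \<and> y \<in> M f b j \<and> x = Tp b) \<or>
        (\<exists>j\<in>I. \<exists>j'\<in>I. j \<lhd> i \<and> j' \<lhd> i \<and> x \<in> M f b j \<and> y \<in> M f b j')" using xy False by metis
    then show ?thesis
    proof (elim disjE)
      assume "\<exists>j\<in>I. \<exists>j'\<in>I. j \<lhd> i \<and> j' \<lhd> i \<and> x \<in> M f b j \<and> y \<in> M f b j'"
      then obtain j j' where j: "j \<in> I" "j' \<in> I" "j \<lhd> i" "j' \<lhd> i" "x \<in> M f b j" "y \<in> M f b j'" by blast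
      obtain l where "l \<in> {j, j'}" "j \<unlhd> l" "j' \<unlhd> l" using I_max j by blast
      then show ?thesis using j M_mono by blast
    qed (use T in blast)+
  qed
  then obtain j where j: "j \<in> I" "j \<lhd> i" "x \<in> M f b j" "y \<in> M f b j" by blast
  have l: "lv x = b \<or> bl b j (lv x)" "lv y = b \<or> bl b j (lv y)" using M_at j False by blast+
  have "f (top_lv x y, idx x y) = g (top_lv x y, idx x y)"
  proof (cases "top_lv x y = b")
    case True
    have "idx x y \<unlhd> j" using idx_props(2)[OF j(3,4) _ _ j(1) True] False by blast
    then have "idx x y \<lhd> i" using j(2) by (rule I.le_less_trans)
    then show ?thesis using ag True unfolding agree_def by blast
  next
    case False
    then have "top_lv x y \<prec> b" using l top_lv_cases[of x y] unfolding bl_def by auto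
    then show ?thesis using ag unfolding agree_def by blast
  qed
  then show ?thesis unfolding gop_def by (simp only:)
qed (auto simp: gop_def)

text \<open>The locality that dependent choice along a well-founded relation requires.\<close>

lemma Step_agree:
  assumes ag: "agree f g b i" and st: "Step f (b, i) r" shows "Step g (b, i) r"
proof -
  obtain D m where r: "r = (D, m)" by fastforce
  note eqs = S_agree[OF ag, symmetric] Mm_agree[OF ag, symmetric]
  have T: "Tup g b i = Tup f b i"
    unfolding Tup_def eqs Sm_agree[OF ag, symmetric] ..
  show ?thesis unfolding Step_def r split
  proof (intro impI)
    assume b: "b \<in> K" "i \<in> I"
    define Q where "Q = S f b i \<union> Mm f b i \<union> D"
    have s: "D \<subseteq> {El b i n | n. n \<in> I}" "common_ext (S f b i) (Mm f b i) (gop f) One Q m"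
      "\<forall>(u, x, h, z)\<in>Tup f b i. foldl m One (spell u x h) = z"
      using st b unfolding Step_def r Q_def by auto
    have "common_ext (S f b i) (Mm f b i) (gop g) One Q m"
      using s(2) gop_agree_S[OF ag] gop_agree_Mm[OF ag b] unfolding common_ext_def by simp
    then show "D \<subseteq> {El b i n |n. n \<in> I} \<and> common_ext (S g b i) (Mm g b i) (gop g) One (S g b i \<union> Mm g b i \<union> D) m \<and>
      (\<forall>(u, x, h, z)\<in>Tup g b i. foldl m One (spell u x h) = z)"
      unfolding eqs T Q_def[symmetric] using s by (intro conjI)
  qed
qed

theorem state_ex: "\<exists>f. \<forall>b\<in>K. \<forall>i\<in>I. Good f b i"
proof -
  have "\<exists>f. \<forall>p. Step f p (f p)"
  proof (rule dependent_wf_choice[OF wf_lessp, of Step])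
    fix f g :: "('k, 'i) state" and p r assume a: "\<And>z. (z, p) \<in> lessp \<Longrightarrow> f z = g z"
    obtain b i where p: "p = (b, i)" by fastforce
    have "agree f g b i" "agree g f b i" using a unfolding agree_def p lessp_def by auto
    then show "Step f p r = Step g p r" using Step_agree unfolding p by blast
  next
    fix p and f :: "('k, 'i) state" assume IH: "\<And>y. (y, p) \<in> lessp \<Longrightarrow> Step f y (f y)"
    obtain b i where p: "p = (b, i)" by fastforce
    show "\<exists>r. Step f p r"
    proof (cases "b \<in> K \<and> i \<in> I")
      case True
      show ?thesis unfolding p
      proof (rule Step_ex)
        show "Good f d j" if "d \<in> K" "j \<in> I" "d \<prec> b" for d j
          by (rule Step_Good[OF that(1,2) IH]) (use that in \<open>simp add: p lessp_def\<close>)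
        show "Good f b j" if "j \<in> I" "j \<lhd> i" for j
          by (rule Step_Good[OF _ that(1) IH]) (use that True in \<open>simp_all add: p lessp_def\<close>)
      qed (use True in auto)
    next
      case False
      then show ?thesis unfolding p Step_def by auto
    qed
  qed
  then show ?thesis using Step_Good by blast
qed

end

section \<open>Large sets reach every element\<close>

definition spell_len :: nat where "spell_len = (\<Sum>j\<leftarrow>[0..<3328]. if pat j = 0 then 2 else 3)"

lemma spell_len_bounds: "0 < spell_len" "spell_len \<le> 9984"
proof -
  have "(\<Sum>j\<leftarrow>[0..<3328::nat]. 2) \<le> spell_len" unfolding spell_len_def by (rule sum_list_mono) auto
  then show "0 < spell_len" by (simp add: sum_list_triv)
  have "spell_len \<le> (\<Sum>j\<leftarrow>[0..<3328::nat]. 3)" unfolding spell_len_def by (rule sum_list_mono) auto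
  then show "spell_len \<le> 9984" by (simp add: sum_list_triv)
qed

text \<open>The identity occurs in the spelled word as \<open>u 0\<close> but may be missing from
  \<open>X\<close>, so it is dropped. The number of its occurrences depends only on the pattern,
  hence one length serves all tuples.\<close>

lemma length_filter_spell:
  assumes "u 0 = z" "\<And>a. a < 4 \<Longrightarrow> a \<noteq> 0 \<Longrightarrow> u a \<noteq> z" "x \<noteq> z" "h \<noteq> z"
  shows "length (filter (\<lambda>y. y \<noteq> z) (spell u x h)) = spell_len"
proof -
  have "length (filter (\<lambda>y. y \<noteq> z) [u (pat j), x, h]) = (if pat j = 0 then 2 else 3)" for j
    using assms pat_less[of j] by auto
  then show ?thesis unfolding spell_def spell_len_def filter_concat length_concat map_map
    by (simp only: comp_def)
qed

context tower
begin

lemma M_cofinal: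
  assumes "b \<in> K" "i \<in> I" "b' \<in> K" "i' \<in> I"
  shows "\<exists>d\<in>K. \<exists>l\<in>I. M f b i \<subseteq> M f d l \<and> M f b' i' \<subseteq> M f d l"
proof -
  have sub: "\<exists>l\<in>I. \<forall>j\<in>I. l \<unlhd> j \<longrightarrow> M f b i \<subseteq> M f d j" if H: "b \<in> K" "i \<in> I" "d \<in> K" "b \<preceq> d" for b i d
  proof (cases "b = d")
    case True then show ?thesis using M_mono that by blast
  next
    case False
    then have bd: "b \<prec> d" using that by (simp add: K.le_less)
    obtain l where l: "l \<in> {i, e b d}" "i \<unlhd> l" "e b d \<unlhd> l" using I_max[OF H(2) e_I[OF H(1,3) bd]] by blast
    have lI: "l \<in> I" using l(1) H(2) e_I[OF H(1,3) bd] by auto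
    have "M f b i \<subseteq> M f d j" if j: "j \<in> I" "l \<unlhd> j" for j
    proof -
      have "i \<unlhd> j" "e b d \<unlhd> j" using l j I.order_trans by blast+
      then have "bl d j b" using \<open>b \<in> K\<close> bd unfolding bl_def by simp
      then have "M f b j \<subseteq> S f d j" using M_sub_S \<open>d \<in> K\<close> j(1) by blast
      then show ?thesis using M_mono[OF \<open>i \<unlhd> j\<close>] S_M by blast
    qed
    then show ?thesis using lI by blast
  qed
  obtain d where d: "d \<in> K" "b \<preceq> d" "b' \<preceq> d"
  proof (cases "b \<preceq> b'")
    case True then show thesis using that[of b'] assms by simp
  next
    case False
    then have "b' \<preceq> b" using K.linear by blast
    then show thesis using that[of b] assms by simp
  qed
  obtain l l' where l: "l \<in> I" "\<forall>j\<in>I. l \<unlhd> j \<longrightarrow> M f b i \<subseteq> M f d j" "l' \<in> I" "\<forall>j\<in>I. l' \<unlhd> j \<longrightarrow> M f b' i' \<subseteq> M f d j"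
    using sub[OF assms(1,2) d(1,2)] sub[OF assms(3,4) d(1,3)] by blast
  obtain n where "n \<in> {l, l'}" "l \<unlhd> n" "l' \<unlhd> n" using I_max[OF l(1,3)] by blast
  then show ?thesis using l d(1) by blast
qed

lemma K_ne: "K \<noteq> {}" using K_bd[of "{}"] card_of_empty by auto

lemma alive_M:
  assumes "alive f x" obtains b i where "b \<in> K" "i \<in> I" "x \<in> M f b i"
proof -
  obtain i0 where i0: "i0 \<in> I" using infinite_imp_nonempty[OF I_inf] by blast
  obtain k0 where k0: "k0 \<in> K" using K_ne by blast
  show thesis
  proof (cases x)
    case One then show thesis using that[OF k0 i0] by simp
  next
    case (Tp k)
    then have "k \<in> K" "x \<in> M f k i0" using assms by (auto intro!: M_I)
    then show thesis using that i0 by blast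
  next
    case (El k j n)
    then have "k \<in> K" "j \<in> I" "x \<in> M f k j" using assms by (auto intro!: M_I)
    then show thesis using that by blast
  qed
qed

lemma alive_tg: "alive f x \<Longrightarrow> \<exists>i\<in>I. tg x i"
  using infinite_imp_nonempty[OF I_inf] by (cases x) auto

lemma grp_alive:
  assumes "\<And>b i. b \<in> K \<Longrightarrow> i \<in> I \<Longrightarrow> Good f b i" shows "grp {x. alive f x} (gop f) One"
proof -
  have "grp (\<Union>((\<lambda>(b, i). M f b i) ` (K \<times> I))) (gop f) One"
  proof (rule grp_directed_union)
    show "(\<lambda>(b, i). M f b i) ` (K \<times> I) \<noteq> {}" using K_ne infinite_imp_nonempty[OF I_inf] by auto
    show "grp X (gop f) One" if "X \<in> (\<lambda>(b, i). M f b i) ` (K \<times> I)" for X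
      using that assms GoodD(1) by auto
    show "\<exists>Z\<in>(\<lambda>(b, i). M f b i) ` (K \<times> I). X \<subseteq> Z \<and> Y \<subseteq> Z"
      if XY: "X \<in> (\<lambda>(b, i). M f b i) ` (K \<times> I)" "Y \<in> (\<lambda>(b, i). M f b i) ` (K \<times> I)" for X Y
    proof -
      obtain b i b' i' where "b \<in> K" "i \<in> I" "b' \<in> K" "i' \<in> I" "X = M f b i" "Y = M f b' i'" using XY by auto
      then obtain d l where "d \<in> K" "l \<in> I" "X \<subseteq> M f d l" "Y \<subseteq> M f d l" using M_cofinal by metis
      then show ?thesis by (intro bexI[of _ "M f d l"]) auto
    qed
  qed
  moreover have "\<Union>((\<lambda>(b, i). M f b i) ` (K \<times> I)) = {x. alive f x}"
  proof
    have "alive f x" if "x \<in> M f b i" for x b i using M_at[OF that] by (cases "x = One") auto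
    then show "\<Union>((\<lambda>(b, i). M f b i) ` (K \<times> I)) \<subseteq> {x. alive f x}" by auto
    show "{x. alive f x} \<subseteq> \<Union>((\<lambda>(b, i). M f b i) ` (K \<times> I))"
    proof
      fix x assume "x \<in> {x. alive f x}"
      then obtain b i where "b \<in> K" "i \<in> I" "x \<in> M f b i" using alive_M[of f x] by auto
      then show "x \<in> \<Union>((\<lambda>(b, i). M f b i) ` (K \<times> I))" by auto
    qed
  qed
  ultimately show ?thesis by simp
qed

lemma I_bound_finite: "finite A \<Longrightarrow> A \<subseteq> I \<Longrightarrow> \<exists>i\<in>I. \<forall>a\<in>A. a \<unlhd> i"
proof (induction A rule: finite_induct)
  case empty then show ?case using infinite_imp_nonempty[OF I_inf] by blast
next
  case (insert x A)
  then obtain i where i: "i \<in> I" "\<forall>a\<in>A. a \<unlhd> i" by auto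
  obtain l where "l \<in> {x, i}" "x \<unlhd> l" "i \<unlhd> l" using I_max[of x i] insert i by auto
  then show ?case using i insert I.order_trans by (intro bexI[of _ l]) auto
qed

text \<open>At most \<lambda> elements have level up to a given one, so a set with more than
  \<lambda> elements has unboundedly many levels. As there are only \<lambda> tags, one bound for
  them survives on an unbounded set of levels.\<close>

lemma big_levels:
  assumes X: "X \<subseteq> {x. alive f x}" "\<not> |X| \<le>o |I|"
  obtains i0 A where "i0 \<in> I" "unb A" "\<And>a. a \<in> A \<Longrightarrow> \<exists>x\<in>X. x \<noteq> One \<and> lv x = a \<and> tg x i0"
proof -
  define B where "B i = {k \<in> K. \<exists>x\<in>X. x \<noteq> One \<and> lv x = k \<and> tg x i}" for i
  have lvK: "lv x \<in> K" if "x \<in> X" "x \<noteq> One" for x using that X(1) by (cases x) auto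
  have "unb (\<Union>i\<in>I. B i)"
    unfolding unb_def
  proof (intro conjI ballI)
    show "(\<Union>i\<in>I. B i) \<subseteq> K" unfolding B_def by auto
    fix k assume k: "k \<in> K"
    show "\<exists>a\<in>\<Union>i\<in>I. B i. k \<prec> a"
    proof (rule ccontr)
      assume neg: "\<not> ?thesis"
      have "lv x \<preceq> k" if x: "x \<in> X" "x \<noteq> One" for x
      proof -
        have "alive f x" using x X(1) by blast
        then obtain i where "i \<in> I" "tg x i" using alive_tg by blast
        then have "lv x \<in> (\<Union>i\<in>I. B i)" unfolding B_def using x lvK by blast
        then show ?thesis using neg by (meson K.leI)
      qed
      then have "|X| \<le>o |I|" by (rule card_levels[OF k X(1)])
      then show False using X(2) by blast
    qed
  qed
  then obtain i where i: "i \<in> I" "unb ((\<Union>i\<in>I. B i) \<inter> B i)" using unb_pigeon[OF _ subset_refl] by metis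
  show thesis by (rule that[OF i]) (auto simp: B_def)
qed

lemma alive_elems: "alive f x \<Longrightarrow> x \<in> elems"
  unfolding elems_def by (cases x) (auto simp: image_iff)

text \<open>Two letters are fixed in advance and guessed, together with \<open>g\<close>, by the
  colour of \<open>\<delta>\<close>. The others are chosen afterwards, with levels
  \<open>a3 \<prec> a4 \<prec> \<delta> \<prec> b\<close>. Just below \<open>\<delta>\<close> the
  distances to \<open>b\<close> are large, so \<open>\<delta>\<close> can be recovered from
  \<open>a3\<close>, \<open>a4\<close> and \<open>b\<close> as a value of
  \<open>del\<close>.\<close>

theorem capture:
  assumes G: "\<And>b i. b \<in> K \<Longrightarrow> i \<in> I \<Longrightarrow> Good f b i"
    and \<pi>: "\<And>A c \<xi>. unb A \<Longrightarrow> c \<in> elems \<times> elems \<times> elems \<Longrightarrow> \<xi> \<in> K \<Longrightarrow> \<exists>\<delta>. reg \<delta> \<and> \<xi> \<prec> \<delta> \<and> lim A \<delta> \<and> \<pi> \<delta> = c"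
    and X: "X \<subseteq> {x. alive f x}" "\<not> |X| \<le>o |I|" and g: "alive f g"
  shows "\<exists>w. length w = spell_len \<and> set w \<subseteq> X \<and> foldl (gop f) One w = g"
proof -
  obtain i0 A where A: "i0 \<in> I" "unb A" "\<And>a. a \<in> A \<Longrightarrow> \<exists>x\<in>X. x \<noteq> One \<and> lv x = a \<and> tg x i0"
    by (rule big_levels[OF X]) (rule that; assumption)
  from A(3) obtain c where c: "\<And>a. a \<in> A \<Longrightarrow> c a \<in> X \<and> c a \<noteq> One \<and> lv (c a) = a \<and> tg (c a) i0" by metis
  have AK: "A \<subseteq> K" and up: "\<And>k. k \<in> K \<Longrightarrow> \<exists>a\<in>A. k \<prec> a" using A(2) unfolding unb_def by auto
  have al: "alive f (c a)" if "a \<in> A" for a using c[OF that] X(1) by blast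
  obtain k0 where k0: "k0 \<in> K" using K_ne by blast
  obtain a1 where a1: "a1 \<in> A" using up[OF k0] by blast
  obtain a2 where a2: "a2 \<in> A" "a1 \<prec> a2" using up a1 AK by blast
  define gl where "gl = (if g = One then k0 else lv g)"
  have glK: "gl \<in> K" unfolding gl_def using k0 g by (cases g) auto
  obtain \<xi>1 where \<xi>1: "\<xi>1 \<in> A" "a2 \<prec> \<xi>1" using up a2 AK by blast
  obtain \<xi>2 where \<xi>2: "\<xi>2 \<in> A" "gl \<prec> \<xi>2" using up[OF glK] by blast
  obtain \<xi> where \<xi>: "\<xi> \<in> K" "a2 \<prec> \<xi>" "gl \<prec> \<xi>"
  proof (cases "\<xi>1 \<preceq> \<xi>2")
    case True then show thesis using that[of \<xi>2] \<xi>1 \<xi>2 AK K.less_le_trans by blast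
  next
    case False
    then have "\<xi>2 \<preceq> \<xi>1" using K.linear by blast
    then show thesis using that[of \<xi>1] \<xi>1 \<xi>2 AK K.less_le_trans by blast
  qed
  have "(c a1, c a2, g) \<in> elems \<times> elems \<times> elems" using alive_elems al a1 a2 g by blast
  from \<pi>[OF A(2) this \<xi>(1)] obtain \<delta> where \<delta>: "reg \<delta>" "\<xi> \<prec> \<delta>" "lim A \<delta>" "\<pi> \<delta> = (c a1, c a2, g)" by blast
  have \<delta>K: "\<delta> \<in> K" using \<delta>(1) unfolding reg_def by blast
  obtain b where b: "b \<in> A" "\<delta> \<prec> b" using up[OF \<delta>K] by blast
  have bK: "b \<in> K" using b AK by blast
  \<comment> \<open>Balls around \<open>b\<close> have size less than \<lambda>, and
    \<open>\<delta>\<close> has cofinality at least \<lambda>.\<close>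
  have bnd: "\<exists>\<zeta>\<in>K. \<zeta> \<prec> \<delta> \<and> (\<forall>k\<in>K. k \<prec> \<delta> \<longrightarrow> e k b \<unlhd> i \<longrightarrow> k \<prec> \<zeta>)" if "i \<in> I" for i
  proof -
    define B where "B = {k \<in> K. k \<prec> \<delta> \<and> e k b \<unlhd> i}"
    have "|B| <o |I|" unfolding B_def
      by (rule card_lt_sub[OF _ e_small[OF bK that]]) (use b(2) K.less_trans in blast)
    moreover have "B \<subseteq> K" "\<forall>k\<in>B. k \<prec> \<delta>" unfolding B_def by auto
    ultimately have "\<exists>\<zeta>\<in>K. \<zeta> \<prec> \<delta> \<and> (\<forall>k\<in>B. k \<prec> \<zeta>)" using \<delta>(1) unfolding reg_def by blast
    then show ?thesis unfolding B_def by blast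
  qed
  have above: "\<exists>a\<in>A. k \<prec> a \<and> \<zeta> \<prec> a \<and> a \<prec> \<delta>" if kz: "k \<in> K" "\<zeta> \<in> K" "k \<prec> \<delta>" "\<zeta> \<prec> \<delta>" for k \<zeta>
  proof (cases "k \<preceq> \<zeta>")
    case True
    obtain a where "a \<in> A" "\<zeta> \<prec> a" "a \<prec> \<delta>" using \<delta>(3) kz unfolding lim_def by blast
    then show ?thesis using True K.le_less_trans by blast
  next
    case False
    then have "\<zeta> \<prec> k" by (simp add: K.not_le)
    obtain a where "a \<in> A" "k \<prec> a" "a \<prec> \<delta>" using \<delta>(3) kz unfolding lim_def by blast
    then show ?thesis using \<open>\<zeta> \<prec> k\<close> K.less_trans by blast
  qed
  define q where "q = e \<delta> b"
  have qI: "q \<in> I" unfolding q_def using e_I \<delta>K bK b(2) by blast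
  obtain \<zeta>1 where \<zeta>1: "\<zeta>1 \<in> K" "\<zeta>1 \<prec> \<delta>" "\<And>k. k \<in> K \<Longrightarrow> k \<prec> \<delta> \<Longrightarrow> e k b \<unlhd> q \<Longrightarrow> k \<prec> \<zeta>1" using bnd[OF qI] by blast
  have a2\<delta>: "a2 \<prec> \<delta>" "a1 \<prec> \<delta>" "gl \<prec> \<delta>" using \<xi> \<delta>(2) a2(2) by (meson K.less_trans)+
  \<comment> \<open>Above \<open>\<zeta>1\<close> the distance to \<open>b\<close> exceeds that of
    \<open>\<delta>\<close>; so \<open>\<delta>\<close> is within distance \<open>q0\<close> of
    \<open>b\<close>.\<close>
  obtain a3 where a3: "a3 \<in> A" "a2 \<prec> a3" "\<zeta>1 \<prec> a3" "a3 \<prec> \<delta>" using above[of a2 \<zeta>1] a2 AK \<zeta>1 a2\<delta> by blast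
  define q0 where "q0 = e a3 b"
  have lt_b: "k \<prec> \<delta> \<Longrightarrow> k \<prec> b" for k using b(2) K.less_trans by blast
  have q0I: "q0 \<in> I" unfolding q0_def using e_I a3 AK bK lt_b by blast
  have qq0: "q \<unlhd> q0"
  proof (rule ccontr)
    assume "\<not> q \<unlhd> q0"
    then have "e a3 b \<unlhd> q" unfolding q0_def using I.linear by blast
    then show False using \<zeta>1(3)[of a3] a3 AK K.less_asym by blast
  qed
  obtain tgi where tgi: "tgi \<in> I" "tg g tgi" using alive_tg[OF g] by blast
  have eI: "e a1 b \<in> I" "e a2 b \<in> I" "e gl b \<in> I" using e_I a1 a2 AK glK bK lt_b a2\<delta> by blast+
  \<comment> \<open>An index at which every letter except \<open>x\<close>, and also
    \<open>g\<close>, is present. Any larger index then finds them in \<open>Sm\<close> and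
    \<open>Mm\<close>.\<close>
  obtain i1 where i1: "i1 \<in> I" "q0 \<unlhd> i1" "i0 \<unlhd> i1" "e a1 b \<unlhd> i1" "e a2 b \<unlhd> i1" "e gl b \<unlhd> i1" "tgi \<unlhd> i1"
    using I_bound_finite[of "{q0, i0, e a1 b, e a2 b, e gl b, tgi}"] q0I A(1) eI tgi by auto
  obtain \<zeta>2 where \<zeta>2: "\<zeta>2 \<in> K" "\<zeta>2 \<prec> \<delta>" "\<And>k. k \<in> K \<Longrightarrow> k \<prec> \<delta> \<Longrightarrow> e k b \<unlhd> i1 \<Longrightarrow> k \<prec> \<zeta>2" using bnd[OF i1(1)] by blast
  \<comment> \<open>Above \<open>\<zeta>2\<close> the distance to \<open>b\<close> exceeds
    \<open>i1\<close>, so \<open>x\<close> enters strictly later than the other letters.\<close>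
  obtain a4 where a4: "a4 \<in> A" "a3 \<prec> a4" "\<zeta>2 \<prec> a4" "a4 \<prec> \<delta>" using above[of a3 \<zeta>2] a3 AK \<zeta>2 by blast
  define i where "i = e a4 b"
  have iI: "i \<in> I" unfolding i_def using e_I a4 AK bK lt_b by blast
  have i1i: "i1 \<lhd> i"
  proof (rule ccontr)
    assume "\<not> i1 \<lhd> i"
    then have "e a4 b \<unlhd> i1" unfolding i_def by (simp add: I.not_less)
    then show False using \<zeta>2(3)[of a4] a4 AK K.less_asym by blast
  qed
  have inS: "x \<in> S f b i1" if "alive f x" "x \<noteq> One" "tg x i1" "lv x \<prec> \<delta>" "lv x \<in> K" "e (lv x) b \<unlhd> i1" for x
    using that lt_b unfolding S_def bl_def by auto
  have Sm: "x \<in> Sm f b i" if "x \<in> S f b i1" for x using that i1 i1i unfolding Sm_def by blast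
  have tgc: "tg (c a) i1" if "a \<in> A" for a using c[OF that] tg_mono i1(3) by blast
  have SmA: "c a \<in> Sm f b i" if "a \<in> A" "a \<prec> \<delta>" "e a b \<unlhd> i1" for a
    using Sm[OF inS[OF al[OF that(1)]]] c[OF that(1)] tgc[OF that(1)] that AK by auto
  \<comment> \<open>By the choice of \<open>\<zeta>2\<close>, no point from \<open>a4\<close> up to
    \<open>\<delta>\<close> is within distance \<open>q0\<close> of \<open>b\<close>.\<close>
  have del: "del b q0 a4 = \<delta>"
    unfolding del_def
  proof (rule K.Least_equality)
    show "a4 \<preceq> \<delta> \<and> bl b q0 \<delta>" unfolding bl_def using a4 \<delta>K b(2) qq0 unfolding q_def by (simp add: K.less_imp_le)
    fix \<eta> assume \<eta>: "a4 \<preceq> \<eta> \<and> bl b q0 \<eta>"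
    show "\<delta> \<preceq> \<eta>"
    proof (rule ccontr)
      assume "\<not> \<delta> \<preceq> \<eta>"
      then have "\<eta> \<prec> \<delta>" by (simp add: K.not_le)
      then have "\<eta> \<prec> \<zeta>2" using \<zeta>2(3)[of \<eta>] \<eta> i1(2) I.order_trans unfolding bl_def by blast
      then have "\<eta> \<prec> a4" using a4(3) K.less_trans by blast
      then show False using \<eta> by (simp add: K.leD)
    qed
  qed
  define u where "u a = (if a = 0 then One else if a = 1 then c a1 else if a = 2 then c a2 else c a3)" for a :: nat
  have T: "(u, c a4, c b, g) \<in> Tup f b i"
    unfolding Tup_def mem_Collect_eq split
  proof (intro conjI)
    show "\<forall>a\<in>{1, 2, 3}. u a \<in> Sm f b i - {One}"
      using SmA[OF a1 a2\<delta>(2) i1(4)] SmA[OF a2(1) a2\<delta>(1) i1(5)] SmA[OF a3(1,4)] i1(2) c a1 a2 a3 unfolding u_def q0_def by auto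
    show "lv (u 1) \<prec> lv (u 2)" "lv (u 2) \<prec> lv (u 3)" "lv (u 3) \<prec> lv (c a4)"
      using c a1 a2 a3 a4 unfolding u_def by auto
    have "tg (c a4) i" using tg_mono[OF tgc[OF a4(1)] I.less_imp_le[OF i1i]] .
    moreover have "bl b i a4" unfolding bl_def i_def using a4 AK lt_b by auto
    ultimately show "c a4 \<in> S f b i - {One}" using al[OF a4(1)] c[OF a4(1)] unfolding S_def by auto
    show "e (lv (c a4)) b = i" using c[OF a4(1)] unfolding i_def by simp
    have "c b \<in> M f b i1" by (rule M_I) (use al[OF b(1)] tgc[OF b(1)] c[OF b(1)] in auto)
    then show "c b \<in> Mm f b i - {One}" using c[OF b(1)] i1(1) i1i unfolding Mm_def by auto
    show "lv (c b) = b" using c[OF b(1)] by simp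
    show "g \<in> Sm f b i"
    proof (cases "g = One")
      case False
      then have "gl = lv g" unfolding gl_def by simp
      then show ?thesis using Sm[OF inS[OF g False]] tg_mono[OF tgi(2) i1(7)] a2\<delta>(3) glK i1(6) by simp
    qed simp
    have "lv (u 3) = a3" "u 1 = c a1" "u 2 = c a2" using c[OF a3(1)] unfolding u_def by auto
    then show "\<pi> (del b (e (lv (u 3)) b) (lv (c a4))) = (u 1, u 2, g)"
      using \<delta>(4) del c[OF a4(1)] unfolding q0_def by simp
  qed (simp add: u_def)
  define w where "w = filter (\<lambda>y. y \<noteq> One) (spell u (c a4) (c b))"
  have "foldl (gop f) x (filter (\<lambda>y. y \<noteq> One) v) = foldl (gop f) x v" for x v
    by (induction v arbitrary: x) (auto simp: gop_One)
  then have "foldl (gop f) One w = g" using G[OF bK iI] T unfolding Good_def w_def by auto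
  moreover have "length w = spell_len"
    unfolding w_def by (rule length_filter_spell) (use c a1 a2 a3 a4 b in \<open>auto simp: u_def\<close>)
  moreover have "set w \<subseteq> X"
  proof -
    have "u a \<in> insert One X" for a unfolding u_def using c a1 a2 a3 by auto
    then have "set (spell u (c a4) (c b)) \<subseteq> insert One X" using set_spell[of u "c a4" "c b"] c a4 b by auto
    then show ?thesis unfolding w_def by auto
  qed
  ultimately show ?thesis by blast
qed

end

section \<open>The group of size \<kappa>\<close>

context cardinals
begin

lemma K_not_le_I: "\<not> |K| \<le>o |I|"
proof
  assume "|K| \<le>o |I|"
  then obtain k where "k \<in> K" "\<forall>b\<in>K. b \<prec> k" using K_bd[of K] by blast
  then show False using K.less_irrefl by blast
qed

lemma I_le_K: "|I| \<le>o |K|"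
  using K_not_le_I ordLeq_total[OF card_of_Well_order card_of_Well_order] by blast

lemma K_Times: "|A| \<le>o |K| \<Longrightarrow> |B| \<le>o |K| \<Longrightarrow> |A \<times> B| \<le>o |K|"
  and K_Un: "|A| \<le>o |K| \<Longrightarrow> |C| \<le>o |K| \<Longrightarrow> |A \<union> C| \<le>o |K|" and K_inf: "infinite K"
proof -
  show inf: "infinite K" using I_le_K card_of_ordLeq_finite I_inf by blast
  have f: "infinite (Field |K| )" using inf by (simp add: Field_card_of)
  show "|A| \<le>o |K| \<Longrightarrow> |B| \<le>o |K| \<Longrightarrow> |A \<times> B| \<le>o |K|"
    by (rule card_of_Times_ordLeq_infinite_Field[OF f _ _ card_of_Card_order])
  show "|A| \<le>o |K| \<Longrightarrow> |C| \<le>o |K| \<Longrightarrow> |A \<union> C| \<le>o |K|"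
    by (rule card_of_Un_ordLeq_infinite_Field[OF f _ _ card_of_Card_order])
qed

lemma card_elems: "|elems| \<le>o |K|"
proof -
  have KK: "|K| \<le>o |K|" by (rule ordLeq_reflexive[OF card_of_Well_order])
  have "|K \<times> I \<times> I| \<le>o |K|" by (rule K_Times[OF KK K_Times[OF I_le_K I_le_K]])
  then have 1: "|(\<lambda>(k, i, n). El k i n) ` (K \<times> I \<times> I)| \<le>o |K|" by (rule ordLeq_transitive[OF card_of_image])
  have 2: "|Tp ` K| \<le>o |K|" by (rule card_of_image)
  have 3: "|{One :: ('k, 'i) elem}| \<le>o |K|" by (rule card_of_singl_ordLeq) (use K_inf in auto)
  have "elems = {One} \<union> (Tp ` K \<union> (\<lambda>(k, i, n). El k i n) ` (K \<times> I \<times> I))" unfolding elems_def by simp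
  then show ?thesis using K_Un[OF 3 K_Un[OF 2 1]] by simp
qed

theorem shelah_set:
  "\<exists>(C :: ('k, 'i) elem set) m. grp C m One \<and> |C| =o |K| \<and>
     (\<forall>X. X \<subseteq> C \<longrightarrow> \<not> |X| \<le>o |I| \<longrightarrow> (\<forall>g\<in>C. \<exists>w. length w = spell_len \<and> set w \<subseteq> X \<and> foldl m One w = g))"
proof -
  obtain F where F: "\<forall>b\<in>K. emap F b (F b)" using emap_ex by blast
  have "|elems \<times> elems \<times> elems| \<le>o |K|" by (rule K_Times[OF card_elems K_Times[OF card_elems card_elems]])
  from colouring_ex[OF this] obtain \<pi> where \<pi>: "\<forall>A c \<xi>. unb A \<longrightarrow> c \<in> elems \<times> elems \<times> elems \<longrightarrow> \<xi> \<in> K \<longrightarrow>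
      (\<exists>\<delta>. reg \<delta> \<and> \<xi> \<prec> \<delta> \<and> lim A \<delta> \<and> \<pi> \<delta> = c)" by (elim exE)
  interpret tower leI ltI leK ltK I K "\<lambda>a b. F b a" \<pi>
    by unfold_locales (use F in blast)
  obtain f where f: "\<forall>b\<in>K. \<forall>i\<in>I. Good f b i" using state_ex by (elim exE)
  define C where "C = {x. alive f x}"
  have "Tp ` K \<subseteq> C" unfolding C_def by auto
  then have "|Tp ` K :: ('k, 'i) elem set| \<le>o |C|" by (rule card_of_mono1)
  moreover have "|K| \<le>o |Tp ` K :: ('k, 'i) elem set|"
    by (rule iffD1[OF card_of_ordLeq, OF exI[of _ Tp]]) (simp add: inj_on_def)
  ultimately have 1: "|K| \<le>o |C|" using ordLeq_transitive by blast
  have "C \<subseteq> elems" unfolding C_def using alive_elems by blast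
  then have "|C| \<le>o |K|" using card_elems card_of_mono1 ordLeq_transitive by blast
  then have "|C| =o |K|" using 1 ordIso_iff_ordLeq by blast
  moreover have "grp C (gop f) One" unfolding C_def by (rule grp_alive) (use f in blast)
  moreover have "\<exists>w. length w = spell_len \<and> set w \<subseteq> X \<and> foldl (gop f) One w = g"
    if "X \<subseteq> C" "\<not> |X| \<le>o |I|" "g \<in> C" for X g
    by (rule capture) (use that f \<pi> in \<open>auto simp: C_def\<close>)
  ultimately show ?thesis by blast
qed

end

lemma wellorder_of_wf:
  assumes "wf R" "trans R" "\<And>x y. x \<noteq> y \<Longrightarrow> (x, y) \<in> R \<or> (y, x) \<in> R"
  shows "class.wellorder (\<lambda>x y. (x, y) \<in> R \<or> x = y) (\<lambda>x y. (x, y) \<in> R)"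
proof
  have irr: "(x, x) \<notin> R" for x using assms(1) by simp
  have asym: "(x, y) \<in> R \<Longrightarrow> (y, x) \<notin> R" for x y using assms(1) by (rule wf_not_sym)
  fix x y z
  show "((x, y) \<in> R) = (((x, y) \<in> R \<or> x = y) \<and> \<not> ((y, x) \<in> R \<or> y = x))" using irr asym by blast
  show "(x, x) \<in> R \<or> x = x" by simp
  show "(x, y) \<in> R \<or> x = y \<Longrightarrow> (y, z) \<in> R \<or> y = z \<Longrightarrow> (x, z) \<in> R \<or> x = z" using transD[OF assms(2)] by blast
  show "(x, y) \<in> R \<or> x = y \<Longrightarrow> (y, x) \<in> R \<or> y = x \<Longrightarrow> x = y" using asym by blast
  show "((x, y) \<in> R \<or> x = y) \<or> (y, x) \<in> R \<or> y = x" using assms(3) by blast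
next
  fix Q a assume "\<And>x. (\<And>y. (y, x) \<in> R \<Longrightarrow> Q y) \<Longrightarrow> Q x"
  then show "Q a" by (rule wf_induct_rule[OF assms(1)])
qed

text \<open>The locale \<open>cardinals\<close> takes orders of whole types, while a cardinal order
  lives on its field. The remaining elements are placed on top, well-ordered arbitrarily.\<close>

lemma Well_order_extend:
  fixes r :: "'x rel" assumes "Well_order r"
  shows "\<exists>R. wf R \<and> trans R \<and> (\<forall>x y. x \<noteq> y \<longrightarrow> (x, y) \<in> R \<or> (y, x) \<in> R) \<and>
    (\<forall>x\<in>Field r. \<forall>y\<in>Field r. (x, y) \<in> R \<longleftrightarrow> (x, y) \<in> r \<and> x \<noteq> y)"
proof -
  obtain w :: "'x rel" where w: "well_order_on UNIV w" using well_order_on by blast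
  define F where "F = Field r"
  have r: "wf (r - Id)" "trans r" "antisym r" "\<And>x y. x \<in> F \<Longrightarrow> y \<in> F \<Longrightarrow> x \<noteq> y \<Longrightarrow> (x, y) \<in> r \<or> (y, x) \<in> r"
    using assms unfolding order_on_defs F_def total_on_def by auto
  have w': "wf (w - Id)" "trans w" "antisym w" "\<And>x y. x \<noteq> y \<Longrightarrow> (x, y) \<in> w \<or> (y, x) \<in> w"
    using w unfolding order_on_defs total_on_def by auto
  define B1 B2 where "B1 = F \<times> (- F)" and "B2 = (w - Id) \<inter> ((- F) \<times> (- F))"
  have rF: "x \<in> F" "y \<in> F" if "(x, y) \<in> r" for x y using that unfolding F_def Field_def by auto
  have "wf B1" unfolding B1_def by (rule wfI_min) blast
  moreover have "wf B2" unfolding B2_def by (rule wf_subset[OF w'(1)]) blast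
  ultimately have "wf (B1 \<union> B2)" by (rule wf_Un) (auto simp: B1_def B2_def)
  with r(1) have wf: "wf ((r - Id) \<union> (B1 \<union> B2))" by (rule wf_Un) (use rF in \<open>auto simp: B1_def B2_def\<close>)
  define R where "R = (r - Id) \<union> (B1 \<union> B2)"
  have R: "(x, y) \<in> R \<longleftrightarrow> (if x \<in> F then (if y \<in> F then (x, y) \<in> r \<and> x \<noteq> y else True) else y \<notin> F \<and> (x, y) \<in> w \<and> x \<noteq> y)" for x y
    unfolding R_def B1_def B2_def using rF by auto
  have "trans R"
  proof (rule transI)
    fix x y z assume a: "(x, y) \<in> R" "(y, z) \<in> R"
    have 1: "(x, z) \<in> r \<and> x \<noteq> z" if "(x, y) \<in> r" "(y, z) \<in> r" "x \<noteq> y" using that transD[OF r(2)] antisymD[OF r(3)] by blast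
    have 2: "(x, z) \<in> w \<and> x \<noteq> z" if "(x, y) \<in> w" "(y, z) \<in> w" "x \<noteq> y" using that transD[OF w'(2)] antisymD[OF w'(3)] by blast
    show "(x, z) \<in> R" using a 1 2 unfolding R by (auto split: if_splits)
  qed
  moreover have "\<forall>x y. x \<noteq> y \<longrightarrow> (x, y) \<in> R \<or> (y, x) \<in> R" using r(4) w'(4) unfolding R by auto
  moreover have "\<forall>x\<in>Field r. \<forall>y\<in>Field r. (x, y) \<in> R \<longleftrightarrow> (x, y) \<in> r \<and> x \<noteq> y" unfolding R F_def by auto
  ultimately show ?thesis using wf unfolding R_def by blast
qed

text \<open>A set that is not cofinal has an upper bound; passing to a larger element makes the
  bound strict.\<close>

lemma regular_bounded:
  assumes "Card_order s" "infinite (Field s)" "regularCard s" "X \<subseteq> Field s" "|X| <o s"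
  shows "\<exists>k\<in>Field s. \<forall>b\<in>X. b \<noteq> k \<and> (b, k) \<in> s"
proof -
  have "\<not> cofinal X s" using assms(3-5) not_ordLess_ordIso unfolding regularCard_def by blast
  then obtain a where a: "a \<in> Field s" "\<forall>b\<in>X. \<not> (a \<noteq> b \<and> (a, b) \<in> s)" unfolding cofinal_def by blast
  obtain k where k: "k \<in> Field s" "a \<noteq> k" "(a, k) \<in> s" using infinite_Card_order_limit[OF assms(1,2) a(1)] by blast
  have wo: "trans s" "antisym s" "refl_on (Field s) s" "total_on (Field s) s"
    using assms(1) unfolding card_order_on_def order_on_defs by auto
  have "b \<noteq> k \<and> (b, k) \<in> s" if b: "b \<in> X" for b
  proof -
    have "b \<in> Field s" "a \<noteq> b \<longrightarrow> (a, b) \<notin> s" using a b assms(4) by auto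
    then have "(b, a) \<in> s" using a(1) wo(3,4) unfolding total_on_def refl_on_def by (cases "a = b") auto
    then show ?thesis using k transD[OF wo(1)] antisymD[OF wo(2)] by blast
  qed
  then show ?thesis using k(1) by blast
qed

text \<open>\<open>cardSuc r\<close> is an order on \<open>'a set\<close>, which explains the type
  of the levels. A set of full size has more than \<lambda> elements, and this is all that
  \<open>shelah_set\<close> asks for.\<close>

lemma shelah_carrier:
  fixes r :: "'a rel"
  assumes r: "Card_order r" "cinfinite r" "regularCard r"
  shows "\<exists>(C :: ('a set, 'a) elem set) m. grp C m One \<and> |C| =o cardSuc r \<and>
     (\<forall>X. X \<subseteq> C \<longrightarrow> |X| =o |C| \<longrightarrow> (\<forall>g\<in>C. \<exists>w. length w = spell_len \<and> set w \<subseteq> X \<and> foldl m One w = g))"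
proof -
  define s where "s = cardSuc r"
  have inf: "infinite (Field r)" using r(2) unfolding cinfinite_def .
  have s: "Card_order s" "infinite (Field s)" "regularCard s"
    unfolding s_def using cardSuc_Card_order[OF r(1)] infinite_cardSuc_regularCard[OF inf r(1)] cardSuc_finite[OF r(1)] inf by auto
  have Fr: "|Field r| =o r" "|Field s| =o s" using card_of_Field_ordIso r(1) s(1) by auto
  have Wr: "Well_order r" "Well_order s" using r(1) s(1) by (auto simp: card_order_on_well_order_on)
  obtain R1 where R1: "wf R1" "trans R1" "\<forall>x y. x \<noteq> y \<longrightarrow> (x, y) \<in> R1 \<or> (y, x) \<in> R1"
    "\<forall>x\<in>Field r. \<forall>y\<in>Field r. (x, y) \<in> R1 \<longleftrightarrow> (x, y) \<in> r \<and> x \<noteq> y" using Well_order_extend[OF Wr(1)] by blast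
  obtain R2 where R2: "wf R2" "trans R2" "\<forall>x y. x \<noteq> y \<longrightarrow> (x, y) \<in> R2 \<or> (y, x) \<in> R2"
    "\<forall>x\<in>Field s. \<forall>y\<in>Field s. (x, y) \<in> R2 \<longleftrightarrow> (x, y) \<in> s \<and> x \<noteq> y" using Well_order_extend[OF Wr(2)] by blast
  have le_s: "|X| <o s \<longleftrightarrow> |X| \<le>o |Field r|" for X :: "'a set set"
  proof -
    have "|X| <o s \<longleftrightarrow> |X| \<le>o r" unfolding s_def by (rule cardSuc_ordLeq_ordLess[OF r(1) card_of_Card_order])
    also have "\<dots> \<longleftrightarrow> |X| \<le>o |Field r|" using Fr(1) ordIso_symmetric ordLeq_ordIso_trans by blast
    finally show ?thesis .
  qed
  interpret cardinals "\<lambda>x y. (x, y) \<in> R1 \<or> x = y" "\<lambda>x y. (x, y) \<in> R1" "\<lambda>x y. (x, y) \<in> R2 \<or> x = y" "\<lambda>x y. (x, y) \<in> R2"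
    "Field r" "Field s"
  proof (intro cardinals.intro cardinals_axioms.intro)
    show "class.wellorder (\<lambda>x y. (x, y) \<in> R1 \<or> x = y) (\<lambda>x y. (x, y) \<in> R1)" using wellorder_of_wf R1 by blast
    show "class.wellorder (\<lambda>x y. (x, y) \<in> R2 \<or> x = y) (\<lambda>x y. (x, y) \<in> R2)" using wellorder_of_wf R2 by blast
    show "infinite (Field r)" by (rule inf)
    show "stable |Field r|" using stable_ordIso1[OF regularCard_stable[OF r(1) inf r(3)] Fr(1)] .
    show "\<exists>i\<in>Field r. \<forall>b\<in>B. (b, i) \<in> R1" if B: "B \<subseteq> Field r" "|B| <o |Field r|" for B
    proof -
      have "|B| <o r" using B(2) Fr(1) ordLess_ordIso_trans by blast
      then obtain k where "k \<in> Field r" "\<forall>b\<in>B. b \<noteq> k \<and> (b, k) \<in> r" using regular_bounded[OF r(1) inf r(3) B(1)] by blast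
      then show ?thesis using R1(4) B(1) by blast
    qed
    show "|{j \<in> Field r. (j, i) \<in> R1 \<or> j = i}| <o |Field r|" if i: "i \<in> Field r" for i
    proof -
      obtain k where k: "k \<in> Field r" "i \<noteq> k" "(i, k) \<in> r" using infinite_Card_order_limit[OF r(1) inf i] by blast
      have "trans R1" by (rule R1(2))
      have "{j \<in> Field r. (j, i) \<in> R1 \<or> j = i} \<subseteq> underS r k"
      proof
        fix j assume j: "j \<in> {j \<in> Field r. (j, i) \<in> R1 \<or> j = i}"
        have "(i, k) \<in> R1" using R1(4) i k by blast
        then have "(j, k) \<in> R1" using j transD[OF R1(2)] by blast
        then show "j \<in> underS r k" using R1(4) j k(1) unfolding underS_def by blast
      qed
      then have "|{j \<in> Field r. (j, i) \<in> R1 \<or> j = i}| \<le>o |underS r k|" by (rule card_of_mono1)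
      moreover have "|underS r k| <o r" by (rule card_of_underS[OF r(1) k(1)])
      ultimately show ?thesis using Fr(1) ordIso_symmetric ordLess_ordIso_trans ordLeq_ordLess_trans by blast
    qed
    show "|{a \<in> Field s. (a, b) \<in> R2}| \<le>o |Field r|" if b: "b \<in> Field s" for b
    proof -
      have "{a \<in> Field s. (a, b) \<in> R2} \<subseteq> underS s b" using R2(4) b unfolding underS_def by blast
      then have "|{a \<in> Field s. (a, b) \<in> R2}| \<le>o |underS s b|" by (rule card_of_mono1)
      moreover have "|underS s b| <o s" by (rule card_of_underS[OF s(1) b])
      ultimately show ?thesis using le_s ordLeq_ordLess_trans by blast
    qed
    show "\<exists>k\<in>Field s. \<forall>b\<in>X. (b, k) \<in> R2" if X: "X \<subseteq> Field s" "|X| \<le>o |Field r|" for X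
    proof -
      have "|X| <o s" using le_s X(2) by blast
      then obtain k where "k \<in> Field s" "\<forall>b\<in>X. b \<noteq> k \<and> (b, k) \<in> s" using regular_bounded[OF s X(1)] by blast
      then show ?thesis using R2(4) X(1) by blast
    qed
    show "|Field s| \<le>o |X|" if X: "X \<subseteq> Field s" "\<not> |X| \<le>o |Field r|" for X
    proof -
      have "\<not> |X| <o s" using le_s X(2) by blast
      then have "s \<le>o |X|" using Wr(2) card_of_Well_order not_ordLess_iff_ordLeq by blast
      then show ?thesis using Fr(2) ordIso_ordLeq_trans by blast
    qed
  qed
  obtain C :: "('a set, 'a) elem set" and m where C: "grp C m One" "|C| =o |Field s|"
    "\<forall>X. X \<subseteq> C \<longrightarrow> \<not> |X| \<le>o |Field r| \<longrightarrow> (\<forall>g\<in>C. \<exists>w. length w = spell_len \<and> set w \<subseteq> X \<and> foldl m One w = g)"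
    using shelah_set by (elim exE conjE) (rule that; assumption)
  have "\<not> |X| \<le>o |Field r|" if "|X| =o |C|" for X :: "('a set, 'a) elem set"
  proof
    assume "|X| \<le>o |Field r|"
    moreover have "|Field s| =o |X|" using that C(2) ordIso_symmetric ordIso_transitive by blast
    ultimately have "|Field s| \<le>o |Field r|" using ordIso_ordLeq_trans by blast
    then show False using K_not_le_I by blast
  qed
  moreover have "|C| =o cardSuc r" using C(2) Fr(2) ordIso_transitive unfolding s_def by blast
  ultimately show ?thesis using C(1,3) by (intro exI[of _ C] exI[of _ m]) blast
qed

section \<open>Shelah groups\<close>

text \<open>The construction multiplies words from the left, the definition of
  \<open>word_set\<close> from the right.\<close>

lemma foldl_eq_foldr:
  assumes "grp C m e" "set w \<subseteq> C"
  shows "foldr m w e \<in> C" "a \<in> C \<Longrightarrow> foldl m a w = m a (foldr m w e)"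
proof -
  have 1: "foldr m w e \<in> C" if "set w \<subseteq> C" for w
    using that assms(1) by (induction w) (auto simp: grp_def)
  then show "foldr m w e \<in> C" using assms(2) .
  show "a \<in> C \<Longrightarrow> foldl m a w = m a (foldr m w e)" using assms(2)
  proof (induction w arbitrary: a)
    case Nil then show ?case using assms(1) unfolding grp_def by simp
  next
    case (Cons x w)
    have x: "x \<in> C" "set w \<subseteq> C" using Cons.prems by auto
    have "foldl m (m a x) w = m (m a x) (foldr m w e)"
      using Cons.IH[OF grp_closed[OF assms(1) Cons.prems(1) x(1)] x(2)] .
    also have "\<dots> = m a (m x (foldr m w e))" using assms(1) Cons.prems(1) x(1) 1[OF x(2)] unfolding grp_def by blast
    finally show ?case by simp
  qed
qed

text \<open>A bijection carries the group structure to any set of the right size, so the auxiliary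
  type of the construction disappears.\<close>

lemma Shelah_transport:
  assumes C: "grp C m e" and \<phi>: "bij_betw \<phi> C C'" and n: "0 < n"
    and cap: "\<And>X g. X \<subseteq> C \<Longrightarrow> |X| =o |C| \<Longrightarrow> g \<in> C \<Longrightarrow> \<exists>w. length w = n \<and> set w \<subseteq> X \<and> foldl m e w = g"
  shows "\<exists>G :: 'b monoid. carrier G = C' \<and> n_Shelah n G"
proof -
  define \<psi> where "\<psi> = inv_into C \<phi>"
  have \<psi>\<phi>: "\<psi> (\<phi> x) = x" if "x \<in> C" for x unfolding \<psi>_def using \<phi> that by (simp add: bij_betw_def)
  have \<phi>\<psi>: "\<phi> (\<psi> y) = y" "\<psi> y \<in> C" if "y \<in> C'" for y
    unfolding \<psi>_def using \<phi> that bij_betw_inv_into_right inv_into_into unfolding bij_betw_def by metis+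
  have \<phi>C: "\<phi> x \<in> C'" if "x \<in> C" for x using \<phi> that unfolding bij_betw_def by blast
  define G :: "'b monoid" where "G = \<lparr>carrier = C', mult = (\<lambda>x y. \<phi> (m (\<psi> x) (\<psi> y))), one = \<phi> e\<rparr>"
  have sel: "carrier G = C'" "\<one>\<^bsub>G\<^esub> = \<phi> e" "\<And>x y. x \<otimes>\<^bsub>G\<^esub> y = \<phi> (m (\<psi> x) (\<psi> y))" unfolding G_def by auto
  have eC: "e \<in> C" using C unfolding grp_def by blast
  have cl: "m x y \<in> C" if "x \<in> C" "y \<in> C" for x y using grp_closed[OF C that] .
  have grpG: "group G"
  proof (rule groupI)
    show "x \<otimes>\<^bsub>G\<^esub> y \<in> carrier G" if "x \<in> carrier G" "y \<in> carrier G" for x y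
      using that \<phi>C cl \<phi>\<psi> unfolding sel by blast
    show "\<one>\<^bsub>G\<^esub> \<in> carrier G" unfolding sel by (rule \<phi>C[OF eC])
    show "x \<otimes>\<^bsub>G\<^esub> y \<otimes>\<^bsub>G\<^esub> z = x \<otimes>\<^bsub>G\<^esub> (y \<otimes>\<^bsub>G\<^esub> z)" if "x \<in> carrier G" "y \<in> carrier G" "z \<in> carrier G" for x y z
    proof -
      have a: "\<psi> x \<in> C" "\<psi> y \<in> C" "\<psi> z \<in> C" using that \<phi>\<psi> unfolding sel by auto
      have "m (m (\<psi> x) (\<psi> y)) (\<psi> z) = m (\<psi> x) (m (\<psi> y) (\<psi> z))" using C a unfolding grp_def by blast
      then show ?thesis unfolding sel \<psi>\<phi>[OF cl[OF a(1,2)]] \<psi>\<phi>[OF cl[OF a(2,3)]] by simp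
    qed
    show "\<one>\<^bsub>G\<^esub> \<otimes>\<^bsub>G\<^esub> x = x" if x: "x \<in> carrier G" for x
    proof -
      have "m e (\<psi> x) = \<psi> x" using C \<phi>\<psi>(2) x unfolding sel grp_def by blast
      then show ?thesis using x \<phi>\<psi> unfolding sel \<psi>\<phi>[OF eC] by simp
    qed
    show "\<exists>y\<in>carrier G. y \<otimes>\<^bsub>G\<^esub> x = \<one>\<^bsub>G\<^esub>" if x: "x \<in> carrier G" for x
    proof -
      obtain y where y: "y \<in> C" "m y (\<psi> x) = e" using C \<phi>\<psi>(2) x unfolding sel grp_def by blast
      then show ?thesis unfolding sel using \<phi>C[OF y(1)] \<psi>\<phi>[OF y(1)] by (intro bexI[of _ "\<phi> y"]) auto
    qed
  qed
  then interpret G: group G .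
  have fold: "foldr (\<otimes>\<^bsub>G\<^esub>) (map \<phi> w) \<one>\<^bsub>G\<^esub> = \<phi> (foldr m w e)" if "set w \<subseteq> C" for w
    using that
  proof (induction w)
    case (Cons x w)
    then have "x \<in> C" "foldr m w e \<in> C" using foldl_eq_foldr(1)[OF C] by auto
    then show ?case using Cons \<psi>\<phi> unfolding sel by simp
  qed (simp add: sel)
  have "word_set G X n = carrier G" if X: "full_size G X" for X
  proof
    have XC: "X \<subseteq> C'" "|X| =o |C'|" using X unfolding full_size_def sel by auto
    have "foldr (\<otimes>\<^bsub>G\<^esub>) xs \<one>\<^bsub>G\<^esub> \<in> carrier G" if "set xs \<subseteq> X" for xs
      using that XC(1) by (induction xs) (auto simp: sel(1)[symmetric])
    then show "word_set G X n \<subseteq> carrier G" unfolding word_set_def by blast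
    show "carrier G \<subseteq> word_set G X n"
    proof
      fix g assume g: "g \<in> carrier G"
      have inj: "inj_on \<psi> C'" using \<phi>\<psi>(1) by (metis inj_on_inverseI)
      have "|\<psi> ` X| =o |X|"
        by (rule ordIso_symmetric[OF card_of_ordIsoI[OF inj_on_imp_bij_betw[OF inj_on_subset[OF inj XC(1)]]]])
      moreover have "|C'| =o |C|" by (rule ordIso_symmetric[OF card_of_ordIsoI[OF \<phi>]])
      ultimately have "|\<psi> ` X| =o |C|" by (blast intro: ordIso_transitive[OF _ ordIso_transitive[OF XC(2)]])
      moreover have "\<psi> ` X \<subseteq> C" using \<phi>\<psi>(2) XC(1) by blast
      moreover have "\<psi> g \<in> C" using \<phi>\<psi>(2) g unfolding sel by blast
      ultimately obtain w where w: "length w = n" "set w \<subseteq> \<psi> ` X" "foldl m e w = \<psi> g" using cap by blast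
      have wC: "set w \<subseteq> C" using w(2) \<open>\<psi> ` X \<subseteq> C\<close> by blast
      have "foldr m w e \<in> C" by (rule foldl_eq_foldr(1)[OF C wC])
      then have "foldr m w e = \<psi> g" using foldl_eq_foldr(2)[OF C wC eC] w(3) C unfolding grp_def by simp
      then have "foldr (\<otimes>\<^bsub>G\<^esub>) (map \<phi> w) \<one>\<^bsub>G\<^esub> = g" using fold[OF wC] \<phi>\<psi>(1) g unfolding sel by simp
      moreover have "set (map \<phi> w) \<subseteq> X"
      proof
        fix y assume "y \<in> set (map \<phi> w)"
        then obtain x where "x \<in> X" "y = \<phi> (\<psi> x)" using w(2) by auto
        then show "y \<in> X" using \<phi>\<psi>(1) XC(1) by auto
      qed
      moreover have "length (map \<phi> w) = n" using w(1) by simp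
      ultimately show "g \<in> word_set G X n" unfolding word_set_def mem_Collect_eq by metis
    qed
  qed
  then have "n_Shelah n G" unfolding n_Shelah_def using grpG n by blast
  then show ?thesis using sel(1) by blast
qed

text \<open>For a fixed \<open>x\<close> in \<open>X\<close>, the element
  \<open>inv x \<otimes> g\<close> is a word of length \<open>n\<close>, and \<open>x\<close> can be
  put in front of it.\<close>

lemma n_Shelah_Suc:
  fixes G (structure)
  assumes "n_Shelah n G" shows "n_Shelah (Suc n) G"
proof -
  interpret group G using assms unfolding n_Shelah_def by blast
  have "word_set G X (Suc n) = carrier G" if X: "full_size G X" for X
  proof
    have XC: "X \<subseteq> carrier G" "|X| =o |carrier G|" using X unfolding full_size_def by auto
    have "foldr (\<otimes>\<^bsub>G\<^esub>) xs \<one>\<^bsub>G\<^esub> \<in> carrier G" if "set xs \<subseteq> X" for xs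
      using that XC(1) by (induction xs) auto
    then show "word_set G X (Suc n) \<subseteq> carrier G" unfolding word_set_def by blast
    have "X \<noteq> {}" using card_of_empty3[of "carrier G"] ordIso_iff_ordLeq XC(2) one_closed by blast
    then obtain x where x: "x \<in> X" "x \<in> carrier G" using XC(1) by blast
    show "carrier G \<subseteq> word_set G X (Suc n)"
    proof
      fix g assume g: "g \<in> carrier G"
      then have "inv x \<otimes> g \<in> word_set G X n" using assms X x unfolding n_Shelah_def by simp
      then obtain xs where xs: "inv x \<otimes> g = foldr (\<otimes>) xs \<one>" "length xs = n" "set xs \<subseteq> X"
        unfolding word_set_def by blast
      have "g = x \<otimes> (inv x \<otimes> g)" using x g by (simp add: m_assoc[symmetric])
      then have "g = foldr (\<otimes>) (x # xs) \<one>" using xs(1) by simp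
      then show "g \<in> word_set G X (Suc n)" unfolding word_set_def mem_Collect_eq
        using xs x by (intro exI[of _ "x # xs"]) auto
    qed
  qed
  then show ?thesis using assms unfolding n_Shelah_def by blast
qed

lemma n_Shelah_mono: "n_Shelah n G \<Longrightarrow> n \<le> k \<Longrightarrow> n_Shelah k G"
proof -
  assume n: "n_Shelah n G" "n \<le> k"
  show "n_Shelah k G" using n(2,1)
    by (induction k rule: dec_induct) (auto intro: n_Shelah_Suc)
qed

theorem Shelah_exists:
  fixes r :: "'a rel" and C' :: "'b set"
  assumes r: "Card_order r" "cinfinite r" "regularCard r" and C': "|C'| =o cardSuc r"
  shows "\<exists>G :: 'b monoid. carrier G = C' \<and> n_Shelah 10120 G"
proof -
  obtain C :: "('a set, 'a) elem set" and m where C: "grp C m One" "|C| =o cardSuc r"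
    "\<forall>X. X \<subseteq> C \<longrightarrow> |X| =o |C| \<longrightarrow> (\<forall>g\<in>C. \<exists>w. length w = spell_len \<and> set w \<subseteq> X \<and> foldl m One w = g)"
    using shelah_carrier[OF r] by (elim exE conjE) (rule that; assumption)
  have "|C| =o |C'|" using C(2) C' ordIso_symmetric ordIso_transitive by blast
  from iffD2[OF card_of_ordIso this] obtain \<phi> where \<phi>: "bij_betw \<phi> C C'" by blast
  obtain G :: "'b monoid" where G: "carrier G = C'" "n_Shelah spell_len G"
    using Shelah_transport[OF C(1) \<phi> spell_len_bounds(1)] C(3) by blast
  \<comment> \<open>The words found so far have length \<open>spell_len \<le> 9984\<close>;
    \<open>n_Shelah_mono\<close> lengthens them.\<close>
  have "n_Shelah 10120 G" by (rule n_Shelah_mono[OF G(2)]) (use spell_len_bounds(2) in simp)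
  then show ?thesis using G(1) by blast
qed

section \<open>Regularity of the alephs, and the final statement\<close>

lemma regularCard_ordIso:
  fixes r :: "'a rel" and s :: "'b rel"
  assumes "Card_order r" "cinfinite r" "regularCard r" "s =o r"
  shows "Card_order s" "cinfinite s" "regularCard s"
proof -
  show 1: "Card_order s" using Card_order_ordIso[OF assms(1,4)] .
  show 2: "cinfinite s" using assms(2,4) cinfinite_mono ordIso_iff_ordLeq ordIso_symmetric by blast
  have "stable r" using regularCard_stable assms(1-3) unfolding cinfinite_def by blast
  then have "stable s" using stable_ordIso1 assms(4) by blast
  then show "regularCard s" using stable_regularCard 1 2 unfolding cinfinite_def by blast
qed

lemma cardSuc_regular:
  assumes "Card_order r" "cinfinite r"
  shows "Card_order (cardSuc r)" "cinfinite (cardSuc r)" "regularCard (cardSuc r)"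
  using assms cardSuc_Card_order infinite_cardSuc_regularCard cardSuc_finite unfolding cinfinite_def by blast+

lemma natLeq_regular: "Card_order natLeq" "cinfinite natLeq" "regularCard natLeq"
  using natLeq_Card_order regularCard_natLeq by (auto simp: cinfinite_def Field_natLeq)

lemma is_aleph_regular: "is_aleph n r \<Longrightarrow> Card_order r \<and> cinfinite r \<and> regularCard r"
proof (induction n arbitrary: r)
  case 0
  then show ?case using regularCard_ordIso[OF natLeq_regular, of r] by simp
next
  case (Suc n)
  then obtain s :: "'a rel" where s: "is_aleph n s" "r =o cardSuc s" by auto
  then show ?case using regularCard_ordIso[OF cardSuc_regular s(2)] Suc.IH by blast
qed

theorem theorem1:
  shows "(\<forall>r :: 'a rel. Card_order r \<and> cinfinite r \<and> regularCard r \<longrightarrow>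
            (\<exists>G :: 'a set monoid. n_Shelah 10120 G \<and> |carrier G| =o cardSuc r)) \<and>
         (\<exists>G :: nat set monoid.
            Shelah G \<and> |carrier G| =o cardSuc natLeq) \<and>
         (\<exists>G :: nat set set monoid.
            Shelah G \<and> |carrier G| =o cardSuc (cardSuc natLeq)) \<and>
         (\<exists>G :: nat set set set monoid.
            Shelah G \<and> |carrier G| =o cardSuc (cardSuc (cardSuc natLeq))) \<and>
         (\<forall>n \<ge> 1. \<forall>r :: 'a rel. is_aleph n r \<longrightarrow>
            (\<exists>G :: 'a monoid. Shelah G \<and> |carrier G| =o r))"
proof -
  have suc: "\<exists>G :: 'x set monoid. n_Shelah 10120 G \<and> |carrier G| =o cardSuc r"
    if "Card_order r" "cinfinite r" "regularCard r" for r :: "'x rel"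
  proof -
    have F: "|Field (cardSuc r)| =o cardSuc r" using card_of_Field_ordIso[OF cardSuc_Card_order[OF that(1)]] .
    then show ?thesis using Shelah_exists[OF that F] by metis
  qed
  have Sh: "\<exists>G :: 'x monoid. Shelah G \<and> |carrier G| =o s" if "\<exists>G :: 'x monoid. n_Shelah 10120 G \<and> |carrier G| =o s" for s :: "'y rel"
    using that unfolding Shelah_def by blast
  note c1 = cardSuc_regular[OF natLeq_regular(1,2)] and c2 = cardSuc_regular[OF cardSuc_regular(1,2)[OF natLeq_regular(1,2)]]
  have "\<exists>G :: 'a monoid. Shelah G \<and> |carrier G| =o r" if n: "n \<ge> 1" and r: "is_aleph n r" for n and r :: "'a rel"
  proof -
    obtain k where "n = Suc k" using n by (cases n) auto
    then obtain s :: "'a rel" where s: "is_aleph k s" "r =o cardSuc s" using r by auto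
    \<comment> \<open>Here \<open>r\<close> is itself a successor cardinal on \<open>'a\<close>, so
      its field can be the carrier and the type need not grow.\<close>
    have F: "|Field r| =o r" using card_of_Field_ordIso[OF is_aleph_Card_order[OF r]] .
    have "|Field r| =o cardSuc s" using F s(2) by (rule ordIso_transitive)
    then obtain G :: "'a monoid" where "carrier G = Field r" "n_Shelah 10120 G"
      using Shelah_exists is_aleph_regular[OF s(1)] by blast
    then show ?thesis using F unfolding Shelah_def by metis
  qed
  then show ?thesis
    using suc Sh[OF suc[OF natLeq_regular]] Sh[OF suc[OF c1]] Sh[OF suc[OF c2]] by blast
qed

end
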